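(* Let $P$ be a regular path measure of the form $$P=\exp\Big(\eta(X_0,X_1)+\sum_{s\in\mathcal{S}}\theta_s(X_s)+\int_{\mathcal{T}}p(t,X_t)\,dt\Big)\,R,$$ with dual parameters $\eta,\theta,p$ that are nice enough in the sense of the context. Then the forward velocity of $P$ is $$\overset{\rightharpoonup}{v}{}^P_t(X_{[0,t]})=\overset{\rightharpoonup}{v}{}^P_t(X_0,X_t)=a\,\nabla\psi^{X_0}_t(X_t),\qquad 0\le t\le1,\ P\text{-a.s.},$$ where $\nabla\psi^{X_0}_t(X_t)$ stands for $\nabla_z\psi^x(t,z)|_{x=X_0,\,z=X_t}$. Moreover, for any $x\in\mathcal{X}$, $\psi^x$ is a classical solution of the second-order Hamilton-Jacobi equation $$\begin{cases}\big[(\partial_t+a\Delta/2)\psi+a|\nabla\psi|^2/2+\mathbf 1_{\{t\in\mathcal{T}\}}p\big](t,z)=0,&0\le t<1,\ t\notin\mathcal{S},\ z\in\mathcal{X},\\ \psi(t,\cdot)-\psi(t^-,\cdot)=-\theta_t,&t\in\mathcal{S},\\ \psi(1,\cdot)=\eta(x,\cdot),&t=1.\end{cases}$$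
   Context: $\mathcal{X}$ is $\mathbb{T}^n=\mathbb{R}^n/[0,1]^n$ or $\mathbb{R}^n$, with volume measure $\mathrm{vol}$ (normalized on $\mathbb{T}^n$). $\Omega=C([0,1],\mathcal{X})$ with canonical process $X$ (on the torus, the increments $dX_t$ are those of a continuous lift to $\mathbb{R}^n$). Fix $a>0$; $R^x$ is the law of $x+\sqrt a\,B$ with $B$ a standard Brownian motion on $\mathcal{X}$ started at $0$, and $R=\int_{\mathcal{X}}R^x(\cdot)\,\mathrm{vol}(dx)$ is the reversible Brownian path measure. Data: $\mathcal{T}\subset[0,1]$ is a finite union of intervals, $\mathcal{S}\subset(0,1)$ is a finite set, and $\eta:\mathcal{X}^2\to\mathbb{R}$, $p:\mathcal{T}\times\mathcal{X}\to\mathbb{R}$, $\theta_s:\mathcal{X}\to\mathbb{R}$ ($s\in\mathcal{S}$) are functions. For $x\in\mathcal{X}$, $0\le t\le1$, put $$\psi^x(t,z)=\psi^x_t(z):=\log E_R\Big[\exp\Big(\eta(x,X_1)+\sum_{s\in\mathcal{S},\,s>t}\theta_s(X_s)+\int_{\mathcal{T}\cap(t,1]}p(r,X_r)\,dr\Big)\,\Big|\,X_t=z\Big].$$ In particular $\psi^x(1,\cdot)=\eta(x,\cdot)$. The path measure $P$ displayed in the claim is a regular solution of the Bredinger problem of minimizing the relative entropy $H(Q|R)=\int\log(dQ/dR)\,dQ$ among path measures $Q$ with $Q_t=P_t$ for $t\in\mathcal{S}\cup\mathcal{T}$ and $Q_{01}=P_{01}$ (where $Q_t=(X_t)_\#Q$,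 $Q_{01}=(X_0,X_1)_\#Q$). "Regular" ("nice enough" dual parameters) means that all objects and equations built from $R,\eta,\theta,p$ are meaningful and that for every $x$ the function $\psi^x$ is well defined, $C^2$ in space and piecewise $C^1$ in time. Explicitly: $\eta,\theta_s,p$ are continuous; $H(P|R)<\infty$ (so that Girsanov's theory applies); $\psi^x$ is finite everywhere; and with $D$ the finite set consisting of $\mathcal{S}$ and the endpoints of the intervals of $\mathcal{T}$, $\partial_t\psi^x$, $\nabla\psi^x$, $\nabla^2\psi^x$ exist and are continuous in $(t,z)$ between consecutive points of $D\cup\{0,1\}$, up to the end times by continuous extension, so that Itô's formula applies to $\psi^x(t,X_t)$ between jump times; $\psi^x$ is right-continuous in $t$ with left limits $\psi^x(t^-,\cdot)$, the jumps being located in $\mathcal{S}$. At endpoints of intervals of $\mathcal{T}$, where $\mathbf 1_{\{t\in\mathcal{T}\}}p$ may be discontinuous in time, the equation is understood through the one-sided limits. The forward velocity $\overset{\rightharpoonup}{v}{}^P$ is the predictable drift field in $dX_t=\overset{\rightharpoonup}{v}{}^P_t\,dt+dM^P_t$, $P$-a.s., with $M^P$ a local $P$-martingale (for unbounded $P$: under $P(\cdot\mid X_0=x)$ for $P_0$-a.e. $x$). It is determined up to $dt\otimes P$-null sets; the claim gives a version. *)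

theory Defs
  imports "HOL-Probability.Probability"
begin

section \<open>The state space: the Euclidean space or the flat torus\<close>

text \<open>The state space is a quotient of \<open>real^'n\<close> by a lattice, the trivial one for the Euclidean
  space and the integer lattice for the torus. It is given by its projection \<open>pr\<close>, which is
  determined up to a homeomorphism by the following universal description.\<close>

definition lattice_quotient ::
    "(real^'n) set \<Rightarrow> (real^'n \<Rightarrow> 'x::topological_space) \<Rightarrow> bool" where
  "lattice_quotient \<Lambda> pr \<longleftrightarrow>
     surj pr \<and> (\<forall>U. open U \<longleftrightarrow> open (pr -` U)) \<and> (\<forall>x y. pr x = pr y \<longleftrightarrow> x - y \<in> \<Lambda>)"

definition integer_lattice :: "(real^'n) set" where
  "integer_lattice = {l. \<forall>i. l $ i \<in> \<int>}"

text \<open>\<open>vol\<close> is the Lebesgue measure, respectively the normalized volume of the torus.\<close>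

definition flat_space :: "(real^'n \<Rightarrow> 'x::topological_space) \<Rightarrow> 'x measure \<Rightarrow> bool" where
  "flat_space pr vol \<longleftrightarrow>
     lattice_quotient {0} pr \<and> vol = distr lborel borel pr \<or>
     lattice_quotient integer_lattice pr \<and>
       vol = distr (restrict_space lborel (cbox 0 1)) borel pr"

text \<open>The Euclidean space and the torus, as types, are instances.\<close>

lemma flat_space_euclidean: "flat_space (id :: real^'n \<Rightarrow> real^'n) lborel"
  using distr_id2[of borel "lborel :: (real^'n) measure"]
  by (auto simp: flat_space_def lattice_quotient_def id_def)

typedef ('n::finite) torus = "range (\<lambda>x::real^'n. {y. y - x \<in> integer_lattice})"
  by blast

definition torus_projection :: "real^'n \<Rightarrow> 'n::finite torus" where
  "torus_projection x = Abs_torus {y. y - x \<in> integer_lattice}"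

lemma integer_lattice_closed:
  "0 \<in> integer_lattice"
  "x \<in> integer_lattice \<Longrightarrow> y \<in> integer_lattice \<Longrightarrow> x - y \<in> integer_lattice"
  "x \<in> integer_lattice \<Longrightarrow> y \<in> integer_lattice \<Longrightarrow> x + y \<in> integer_lattice"
  by (auto simp: integer_lattice_def)

lemma integer_lattice_norm_ge_1:
  fixes l :: "real^'n"
  assumes "l \<in> integer_lattice" "l \<noteq> 0" shows "1 \<le> norm l"
proof -
  obtain i where i: "l $ i \<noteq> 0" using assms(2) by (auto simp: vec_eq_iff)
  have "l $ i \<in> \<int>" using assms(1) by (auto simp: integer_lattice_def)
  then have "1 \<le> \<bar>l $ i\<bar>" using i by (metis Ints_nonzero_abs_ge1)
  also have "\<dots> \<le> norm l" by (rule component_le_norm_cart)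
  finally show ?thesis .
qed

lemma torus_projection_eq_iff:
  "torus_projection x = torus_projection y \<longleftrightarrow> x - y \<in> integer_lattice"
proof -
  have "torus_projection x = torus_projection y \<longleftrightarrow>
      {z. z - x \<in> integer_lattice} = {z. z - y \<in> integer_lattice}"
    unfolding torus_projection_def by (rule Abs_torus_inject) auto
  also have "\<dots> \<longleftrightarrow> x - y \<in> integer_lattice"
  proof
    assume "{z. z - x \<in> integer_lattice} = {z. z - y \<in> integer_lattice}"
    then show "x - y \<in> integer_lattice"
      using integer_lattice_closed(1) by (metis (no_types, lifting) cancel_comm_monoid_add_class.diff_cancel mem_Collect_eq)
  next
    assume l: "x - y \<in> integer_lattice"
    have "z - x \<in> integer_lattice \<longleftrightarrow> z - y \<in> integer_lattice" for z
    proof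
      assume "z - x \<in> integer_lattice"
      from integer_lattice_closed(3)[OF this l] show "z - y \<in> integer_lattice" by simp
    next
      assume "z - y \<in> integer_lattice"
      from integer_lattice_closed(2)[OF this l] show "z - x \<in> integer_lattice" by simp
    qed
    then show "{z. z - x \<in> integer_lattice} = {z. z - y \<in> integer_lattice}" by auto
  qed
  finally show ?thesis .
qed

lemma surj_torus_projection: "surj (torus_projection :: real^'n \<Rightarrow> 'n::finite torus)"
proof -
  have "\<exists>x. z = torus_projection x" for z :: "'n torus"
    by (cases z) (auto simp: torus_projection_def)
  then show ?thesis by auto
qed

instantiation torus :: (finite) topological_space
begin
definition "open_torus (U :: 'a torus set) \<longleftrightarrow> open (torus_projection -` U)"
instance
  by standard (auto simp: open_torus_def vimage_Union)
end

lemma lattice_quotient_torus: "lattice_quotient integer_lattice torus_projection"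
  using surj_torus_projection
  by (auto simp: lattice_quotient_def open_torus_def torus_projection_eq_iff)

lemma lattice_quotient_open_image:
  assumes "lattice_quotient \<Lambda> pr" "open U" shows "open (pr ` U)"
proof -
  have "pr -` (pr ` U) = (\<Union>l\<in>\<Lambda>. (\<lambda>x. x + l) ` U)"
  proof (intro set_eqI iffI)
    fix x assume "x \<in> pr -` (pr ` U)"
    then obtain u where "u \<in> U" "pr x = pr u" by auto
    then have "x - u \<in> \<Lambda>" using assms(1) by (auto simp: lattice_quotient_def)
    then show "x \<in> (\<Union>l\<in>\<Lambda>. (\<lambda>x. x + l) ` U)" using \<open>u \<in> U\<close>
      by (auto intro!: bexI[of _ "x - u"] image_eqI[of _ _ u])
  next
    fix x assume "x \<in> (\<Union>l\<in>\<Lambda>. (\<lambda>x. x + l) ` U)"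
    then obtain l u where "l \<in> \<Lambda>" "u \<in> U" "x = u + l" by auto
    then have "pr x = pr u" using assms(1) by (auto simp: lattice_quotient_def)
    then show "x \<in> pr -` (pr ` U)" using \<open>u \<in> U\<close> by auto
  qed
  moreover have "open \<dots>"
    using assms(2) by (intro open_UN ballI) (metis open_translation add.commute image_cong)
  ultimately show ?thesis using assms(1) unfolding lattice_quotient_def by metis
qed

instance torus :: (finite) second_countable_topology
proof
  obtain B :: "(real^'a) set set" where B: "countable B" "topological_basis B"
    using ex_countable_basis by blast
  have "topological_basis ((`) torus_projection ` B)"
  proof (rule topological_basisI)
    fix V :: "'a torus set" assume "V \<in> (`) torus_projection ` B"
    then show "open V"
      using lattice_quotient_open_image[OF lattice_quotient_torus]
      using topological_basis_open[OF B(2)] by auto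
  next
    fix V :: "'a torus set" and z assume V: "open V" "z \<in> V"
    obtain x where x: "z = torus_projection x" using surj_torus_projection by (metis surjD)
    have "open (torus_projection -` V)" "x \<in> torus_projection -` V"
      using V x by (auto simp: open_torus_def)
    then obtain C where "C \<in> B" "x \<in> C" "C \<subseteq> torus_projection -` V"
      using topological_basisE[OF B(2)] by metis
    then show "\<exists>W\<in>(`) torus_projection ` B. z \<in> W \<and> W \<subseteq> V" using x by auto
  qed
  then show "\<exists>B::'a torus set set. countable B \<and> open = generate_topology B"
    using B(1) topological_basis_imp_subbasis
    by (intro exI[of _ "(`) torus_projection ` B"]) auto
qed

instance torus :: (finite) t2_space
proof
  fix z w :: "'a torus" assume "z \<noteq> w"
  obtain x y where xy: "z = torus_projection x" "w = torus_projection y"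
    using surj_torus_projection by (metis surjD)
  have cl: "closed (integer_lattice :: (real^'a) set)"
  proof (rule discrete_imp_closed[of 1])
    show "\<forall>x\<in>integer_lattice. \<forall>y\<in>integer_lattice. dist y x < 1 \<longrightarrow> y = (x::real^'a)"
      using integer_lattice_norm_ge_1 integer_lattice_closed(2)
      by (metis dist_norm eq_iff_diff_eq_0 not_less)
  qed simp
  have "x - y \<in> - integer_lattice" using \<open>z \<noteq> w\<close> xy torus_projection_eq_iff by auto
  then obtain e where e: "e > 0" "ball (x - y) e \<subseteq> - integer_lattice"
    using cl by (metis closed_def openE)
  have "torus_projection ` ball x (e/2) \<inter> torus_projection ` ball y (e/2) = {}"
  proof (rule ccontr)
    assume "\<not> ?thesis"
    then obtain u v where uv: "dist x u < e/2" "dist y v < e/2"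
      "torus_projection u = torus_projection v" by auto
    have "dist (x - y) (u - v) \<le> dist x u + dist y v"
      using norm_triangle_ineq4[of "x - u" "y - v"] by (simp add: dist_norm algebra_simps)
    then have "u - v \<in> ball (x - y) e" using uv by simp
    moreover have "u - v \<in> integer_lattice" using uv(3) torus_projection_eq_iff by blast
    ultimately show False using e(2) by blast
  qed
  moreover have "z \<in> torus_projection ` ball x (e/2)" "w \<in> torus_projection ` ball y (e/2)"
    using xy e(1) by auto
  ultimately show "\<exists>U V. open U \<and> open V \<and> z \<in> U \<and> w \<in> V \<and> U \<inter> V = {}"
    using lattice_quotient_open_image[OF lattice_quotient_torus] by (metis open_ball)
qed


lemma flat_space_torus:
  "flat_space torus_projection
     (distr (restrict_space lborel (cbox 0 1)) borel torus_projection)"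
  using lattice_quotient_torus by (auto simp: flat_space_def)


section \<open>Brownian path measures\<close>

text \<open>Paths are extensional functions on the unit interval, and the \<open>\<sigma>\<close>-algebra is the one
  generated by the canonical process \<open>\<lambda>t \<omega>. \<omega> t\<close>.\<close>

definition path_space :: "(real \<Rightarrow> 'x::topological_space) measure" where
  "path_space = restrict_space (PiM {0..1} (\<lambda>_. borel)) {\<omega>. continuous_on {0..1} \<omega>}"

definition standard_brownian_motion :: "'w measure \<Rightarrow> (real \<Rightarrow> 'w \<Rightarrow> real^'n) \<Rightarrow> bool" where
  "standard_brownian_motion M B \<longleftrightarrow>
     prob_space M \<and>
     (\<forall>t\<in>{0..1}. B t \<in> borel_measurable M) \<and>
     (\<forall>\<omega>\<in>space M. B 0 \<omega> = 0 \<and> continuous_on {0..1} (\<lambda>t. B t \<omega>)) \<and>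
     (\<forall>s t. 0 \<le> s \<and> s < t \<and> t \<le> 1 \<longrightarrow>
        distributed M lborel (\<lambda>\<omega>. B t \<omega> - B s \<omega>)
          (\<lambda>x. ennreal (\<Prod>i\<in>UNIV. normal_density 0 (sqrt (t - s)) (x $ i)))) \<and>
     (\<forall>(k::nat) u. mono u \<and> range u \<subseteq> {0..1} \<longrightarrow>
        prob_space.indep_vars M (\<lambda>_. borel) (\<lambda>i \<omega>. B (u (Suc i)) \<omega> - B (u i) \<omega>) {..<k})"

text \<open>The law of \<open>x + sqrt a B\<close>, where \<open>inv pr x\<close> is any lift of \<open>x\<close>.\<close>

definition brownian_law ::
    "(real^'n \<Rightarrow> 'x::topological_space) \<Rightarrow> real \<Rightarrow> 'w measure \<Rightarrow> (real \<Rightarrow> 'w \<Rightarrow> real^'n) \<Rightarrow>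
     'x \<Rightarrow> (real \<Rightarrow> 'x) measure" where
  "brownian_law pr a M B x =
     distr M path_space (\<lambda>\<omega>. \<lambda>r\<in>{0..1}. pr (inv pr x + sqrt a *\<^sub>R B r \<omega>))"

definition reversible_brownian ::
    "(real^'n \<Rightarrow> 'x::topological_space) \<Rightarrow> 'x measure \<Rightarrow> real \<Rightarrow> 'w measure \<Rightarrow>
     (real \<Rightarrow> 'w \<Rightarrow> real^'n) \<Rightarrow> (real \<Rightarrow> 'x) measure" where
  "reversible_brownian pr vol a M B = Giry_Monad.bind vol (brownian_law pr a M B)"

definition regular_conditional_law ::
    "'b measure \<Rightarrow> 'a measure \<Rightarrow> ('a \<Rightarrow> 'b) \<Rightarrow> ('b \<Rightarrow> 'a measure) \<Rightarrow> bool" where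
  "regular_conditional_law N Q Y K \<longleftrightarrow>
     K \<in> N \<rightarrow>\<^sub>M prob_algebra Q \<and>
     Q = Giry_Monad.bind (distr Q N Y) K \<and>
     (AE y in distr Q N Y. AE \<omega> in K y. Y \<omega> = y)"

text \<open>The law of the Brownian path conditioned to be at \<open>z\<close> at time \<open>t\<close>, for every \<open>z\<close>. Since \<open>vol\<close>
  is translation invariant, substituting \<open>z = x + sqrt a B t\<close> in the definition of the reversible
  Brownian measure shows that this is a regular conditional law given the position at time \<open>t\<close>
  (see \<open>regular_conditional_law_brownian\<close> below); it is the version of it that is weakly
  continuous in \<open>z\<close>.\<close>

definition brownian_law_through ::
    "(real^'n \<Rightarrow> 'x::topological_space) \<Rightarrow> real \<Rightarrow> 'w measure \<Rightarrow> (real \<Rightarrow> 'w \<Rightarrow> real^'n) \<Rightarrow>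
     real \<Rightarrow> 'x \<Rightarrow> (real \<Rightarrow> 'x) measure" where
  "brownian_law_through pr a M B t z =
     distr M path_space (\<lambda>\<omega>. \<lambda>r\<in>{0..1}. pr (inv pr z + sqrt a *\<^sub>R (B r \<omega> - B t \<omega>)))"

text \<open>Measurability on the state space can be tested on lifts.\<close>

lemma lattice_quotient_continuous:
  assumes "lattice_quotient \<Lambda> pr" shows "continuous_on UNIV pr"
  using assms by (auto simp: continuous_on_open_vimage lattice_quotient_def)

lemma lattice_quotient_borel_image:
  fixes pr :: "real^'n \<Rightarrow> 'x::topological_space"
  assumes q: "lattice_quotient \<Lambda> pr" and sep: "\<And>l. l \<in> \<Lambda> \<Longrightarrow> l \<noteq> 0 \<Longrightarrow> 1 \<le> norm l"
    and E: "E \<in> sets borel"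
  shows "pr ` E \<in> sets borel"
proof -
  have *: "pr ` (C \<inter> ball c (1/2)) \<in> sets borel" if "C \<in> sets borel" for C c
  proof -
    let ?b = "ball c (1/2)"
    have inj: "inj_on pr ?b"
    proof (rule inj_onI)
      fix x y assume "x \<in> ?b" "y \<in> ?b" "pr x = pr y"
      then have "x - y \<in> \<Lambda>" "norm (x - y) < 1"
        using q dist_triangle_half_r[of c x 1 y]
        by (auto simp: lattice_quotient_def dist_norm)
      then show "x = y" using sep[of "x - y"] by auto
    qed
    have b: "pr ` ?b \<in> sets borel"
      using lattice_quotient_open_image[OF q] by (simp add: borel_open)
    have "C \<in> sigma_sets UNIV {S. open S}" using that by (simp add: borel_def)
    then show ?thesis
    proof induction
      case (Basic S)
      then have "open (S \<inter> ?b)" by auto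
      then show ?case using lattice_quotient_open_image[OF q] by (intro borel_open)
    next
      case (Compl S)
      have "pr ` ((UNIV - S) \<inter> ?b) = pr ` ?b - pr ` (S \<inter> ?b)"
        using inj by (auto simp: inj_on_def)
      then show ?case using Compl b by auto
    next
      case (Union A)
      have "pr ` (\<Union> (range A) \<inter> ?b) = (\<Union>i. pr ` (A i \<inter> ?b))" by auto
      then show ?case using Union by auto
    qed simp
  qed
  obtain Q :: "(real^'n) set" where Q: "countable Q" "\<And>U. open U \<Longrightarrow> U \<noteq> {} \<Longrightarrow> \<exists>d\<in>Q. d \<in> U"
    using countable_dense_exists by blast
  have "pr ` E = (\<Union>c\<in>Q. pr ` (E \<inter> ball c (1/2)))"
  proof (intro equalityI subsetI)
    fix z assume "z \<in> pr ` E"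
    then obtain x where x: "x \<in> E" "z = pr x" by auto
    obtain c where "c \<in> Q" "c \<in> ball x (1/2)" using Q(2)[of "ball x (1/2)"] by auto
    then show "z \<in> (\<Union>c\<in>Q. pr ` (E \<inter> ball c (1/2)))" using x
      by (intro UN_I[of c] image_eqI[of _ _ x]) (auto simp: dist_commute)
  qed auto
  then show ?thesis using * E Q(1) by auto
qed

lemma lattice_quotient_borel_measurable:
  fixes pr :: "real^'n \<Rightarrow> 'x::topological_space"
  assumes q: "lattice_quotient \<Lambda> pr" and sep: "\<And>l. l \<in> \<Lambda> \<Longrightarrow> l \<noteq> 0 \<Longrightarrow> 1 \<le> norm l"
    and g: "(\<lambda>y. g (pr y)) \<in> borel \<rightarrow>\<^sub>M N"
  shows "g \<in> borel \<rightarrow>\<^sub>M N"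
proof (rule measurableI)
  have s: "surj pr" using q by (auto simp: lattice_quotient_def)
  fix x show "g x \<in> space N" using measurable_space[OF g] s by (metis UNIV_I space_borel surjD)
next
  have s: "surj pr" using q by (auto simp: lattice_quotient_def)
  fix A assume "A \<in> sets N"
  then have "(\<lambda>y. g (pr y)) -` A \<in> sets borel" using measurable_sets[OF g] by simp
  from lattice_quotient_borel_image[OF q sep this]
  have "pr ` ((\<lambda>y. g (pr y)) -` A) \<in> sets borel" by blast
  also have "pr ` ((\<lambda>y. g (pr y)) -` A) = g -` A"
    using surj_image_vimage_eq[OF s, of "g -` A"] by (simp add: vimage_def)
  finally show "g -` A \<inter> space borel \<in> sets borel" by simp
qed

lemma countable_integer_lattice: "countable (integer_lattice :: (real^'n) set)"
proof -
  have "integer_lattice = range (\<lambda>k::int^'n. \<chi> i. real_of_int (k $ i))"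
  proof (intro equalityI subsetI)
    fix l :: "real^'n" assume "l \<in> integer_lattice"
    then have "l = (\<chi> i. real_of_int ((\<chi> i. \<lfloor>l $ i\<rfloor>) $ i))"
      by (auto simp: integer_lattice_def vec_eq_iff elim: Ints_cases)
    then show "l \<in> range (\<lambda>k::int^'n. \<chi> i. real_of_int (k $ i))" by blast
  qed (auto simp: integer_lattice_def)
  moreover have "countable (UNIV :: (int^'n) set)"
  proof -
    have "countable (PiE (UNIV::'n set) (\<lambda>_. UNIV :: int set))" by (intro countable_PiE) auto
    then have "countable (UNIV :: ('n \<Rightarrow> int) set)" by (simp add: PiE_UNIV_domain)
    then have "countable (range (\<lambda>f::'n \<Rightarrow> int. \<chi> i. f i))" by blast
    moreover have "range (\<lambda>f::'n \<Rightarrow> int. \<chi> i. f i) = UNIV"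
      by (rule surjI[of _ vec_nth]) simp
    ultimately show ?thesis by simp
  qed
  then have "countable (range (\<lambda>k::int^'n. (\<chi> i. real_of_int (k $ i)) :: real^'n))"
    by (rule countable_image)
  ultimately show ?thesis by simp
qed

lemma nn_integral_lborel_translation:
  fixes f :: "real^'n \<Rightarrow> ennreal"
  assumes "f \<in> borel_measurable borel"
  shows "(\<integral>\<^sup>+y. f y \<partial>lborel) = (\<integral>\<^sup>+y. f (c + y) \<partial>lborel)"
  using assms by (subst lborel_distr_plus[symmetric, of c]) (simp add: nn_integral_distr)

lemma nn_integral_unit_cube_translation:
  fixes f :: "real^'n \<Rightarrow> ennreal"
  assumes [measurable]: "f \<in> borel_measurable borel"
    and per: "\<And>y l. l \<in> integer_lattice \<Longrightarrow> f (y + l) = f y"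
  shows "(\<integral>\<^sup>+y. f (y - c) * indicator (cbox 0 1) y \<partial>lborel) =
         (\<integral>\<^sup>+y. f y * indicator (cbox 0 1) y \<partial>lborel)"
proof -
  define Q where "Q = {y::real^'n. \<forall>i. 0 \<le> y $ i \<and> y $ i < 1}"
  have [measurable]: "Q \<in> sets borel"
    unfolding Q_def by measurable
  have "emeasure lborel (cbox 0 1 - box 0 (1::real^'n)) =
      emeasure lborel (cbox 0 (1::real^'n)) - emeasure lborel (box 0 (1::real^'n))"
    by (rule emeasure_Diff) (auto simp: box_subset_cbox emeasure_lborel_box_eq)
  also have "\<dots> = 0"
    by (simp add: emeasure_lborel_box_eq emeasure_lborel_cbox_eq)
  finally have "cbox 0 1 - box 0 (1::real^'n) \<in> null_sets lborel"
    by (intro null_setsI) auto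
  then have "AE y in lborel. y \<notin> cbox 0 1 - box 0 (1::real^'n)"
    by (rule AE_not_in)
  moreover have "Q \<subseteq> cbox 0 1" "box 0 1 \<subseteq> Q"
    by (auto simp: Q_def mem_box_cart less_imp_le)
  ultimately have ae: "AE y in lborel. indicator (cbox 0 1) y = (indicator Q y :: ennreal)"
    by (auto simp: indicator_def elim!: eventually_mono)
  have one: "(\<integral>\<^sup>+l. indicator Q (y + l) \<partial>count_space integer_lattice) = (1::ennreal)" for y :: "real^'n"
  proof -
    define m :: "real^'n" where "m = (\<chi> i. - real_of_int \<lfloor>y $ i\<rfloor>)"
    have "indicator Q (y + l) = (indicator {m} l :: ennreal)" if "l \<in> integer_lattice" for l
    proof -
      have "y + l \<in> Q \<longleftrightarrow> l = m"
      proof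
        assume "y + l \<in> Q"
        then have "l $ i = m $ i" for i
        proof -
          have "l $ i \<in> \<int>" using that by (simp add: integer_lattice_def)
          then obtain k where k: "l $ i = of_int k" by (rule Ints_cases)
          have "0 \<le> (y + l) $ i" "(y + l) $ i < 1"
            using \<open>y + l \<in> Q\<close>[unfolded Q_def mem_Collect_eq, rule_format, of i] by auto
          then have "0 \<le> y $ i + of_int k" "y $ i + of_int k < 1"
            using k by simp_all
          then have "\<lfloor>y $ i\<rfloor> = - k" by linarith
          then show ?thesis using k by (simp add: m_def)
        qed
        then show "l = m" by (simp add: vec_eq_iff)
      next
        assume "l = m"
        show "y + l \<in> Q" unfolding Q_def mem_Collect_eq
        proof
          fix i
          have "(y + l) $ i = y $ i - of_int \<lfloor>y $ i\<rfloor>" using \<open>l = m\<close> by (simp add: m_def)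
          then show "0 \<le> (y + l) $ i \<and> (y + l) $ i < 1" by linarith
        qed
      qed
      then show ?thesis by (simp add: indicator_def)
    qed
    then have "(\<integral>\<^sup>+l. indicator Q (y + l) \<partial>count_space integer_lattice) =
        (\<integral>\<^sup>+l. indicator {m} l \<partial>count_space integer_lattice)"
      by (intro nn_integral_cong) auto
    also have "\<dots> = emeasure (count_space integer_lattice) {m}"
      by (rule nn_integral_indicator) (auto simp: m_def integer_lattice_def)
    also have "\<dots> = 1"
      by (subst emeasure_count_space_finite) (auto simp: m_def integer_lattice_def)
    finally show ?thesis .
  qed
  have "(\<integral>\<^sup>+y. f (y - c) * indicator (cbox 0 1) y \<partial>lborel) =
      (\<integral>\<^sup>+y. f (y - c) * indicator Q y \<partial>lborel)"
    using ae by (intro nn_integral_cong_AE) auto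
  also have "\<dots> = (\<integral>\<^sup>+y. f y * indicator Q (c + y) \<partial>lborel)"
    by (subst nn_integral_lborel_translation[of _ c]) auto
  also have "\<dots> = (\<integral>\<^sup>+y. \<integral>\<^sup>+l. f y * indicator Q (c + y) * indicator Q (y + l)
      \<partial>count_space integer_lattice \<partial>lborel)"
    by (subst nn_integral_cmult) (auto simp: one)
  also have "\<dots> = (\<integral>\<^sup>+l. \<integral>\<^sup>+y. f y * indicator Q (c + y) * indicator Q (y + l)
      \<partial>lborel \<partial>count_space integer_lattice)"
    by (rule nn_integral_count_space_nn_integral[OF countable_integer_lattice]) measurable
  also have "\<dots> = (\<integral>\<^sup>+l. \<integral>\<^sup>+y. f y * indicator Q y * indicator Q (c + y - l)
      \<partial>lborel \<partial>count_space integer_lattice)"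
  proof (rule nn_integral_cong)
    fix l :: "real^'n" assume "l \<in> space (count_space integer_lattice)"
    then have l: "- l \<in> integer_lattice" by (auto simp: integer_lattice_def)
    show "(\<integral>\<^sup>+y. f y * indicator Q (c + y) * indicator Q (y + l) \<partial>lborel) =
      (\<integral>\<^sup>+y. f y * indicator Q y * indicator Q (c + y - l) \<partial>lborel)"
      using per[OF l]
      by (subst nn_integral_lborel_translation[of _ "- l"])
         (auto intro!: nn_integral_cong simp: algebra_simps)
  qed
  also have "\<dots> = (\<integral>\<^sup>+y. \<integral>\<^sup>+l. f y * indicator Q y * indicator Q (c + y - l)
      \<partial>count_space integer_lattice \<partial>lborel)"
    by (rule nn_integral_count_space_nn_integral[symmetric, OF countable_integer_lattice]) measurable
  also have "\<dots> = (\<integral>\<^sup>+y. f y * indicator Q y \<partial>lborel)"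
  proof (rule nn_integral_cong)
    fix y :: "real^'n"
    have bij: "bij_betw uminus integer_lattice (integer_lattice :: (real^'n) set)"
      by (rule bij_betwI[where g = uminus]) (auto simp: integer_lattice_def)
    have "(\<integral>\<^sup>+l. indicator Q (c + y - l) \<partial>count_space integer_lattice) =
        (\<integral>\<^sup>+l. indicator Q (c + y + l) \<partial>count_space integer_lattice :: ennreal)"
      by (subst nn_integral_bij_count_space[symmetric, OF bij]) simp
    then show "(\<integral>\<^sup>+l. f y * indicator Q y * indicator Q (c + y - l)
      \<partial>count_space integer_lattice) = f y * indicator Q y"
      by (subst nn_integral_cmult) (auto simp: one)
  qed
  also have "\<dots> = (\<integral>\<^sup>+y. f y * indicator (cbox 0 1) y \<partial>lborel)"
    using ae by (intro nn_integral_cong_AE) auto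
  finally show ?thesis .
qed


lemma flat_space_lattice:
  fixes pr :: "real^'n \<Rightarrow> 'x::topological_space"
  assumes "flat_space pr vol"
  obtains \<Lambda> C where "lattice_quotient \<Lambda> pr" "\<And>l. l \<in> \<Lambda> \<Longrightarrow> l \<noteq> 0 \<Longrightarrow> 1 \<le> norm l"
    "\<And>x y w. pr x = pr y \<Longrightarrow> pr (x + w) = pr (y + w)"
    "C \<in> sets borel" "vol = distr (restrict_space lborel C) borel pr"
    "\<And>(f :: real^'n \<Rightarrow> ennreal) c. f \<in> borel_measurable borel \<Longrightarrow>
       (\<And>x y. pr x = pr y \<Longrightarrow> f x = f y) \<Longrightarrow>
       (\<integral>\<^sup>+y. f (y - c) * indicator C y \<partial>lborel) = (\<integral>\<^sup>+y. f y * indicator C y \<partial>lborel)"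
proof -
  from assms consider
    "lattice_quotient {0} pr" "vol = distr lborel borel pr" |
    "lattice_quotient integer_lattice pr" "vol = distr (restrict_space lborel (cbox 0 1)) borel pr"
    by (auto simp: flat_space_def)
  then show thesis
  proof cases
    case 1
    show thesis
    proof (rule that[OF 1(1), of UNIV])
      have "restrict_space lborel UNIV = (lborel :: (real^'n) measure)"
        by (rule measure_eqI) (auto simp: emeasure_restrict_space sets_restrict_space)
      then show "vol = distr (restrict_space lborel UNIV) borel pr" using 1(2) by simp
      fix f :: "real^'n \<Rightarrow> ennreal" and c assume "f \<in> borel_measurable borel"
      then show "(\<integral>\<^sup>+y. f (y - c) * indicator UNIV y \<partial>lborel) =
          (\<integral>\<^sup>+y. f y * indicator UNIV y \<partial>lborel)"
        using nn_integral_lborel_translation[of f "- c"] by simp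
    qed (use 1(1) in \<open>auto simp: lattice_quotient_def\<close>)
  next
    case 2
    have per: "pr (y + l) = pr y" if "l \<in> integer_lattice" for y l
      using that 2(1) by (auto simp: lattice_quotient_def)
    show thesis
    proof (rule that[OF 2(1), of "cbox 0 1"])
      fix f :: "real^'n \<Rightarrow> ennreal" and c
      assume f: "f \<in> borel_measurable borel" "\<And>x y. pr x = pr y \<Longrightarrow> f x = f y"
      show "(\<integral>\<^sup>+y. f (y - c) * indicator (cbox 0 1) y \<partial>lborel) =
          (\<integral>\<^sup>+y. f y * indicator (cbox 0 1) y \<partial>lborel)"
        by (rule nn_integral_unit_cube_translation[OF f(1) f(2)[OF per]])
    qed (use 2 integer_lattice_norm_ge_1 in \<open>auto simp: lattice_quotient_def\<close>)
  qed
qed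

lemma space_path_space:
  "space path_space = {\<omega> \<in> extensional {0..1}. continuous_on {0..1} \<omega>}"
  by (auto simp: path_space_def space_restrict_space space_PiM PiE_def)

lemma measurable_path_eval:
  assumes "t \<in> {0..1}" shows "(\<lambda>\<omega>. \<omega> t) \<in> path_space \<rightarrow>\<^sub>M borel"
  unfolding path_space_def using assms
  by (intro measurable_restrict_space1 measurable_component_singleton)

lemma regular_conditional_law_brownian:
  fixes pr :: "real^'n \<Rightarrow> 'x::{second_countable_topology, t2_space}" and a :: real
  assumes fs: "flat_space pr vol" and B: "standard_brownian_motion M B" and t: "t \<in> {0..1}"
  defines "R \<equiv> reversible_brownian pr vol a M B"
  shows "distr R borel (\<lambda>\<omega>. \<omega> t) = vol"
    and "regular_conditional_law borel R (\<lambda>\<omega>. \<omega> t) (brownian_law_through pr a M B t)"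
proof -
  obtain \<Lambda> C where q: "lattice_quotient \<Lambda> pr" and sep: "\<And>l. l \<in> \<Lambda> \<Longrightarrow> l \<noteq> 0 \<Longrightarrow> 1 \<le> norm l"
    and tr: "\<And>x y w. pr x = pr y \<Longrightarrow> pr (x + w) = pr (y + w)"
    and C[measurable]: "C \<in> sets borel" and vol: "vol = distr (restrict_space lborel C) borel pr"
    and inv: "\<And>(f :: real^'n \<Rightarrow> ennreal) c. f \<in> borel_measurable borel \<Longrightarrow>
       (\<And>x y. pr x = pr y \<Longrightarrow> f x = f y) \<Longrightarrow>
       (\<integral>\<^sup>+y. f (y - c) * indicator C y \<partial>lborel) = (\<integral>\<^sup>+y. f y * indicator C y \<partial>lborel)"
    by (rule flat_space_lattice[OF fs]) blast
  interpret M: prob_space M using B by (simp add: standard_brownian_motion_def)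
  have B_meas[measurable]: "B r \<in> borel_measurable M" if "r \<in> {0..1}" for r
    using B that by (auto simp: standard_brownian_motion_def)
  have B_cont: "continuous_on {0..1} (\<lambda>t. B t \<omega>)" and B0: "B 0 \<omega> = 0" if "\<omega> \<in> space M" for \<omega>
    using B that by (auto simp: standard_brownian_motion_def)
  note pr_cont = lattice_quotient_continuous[OF q]
  have pr_meas[measurable]: "pr \<in> borel_measurable borel"
    using pr_cont by (rule borel_measurable_continuous_onI)
  have pr_inv: "pr (inv pr z) = z" for z
    using q by (auto simp: lattice_quotient_def intro: surj_f_inv_f)
  define \<Phi> where "\<Phi> s y \<omega> = (\<lambda>r\<in>{0..1}. pr (y + sqrt a *\<^sub>R (B r \<omega> - B s \<omega>)))" for s y \<omega>
  define K where "K s = brownian_law_through pr a M B s" for s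
  have \<Phi>_meas: "(\<lambda>(y, \<omega>). \<Phi> s y \<omega>) \<in> borel \<Otimes>\<^sub>M M \<rightarrow>\<^sub>M path_space" if s[measurable]: "s \<in> {0..1}" for s
    unfolding path_space_def
  proof (rule measurable_restrict_space2)
    show "(\<lambda>(y, \<omega>). \<Phi> s y \<omega>) \<in> space (borel \<Otimes>\<^sub>M M) \<rightarrow> {\<omega>. continuous_on {0..1} \<omega>}"
    proof (clarsimp simp: space_pair_measure)
      fix y \<omega> assume "\<omega> \<in> space M"
      have "continuous_on {0..1} (\<lambda>r. pr (y + sqrt a *\<^sub>R (B r \<omega> - B s \<omega>)))"
        using B_cont[OF \<open>\<omega> \<in> space M\<close>]
        by (intro continuous_on_compose2[OF pr_cont] continuous_intros) auto
      then show "continuous_on {0..1} (\<Phi> s y \<omega>)"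
        by (rule continuous_on_cong[THEN iffD2, rotated 2]) (auto simp: \<Phi>_def)
    qed
    have "(\<lambda>yo. \<lambda>r\<in>{0..1}. pr (fst yo + sqrt a *\<^sub>R (B r (snd yo) - B s (snd yo))))
        \<in> borel \<Otimes>\<^sub>M M \<rightarrow>\<^sub>M PiM {0..1} (\<lambda>_. borel)"
    proof (rule measurable_restrict)
      fix r :: real assume [measurable]: "r \<in> {0..1}"
      show "(\<lambda>yo. pr (fst yo + sqrt a *\<^sub>R (B r (snd yo) - B s (snd yo)))) \<in> borel_measurable (borel \<Otimes>\<^sub>M M)"
        by measurable
    qed
    then show "(\<lambda>(y, \<omega>). \<Phi> s y \<omega>) \<in> borel \<Otimes>\<^sub>M M \<rightarrow>\<^sub>M PiM {0..1} (\<lambda>_. borel)"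
      by (simp add: \<Phi>_def case_prod_beta)
  qed
  have \<Phi>_cong: "\<Phi> s x \<omega> = \<Phi> s y \<omega>" if "pr x = pr y" for s x y \<omega>
    using tr[OF that] by (simp add: \<Phi>_def)
  have \<Phi>_meas1: "\<Phi> s y \<in> M \<rightarrow>\<^sub>M path_space" if "s \<in> {0..1}" for s y
    using measurable_compose_Pair1[OF _ \<Phi>_meas[OF that], of y] by simp
  have K_distr: "K s z = distr M path_space (\<Phi> s (inv pr z))" for s z
    by (simp add: K_def brownian_law_through_def \<Phi>_def[abs_def])
  have K_pr: "K s (pr y) = distr M path_space (\<Phi> s y)" for s y
    unfolding K_distr by (intro distr_cong refl \<Phi>_cong pr_inv)
  have K_em: "emeasure (K s (pr y)) A = (\<integral>\<^sup>+\<omega>. indicator A (\<Phi> s y \<omega>) \<partial>M)"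
    if "s \<in> {0..1}" "A \<in> sets path_space" for s y A
  proof -
    have "emeasure (K s (pr y)) A = (\<integral>\<^sup>+\<omega>. indicator A \<omega> \<partial>K s (pr y))"
      using that by (simp add: K_pr)
    also have "\<dots> = (\<integral>\<^sup>+\<omega>. indicator A (\<Phi> s y \<omega>) \<partial>M)"
      unfolding K_pr using \<Phi>_meas1[OF that(1)] that(2) by (subst nn_integral_distr) auto
    finally show ?thesis .
  qed
  have ind_meas: "(\<lambda>(y, \<omega>). indicator A (\<Phi> s y \<omega>) :: ennreal) \<in> borel_measurable (borel \<Otimes>\<^sub>M M)"
    if "s \<in> {0..1}" "A \<in> sets path_space" for s A
    using measurable_compose[OF \<Phi>_meas[OF that(1)] borel_measurable_indicator[OF that(2)]]
    unfolding split_beta' .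
  have K_pr_meas: "(\<lambda>y. emeasure (K s (pr y)) A) \<in> borel_measurable borel"
    if "s \<in> {0..1}" "A \<in> sets path_space" for s A
    unfolding K_em[OF that] by (rule M.borel_measurable_nn_integral[OF ind_meas[OF that]])
  have K_sub: "K s \<in> borel \<rightarrow>\<^sub>M subprob_algebra path_space" if "s \<in> {0..1}" for s
  proof (rule measurable_subprob_algebra)
    show "subprob_space (K s z)" for z
      unfolding K_distr
      by (intro prob_space_imp_subprob_space M.prob_space_distr \<Phi>_meas1[OF that])
    show "sets (K s z) = sets path_space" for z by (simp add: K_distr)
    show "(\<lambda>z. emeasure (K s z) A) \<in> borel_measurable borel" if "A \<in> sets path_space" for A
      by (rule lattice_quotient_borel_measurable[OF q sep K_pr_meas]) (use that \<open>s \<in> {0..1}\<close> in auto)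
  qed
  have K_prob: "prob_space (K s z)" if "s \<in> {0..1}" for s z
    unfolding K_distr by (intro M.prob_space_distr \<Phi>_meas1[OF that])
  have bl: "brownian_law pr a M B x = K 0 x" for x
    unfolding K_def brownian_law_def brownian_law_through_def
    by (rule distr_cong) (simp_all add: B0)
  have vol_sp: "space vol = UNIV" "sets vol = sets borel" by (simp_all add: vol)
  have mv: "K s \<in> vol \<rightarrow>\<^sub>M subprob_algebra path_space" if "s \<in> {0..1}" for s
    using K_sub[OF that] by (simp add: measurable_cong_sets[OF vol_sp(2) refl])
  have R_bind: "R = Giry_Monad.bind vol (K 0)"
    by (simp add: R_def reversible_brownian_def ext[of "brownian_law pr a M B" "K 0", OF bl])
  have sets_R: "sets R = sets path_space"
    unfolding R_bind by (rule sets_bind) (auto simp: vol_sp K_distr)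
  have space_R: "space R = space path_space" by (rule sets_eq_imp_space_eq[OF sets_R])
  have int_K: "(\<integral>\<^sup>+z. emeasure (K s z) A \<partial>vol) =
      (\<integral>\<^sup>+\<omega>. \<integral>\<^sup>+y. indicator A (\<Phi> s y \<omega>) * indicator C y \<partial>lborel \<partial>M)"
    if s: "s \<in> {0..1}" "A \<in> sets path_space" for s A
  proof -
    have "(\<integral>\<^sup>+z. emeasure (K s z) A \<partial>vol) = (\<integral>\<^sup>+y. emeasure (K s (pr y)) A \<partial>restrict_space lborel C)"
      unfolding vol
      by (rule nn_integral_distr)
        (use measurable_emeasure_subprob_algebra[OF s(2)] K_sub[OF s(1)] in
          \<open>auto intro!: measurable_restrict_space1 measurable_compose[OF K_sub[OF s(1)]]\<close>)
    also have "\<dots> = (\<integral>\<^sup>+y. emeasure (K s (pr y)) A * indicator C y \<partial>lborel)"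
      by (rule nn_integral_restrict_space) simp
    also have "\<dots> = (\<integral>\<^sup>+y. \<integral>\<^sup>+\<omega>. indicator A (\<Phi> s y \<omega>) * indicator C y \<partial>M \<partial>lborel)"
      using ind_meas[OF s] by (intro nn_integral_cong)
        (auto simp: K_em[OF s] intro!: nn_integral_multc[symmetric] measurable_compose_Pair1[of _ borel]
          measurable_compose[OF \<Phi>_meas1[OF s(1)]] borel_measurable_indicator s(2))
    also have "\<dots> = (\<integral>\<^sup>+\<omega>. \<integral>\<^sup>+y. indicator A (\<Phi> s y \<omega>) * indicator C y \<partial>lborel \<partial>M)"
    proof -
      interpret P: pair_sigma_finite lborel M ..
      have "(\<lambda>(y, \<omega>). indicator A (\<Phi> s y \<omega>) * indicator C y :: ennreal) \<in> borel_measurable (lborel \<Otimes>\<^sub>M M)"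
      proof -
        have "(\<lambda>(y, \<omega>). indicator A (\<Phi> s y \<omega>) :: ennreal) \<in> borel_measurable (lborel \<Otimes>\<^sub>M M)"
          using ind_meas[OF s] by (simp cong: measurable_cong_sets sets_pair_measure_cong)
        then have "(\<lambda>x. (case x of (y, \<omega>) \<Rightarrow> indicator A (\<Phi> s y \<omega>)) * indicator C (fst x) :: ennreal)
            \<in> borel_measurable (lborel \<Otimes>\<^sub>M M)" by measurable
        then show ?thesis by (simp add: case_prod_beta)
      qed
      from P.Fubini[OF this] show ?thesis by simp
    qed
    finally show ?thesis .
  qed
  have R_em: "emeasure R A = (\<integral>\<^sup>+z. emeasure (K t z) A \<partial>vol)" if A: "A \<in> sets path_space" for A
  proof -
    have "emeasure R A = (\<integral>\<^sup>+z. emeasure (K 0 z) A \<partial>vol)"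
      unfolding R_bind by (rule emeasure_bind[OF _ mv A]) (auto simp: vol_sp)
    also have "\<dots> = (\<integral>\<^sup>+\<omega>. \<integral>\<^sup>+y. indicator A (\<Phi> 0 y \<omega>) * indicator C y \<partial>lborel \<partial>M)"
      by (rule int_K[OF _ A]) simp
    also have "\<dots> = (\<integral>\<^sup>+\<omega>. \<integral>\<^sup>+y. indicator A (\<Phi> t y \<omega>) * indicator C y \<partial>lborel \<partial>M)"
    proof (rule nn_integral_cong)
      fix \<omega> assume \<omega>: "\<omega> \<in> space M"
      have eq: "\<Phi> t y \<omega> = \<Phi> 0 (y - sqrt a *\<^sub>R B t \<omega>) \<omega>" for y
        by (auto simp: \<Phi>_def B0[OF \<omega>] algebra_simps cong: restrict_cong)
      have "(\<lambda>y. indicator A (\<Phi> 0 y \<omega>) :: ennreal) \<in> borel_measurable borel"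
        using measurable_Pair1[OF ind_meas[OF _ A], of 0 \<omega>] \<omega> by simp
      then show "(\<integral>\<^sup>+y. indicator A (\<Phi> 0 y \<omega>) * indicator C y \<partial>lborel) =
          (\<integral>\<^sup>+y. indicator A (\<Phi> t y \<omega>) * indicator C y \<partial>lborel)"
        unfolding eq
        by (rule inv[symmetric, where f = "\<lambda>y. indicator A (\<Phi> 0 y \<omega>)"]) (metis \<Phi>_cong)
    qed
    also have "\<dots> = (\<integral>\<^sup>+z. emeasure (K t z) A \<partial>vol)" by (rule int_K[OF t A, symmetric])
    finally show ?thesis .
  qed
  have Kt: "AE \<omega> in K t z. \<omega> t = z" for z
  proof -
    have "\<Phi> t (inv pr z) \<omega> t = z" for \<omega> using t by (simp add: \<Phi>_def pr_inv)
    moreover have "{\<omega> \<in> space path_space. \<omega> t = z} \<in> sets path_space"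
      using measurable_sets[OF measurable_path_eval[OF t], of "{z}"]
      by (simp add: vimage_def Int_def conj_commute)
    ultimately show ?thesis
      unfolding K_distr by (subst AE_distr_iff[OF \<Phi>_meas1[OF t]]) auto
  qed
  show dist: "distr R borel (\<lambda>\<omega>. \<omega> t) = vol"
  proof (rule measure_eqI)
    fix D assume "D \<in> sets (distr R borel (\<lambda>\<omega>. \<omega> t))"
    then have D: "D \<in> sets borel" by simp
    have ev: "(\<lambda>\<omega>. \<omega> t) \<in> R \<rightarrow>\<^sub>M borel"
      using measurable_path_eval[OF t] by (simp cong: measurable_cong_sets add: sets_R)
    define A where "A = (\<lambda>\<omega>. \<omega> t) -` D \<inter> space path_space"
    have A: "A \<in> sets path_space" unfolding A_def by (rule measurable_sets[OF measurable_path_eval[OF t] D])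
    have "emeasure (K t z) A = indicator D z" for z
    proof -
      interpret Kz: prob_space "K t z" by (rule K_prob[OF t])
      have sp: "space (K t z) = space path_space" by (simp add: K_distr)
      have "AE \<omega> in K t z. \<omega> \<in> A \<longleftrightarrow> z \<in> D"
        using Kt[of z] AE_space by eventually_elim (auto simp: A_def sp)
      then have "(\<integral>\<^sup>+\<omega>. indicator A \<omega> \<partial>K t z) = (\<integral>\<^sup>+\<omega>. indicator D z \<partial>K t z)"
        by (intro nn_integral_cong_AE) (auto simp: indicator_def elim!: eventually_mono)
      moreover have "emeasure (K t z) (space path_space) = 1"
        using Kz.emeasure_space_1 by (simp add: sp)
      moreover have "A \<in> sets (K t z)" using A by (simp add: K_distr)
      ultimately show ?thesis by (simp add: sp)
    qed
    then have "emeasure R A = emeasure vol D"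
      using D by (simp add: R_em[OF A] vol_sp)
    then show "emeasure (distr R borel (\<lambda>\<omega>. \<omega> t)) D = emeasure vol D"
      by (simp add: emeasure_distr[OF ev D] A_def space_R)
  qed (simp add: vol_sp)
  show "regular_conditional_law borel R (\<lambda>\<omega>. \<omega> t) (brownian_law_through pr a M B t)"
    unfolding regular_conditional_law_def dist K_def[symmetric]
  proof (intro conjI)
    have "K t \<in> borel \<rightarrow>\<^sub>M prob_algebra path_space"
      using K_sub[OF t] K_prob[OF t] by (rule measurable_prob_algebraI[rotated])
    also have "prob_algebra path_space = (prob_algebra R :: (real \<Rightarrow> 'x) measure measure)"
      unfolding prob_algebra_def by (simp add: sets_R cong: subprob_algebra_cong)
    finally show "K t \<in> borel \<rightarrow>\<^sub>M prob_algebra R" .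
    have sb: "sets (Giry_Monad.bind vol (K t)) = sets path_space"
      by (rule sets_bind) (auto simp: vol_sp K_distr)
    show "R = Giry_Monad.bind vol (K t)"
      by (rule measure_eqI)
        (auto simp: sets_R sb R_em emeasure_bind[OF _ mv[OF t]] vol_sp)
    show "AE y in vol. AE \<omega> in K t y. \<omega> t = y" using Kt by simp
  qed
qed


section \<open>Relative entropy and the Bredinger problem\<close>

text \<open>The convention for \<open>ereal\<close> is \<open>\<infinity> - \<infinity> = \<infinity>\<close>, so that the relative entropy is less than \<open>\<infinity>\<close>
  iff the positive part of the logarithmic density is integrable.\<close>

definition relative_entropy :: "'a measure \<Rightarrow> 'a measure \<Rightarrow> ereal" where
  "relative_entropy Q R =
     (if sigma_finite_measure Q \<and> sets Q = sets R \<and> absolutely_continuous R Q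
      then enn2ereal (\<integral>\<^sup>+\<omega>. ennreal (entropy_density (exp 1) R Q \<omega>) \<partial>Q)
         - enn2ereal (\<integral>\<^sup>+\<omega>. ennreal (- entropy_density (exp 1) R Q \<omega>) \<partial>Q)
      else \<infinity>)"

definition bredinger_solution ::
    "(real \<Rightarrow> 'x::topological_space) measure \<Rightarrow> real set \<Rightarrow> (real \<Rightarrow> 'x) measure \<Rightarrow> bool" where
  "bredinger_solution R I P \<longleftrightarrow>
     (\<forall>Q. sets Q = sets path_space \<and>
        (\<forall>t\<in>I. distr Q borel (\<lambda>\<omega>. \<omega> t) = distr P borel (\<lambda>\<omega>. \<omega> t)) \<and>
        distr Q borel (\<lambda>\<omega>. (\<omega> 0, \<omega> 1)) = distr P borel (\<lambda>\<omega>. (\<omega> 0, \<omega> 1)) \<longrightarrow>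
        relative_entropy P R \<le> relative_entropy Q R)"


section \<open>Forward velocity\<close>

definition path_filtration :: "real \<Rightarrow> (real \<Rightarrow> 'x::topological_space) measure" where
  "path_filtration t = sigma (space path_space)
     {(\<lambda>\<omega>. \<omega> r) -` A \<inter> space path_space | r A. r \<in> {0..1} \<and> r \<le> t \<and> A \<in> sets borel}"

definition predictable_algebra :: "(real \<times> (real \<Rightarrow> 'x::topological_space)) measure" where
  "predictable_algebra = sigma ({0..1} \<times> space path_space)
     ({{0} \<times> A | A. A \<in> sets (path_filtration 0)} \<union>
      {{s<..t} \<times> A | s t A. 0 \<le> s \<and> s \<le> t \<and> t \<le> 1 \<and> A \<in> sets (path_filtration s)})"

definition path_martingale ::
    "(real \<Rightarrow> 'x::topological_space) measure \<Rightarrow> (real \<Rightarrow> (real \<Rightarrow> 'x) \<Rightarrow> real^'n) \<Rightarrow> bool" where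
  "path_martingale P N \<longleftrightarrow>
     (\<forall>t\<in>{0..1}. N t \<in> borel_measurable (path_filtration t) \<and> integrable P (N t)) \<and>
     (\<forall>s t. 0 \<le> s \<and> s \<le> t \<and> t \<le> 1 \<longrightarrow> (\<forall>A\<in>sets (path_filtration s).
        set_lebesgue_integral P A (N t) = set_lebesgue_integral P A (N s)))"

definition path_local_martingale ::
    "(real \<Rightarrow> 'x::topological_space) measure \<Rightarrow> (real \<Rightarrow> (real \<Rightarrow> 'x) \<Rightarrow> real^'n) \<Rightarrow> bool" where
  "path_local_martingale P N \<longleftrightarrow>
     (\<forall>t\<in>{0..1}. N t \<in> borel_measurable (path_filtration t)) \<and>
     (\<exists>\<tau>::nat \<Rightarrow> (real \<Rightarrow> 'x) \<Rightarrow> real.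
        (\<forall>k. stopping_time path_filtration (\<tau> k) \<and> (\<forall>\<omega>\<in>space path_space. 0 \<le> \<tau> k \<omega>)) \<and>
        (AE \<omega> in P. incseq (\<lambda>k. \<tau> k \<omega>) \<and> (\<exists>k. 1 \<le> \<tau> k \<omega>)) \<and>
        (\<forall>k. path_martingale P (\<lambda>t \<omega>. N (min t (\<tau> k \<omega>)) \<omega>)))"

text \<open>\<open>X\<^sub>t - X\<^sub>0\<close> is the increment of a continuous lift of the path; it does not depend on the lift.\<close>

definition path_increment ::
    "(real^'n \<Rightarrow> 'x::topological_space) \<Rightarrow> real \<Rightarrow> (real \<Rightarrow> 'x) \<Rightarrow> real^'n" where
  "path_increment pr t \<omega> =
     (let w = (SOME w. continuous_on {0..1} w \<and> (\<forall>r\<in>{0..1}. pr (w r) = \<omega> r)) in w t - w 0)"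

definition has_drift ::
    "(real^'n \<Rightarrow> 'x::topological_space) \<Rightarrow> (real \<Rightarrow> 'x) measure \<Rightarrow>
     (real \<Rightarrow> (real \<Rightarrow> 'x) \<Rightarrow> real^'n) \<Rightarrow> bool" where
  "has_drift pr P v \<longleftrightarrow>
     (\<lambda>(t, \<omega>). v t \<omega>) \<in> borel_measurable predictable_algebra \<and>
     (AE \<omega> in P. set_integrable lborel {0..1} (\<lambda>r. v r \<omega>)) \<and>
     (\<exists>N. path_local_martingale P N \<and>
        (AE \<omega> in P. \<forall>t\<in>{0..1}.
           path_increment pr t \<omega> = set_lebesgue_integral lborel {0..t} (\<lambda>r. v r \<omega>) + N t \<omega>))"

definition forward_velocity ::
    "(real^'n \<Rightarrow> 'x::topological_space) \<Rightarrow> (real \<Rightarrow> 'x) measure \<Rightarrow>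
     (real \<Rightarrow> (real \<Rightarrow> 'x) \<Rightarrow> real^'n) \<Rightarrow> bool" where
  "forward_velocity pr P v \<longleftrightarrow>
     (if finite_measure P then has_drift pr P v
      else \<exists>K. regular_conditional_law borel P (\<lambda>\<omega>. \<omega> 0) K \<and>
             (AE x in distr P borel (\<lambda>\<omega>. \<omega> 0). has_drift pr (K x) v))"


section \<open>Differential calculus on the state space and the Hamilton-Jacobi equation\<close>

text \<open>Functions on the state space are differentiated through their lifts to \<open>real^'n\<close>.\<close>

definition gradient :: "(real^'n \<Rightarrow> 'x) \<Rightarrow> ('x \<Rightarrow> real) \<Rightarrow> 'x \<Rightarrow> real^'n" where
  "gradient pr f z = (\<chi> i. frechet_derivative (f \<circ> pr) (at (inv pr z)) (axis i 1))"

definition laplacian :: "(real^'n \<Rightarrow> 'x) \<Rightarrow> ('x \<Rightarrow> real) \<Rightarrow> 'x \<Rightarrow> real" where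
  "laplacian pr f z =
     (\<Sum>i\<in>UNIV. frechet_derivative (\<lambda>y. gradient pr f (pr y) $ i) (at (inv pr z)) (axis i 1))"

definition twice_cont_diff :: "(real^'n \<Rightarrow> 'x) \<Rightarrow> ('x \<Rightarrow> real) \<Rightarrow> bool" where
  "twice_cont_diff pr f \<longleftrightarrow>
     (\<exists>G (H :: real^'n \<Rightarrow> real^'n^'n). continuous_on UNIV H \<and>
        (\<forall>y. GDERIV (f \<circ> pr) y :> G y \<and> (G has_derivative (\<lambda>h. H y *v h)) (at y)))"

text \<open>Between consecutive points \<open>s\<close> and \<open>t\<close> of \<open>E\<close>, the time derivative, the gradient and the
  Hessian exist and extend continuously to the closed time interval.\<close>

definition piecewise_smooth ::
    "(real^'n \<Rightarrow> 'x) \<Rightarrow> real set \<Rightarrow> (real \<Rightarrow> 'x \<Rightarrow> real) \<Rightarrow> bool" where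
  "piecewise_smooth pr E u \<longleftrightarrow>
     (\<forall>s\<in>E. \<forall>t\<in>E. s < t \<and> E \<inter> {s<..<t} = {} \<longrightarrow>
        (\<exists>T G (H :: real \<Rightarrow> real^'n \<Rightarrow> real^'n^'n).
           continuous_on ({s..t} \<times> UNIV) (\<lambda>(r, y). T r y) \<and>
           continuous_on ({s..t} \<times> UNIV) (\<lambda>(r, y). G r y) \<and>
           continuous_on ({s..t} \<times> UNIV) (\<lambda>(r, y). H r y) \<and>
           (\<forall>r\<in>{s<..<t}. \<forall>y.
              ((\<lambda>r. u r (pr y)) has_real_derivative T r y) (at r) \<and>
              GDERIV (u r \<circ> pr) y :> G r y \<and>
              (G r has_derivative (\<lambda>h. H r y *v h)) (at y))))"

definition right_continuous_with_jumps_in ::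
    "real set \<Rightarrow> (real \<Rightarrow> 'x \<Rightarrow> real) \<Rightarrow> bool" where
  "right_continuous_with_jumps_in S u \<longleftrightarrow>
     (\<forall>t\<in>{0..<1}. \<forall>z. ((\<lambda>r. u r z) \<longlongrightarrow> u t z) (at_right t)) \<and>
     (\<forall>t\<in>{0<..1}. \<forall>z. \<exists>l. ((\<lambda>r. u r z) \<longlongrightarrow> l) (at_left t)) \<and>
     (\<forall>t\<in>{0<..1} - S. \<forall>z. ((\<lambda>r. u r z) \<longlongrightarrow> u t z) (at_left t))"

text \<open>The left-hand side of the equation for a function with time derivative \<open>d\<close> and potential
  \<open>q\<close> at the given time.\<close>

definition hj_operator ::
    "(real^'n \<Rightarrow> 'x) \<Rightarrow> real \<Rightarrow> real \<Rightarrow> ('x \<Rightarrow> real) \<Rightarrow> real \<Rightarrow> 'x \<Rightarrow> real" where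
  "hj_operator pr a d f q z =
     d + a * laplacian pr f z / 2 + a * (norm (gradient pr f z))\<^sup>2 / 2 + q"

text \<open>\<open>D\<close> contains \<open>S\<close> and the endpoints of the intervals that make up \<open>T\<close>. At an endpoint that is
  not in \<open>S\<close>, the time derivative and the potential are replaced by their one-sided versions, from
  the right and from the left. At time \<open>0\<close> only the right-hand side makes sense.\<close>

definition hj_classical_solution ::
    "(real^'n \<Rightarrow> 'x) \<Rightarrow> real \<Rightarrow> real set \<Rightarrow> real set \<Rightarrow> real set \<Rightarrow> (real \<Rightarrow> 'x \<Rightarrow> real) \<Rightarrow>
     (real \<Rightarrow> 'x \<Rightarrow> real) \<Rightarrow> ('x \<Rightarrow> real) \<Rightarrow> (real \<Rightarrow> 'x \<Rightarrow> real) \<Rightarrow> bool" where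
  "hj_classical_solution pr a T S D p \<theta> h u \<longleftrightarrow>
     (\<forall>t\<in>{0..<1} - S. twice_cont_diff pr (u t)) \<and>
     (\<forall>t\<in>{0..<1} - D. \<forall>z. \<exists>d.
        ((\<lambda>r. u r z) has_real_derivative d) (at t within {0..1}) \<and>
        hj_operator pr a d (u t) (indicator T t * p t z) z = 0) \<and>
     (\<forall>t\<in>{0..<1} \<inter> D - S. \<forall>z. \<exists>d q.
        ((\<lambda>r. u r z) has_real_derivative d) (at_right t) \<and>
        ((\<lambda>r. indicator T r * p r z) \<longlongrightarrow> q) (at_right t) \<and>
        hj_operator pr a d (u t) q z = 0) \<and>
     (\<forall>t\<in>{0<..<1} \<inter> D - S. \<forall>z. \<exists>d q.
        ((\<lambda>r. u r z) has_real_derivative d) (at_left t) \<and>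
        ((\<lambda>r. indicator T r * p r z) \<longlongrightarrow> q) (at_left t) \<and>
        hj_operator pr a d (u t) q z = 0) \<and>
     (\<forall>t\<in>S. \<forall>z. ((\<lambda>r. u r z) \<longlongrightarrow> u t z + \<theta> t z) (at_left t)) \<and>
     (\<forall>z. u 1 z = h z)"

end

theory Submission
  imports Defs
begin

text \<open>Fix the starting point \<open>x\<close>, lift everything to Euclidean space and let
  \<open>u(t, y)\<close> be the expectation of the weight \<open>F x t\<close> under Brownian motion started from \<open>y\<close> at time \<open>t\<close>,
  so that \<open>\<psi> = ln u\<close>. By the Markov property \<open>u(t, y)\<close> is the expectation of the weight collected up
  to time \<open>r\<close> times \<open>u(r, X r)\<close>. Between consecutive times of \<open>D\<close>, expanding this for small
  \<open>r - t\<close> gives the Hamilton-Jacobi equation: the integrand is controlled only while the path stays in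
  a small ball, and leaving it in time \<open>d\<close> has probability of order \<open>d\<^sup>2\<close>, also under the weighted law.
  The same expansion, multiplied by an increment of \<open>X t - \<integral> a \<nabla>\<psi>\<close>, shows that the
  weighted conditional expectation of that increment is \<open>o(d)\<close>. Summing over a grid makes this process,
  stopped when it or the path becomes large, a martingale under every conditional law given
  the initial point. This avoids Ito's formula and Girsanov's theorem. Disintegrating \<open>P\<close> along the
  initial point gives the statement for \<open>P\<close>.\<close>

section \<open>Measurability of processes with continuous paths\<close>

text \<open>All that is known of the weight \<open>F x t\<close> is that its expectation is finite.
  Without higher moments, Cauchy-Schwarz cannot control its expectation over the event that the path
  leaves a ball. The substitute is a stopping argument: at the first grid time outside the ball the
  path is still in the ball of twice the radius, where the value function is bounded, and
  conditioning there replaces the remaining weight by that bound. So the weighted exit probability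
  is at most a constant times the unweighted one, which is O(d^2) by a maximal inequality and fourth
  moments. A grid of mesh d has about 1/d steps, hence errors o(d) per step, uniform on compact
  sets, add up to zero.

  Derivatives of \<psi> are given only between consecutive times of \<open>D\<close>, with
  continuous extensions. Statements at the times of \<open>D\<close> are one-sided limits, and the
  jump at a time of \<open>S\<close> is a consequence of the definition of \<psi> that has to be
  derived. No domination of the value function is available near a jump, so Fatou's lemma is applied
  twice and the positivity of the Gaussian density turns equality almost everywhere into
  equality.\<close>

text \<open>Rounding the time down to a multiple of 1/(n+1) leaves countably many times, so the
  rounded process is jointly measurable. It converges by continuity, and openness of
  \<open>I\<close> guarantees that the rounded times eventually lie in \<open>I\<close>.\<close>

lemma borel_measurable_continuous_process:
  fixes Z :: "real \<Rightarrow> 'b \<Rightarrow> 'c::metric_space"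
  assumes I: "open I" and Z: "\<And>q. q \<in> I \<Longrightarrow> Z q \<in> borel_measurable N"
    and cont: "\<And>z. z \<in> space N \<Longrightarrow> continuous_on I (\<lambda>q. Z q z)"
  shows "(\<lambda>(q, z). if q \<in> I then Z q z else c) \<in> borel_measurable (borel \<Otimes>\<^sub>M N)"
proof -
  define Z' where "Z' q z = (if q \<in> I then Z q z else c)" for q z
  define g where "g n q = real_of_int \<lfloor>real (Suc n) * q\<rfloor> / real (Suc n)" for n :: nat and q :: real
  have [measurable]: "Z' q \<in> borel_measurable N" for q
    using Z[of q] by (cases "q \<in> I") (auto simp: Z'_def[abs_def])
  have s: "(\<lambda>x. Z' (g n (fst x)) (snd x)) \<in> borel_measurable (borel \<Otimes>\<^sub>M N)" for n
    unfolding g_def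
    by (rule measurable_compose_countable[where f = "\<lambda>i x. Z' (real_of_int i / real (Suc n)) (snd x)"])
      measurable
  have [measurable]: "I \<in> sets borel" using I by simp
  have m: "(\<lambda>x::real \<times> 'b. if fst x \<in> I then Z' (g n (fst x)) (snd x) else c) \<in> borel_measurable (borel \<Otimes>\<^sub>M N)" for n
    by (intro measurable_If s) (auto intro!: pred_sets2)
  have "(\<lambda>x::real \<times> 'b. if fst x \<in> I then Z (fst x) (snd x) else c) \<in> borel_measurable (borel \<Otimes>\<^sub>M N)"
  proof (rule borel_measurable_LIMSEQ_metric[OF m])
    fix x :: "real \<times> 'b" assume x: "x \<in> space (borel \<Otimes>\<^sub>M N)"
    show "(\<lambda>n. if fst x \<in> I then Z' (g n (fst x)) (snd x) else c)
      \<longlonglongrightarrow> (if fst x \<in> I then Z (fst x) (snd x) else c)"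
    proof (cases "fst x \<in> I")
      case True
      have g: "(\<lambda>n. g n (fst x)) \<longlonglongrightarrow> fst x"
      proof (rule tendsto_sandwich)
        show "\<forall>\<^sub>F n in sequentially. fst x - 1 / real (Suc n) \<le> g n (fst x)"
        proof (rule always_eventually, rule allI)
          fix n
          have "fst x - 1 / real (Suc n) = (real (Suc n) * fst x - 1) / real (Suc n)"
            by (simp add: diff_divide_distrib)
          also have "\<dots> \<le> g n (fst x)"
            unfolding g_def by (rule divide_right_mono) linarith+
          finally show "fst x - 1 / real (Suc n) \<le> g n (fst x)" .
        qed
        show "\<forall>\<^sub>F n in sequentially. g n (fst x) \<le> fst x"
        proof (rule always_eventually, rule allI)
          fix n
          have "g n (fst x) \<le> (real (Suc n) * fst x) / real (Suc n)"
            unfolding g_def by (rule divide_right_mono) linarith+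
          then show "g n (fst x) \<le> fst x" by simp
        qed
        show "(\<lambda>n. fst x - 1 / real (Suc n)) \<longlonglongrightarrow> fst x"
          using tendsto_diff[OF tendsto_const LIMSEQ_inverse_real_of_nat, of "fst x"]
          by (simp add: inverse_eq_divide)
      qed simp
      have ev: "\<forall>\<^sub>F n in sequentially. g n (fst x) \<in> I"
        using topological_tendstoD[OF g I True] .
      have "isCont (\<lambda>q. Z q (snd x)) (fst x)"
        using cont[of "snd x"] x I True by (auto simp: space_pair_measure continuous_on_eq_continuous_at)
      from isCont_tendsto_compose[OF this g]
      have "(\<lambda>n. Z' (g n (fst x)) (snd x)) \<longlonglongrightarrow> Z (fst x) (snd x)"
        by (rule Lim_transform_eventually) (use ev in \<open>auto simp: Z'_def elim!: eventually_mono\<close>)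
      then show ?thesis using True by simp
    qed simp
  qed
  then show ?thesis by (simp add: case_prod_beta)
qed

text \<open>A non-strict bound passes from a countable dense set of times to its closure.\<close>

lemma sets_continuous_process_le:
  fixes Z :: "real \<Rightarrow> 'b \<Rightarrow> real"
  assumes Z: "\<And>q. q \<in> {c..d} \<Longrightarrow> Z q \<in> borel_measurable N"
    and cont: "\<And>z. z \<in> space N \<Longrightarrow> continuous_on {c..d} (\<lambda>q. Z q z)"
  shows "{z\<in>space N. \<forall>q\<in>{c..d}. Z q z \<le> k} \<in> sets N"
proof -
  obtain Q where Q: "countable Q" "Q \<subseteq> {c..d}" "{c..d} \<subseteq> closure Q"
    using separable[of "{c..d}"] by metis
  have "{z\<in>space N. \<forall>q\<in>{c..d}. Z q z \<le> k} = {z\<in>space N. \<forall>q\<in>Q. Z q z \<le> k}"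
  proof (intro Collect_cong conj_cong refl)
    fix z assume z: "z \<in> space N"
    show "(\<forall>q\<in>{c..d}. Z q z \<le> k) \<longleftrightarrow> (\<forall>q\<in>Q. Z q z \<le> k)"
    proof
      assume *: "\<forall>q\<in>Q. Z q z \<le> k"
      have "closure Q = {c..d}" using Q closure_minimal[of Q "{c..d}"] by auto
      then show "\<forall>q\<in>{c..d}. Z q z \<le> k"
        using continuous_le_on_closure[of Q "\<lambda>q. Z q z" _ k] cont[OF z] * by auto
    qed (use Q(2) in auto)
  qed
  also have "\<dots> \<in> sets N"
    using Q Z by (intro sets.sets_Collect_countable_All' borel_measurable_le) auto
  finally show ?thesis .
qed

text \<open>On a compact interval the supremum is attained, so reaching \<open>k\<close> means
  exceeding each \<open>k - inverse (Suc n)\<close> somewhere; the complements of these events are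
  of the form already treated.\<close>

lemma sets_continuous_process_hit:
  fixes Z :: "real \<Rightarrow> 'b \<Rightarrow> real"
  assumes Z: "\<And>q. q \<in> {c..d} \<Longrightarrow> Z q \<in> borel_measurable N"
    and cont: "\<And>z. z \<in> space N \<Longrightarrow> continuous_on {c..d} (\<lambda>q. Z q z)"
  shows "{z\<in>space N. \<exists>q\<in>{c..d}. k \<le> Z q z} \<in> sets N"
proof -
  have "{z\<in>space N. \<exists>q\<in>{c..d}. k \<le> Z q z} =
    space N - (\<Union>n::nat. {z\<in>space N. \<forall>q\<in>{c..d}. Z q z \<le> k - inverse (Suc n)})"
  proof (intro set_eqI iffI)
    fix z assume "z \<in> space N - (\<Union>n::nat. {z\<in>space N. \<forall>q\<in>{c..d}. Z q z \<le> k - inverse (Suc n)})"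
    then have z: "z \<in> space N"
      and "\<not> (\<forall>q\<in>{c..d}. Z q z \<le> k - inverse (Suc n))" for n by auto
    then have *: "\<exists>q\<in>{c..d}. Z q z > k - inverse (Suc n)" for n by (meson not_le)
    from *[of 0] obtain q where q: "q \<in> {c..d}" "\<forall>r\<in>{c..d}. Z r z \<le> Z q z"
      using continuous_attains_sup[OF _ _ cont[OF z]] by force
    have "k - inverse (Suc n) \<le> Z q z" for n using *[of n] q(2) by force
    moreover have "(\<lambda>n. k - inverse (real (Suc n))) \<longlonglongrightarrow> k"
      using tendsto_diff[OF tendsto_const LIMSEQ_inverse_real_of_nat, of k] by simp
    ultimately have "k \<le> Z q z" using LIMSEQ_le_const2 by blast
    then show "z \<in> {z\<in>space N. \<exists>q\<in>{c..d}. k \<le> Z q z}" using q z by auto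
  next
    fix z assume "z \<in> {z\<in>space N. \<exists>q\<in>{c..d}. k \<le> Z q z}"
    then obtain q where q: "z \<in> space N" "q \<in> {c..d}" "k \<le> Z q z" by auto
    have "\<not> (\<forall>q\<in>{c..d}. Z q z \<le> k - inverse (Suc n))" for n
    proof
      assume "\<forall>q\<in>{c..d}. Z q z \<le> k - inverse (Suc n)"
      then have "Z q z \<le> k - inverse (Suc n)" using q(2) by blast
      moreover have "0 < inverse (real (Suc n))" by simp
      ultimately show False using q(3) by linarith
    qed
    then show "z \<in> space N - (\<Union>n::nat. {z\<in>space N. \<forall>q\<in>{c..d}. Z q z \<le> k - inverse (Suc n)})"
      using q(1) by auto
  qed
  also have "\<dots> \<in> sets N"
    by (intro sets.Diff sets.top sets.countable_UN image_subsetI sets_continuous_process_le Z cont)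
  finally show ?thesis .
qed

section \<open>Flat spaces and lifts of paths\<close>

text \<open>Covers both state spaces: for the trivial lattice \<open>separated\<close> is vacuous.
  Lattice points at mutual distance at least 1 make \<open>pr\<close> injective on balls of radius
  1/2, the source of the threshold 1/2 below.\<close>

locale flat_quotient =
  fixes pr :: "real^'n \<Rightarrow> 'x::{second_countable_topology, t2_space}" and \<Lambda> :: "(real^'n) set"
  assumes quotient: "lattice_quotient \<Lambda> pr"
    and separated: "\<And>l. l \<in> \<Lambda> \<Longrightarrow> l \<noteq> 0 \<Longrightarrow> 1 \<le> norm l"
    and translate: "\<And>x y w. pr x = pr y \<Longrightarrow> pr (x + w) = pr (y + w)"
begin

lemma pr_eq_iff: "pr x = pr y \<longleftrightarrow> x - y \<in> \<Lambda>"
  using quotient by (auto simp: lattice_quotient_def)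

lemma surj_pr: "surj pr"
  using quotient by (auto simp: lattice_quotient_def)

lemma pr_inv [simp]: "pr (inv pr z) = z"
  using surj_pr by (rule surj_f_inv_f)

lemma continuous_on_pr [continuous_intros]:
  "continuous_on A f \<Longrightarrow> continuous_on A (\<lambda>x. pr (f x))"
  using lattice_quotient_continuous[OF quotient] by (rule continuous_on_compose2) auto

lemma measurable_pr [measurable]: "pr \<in> borel_measurable borel"
  using lattice_quotient_continuous[OF quotient] by (rule borel_measurable_continuous_onI)

lemma continuous_on_quotient:
  fixes g :: "'x \<Rightarrow> 'c::topological_space"
  assumes "continuous_on UNIV (\<lambda>y. g (pr y))"
  shows "continuous_on UNIV g"
  using assms quotient unfolding continuous_on_open_vimage[OF open_UNIV] lattice_quotient_def
  by (simp add: vimage_def)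

lemma measurable_quotient: "(\<lambda>y. g (pr y)) \<in> borel \<rightarrow>\<^sub>M N \<Longrightarrow> g \<in> borel \<rightarrow>\<^sub>M N"
  using lattice_quotient_borel_measurable[OF quotient separated] .

lemma pr_add_cancel:
  assumes "pr x = pr y" "pr (x + w) = pr (y + w')" "norm (w - w') < 1"
  shows "w = w'"
proof -
  have "pr (x + w) = pr (x + w')" using translate[OF assms(1), of w'] assms(2) by simp
  then have "w - w' \<in> \<Lambda>" unfolding pr_eq_iff by simp
  then show ?thesis using separated[of "w - w'"] assms(3) by auto
qed

lemma open_image_pr: "open U \<Longrightarrow> open (pr ` U)"
  using lattice_quotient_open_image[OF quotient] .

section \<open>Testing measurability into the quotient by real functions\<close>

text \<open>No metric is given on the quotient. The distance of a lift to the preimage of the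
  complement of \<open>U\<close> is invariant under the lattice and therefore descends to a
  continuous function with the right zero set.\<close>

lemma open_eq_cozero:
  assumes "open (U :: 'x set)"
  obtains f :: "'x \<Rightarrow> real" where "continuous_on UNIV f" "U = {z. f z \<noteq> 0}"
proof (cases "U = UNIV")
  case True
  then show ?thesis using that[of "\<lambda>_. 1"] by simp
next
  case False
  define C where "C = - (pr -` U)"
  define f where "f z = infdist (inv pr z) C" for z
  have "open (pr -` U)" using assms quotient by (auto simp: lattice_quotient_def)
  then have "closed C" unfolding C_def by (rule closed_Compl)
  moreover obtain z where "z \<notin> U" using False by auto
  then have "inv pr z \<in> C" by (simp add: C_def)
  ultimately have C: "closed C" "C \<noteq> {}" by auto
  \<comment> \<open>\<open>C\<close> is a full preimage, so moving a point of \<open>C\<close> by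
    the lattice vector \<open>y' - y\<close> stays in \<open>C\<close>.\<close>
  have le: "infdist y' C \<le> infdist y C" if "pr y = pr y'" for y y'
  proof -
    have "infdist y' C \<le> dist y c" if "c \<in> C" for c
    proof -
      have "pr (c + (y' - y)) = pr c"
        unfolding pr_eq_iff using \<open>pr y = pr y'\<close>[symmetric, unfolded pr_eq_iff] by simp
      then have "c + (y' - y) \<in> C" using that by (simp add: C_def)
      from infdist_le[OF this, of y'] show ?thesis by (simp add: dist_norm algebra_simps)
    qed
    then show ?thesis unfolding infdist_notempty[OF C(2), of y] by (rule cINF_greatest[OF C(2)])
  qed
  have fpr: "f (pr y) = infdist y C" for y
    unfolding f_def by (intro antisym le) simp_all
  have "continuous_on UNIV f"
    by (rule continuous_on_quotient) (simp add: fpr continuous_on_infdist continuous_on_id)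
  moreover have "U = {z. f z \<noteq> 0}"
  proof (intro set_eqI)
    fix z
    have "f z = 0 \<longleftrightarrow> inv pr z \<in> C"
      unfolding f_def using in_closed_iff_infdist_zero[OF C] by blast
    then show "z \<in> U \<longleftrightarrow> z \<in> {z. f z \<noteq> 0}" by (simp add: C_def)
  qed
  ultimately show ?thesis using that by blast
qed

text \<open>Reduces maps into the quotient to real functions, for which pointwise limits of
  measurable functions are measurable.\<close>

lemma measurable_cozeroI:
  fixes g :: "'b \<Rightarrow> 'x"
  assumes "\<And>f::'x \<Rightarrow> real. continuous_on UNIV f \<Longrightarrow> (\<lambda>w. f (g w)) \<in> borel_measurable N"
  shows "g \<in> N \<rightarrow>\<^sub>M borel"
proof (rule borel_measurableI)
  fix U :: "'x set" assume "open U"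
  then obtain f :: "'x \<Rightarrow> real" where f: "continuous_on UNIV f" "U = {z. f z \<noteq> 0}"
    by (rule open_eq_cozero)
  note [measurable] = assms[OF f(1)]
  have "g -` U \<inter> space N = {w \<in> space N. f (g w) \<noteq> 0}" using f(2) by auto
  also have "\<dots> \<in> sets N" by measurable
  finally show "g -` U \<inter> space N \<in> sets N" .
qed

lemma measurable_continuous_process:
  fixes Z :: "real \<Rightarrow> 'b \<Rightarrow> 'x"
  assumes cd: "c \<le> d" and Z: "\<And>q. q \<in> {c..d} \<Longrightarrow> Z q \<in> N \<rightarrow>\<^sub>M borel"
    and cont: "\<And>z. z \<in> space N \<Longrightarrow> continuous_on {c..d} (\<lambda>q. Z q z)"
  shows "(\<lambda>(q, z). Z (max c (min d q)) z) \<in> borel \<Otimes>\<^sub>M N \<rightarrow>\<^sub>M borel"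
proof (rule measurable_cozeroI)
  fix f :: "'x \<Rightarrow> real" assume f: "continuous_on UNIV f"
  have "(\<lambda>(q, z). if q \<in> UNIV then f (Z (max c (min d q)) z) else 0) \<in> borel_measurable (borel \<Otimes>\<^sub>M N)"
  proof (rule borel_measurable_continuous_process)
    show "(\<lambda>z. f (Z (max c (min d q)) z)) \<in> borel_measurable N" for q
      using measurable_compose[OF Z borel_measurable_continuous_onI[OF f]] cd by auto
    show "continuous_on UNIV (\<lambda>q. f (Z (max c (min d q)) z))" if "z \<in> space N" for z
      using cd by (intro continuous_on_compose2[OF f] continuous_on_compose2[OF cont[OF that]] continuous_intros) auto
  qed simp
  then show "(\<lambda>x. f ((case x of (q, z) \<Rightarrow> Z (max c (min d q)) z))) \<in> borel_measurable (borel \<Otimes>\<^sub>M N)"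
    by (simp add: case_prod_beta)
qed

section \<open>Continuous lifts of paths\<close>

text \<open>Interval bisection: having a lift is stable under joining adjacent intervals, and it
  holds on short intervals because \<open>pr\<close> has a continuous local inverse.\<close>

lemma lift_exists:
  fixes \<gamma> :: "real \<Rightarrow> 'x"
  assumes "a \<le> b" and \<gamma>: "continuous_on {a..b} \<gamma>"
  shows "\<exists>w. continuous_on {a..b} w \<and> (\<forall>r\<in>{a..b}. pr (w r) = \<gamma> r)"
proof -
  define P where "P c d \<longleftrightarrow> ({c..d} \<subseteq> {a..b} \<longrightarrow>
    (\<exists>w. continuous_on {c..d} w \<and> (\<forall>r\<in>{c..d}. pr (w r) = \<gamma> r)))" for c d
  have "P a b"
  proof (rule Bolzano[OF \<open>a \<le> b\<close>])
    fix c d e assume P: "P c d" "P d e" and le: "c \<le> d" "d \<le> e"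
    show "P c e"
      unfolding P_def
    proof
      assume sub: "{c..e} \<subseteq> {a..b}"
      then have "{c..d} \<subseteq> {a..b}" "{d..e} \<subseteq> {a..b}" using le by auto
      then obtain w1 w2 where w: "continuous_on {c..d} w1" "\<And>r. r\<in>{c..d} \<Longrightarrow> pr (w1 r) = \<gamma> r"
        "continuous_on {d..e} w2" "\<And>r. r\<in>{d..e} \<Longrightarrow> pr (w2 r) = \<gamma> r"
        using P unfolding P_def by meson
      have "pr (w1 d) = pr (w2 d)" using w(2)[of d] w(4)[of d] le by simp
      then have l: "pr (w2 r + (w1 d - w2 d)) = pr (w2 r)" for r by (simp add: pr_eq_iff)
      \<comment> \<open>The two lifts differ at \<open>d\<close> by a lattice vector; shifting the
        second by it makes them fit without changing its projection.\<close>
      define w where "w r = (if r \<le> d then w1 r else w2 r + (w1 d - w2 d))" for r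
      have "continuous_on ({c..d} \<union> {d..e}) w"
        unfolding w_def by (intro continuous_on_cases w(1) continuous_intros w(3)) auto
      moreover have "{c..d} \<union> {d..e} = {c..e}" using le by auto
      ultimately have "continuous_on {c..e} w" by simp
      moreover have "\<forall>r\<in>{c..e}. pr (w r) = \<gamma> r" using w(2,4) l by (auto simp: w_def)
      ultimately show "\<exists>w. continuous_on {c..e} w \<and> (\<forall>r\<in>{c..e}. pr (w r) = \<gamma> r)" by blast
    qed
  next
    fix x assume x: "a \<le> x" "x \<le> b"
    \<comment> \<open>Two points of a ball of radius 1/2 are at distance less than 1, so
      \<open>pr\<close> is injective on \<open>V\<close>; being open it has a continuous inverse
      there.\<close>
    define V where "V = ball (inv pr (\<gamma> x)) (1/2)"
    have inj: "inj_on pr V"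
    proof (rule inj_onI)
      fix y z assume "y \<in> V" "z \<in> V" "pr y = pr z"
      then have "norm (y - z) < 1"
        using dist_triangle_half_r[of "inv pr (\<gamma> x)" y 1 z] by (simp add: V_def dist_norm)
      then show "y = z" using pr_add_cancel[of 0 0 y z] \<open>pr y = pr z\<close> by simp
    qed
    have s: "continuous_on (pr ` V) (inv_into V pr)"
    proof (rule continuous_on_inverse_open_map)
      show "continuous_on V pr" by (intro continuous_intros)
      show "inv_into V pr (pr y) = y" if "y \<in> V" for y using inj that by simp
      show "openin (top_of_set (pr ` V)) (pr ` U)" if "openin (top_of_set V) U" for U
      proof -
        have "open U" using that by (simp add: V_def openin_open_eq)
        then have "open (pr ` U)" by (rule open_image_pr)
        moreover have "pr ` U \<subseteq> pr ` V" using that openin_imp_subset by blast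
        ultimately show ?thesis by (simp add: open_subset)
      qed
    qed simp
    have "open (pr ` V)" by (rule open_image_pr) (simp add: V_def)
    moreover have "\<gamma> x \<in> pr ` V" by (rule image_eqI[of _ _ "inv pr (\<gamma> x)"]) (auto simp: V_def)
    ultimately obtain A where A: "open A" "x \<in> A" "\<forall>y\<in>{a..b}. y \<in> A \<longrightarrow> \<gamma> y \<in> pr ` V"
      using \<gamma> x unfolding continuous_on_topological by (metis atLeastAtMost_iff)
    then obtain h where h: "h > 0" "ball x h \<subseteq> A" by (meson openE)
    show "\<exists>d>0. \<forall>c e. c \<le> x \<and> x \<le> e \<and> e - c < d \<longrightarrow> P c e"
    proof (intro exI conjI allI impI)
      fix c e assume ce: "c \<le> x \<and> x \<le> e \<and> e - c < h"
      show "P c e"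
        unfolding P_def
      proof (intro impI exI conjI ballI)
        assume sub: "{c..e} \<subseteq> {a..b}"
        have V: "\<gamma> r \<in> pr ` V" if "r \<in> {c..e}" for r
        proof -
          have "dist x r < h" using that ce by (auto simp: dist_real_def)
          then have "r \<in> A" using h(2) by (meson mem_ball subsetD)
          then show ?thesis using that A(3) sub by blast
        qed
        show "continuous_on {c..e} (\<lambda>r. inv_into V pr (\<gamma> r))"
          by (intro continuous_on_compose2[OF s] continuous_on_subset[OF \<gamma>] sub) (use V in auto)
        show "pr (inv_into V pr (\<gamma> r)) = \<gamma> r" if "r \<in> {c..e}" for r
          using V[OF that] by (rule f_inv_into_f)
      qed
    qed (rule h(1))
  qed
  then show ?thesis by (simp add: P_def)
qed

text \<open>The difference of two lifts is lattice-valued, so the continuous function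
  \<open>g\<close> takes values in {0} and [1, \<infinity>); it vanishes at \<open>s\<close>, and
  its range over an interval is connected.\<close>

lemma lift_unique:
  fixes w w' :: "real \<Rightarrow> real^'n"
  assumes "continuous_on {a..b} w" "continuous_on {a..b} w'"
    and "\<And>r. r \<in> {a..b} \<Longrightarrow> pr (w r) = pr (w' r)" and "r \<in> {a..b}" "s \<in> {a..b}"
  shows "w r - w s = w' r - w' s"
proof -
  define g where "g r = norm ((w r - w' r) - (w s - w' s))" for r
  have g: "g r = 0 \<or> 1 \<le> g r" if r: "r \<in> {a..b}" for r
  proof -
    have "pr (w r - w' r) = pr 0" "pr (w s - w' s) = pr 0"
      using assms(3)[OF r] assms(3)[OF assms(5)] by (simp_all add: pr_eq_iff)
    then have "(w r - w' r) - (w s - w' s) \<in> \<Lambda>" using pr_eq_iff by metis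
    then show ?thesis using separated unfolding g_def by force
  qed
  have "connected (g ` {a..b})"
    unfolding g_def by (intro connected_continuous_image continuous_intros assms(1,2)) auto
  moreover have "g s \<in> g ` {a..b}" "g r \<in> g ` {a..b}" using assms(4,5) by auto
  moreover have "g s = 0" by (simp add: g_def)
  ultimately have "1/2 \<in> g ` {a..b}" if "1 \<le> g r"
    using that connectedD_interval[of "g ` {a..b}" "g s" "g r" "1/2"] by simp
  then have "g r = 0" using g assms(4) by force
  then have "w r - w' r = w s - w' s" by (simp add: g_def)
  moreover have "w r - w s = (w r - w' r) - (w s - w' s) + (w' r - w' s)" by simp
  ultimately show ?thesis by simp
qed

lemma path_increment_lift:
  assumes "continuous_on {0..1} w" "\<And>r. r \<in> {0..1} \<Longrightarrow> pr (w r) = v r" "t \<in> {0..1}"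
  shows "path_increment pr t v = w t - w 0"
proof -
  define w' where "w' = (SOME w. continuous_on {0..1} w \<and> (\<forall>r\<in>{0..1}. pr (w r) = v r))"
  have "continuous_on {0..1} w' \<and> (\<forall>r\<in>{0..1}. pr (w' r) = v r)"
    unfolding w'_def by (rule someI[of _ w]) (use assms in auto)
  then show ?thesis
    unfolding path_increment_def w'_def[symmetric] Let_def
    using assms by (intro lift_unique[of 0 1]) auto
qed

lemma path_space_lift:
  assumes "v \<in> space path_space"
  obtains w where "continuous_on {0..1} w" "\<And>r. r \<in> {0..1} \<Longrightarrow> pr (w r) = v r" "w 0 = inv pr (v 0)"
    "\<And>t. t \<in> {0..1} \<Longrightarrow> path_increment pr t v = w t - w 0"
proof -
  obtain w where w: "continuous_on {0..1} w" "\<And>r. r \<in> {0..1} \<Longrightarrow> pr (w r) = v r"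
    using lift_exists[of 0 1 v] assms by (auto simp: space_path_space)
  define w' where "w' r = w r + (inv pr (v 0) - w 0)" for r
  have "pr (inv pr (v 0)) = pr (w 0)" using w(2)[of 0] by simp
  then have "inv pr (v 0) - w 0 \<in> \<Lambda>" unfolding pr_eq_iff .
  then have "pr (w' r) = pr (w r)" for r unfolding w'_def pr_eq_iff by simp
  then have w': "continuous_on {0..1} w'" "\<And>r. r \<in> {0..1} \<Longrightarrow> pr (w' r) = v r" "w' 0 = inv pr (v 0)"
    using w by (auto simp: w'_def intro!: continuous_intros)
  then show thesis using that path_increment_lift[OF w'(1,2)] by blast
qed

section \<open>Recovering the lifted increment from the path\<close>

text \<open>\<open>path_increment\<close> chooses a lift by Hilbert choice, which says nothing about
  measurability. This function reads a displacement off two nearby points of the quotient without a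
  lift; below length 1/2 the displacement is unique.\<close>

definition small_increment :: "'x \<times> 'x \<Rightarrow> real^'n" where
  "small_increment zz = (if \<exists>w y. norm w < 1/2 \<and> pr y = fst zz \<and> pr (y + w) = snd zz
     then THE w. norm w < 1/2 \<and> (\<exists>y. pr y = fst zz \<and> pr (y + w) = snd zz) else 0)"

lemma small_increment_eq:
  assumes "norm w < 1/2" "pr y = z" "pr (y + w) = z'"
  shows "small_increment (z, z') = w"
proof -
  have "(THE w. norm w < 1/2 \<and> (\<exists>y. pr y = z \<and> pr (y + w) = z')) = w"
  proof (rule the_equality)
    fix w' assume "norm w' < 1/2 \<and> (\<exists>y. pr y = z \<and> pr (y + w') = z')"
    then obtain y' where y': "norm w' < 1/2" "pr y' = z" "pr (y' + w') = z'" by blast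
    show "w' = w"
    proof (rule pr_add_cancel)
      show "pr y' = pr y" "pr (y' + w') = pr (y + w)" using assms y' by auto
      show "norm (w' - w) < 1" using norm_triangle_ineq4[of w' w] assms(1) y'(1) by linarith
    qed
  qed (use assms in auto)
  then show ?thesis unfolding small_increment_def using assms by auto
qed

text \<open>The set \<open>O' V\<close> of pairs joined by a short displacement in \<open>V\<close>
  is open because \<open>pr\<close> is an open map.\<close>

lemma measurable_small_increment [measurable]: "small_increment \<in> borel_measurable borel"
proof (rule borel_measurableI)
  fix U :: "(real^'n) set" assume U: "open U"
  define O' where "O' V = (\<lambda>(y, w). (pr y, pr (y + w))) ` (UNIV \<times> (V \<inter> ball 0 (1/2)))" for V
  have op: "open (O' V)" if "open V" for V
  proof (rule topological_space_class.openI)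
    fix zz assume "zz \<in> O' V"
    then obtain y w where yw: "zz = (pr y, pr (y + w))" "w \<in> V" "norm w < 1/2" by (auto simp: O'_def)
    have "open (V \<inter> ball 0 (1/2))" using that by auto
    then obtain e where e: "e > 0" "ball w e \<subseteq> V \<inter> ball 0 (1/2)"
      using yw by (metis IntI mem_ball_0 openE)
    have "pr ` ball y (e/2) \<times> pr ` ball (y + w) (e/2) \<subseteq> O' V"
    proof clarify
      fix y1 y2 assume "y1 \<in> ball y (e/2)" "y2 \<in> ball (y + w) (e/2)"
      then have "norm (y1 - y) < e/2" "norm (y2 - (y + w)) < e/2"
        by (simp_all add: dist_norm norm_minus_commute)
      then have "norm ((y2 - (y + w)) - (y1 - y)) < e"
        using norm_triangle_ineq4[of "y2 - (y + w)" "y1 - y"] by linarith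
      then have "dist w (y2 - y1) < e" by (simp add: dist_norm norm_minus_commute algebra_simps)
      then have "y2 - y1 \<in> V \<inter> ball 0 (1/2)" using e(2) by (meson mem_ball subsetD)
      then show "(pr y1, pr y2) \<in> O' V" by (auto simp: O'_def intro!: image_eqI[of _ _ "(y1, y2 - y1)"])
    qed
    moreover have "open (pr ` ball y (e/2) \<times> pr ` ball (y + w) (e/2))"
      by (intro open_Times open_image_pr) auto
    moreover have "zz \<in> pr ` ball y (e/2) \<times> pr ` ball (y + w) (e/2)" using yw(1) e(1) by auto
    ultimately show "\<exists>T. open T \<and> zz \<in> T \<and> T \<subseteq> O' V" by blast
  qed
  \<comment> \<open>Pairs that no short displacement joins get the value 0, which adds the
    complement of the open set \<open>O' UNIV\<close> exactly when 0 is in \<open>U\<close>.\<close>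
  have "small_increment -` U = (if 0 \<in> U then O' U \<union> - O' UNIV else O' U)"
  proof (rule set_eqI)
    fix zz :: "'x \<times> 'x" obtain z z' where zz: "zz = (z, z')" by (cases zz)
    show "zz \<in> small_increment -` U \<longleftrightarrow> zz \<in> (if 0 \<in> U then O' U \<union> - O' UNIV else O' U)"
    proof (cases "zz \<in> O' UNIV")
      case True
      then obtain y w where yw: "zz = (pr y, pr (y + w))" "norm w < 1/2" by (auto simp: O'_def)
      then have s: "small_increment zz = w" using small_increment_eq by simp
      have "zz \<in> O' U \<longleftrightarrow> w \<in> U"
      proof
        assume "zz \<in> O' U"
        then obtain y' w' where "zz = (pr y', pr (y' + w'))" "norm w' < 1/2" "w' \<in> U"
          by (auto simp: O'_def)
        then have "small_increment zz = w'" using small_increment_eq by simp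
        then show "w \<in> U" using s \<open>w' \<in> U\<close> by simp
      qed (use yw in \<open>auto simp: O'_def intro!: image_eqI[of _ _ "(y, w)"]\<close>)
      then show ?thesis using s True by auto
    next
      case False
      then have "\<not> (\<exists>w y. norm w < 1/2 \<and> pr y = fst zz \<and> pr (y + w) = snd zz)"
        by (force simp: O'_def zz image_iff)
      then have "small_increment zz = 0" unfolding small_increment_def by (rule if_not_P)
      moreover have "O' U \<subseteq> O' UNIV" by (auto simp: O'_def)
      ultimately show ?thesis using False by auto
    qed
  qed
  also have "\<dots> \<in> sets borel" using op[OF U] op[of UNIV] by auto
  finally show "small_increment -` U \<inter> space borel \<in> sets borel" by simp
qed

text \<open>By uniform continuity all grid increments of the lift are shorter than 1/2 on a fine
  grid, so the sum telescopes; it equals the limit from some grid on.\<close>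

lemma sum_small_increments:
  assumes w: "continuous_on {0..1} w" "\<And>r. r \<in> {0..1} \<Longrightarrow> pr (w r) = v r" and t: "t \<in> {0..1}"
  shows "(\<lambda>m. \<Sum>k<Suc m. small_increment (v (t * (k / Suc m)), v (t * (Suc k / Suc m))))
    \<longlonglongrightarrow> w t - w 0"
proof (rule tendsto_eventually)
  obtain d where d: "d > 0" "\<And>r s. r \<in> {0..1} \<Longrightarrow> s \<in> {0..1} \<Longrightarrow> dist r s < d \<Longrightarrow> dist (w r) (w s) < 1/2"
    using compact_uniformly_continuous[OF w(1)] unfolding uniformly_continuous_on_def
    by (metis compact_Icc half_gt_zero_iff zero_less_one)
  have "\<forall>\<^sub>F m in sequentially. inverse (real (Suc m)) < d"
    using order_tendstoD(2)[OF LIMSEQ_inverse_real_of_nat d(1)] .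
  then show "\<forall>\<^sub>F m in sequentially.
    (\<Sum>k<Suc m. small_increment (v (t * (k / Suc m)), v (t * (Suc k / Suc m)))) = w t - w 0"
  proof eventually_elim
    fix m assume m: "inverse (real (Suc m)) < d"
    define r where "r k = t * (real k / real (Suc m))" for k
    have "small_increment (v (r k), v (r (Suc k))) = w (r (Suc k)) - w (r k)" if k: "k < Suc m" for k
    proof -
      have r01: "r j \<in> {0..1}" if "j \<le> Suc m" for j
      proof -
        have "0 \<le> real j / real (Suc m)" "real j / real (Suc m) \<le> 1" using that by auto
        then show ?thesis using t mult_le_one[of t "real j / real (Suc m)"] unfolding r_def by simp
      qed
      have "r (Suc k) - r k = t * inverse (Suc m)"
        unfolding r_def right_diff_distrib[symmetric] diff_divide_distrib[symmetric]
        by (simp add: inverse_eq_divide)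
      also have "\<dots> \<le> inverse (Suc m)" using t by (intro mult_left_le_one_le) auto
      finally have "\<bar>r (Suc k) - r k\<bar> < d"
        using m t by (auto simp: r_def mult_left_mono divide_right_mono)
      then have "norm (w (r (Suc k)) - w (r k)) < 1/2"
        using d(2)[OF r01 r01, of "Suc k" k] k by (simp add: dist_norm)
      then show ?thesis
        using small_increment_eq[of "w (r (Suc k)) - w (r k)" "w (r k)"] w(2) r01[of k] r01[of "Suc k"] k by simp
    qed
    then have "(\<Sum>k<Suc m. small_increment (v (r k), v (r (Suc k)))) = (\<Sum>k<Suc m. w (r (Suc k)) - w (r k))"
      by (intro sum.cong) auto
    also have "\<dots> = w (r (Suc m)) - w (r 0)" by (rule sum_lessThan_telescope)
    finally show "(\<Sum>k<Suc m. small_increment (v (t * (k / Suc m)), v (t * (Suc k / Suc m)))) = w t - w 0"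
      by (simp add: r_def)
  qed
qed

end

section \<open>The canonical filtration of path space\<close>

lemma space_path_filtration [simp]: "space (path_filtration t) = space path_space"
  unfolding path_filtration_def by (rule space_measure_of) auto

lemma sets_path_filtration: "sets (path_filtration t :: (real \<Rightarrow> 'x::topological_space) measure) =
    sigma_sets (space path_space)
     {(\<lambda>w. w r) -` A \<inter> space path_space | r A. r \<in> {0..1} \<and> r \<le> t \<and> A \<in> sets borel}"
  unfolding path_filtration_def by (rule sets_measure_of) auto

lemma measurable_path_filtration_eval:
  "r \<in> {0..1} \<Longrightarrow> r \<le> t \<Longrightarrow> (\<lambda>w. w r) \<in> path_filtration t \<rightarrow>\<^sub>M borel"
  by (rule measurableI) (auto simp: sets_path_filtration)

lemma path_filtration_mono: "s \<le> t \<Longrightarrow> sets (path_filtration s) \<subseteq> sets (path_filtration t)"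
  unfolding sets_path_filtration by (rule sigma_sets_mono') force

lemma path_filtration_subset: "sets (path_filtration t) \<subseteq> sets path_space"
  unfolding sets_path_filtration
  using measurable_sets[OF measurable_path_eval]
  by (intro sets.sigma_sets_subset) (auto simp del: atLeastAtMost_iff)

lemma measurable_from_path_filtration: "f \<in> path_filtration t \<rightarrow>\<^sub>M N \<Longrightarrow> f \<in> path_space \<rightarrow>\<^sub>M N"
  using path_filtration_subset by (auto simp: measurable_def)

lemma measurable_path_filtration_mono:
  "f \<in> path_filtration s \<rightarrow>\<^sub>M N \<Longrightarrow> s \<le> t \<Longrightarrow> f \<in> path_filtration t \<rightarrow>\<^sub>M N"
  using path_filtration_mono by (fastforce simp: measurable_def)

text \<open>The approximating sums use only positions at times up to \<open>t\<close>, which gives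
  adaptedness and not just measurability.\<close>

lemma (in flat_quotient) measurable_path_increment:
  assumes t: "t \<in> {0..1}"
  shows "path_increment pr t \<in> borel_measurable (path_filtration t)"
proof (rule borel_measurable_LIMSEQ_metric)
  fix m :: nat
  have "(\<lambda>v::real \<Rightarrow> 'x. (v (t * (k / Suc m)), v (t * (Suc k / Suc m)))) \<in> path_filtration t \<rightarrow>\<^sub>M borel" if "k < Suc m" for k
  proof -
    have "t * (j / Suc m) \<in> {0..1}" "t * (j / Suc m) \<le> t" if "j \<le> Suc m" for j :: nat
    proof -
      have j: "0 \<le> real j / real (Suc m)" "real j / real (Suc m) \<le> 1" using that by auto
      show "t * (j / Suc m) \<le> t" using j t mult_left_le[of "real j / real (Suc m)" t] by simp
      show "t * (j / Suc m) \<in> {0..1}"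
        using j t mult_le_one[of t "real j / real (Suc m)"] by simp
    qed
    then have "(\<lambda>v::real \<Rightarrow> 'x. (v (t * (k / Suc m)), v (t * (Suc k / Suc m)))) \<in> path_filtration t \<rightarrow>\<^sub>M borel \<Otimes>\<^sub>M borel"
      using that by (intro measurable_Pair measurable_path_filtration_eval) (auto simp del: of_nat_Suc)
    then show ?thesis unfolding borel_prod .
  qed
  then show "(\<lambda>v. \<Sum>k<Suc m. small_increment (v (t * (k / Suc m)), v (t * (Suc k / Suc m))))
      \<in> borel_measurable (path_filtration t)"
    by (intro borel_measurable_sum measurable_compose[OF _ measurable_small_increment]) auto
next
  fix v :: "real \<Rightarrow> 'x" assume "v \<in> space (path_filtration t)"
  then obtain w where w: "continuous_on {0..1} w" "\<And>r. r \<in> {0..1} \<Longrightarrow> pr (w r) = v r"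
    "path_increment pr t v = w t - w 0" using t path_space_lift by (metis space_path_filtration)
  from sum_small_increments[OF w(1,2) t]
  show "(\<lambda>m. \<Sum>k<Suc m. small_increment (v (t * (k / Suc m)), v (t * (Suc k / Suc m))))
      \<longlonglongrightarrow> path_increment pr t v" by (simp only: w(3))
qed

section \<open>Brownian motion\<close>

locale brownian =
  fixes M :: "'w measure" and B :: "real \<Rightarrow> 'w \<Rightarrow> real^'n"
  assumes brownian: "standard_brownian_motion M B"

sublocale brownian \<subseteq> prob_space M
  using brownian by (simp add: standard_brownian_motion_def)

context brownian
begin

lemma measurable_B [measurable]: "t \<in> {0..1} \<Longrightarrow> B t \<in> borel_measurable M"
  and B_0: "w \<in> space M \<Longrightarrow> B 0 w = 0"
  and continuous_on_B: "w \<in> space M \<Longrightarrow> continuous_on {0..1} (\<lambda>t. B t w)"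
  and increment_distributed: "0 \<le> s \<Longrightarrow> s < t \<Longrightarrow> t \<le> 1 \<Longrightarrow>
        distributed M lborel (\<lambda>w. B t w - B s w)
          (\<lambda>x. ennreal (\<Prod>i\<in>UNIV. normal_density 0 (sqrt (t - s)) (x $ i)))"
  and indep_increments: "mono u \<Longrightarrow> range u \<subseteq> {0..1} \<Longrightarrow>
        indep_vars (\<lambda>_. borel) (\<lambda>i w. B (u (Suc i)) w - B (u i) w) {..<k::nat}"
  using brownian by (auto simp: standard_brownian_motion_def)

lemma continuous_on_B' [continuous_intros]:
  "w \<in> space M \<Longrightarrow> continuous_on A g \<Longrightarrow> g ` A \<subseteq> {0..1} \<Longrightarrow> continuous_on A (\<lambda>x. B (g x) w)"
  by (rule continuous_on_compose2[OF continuous_on_B])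

subsection \<open>Past and future increments\<close>

definition past_algebra :: "real \<Rightarrow> 'w measure" where
  "past_algebra r = sigma (space M) {B q -` A \<inter> space M | q A. q \<in> {0..r} \<and> A \<in> sets borel}"

definition future_algebra :: "real \<Rightarrow> 'w measure" where
  "future_algebra r = sigma (space M)
     {(\<lambda>w. B q w - B r w) -` A \<inter> space M | q A. q \<in> {r..1} \<and> A \<in> sets borel}"

lemma space_past [simp]: "space (past_algebra r) = space M"
  and space_future [simp]: "space (future_algebra r) = space M"
  by (auto simp: past_algebra_def future_algebra_def intro!: space_measure_of)

lemma sets_past: "sets (past_algebra r) =
    sigma_sets (space M) {B q -` A \<inter> space M | q A. q \<in> {0..r} \<and> A \<in> sets borel}"
  and sets_future: "sets (future_algebra r) = sigma_sets (space M)
     {(\<lambda>w. B q w - B r w) -` A \<inter> space M | q A. q \<in> {r..1} \<and> A \<in> sets borel}"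
  unfolding past_algebra_def future_algebra_def by (rule sets_measure_of, blast)+

lemma measurable_past_B: "q \<in> {0..r} \<Longrightarrow> B q \<in> borel_measurable (past_algebra r)"
  by (rule measurableI) (auto simp: sets_past)

lemma measurable_future_increment:
  "q \<in> {r..1} \<Longrightarrow> (\<lambda>w. B q w - B r w) \<in> borel_measurable (future_algebra r)"
  by (rule measurableI) (auto simp: sets_future)

lemma past_mono: "s \<le> t \<Longrightarrow> sets (past_algebra s) \<subseteq> sets (past_algebra t)"
  unfolding sets_past by (rule sigma_sets_mono') force

lemma past_subset: "r \<le> 1 \<Longrightarrow> sets (past_algebra r) \<subseteq> events"
  unfolding sets_past by (rule sets.sigma_sets_subset) (auto intro!: measurable_sets[OF measurable_B])

lemma future_subset: "0 \<le> r \<Longrightarrow> sets (future_algebra r) \<subseteq> events"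
proof -
  assume "0 \<le> r"
  then have "(\<lambda>w. B q w - B r w) \<in> borel_measurable M" if "q \<in> {r..1}" for q
    using that by (intro borel_measurable_diff measurable_B) auto
  then show ?thesis
    unfolding sets_future by (intro sets.sigma_sets_subset) (auto intro!: measurable_sets)
qed

lemma measurable_from_past: "r \<le> 1 \<Longrightarrow> f \<in> past_algebra r \<rightarrow>\<^sub>M N \<Longrightarrow> f \<in> M \<rightarrow>\<^sub>M N"
  using past_subset by (fastforce simp: measurable_def)

lemma measurable_from_future: "0 \<le> r \<Longrightarrow> f \<in> future_algebra r \<rightarrow>\<^sub>M N \<Longrightarrow> f \<in> M \<rightarrow>\<^sub>M N"
  using future_subset by (fastforce simp: measurable_def)

text \<open>With all times in increasing order, values up to \<open>r\<close> are sums of increments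
  before \<open>r\<close>, and differences from \<open>B r\<close> are sums of increments after it.
  Disjoint blocks of independent increments are independent.\<close>

lemma indep_finite_past_future:
  assumes r: "r \<in> {0..1}" and J: "finite J" "J \<subseteq> {0..r}" and J': "finite J'" "J' \<subseteq> {r..1}"
    and A: "\<And>q. A q \<in> sets borel" and A': "\<And>q. A' q \<in> sets borel"
  shows "prob ({w\<in>space M. \<forall>q\<in>J. B q w \<in> A q} \<inter> {w\<in>space M. \<forall>q\<in>J'. B q w - B r w \<in> A' q}) =
    prob {w\<in>space M. \<forall>q\<in>J. B q w \<in> A q} * prob {w\<in>space M. \<forall>q\<in>J'. B q w - B r w \<in> A' q}"
proof -
  \<comment> \<open>Time 0 is included because \<open>B 0 = 0\<close> lets values be written as sums
    of increments; \<open>r\<close> is included so that no increment straddles it.\<close>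
  define T where "T = J \<union> J' \<union> {0, r}"
  have T: "finite T" "T \<subseteq> {0..1}" "0 \<in> T" "r \<in> T" using J J' r by (auto simp: T_def)
  define L where "L = sorted_list_of_set T"
  define n where "n = length L"
  have L: "sorted_wrt (<) L" "set L = T" using T by (auto simp: L_def)
  have n: "n > 0" using L T by (cases L) (auto simp: n_def)
  \<comment> \<open>\<open>indep_increments\<close> expects a monotone sequence indexed by all
    naturals; the sorted list is continued constantly after its last entry.\<close>
  define u where "u i = L ! (min i (n - 1))" for i
  have u_mono: "mono u"
  proof (rule monoI)
    fix i j :: nat assume "i \<le> j"
    then have le: "min i (n - 1) \<le> min j (n - 1)" by auto
    have "sorted L" by (rule strict_sorted_imp_sorted[OF L(1)])
    moreover have "min j (n - 1) < length L" using n unfolding n_def by linarith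
    ultimately show "u i \<le> u j" unfolding u_def by (rule sorted_nth_mono[OF _ le])
  qed
  have u_less: "u i < u j" if "i < j" "j < n" for i j
  proof -
    have "min i (n - 1) = i" "min j (n - 1) = j" using that by linarith+
    then show ?thesis
      using sorted_wrt_nth_less[OF L(1), of i j] that unfolding u_def n_def by simp
  qed
  have u_range: "range u \<subseteq> {0..1}"
  proof
    fix x assume "x \<in> range u"
    then obtain i where "x = L ! min i (n - 1)" by (auto simp: u_def)
    moreover have "min i (n - 1) < length L" using n unfolding n_def by linarith
    ultimately have "x \<in> set L" by (simp only: nth_mem)
    then show "x \<in> {0..1}" using L T by auto
  qed
  define idx where "idx q = (SOME i. i < n \<and> u i = q)" for q
  have idx: "idx q < n" "u (idx q) = q" if "q \<in> T" for q
  proof -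
    have "q \<in> set L" using that L(2) by simp
    then obtain i where i: "i < n" "L ! i = q" unfolding n_def in_set_conv_nth by blast
    then have "min i (n - 1) = i" by linarith
    then have "i < n \<and> u i = q" using i by (simp add: u_def)
    then have "idx q < n \<and> u (idx q) = q" unfolding idx_def by (rule someI)
    then show "idx q < n" "u (idx q) = q" by auto
  qed
  define kr where "kr = idx r"
  have kr: "kr < n" "u kr = r" using idx T by (auto simp: kr_def)
  have idx_le: "idx q \<le> kr" if "q \<in> J" for q
  proof (rule ccontr)
    assume "\<not> idx q \<le> kr"
    then have "u kr < u (idx q)" using idx[of q] that by (intro u_less) (auto simp: T_def)
    then show False using idx[of q] kr J that by (force simp: T_def)
  qed
  have idx_ge: "kr \<le> idx q" if "q \<in> J'" for q
  proof (rule ccontr)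
    assume "\<not> kr \<le> idx q"
    then have "u (idx q) < u kr" using kr by (intro u_less) auto
    then show False using idx[of q] kr J' that by (force simp: T_def)
  qed
  have u0: "u 0 = 0"
  proof -
    have "u 0 \<le> u (idx 0)" using u_mono by (auto dest: monoD)
    moreover have "u 0 \<in> {0..1}" using u_range by blast
    ultimately show ?thesis using idx(2)[OF T(3)] by simp
  qed
  define X where "X i w = B (u (Suc i)) w - B (u i) w" for i w
  have "indep_vars (\<lambda>_. borel) X {..<n}"
    using indep_increments[OF u_mono u_range] unfolding X_def .
  then have iv: "indep_var (PiM {..<kr} (\<lambda>_. borel)) (\<lambda>w. restrict (\<lambda>i. X i w) {..<kr})
      (PiM {kr..<n} (\<lambda>_. borel)) (\<lambda>w. restrict (\<lambda>i. X i w) {kr..<n})"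
    by (rule indep_var_restrict) (use kr in auto)
  define S1 where "S1 = {x\<in>space (PiM {..<kr} (\<lambda>_. borel :: (real^'n) measure)). \<forall>q\<in>J. (\<Sum>l<idx q. x l) \<in> A q}"
  define S2 where "S2 = {x\<in>space (PiM {kr..<n} (\<lambda>_. borel :: (real^'n) measure)). \<forall>q\<in>J'. (\<Sum>l=kr..<idx q. x l) \<in> A' q}"
  have S1: "S1 \<in> sets (PiM {..<kr} (\<lambda>_. borel))"
    unfolding S1_def
  proof (rule sets.sets_Collect_countable_All'[OF _ countable_finite[OF J(1)]] )
    fix q assume q: "q \<in> J"
    have "(\<lambda>x. \<Sum>l<idx q. x l) \<in> borel_measurable (PiM {..<kr} (\<lambda>_. borel :: (real^'n) measure))"
      using idx_le[OF q] by (intro borel_measurable_sum measurable_component_singleton) auto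
    from measurable_sets[OF this A]
    show "{x \<in> space (PiM {..<kr} (\<lambda>_. borel)). (\<Sum>l<idx q. x l) \<in> A q} \<in> sets (PiM {..<kr} (\<lambda>_. borel))"
      by (simp add: vimage_def Int_def conj_commute)
  qed
  have S2: "S2 \<in> sets (PiM {kr..<n} (\<lambda>_. borel))"
    unfolding S2_def
  proof (rule sets.sets_Collect_countable_All'[OF _ countable_finite[OF J'(1)]])
    fix q assume q: "q \<in> J'"
    have "(\<lambda>x. \<Sum>l=kr..<idx q. x l) \<in> borel_measurable (PiM {kr..<n} (\<lambda>_. borel :: (real^'n) measure))"
      using idx(1)[of q] q by (intro borel_measurable_sum measurable_component_singleton) (auto simp: T_def)
    from measurable_sets[OF this A']
    show "{x \<in> space (PiM {kr..<n} (\<lambda>_. borel)). (\<Sum>l=kr..<idx q. x l) \<in> A' q} \<in> sets (PiM {kr..<n} (\<lambda>_. borel))"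
      by (simp add: vimage_def Int_def conj_commute)
  qed
  have s1: "(\<Sum>l<idx q. X l w) = B q w" if "q \<in> J" "w \<in> space M" for q w
    unfolding X_def sum_lessThan_telescope[of "\<lambda>l. B (u l) w"]
    using idx[of q] that by (simp add: u0 B_0 T_def)
  have s2: "(\<Sum>l=kr..<idx q. X l w) = B q w - B r w" if "q \<in> J'" for q w
    unfolding X_def sum_Suc_diff'[OF idx_ge[OF that], of "\<lambda>l. B (u l) w"]
    using idx[of q] that kr by (simp add: T_def)
  have e1: "(\<lambda>w. restrict (\<lambda>i. X i w) {..<kr}) -` S1 \<inter> space M = {w\<in>space M. \<forall>q\<in>J. B q w \<in> A q}"
  proof -
    have "(\<Sum>l<idx q. restrict (\<lambda>i. X i w) {..<kr} l) = B q w" if "q \<in> J" "w \<in> space M" for q w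
      using idx_le[OF that(1)] by (subst s1[OF that, symmetric]) (auto intro!: sum.cong)
    then show ?thesis by (auto simp: S1_def space_PiM)
  qed
  have e2: "(\<lambda>w. restrict (\<lambda>i. X i w) {kr..<n}) -` S2 \<inter> space M
      = {w\<in>space M. \<forall>q\<in>J'. B q w - B r w \<in> A' q}"
  proof -
    have "(\<Sum>l=kr..<idx q. restrict (\<lambda>i. X i w) {kr..<n} l) = B q w - B r w" if "q \<in> J'" for q w
      using idx(1)[of q] that by (subst s2[OF that, symmetric]) (auto intro!: sum.cong simp: T_def)
    then show ?thesis by (auto simp: S2_def space_PiM)
  qed
  have e3: "(\<lambda>w. (restrict (\<lambda>i. X i w) {..<kr}, restrict (\<lambda>i. X i w) {kr..<n})) -` (S1 \<times> S2) \<inter> space M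
    = {w\<in>space M. \<forall>q\<in>J. B q w \<in> A q} \<inter> {w\<in>space M. \<forall>q\<in>J'. B q w - B r w \<in> A' q}"
    unfolding e1[symmetric] e2[symmetric] by auto
  show ?thesis using indep_varD[OF iv S1 S2] unfolding e1 e2 e3 .
qed

text \<open>Events that constrain finitely many times form an intersection-stable generator of
  either algebra, and on these generators independence is already known.\<close>

lemma indep_past_future:
  assumes r: "r \<in> {0..1}"
  shows "indep_var (past_algebra r) (\<lambda>w. w) (future_algebra r) (\<lambda>w. w)"
proof -
  define E where "E = {{w\<in>space M. \<forall>q\<in>J. B q w \<in> A q} | J A. finite J \<and> J \<subseteq> {0..r} \<and> (\<forall>q. A q \<in> sets borel)}"
  define E' where "E' = {{w\<in>space M. \<forall>q\<in>J. B q w - B r w \<in> A q} | J A. finite J \<and> J \<subseteq> {r..1} \<and> (\<forall>q. A q \<in> sets borel)}"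
  have gen: "sigma_sets (space M) {{w\<in>space M. \<forall>q\<in>J. Z q w \<in> A q} | J A. finite J \<and> J \<subseteq> I \<and> (\<forall>q. A q \<in> sets borel)}
    = sigma_sets (space M) {Z q -` A \<inter> space M | q A. q \<in> I \<and> A \<in> sets borel}" (is "sigma_sets _ ?E = sigma_sets _ ?G")
    for Z :: "real \<Rightarrow> 'w \<Rightarrow> real^'n" and I
  proof (rule sigma_sets_eqI)
    fix a assume "a \<in> ?E"
    then obtain J A where a: "a = {w\<in>space M. \<forall>q\<in>J. Z q w \<in> A q}" "finite J" "J \<subseteq> I" "\<forall>q. A q \<in> sets borel" by auto
    define N where "N = sigma (space M) ?G"
    have N: "space N = space M" "sets N = sigma_sets (space M) ?G"
      unfolding N_def by (rule space_measure_of, blast, rule sets_measure_of, blast)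
    have "{w\<in>space N. \<forall>q\<in>J. Z q w \<in> A q} \<in> sets N"
    proof (rule sets.sets_Collect_countable_All'[OF _ countable_finite[OF a(2)]])
      fix q assume "q \<in> J"
      then have "q \<in> I" "A q \<in> sets borel" using a(3,4) by blast+
      then have "Z q -` A q \<inter> space M \<in> ?G" by blast
      moreover have "{w\<in>space N. Z q w \<in> A q} = Z q -` A q \<inter> space M" unfolding N(1) by blast
      ultimately show "{w\<in>space N. Z q w \<in> A q} \<in> sets N"
        unfolding N(2) by (simp only: sigma_sets.Basic)
    qed
    then show "a \<in> sigma_sets (space M) ?G" unfolding a(1) N .
  next
    fix b assume "b \<in> ?G"
    then obtain q A where b: "b = Z q -` A \<inter> space M" "q \<in> I" "A \<in> sets borel" by auto
    have "b = {w\<in>space M. \<forall>q\<in>{q}. Z q w \<in> A}" using b(1) by auto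
    then have "b \<in> ?E" using b(2,3) by (intro CollectI exI[of _ "{q}"] exI[of _ "\<lambda>_. A"]) simp
    then show "b \<in> sigma_sets (space M) ?E" by (rule sigma_sets.Basic)
  qed
  have stable: "Int_stable {{w\<in>space M. \<forall>q\<in>J. Z q w \<in> A q} | J A. finite J \<and> J \<subseteq> I \<and> (\<forall>q. A q \<in> sets borel)}"
    for Z :: "real \<Rightarrow> 'w \<Rightarrow> real^'n" and I
  proof (rule Int_stableI, clarify)
    fix J1 J2 and A1 A2 :: "real \<Rightarrow> (real^'n) set"
    assume *: "finite J1" "J1 \<subseteq> I" "\<forall>q. A1 q \<in> sets (borel::(real^'n) measure)"
      "finite J2" "J2 \<subseteq> I" "\<forall>q. A2 q \<in> sets (borel::(real^'n) measure)"
    define A where "A q = (if q \<in> J1 then A1 q else UNIV) \<inter> (if q \<in> J2 then A2 q else UNIV)" for q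
    have "{w\<in>space M. \<forall>q\<in>J1. Z q w \<in> A1 q} \<inter> {w\<in>space M. \<forall>q\<in>J2. Z q w \<in> A2 q}
      = {w\<in>space M. \<forall>q\<in>J1 \<union> J2. Z q w \<in> A q}" by (auto simp: A_def split: if_splits)
    moreover have "\<forall>q. A q \<in> sets borel" using * by (auto simp: A_def)
    ultimately show "\<exists>J A. {w\<in>space M. \<forall>q\<in>J1. Z q w \<in> A1 q} \<inter> {w\<in>space M. \<forall>q\<in>J2. Z q w \<in> A2 q}
      = {w\<in>space M. \<forall>q\<in>J. Z q w \<in> A q} \<and> finite J \<and> J \<subseteq> I \<and> (\<forall>q. A q \<in> sets borel)"
      using * by (intro exI[of _ "J1 \<union> J2"] exI[of _ A]) auto
  qed
  have sE: "sigma_sets (space M) E = sets (past_algebra r)" and sE': "sigma_sets (space M) E' = sets (future_algebra r)"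
    unfolding E_def E'_def sets_past sets_future by (rule gen)+
  have sub: "E \<subseteq> events" "E' \<subseteq> events"
    using sigma_sets_superset_generator[of E "space M"] sigma_sets_superset_generator[of E' "space M"]
      past_subset[of r] future_subset[of r] r
    unfolding sE sE' by (simp_all only: atLeastAtMost_iff) (blast intro: order_trans)+
  have "indep_set E E'"
    unfolding indep_sets2_eq
  proof (intro conjI ballI sub)
    fix e e' assume "e \<in> E" "e' \<in> E'"
    then obtain J A J' A' where "e = {w\<in>space M. \<forall>q\<in>J. B q w \<in> A q}" "finite J" "J \<subseteq> {0..r}" "\<And>q. A q \<in> sets borel"
      "e' = {w\<in>space M. \<forall>q\<in>J'. B q w - B r w \<in> A' q}" "finite J'" "J' \<subseteq> {r..1}" "\<And>q. A' q \<in> sets borel"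
      unfolding E_def E'_def by blast
    then show "prob (e \<inter> e') = prob e * prob e'" by (simp only: indep_finite_past_future[OF r])
  qed
  then have "indep_set (sigma_sets (space M) E) (sigma_sets (space M) E')"
    by (rule indep_set_sigma_sets) (unfold E_def E'_def, rule stable, rule stable)
  then have ind: "indep_set (sets (past_algebra r)) (sets (future_algebra r))" unfolding sE sE' .
  have *: "{(\<lambda>w. w) -` A \<inter> space M | A. A \<in> sets N} = sets N" if "space N = space M" for N
  proof -
    have "(\<lambda>w. w) -` A \<inter> space M = A" if "A \<in> sets N" for A
      using sets.sets_into_space[OF that] \<open>space N = space M\<close> by auto
    then show ?thesis by (safe; metis)
  qed
  have s: "sigma_sets (space M) (sets (past_algebra r)) = sets (past_algebra r)"
    "sigma_sets (space M) (sets (future_algebra r)) = sets (future_algebra r)"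
    using sets.sigma_sets_eq[of "past_algebra r"] sets.sigma_sets_eq[of "future_algebra r"] by simp_all
  show ?thesis
    unfolding indep_var_eq *[OF space_past] *[OF space_future] s
    using ind r measurable_from_past[OF _ measurable_ident_sets[OF refl], of r]
      measurable_from_future[OF _ measurable_ident_sets[OF refl], of r] by simp
qed

lemma distr_past_future:
  assumes r: "r \<in> {0..1}"
  shows "distr M (past_algebra r) (\<lambda>w. w) \<Otimes>\<^sub>M distr M (future_algebra r) (\<lambda>w. w) =
    distr M (past_algebra r \<Otimes>\<^sub>M future_algebra r) (\<lambda>w. (w, w))"
    and measurable_diagonal: "(\<lambda>w. (w, w)) \<in> M \<rightarrow>\<^sub>M past_algebra r \<Otimes>\<^sub>M future_algebra r"
proof -
  show "distr M (past_algebra r) (\<lambda>w. w) \<Otimes>\<^sub>M distr M (future_algebra r) (\<lambda>w. w) =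
    distr M (past_algebra r \<Otimes>\<^sub>M future_algebra r) (\<lambda>w. (w, w))"
    using indep_past_future[OF r] by (simp add: indep_var_distribution_eq)
  show "(\<lambda>w. (w, w)) \<in> M \<rightarrow>\<^sub>M past_algebra r \<Otimes>\<^sub>M future_algebra r"
    using r by (intro measurable_Pair) (auto intro: measurable_from_past measurable_from_future)
qed

text \<open>By independence the future argument may be evaluated at a second, independent sample
  point. This is the form in which the Markov property enters.\<close>

lemma resample_nn_integral:
  assumes r: "r \<in> {0..1}" and h: "h \<in> borel_measurable (past_algebra r \<Otimes>\<^sub>M future_algebra r)"
  shows "(\<integral>\<^sup>+w. h (w, w) \<partial>M) = (\<integral>\<^sup>+w. \<integral>\<^sup>+w'. h (w, w') \<partial>M \<partial>M)"
proof -
  let ?P = "distr M (past_algebra r) (\<lambda>w. w)" and ?F = "distr M (future_algebra r) (\<lambda>w. w)"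
  have m: "(\<lambda>w. w) \<in> M \<rightarrow>\<^sub>M past_algebra r" "(\<lambda>w. w) \<in> M \<rightarrow>\<^sub>M future_algebra r"
    using r by (auto intro: measurable_from_past measurable_from_future)
  interpret F: prob_space ?F by (rule prob_space_distr[OF m(2)])
  have h': "h \<in> borel_measurable (?P \<Otimes>\<^sub>M ?F)"
    using h by (simp cong: measurable_cong_sets sets_pair_measure_cong)
  have "(\<integral>\<^sup>+w. h (w, w) \<partial>M) = integral\<^sup>N (?P \<Otimes>\<^sub>M ?F) h"
    unfolding distr_past_future[OF r] using h by (subst nn_integral_distr[OF measurable_diagonal[OF r]]) auto
  also have "\<dots> = (\<integral>\<^sup>+w. \<integral>\<^sup>+w'. h (w, w') \<partial>?F \<partial>?P)"
    by (rule F.nn_integral_fst[OF h', symmetric])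
  also have "\<dots> = (\<integral>\<^sup>+w. \<integral>\<^sup>+w'. h (w, w') \<partial>?F \<partial>M)"
    using F.borel_measurable_nn_integral_fst[OF h'] by (subst nn_integral_distr[OF m(1)]) auto
  also have "\<dots> = (\<integral>\<^sup>+w. \<integral>\<^sup>+w'. h (w, w') \<partial>M \<partial>M)"
    using h by (intro nn_integral_cong nn_integral_distr[OF m(2)]) (auto intro: measurable_Pair2)
  finally show ?thesis .
qed

lemma resample_integral:
  fixes h :: "'w \<times> 'w \<Rightarrow> real"
  assumes r: "r \<in> {0..1}" and h: "h \<in> borel_measurable (past_algebra r \<Otimes>\<^sub>M future_algebra r)"
    and int: "integrable M (\<lambda>w. h (w, w))"
  shows "(\<integral>w. h (w, w) \<partial>M) = (\<integral>w. \<integral>w'. h (w, w') \<partial>M \<partial>M)"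
    and "integrable M (\<lambda>w. \<integral>w'. h (w, w') \<partial>M)"
proof -
  let ?P = "distr M (past_algebra r) (\<lambda>w. w)" and ?F = "distr M (future_algebra r) (\<lambda>w. w)"
  have m: "(\<lambda>w. w) \<in> M \<rightarrow>\<^sub>M past_algebra r" "(\<lambda>w. w) \<in> M \<rightarrow>\<^sub>M future_algebra r"
    using r by (auto intro: measurable_from_past measurable_from_future)
  interpret F: prob_space ?F by (rule prob_space_distr[OF m(2)])
  interpret P: prob_space ?P by (rule prob_space_distr[OF m(1)])
  interpret PF: pair_sigma_finite ?P ?F ..
  have h': "h \<in> borel_measurable (?P \<Otimes>\<^sub>M ?F)"
    using h by (simp cong: measurable_cong_sets sets_pair_measure_cong)
  have i: "integrable (?P \<Otimes>\<^sub>M ?F) h"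
    unfolding distr_past_future[OF r] using h int by (subst integrable_distr_eq[OF measurable_diagonal[OF r]]) auto
  have F: "(\<integral>w'. h (w, w') \<partial>?F) = (\<integral>w'. h (w, w') \<partial>M)" if "w \<in> space M" for w
    using h that by (intro integral_distr[OF m(2)]) (auto intro: measurable_Pair2)
  have Fm: "(\<lambda>w. \<integral>w'. h (w, w') \<partial>?F) \<in> borel_measurable (past_algebra r)"
    using F.borel_measurable_lebesgue_integral[of "\<lambda>w w'. h (w, w')" ?P] h' by simp
  have "(\<integral>w. h (w, w) \<partial>M) = integral\<^sup>L (?P \<Otimes>\<^sub>M ?F) h"
    unfolding distr_past_future[OF r] using h by (subst integral_distr[OF measurable_diagonal[OF r]]) auto
  also have "\<dots> = (\<integral>w. \<integral>w'. h (w, w') \<partial>?F \<partial>?P)"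
    by (rule PF.integral_fst'[OF i, symmetric])
  also have "\<dots> = (\<integral>w. \<integral>w'. h (w, w') \<partial>?F \<partial>M)" by (rule integral_distr[OF m(1) Fm])
  also have "\<dots> = (\<integral>w. \<integral>w'. h (w, w') \<partial>M \<partial>M)" by (intro Bochner_Integration.integral_cong refl F)
  finally show "(\<integral>w. h (w, w) \<partial>M) = (\<integral>w. \<integral>w'. h (w, w') \<partial>M \<partial>M)" .
  have "integrable ?P (\<lambda>w. \<integral>w'. h (w, w') \<partial>?F)" using PF.integrable_fst'[OF i] .
  then have "integrable M (\<lambda>w. \<integral>w'. h (w, w') \<partial>?F)"
    using integrable_distr_eq[OF m(1) Fm] by simp
  then show "integrable M (\<lambda>w. \<integral>w'. h (w, w') \<partial>M)"
    by (subst (asm) Bochner_Integration.integrable_cong[OF refl F])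
qed

subsection \<open>Moments of the increments\<close>

text \<open>The density is a product over the coordinates, so Fubini over \<open>real^'n\<close>
  factorizes the integral. The marginals and the independence of the components both follow from
  it.\<close>

lemma nn_integral_increment_prod:
  assumes st: "0 \<le> s" "s < t" "t \<le> 1" and g[measurable]: "\<And>i. g i \<in> borel_measurable borel"
  shows "(\<integral>\<^sup>+w. (\<Prod>i\<in>UNIV. g i ((B t w - B s w) $ i)) \<partial>M) =
    (\<Prod>i\<in>UNIV. \<integral>\<^sup>+x. ennreal (normal_density 0 (sqrt (t - s)) x) * g i x \<partial>lborel)"
proof -
  let ?n = "normal_density 0 (sqrt (t - s))"
  have Basis: "Basis = range (\<lambda>i::'n. axis i (1::real))" by (auto simp: Basis_vec_def)
  have inj: "inj (\<lambda>i::'n. axis i (1::real))" by (auto intro!: injI simp: axis_eq_axis)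
  have "(\<integral>\<^sup>+w. (\<Prod>i\<in>UNIV. g i ((B t w - B s w) $ i)) \<partial>M) =
    (\<integral>\<^sup>+x. ennreal (\<Prod>i\<in>UNIV. ?n ((x::real^'n) $ i)) * (\<Prod>i\<in>UNIV. g i (x $ i)) \<partial>lborel)"
    by (rule distributed_nn_integral[OF increment_distributed[OF st], symmetric]) measurable
  also have "\<dots> = (\<integral>\<^sup>+x. (\<Prod>b\<in>Basis. ennreal (?n ((x::real^'n) \<bullet> b)) * g (axis_index b) (x \<bullet> b)) \<partial>lborel)"
    unfolding Basis prod.reindex[OF inj]
    using st by (intro nn_integral_cong) (simp add: prod_ennreal prod.distrib inner_axis)
  also have "\<dots> = (\<Prod>b\<in>Basis. \<integral>\<^sup>+x. ennreal (?n x) * g (axis_index (b::real^'n)) x \<partial>lborel)"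
    by (rule nn_integral_lborel_prod) auto
  also have "\<dots> = (\<Prod>i\<in>UNIV. \<integral>\<^sup>+x. ennreal (?n x) * g i x \<partial>lborel)"
    unfolding Basis prod.reindex[OF inj] by simp
  finally show ?thesis .
qed

lemma increment_component_distributed:
  assumes st: "0 \<le> s" "s < t" "t \<le> 1"
  shows "distributed M lborel (\<lambda>w. (B t w - B s w) $ i) (normal_density 0 (sqrt (t - s)))"
proof -
  let ?n = "normal_density 0 (sqrt (t - s))" and ?D = "\<lambda>i w. (B t w - B s w) $ i"
  have "B t \<in> borel_measurable M" "B s \<in> borel_measurable M" using st by auto
  from this[THEN measurable_compose[OF _ borel_measurable_nth]]
  have [measurable]: "(\<lambda>w. B t w $ i) \<in> borel_measurable M" "(\<lambda>w. B s w $ i) \<in> borel_measurable M" for i .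
  have [measurable]: "?D i \<in> borel_measurable M" for i unfolding vector_minus_component by measurable
  interpret N: prob_space "density lborel ?n" using st by (intro prob_space_normal_density) auto
  have "emeasure (distr M lborel (\<lambda>w. (B t w - B s w) $ i)) A = emeasure (density lborel ?n) A"
    if A[measurable]: "A \<in> sets borel" for A
  proof -
    have one: "(\<integral>\<^sup>+x. ennreal (?n x) \<partial>lborel) = 1"
      using N.emeasure_space_1 by (simp add: emeasure_density)
    have "emeasure (distr M lborel (\<lambda>w. (B t w - B s w) $ i)) A =
      (\<integral>\<^sup>+w. (\<Prod>j\<in>UNIV. (if j = i then indicator A ((B t w - B s w) $ j) else 1)) \<partial>M)"
    proof -
      have "emeasure (distr M lborel (?D i)) A = (\<integral>\<^sup>+x. indicator A x \<partial>distr M lborel (?D i))" by simp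
      also have "\<dots> = (\<integral>\<^sup>+w. indicator A (?D i w) \<partial>M)" by (rule nn_integral_distr) auto
      finally show ?thesis by (simp add: prod.delta)
    qed
    also have "\<dots> = (\<Prod>j\<in>UNIV. \<integral>\<^sup>+x. ennreal (?n x) * (if j = i then indicator A x else 1) \<partial>lborel)"
      by (rule nn_integral_increment_prod[OF st, of "\<lambda>j x. if j = i then indicator A x else 1"]) auto
    also have "\<dots> = (\<Prod>j\<in>UNIV. if j = i then emeasure (density lborel ?n) A else 1)"
      by (intro prod.cong refl) (auto simp: emeasure_density one)
    finally show ?thesis by (simp add: prod.delta)
  qed
  then show ?thesis
    unfolding distributed_def by (auto intro!: measure_eqI)
qed

lemma indep_increment_components:
  assumes st: "0 \<le> s" "s < t" "t \<le> 1"
  shows "indep_vars (\<lambda>_. borel) (\<lambda>i w. (B t w - B s w) $ i) UNIV"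
proof -
  let ?n = "normal_density 0 (sqrt (t - s))" and ?D = "\<lambda>i w. (B t w - B s w) $ i"
  have "B t \<in> borel_measurable M" "B s \<in> borel_measurable M" using st by auto
  from this[THEN measurable_compose[OF _ borel_measurable_nth]]
  have [measurable]: "(\<lambda>w. B t w $ i) \<in> borel_measurable M" "(\<lambda>w. B s w $ i) \<in> borel_measurable M" for i .
  have [measurable]: "?D i \<in> borel_measurable M" for i unfolding vector_minus_component by measurable
  have marg: "distr M borel (?D i) = distr M lborel (?D i)" for i by (rule distr_cong) auto
  have p: "prob_space (distr M borel (?D i))" for i by (intro prob_space_distr) measurable
  have "distr M (\<Pi>\<^sub>M i\<in>UNIV. borel) (\<lambda>x. \<lambda>i\<in>UNIV. ?D i x) = (\<Pi>\<^sub>M i\<in>UNIV. distr M borel (?D i))"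
  proof (rule product_sigma_finite.PiM_eqI)
    show "product_sigma_finite (\<lambda>i. distr M borel (?D i))"
      using p by (intro product_sigma_finite.intro prob_space_imp_sigma_finite)
    show "sets (distr M (\<Pi>\<^sub>M i\<in>UNIV. borel) (\<lambda>x. \<lambda>i\<in>UNIV. ?D i x)) = sets (\<Pi>\<^sub>M i\<in>UNIV. distr M borel (?D i))"
      by (simp cong: sets_PiM_cong)
    fix A :: "'n \<Rightarrow> real set" assume "\<And>i. i \<in> UNIV \<Longrightarrow> A i \<in> sets (distr M borel (?D i))"
    then have A[measurable]: "A i \<in> sets borel" for i by auto
    have "emeasure (distr M (\<Pi>\<^sub>M i\<in>UNIV. borel) (\<lambda>x. \<lambda>i\<in>UNIV. ?D i x)) (Pi\<^sub>E UNIV A) =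
      emeasure M ((\<lambda>x. \<lambda>i\<in>UNIV. ?D i x) -` (Pi\<^sub>E UNIV A) \<inter> space M)"
      by (intro emeasure_distr measurable_restrict sets_PiM_I_finite) auto
    also have "\<dots> = emeasure M {w\<in>space M. \<forall>i. ?D i w \<in> A i}"
      by (rule arg_cong[where f = "emeasure M"]) auto
    also have "\<dots> = (\<integral>\<^sup>+w. indicator {w\<in>space M. \<forall>i. ?D i w \<in> A i} w \<partial>M)"
      by (rule nn_integral_indicator[symmetric]) measurable
    also have "\<dots> = (\<integral>\<^sup>+w. (\<Prod>i\<in>UNIV. indicator (A i) (?D i w)) \<partial>M)"
      by (intro nn_integral_cong) (auto simp: indicator_def)
    also have "\<dots> = (\<Prod>i\<in>UNIV. \<integral>\<^sup>+x. ennreal (?n x) * indicator (A i) x \<partial>lborel)"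
      by (rule nn_integral_increment_prod[OF st, of "\<lambda>i. indicator (A i)"]) auto
    also have "\<dots> = (\<Prod>i\<in>UNIV. emeasure (distr M borel (?D i)) (A i))"
      using distributed_distr_eq_density[OF increment_component_distributed[OF st]]
      by (intro prod.cong refl) (simp add: marg emeasure_density del: vector_minus_component)
    finally show "emeasure (distr M (\<Pi>\<^sub>M i\<in>UNIV. borel) (\<lambda>x. \<lambda>i\<in>UNIV. ?D i x)) (Pi\<^sub>E UNIV A) =
      (\<Prod>i\<in>UNIV. emeasure (distr M borel (?D i)) (A i))" .
  qed simp
  then show ?thesis
    by (subst indep_vars_iff_distr_eq_PiM[OF UNIV_not_empty]) measurable
qed

lemma increment_component_moments:
  assumes st: "0 \<le> s" "s < t" "t \<le> 1"
  shows "integrable M (\<lambda>w. (B t w - B s w) $ i ^ k)"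
    and "(\<integral>w. (B t w - B s w) $ i \<partial>M) = 0"
    and "(\<integral>w. ((B t w - B s w) $ i)\<^sup>2 \<partial>M) = t - s"
    and "(\<integral>w. (B t w - B s w) $ i ^ 4 \<partial>M) = 3 * (t - s)\<^sup>2"
proof -
  have s: "0 < sqrt (t - s)" using st by auto
  note d = increment_component_distributed[OF st, of i]
  have int: "(\<integral>w. (B t w - B s w) $ i ^ k \<partial>M) = (\<integral>x. normal_density 0 (sqrt (t - s)) x * x ^ k \<partial>lborel)" for k
    by (rule distributed_integral[OF d, symmetric]) auto
  show "integrable M (\<lambda>w. (B t w - B s w) $ i ^ k)"
    using integrable_normal_moment[OF s, of 0 k] distributed_integrable[OF d, of "\<lambda>x. x ^ k"] by simp
  show "(\<integral>w. (B t w - B s w) $ i \<partial>M) = 0"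
    using int[of 1] integral_normal_moment_odd[OF s, of 0 0] by simp
  show "(\<integral>w. ((B t w - B s w) $ i)\<^sup>2 \<partial>M) = t - s"
    using int[of 2] integral_normal_moment_even[OF s, of 0 1] st by (simp add: fact_numeral)
  show "(\<integral>w. (B t w - B s w) $ i ^ 4 \<partial>M) = 3 * (t - s)\<^sup>2"
    using int[of 4] integral_normal_moment_even[OF s, of 0 2] st
    by (simp add: fact_numeral power2_eq_square field_simps)
qed

lemma increment_component_covariance:
  assumes st: "0 \<le> s" "s < t" "t \<le> 1" and ij: "i \<noteq> j"
  shows "integrable M (\<lambda>w. (B t w - B s w) $ i * (B t w - B s w) $ j)"
    and "(\<integral>w. (B t w - B s w) $ i * (B t w - B s w) $ j \<partial>M) = 0"
proof -
  let ?D = "\<lambda>i w. (B t w - B s w) $ i"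
  have "indep_var borel ((\<lambda>x. x i) \<circ> (\<lambda>w. restrict (\<lambda>i. ?D i w) {i}))
      borel ((\<lambda>x. x j) \<circ> (\<lambda>w. restrict (\<lambda>i. ?D i w) {j}))"
    by (rule indep_var_compose[OF indep_var_restrict[OF indep_increment_components[OF st]]])
      (use ij in \<open>auto intro!: measurable_component_singleton\<close>)
  then have "indep_var borel (?D i) borel (?D j)" by (simp add: comp_def)
  then show "integrable M (\<lambda>w. (B t w - B s w) $ i * (B t w - B s w) $ j)"
    "(\<integral>w. (B t w - B s w) $ i * (B t w - B s w) $ j \<partial>M) = 0"
    using indep_var_integrable[of "?D i" "?D j"] indep_var_lebesgue_integral[of "?D i" "?D j"]
      increment_component_moments(1)[OF st, of _ 1] increment_component_moments(2)[OF st]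
    unfolding power_one_right by simp_all
qed

text \<open>The 3 is the fourth moment of a standard normal variable; one factor of the dimension
  comes from the Cauchy-Schwarz bound \<open>n4\<close> and the other from summing over the
  coordinates.\<close>

lemma increment_norm_moments:
  fixes s t :: real
  assumes st: "0 \<le> s" "s < t" "t \<le> 1"
  shows "integrable M (\<lambda>w. (norm (B t w - B s w))\<^sup>2)"
    and "(\<integral>w. (norm (B t w - B s w))\<^sup>2 \<partial>M) = real CARD('n) * (t - s)"
    and "integrable M (\<lambda>w. norm (B t w - B s w) ^ 4)"
    and "(\<integral>w. norm (B t w - B s w) ^ 4 \<partial>M) \<le> 3 * (real CARD('n) * (t - s))\<^sup>2"
proof -
  let ?D = "\<lambda>w. B t w - B s w"
  have [measurable]: "B t \<in> borel_measurable M" "B s \<in> borel_measurable M" using st by auto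
  have n2: "(norm (x::real^'n))\<^sup>2 = (\<Sum>i\<in>UNIV. (x $ i)\<^sup>2)" for x
    by (simp add: norm_vec_def L2_set_def sum_nonneg)
  have n4: "norm (x::real^'n) ^ 4 \<le> real CARD('n) * (\<Sum>i\<in>UNIV. x $ i ^ 4)" for x
  proof -
    have "norm x ^ 4 = ((norm x)\<^sup>2)\<^sup>2" by simp
    also have "\<dots> \<le> (\<Sum>i\<in>(UNIV::'n set). 1\<^sup>2) * (\<Sum>i\<in>UNIV. ((x $ i)\<^sup>2)\<^sup>2)"
      unfolding n2 using Cauchy_Schwarz_ineq_sum[of "\<lambda>_. 1" "\<lambda>i. (x $ i)\<^sup>2" UNIV] by simp
    finally show ?thesis by simp
  qed
  have int: "integrable M (\<lambda>w. ?D w $ i ^ k)" for i k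
    by (rule increment_component_moments(1)[OF st])
  show "integrable M (\<lambda>w. (norm (?D w))\<^sup>2)" unfolding n2 using int by (intro Bochner_Integration.integrable_sum)
  show "(\<integral>w. (norm (?D w))\<^sup>2 \<partial>M) = real CARD('n) * (t - s)"
    unfolding n2 using int by (subst Bochner_Integration.integral_sum) (auto simp: increment_component_moments(3)[OF st, unfolded vector_minus_component])
  have i4: "integrable M (\<lambda>w. real CARD('n) * (\<Sum>i\<in>UNIV. ?D w $ i ^ 4))"
    using int by (intro integrable_mult_right Bochner_Integration.integrable_sum)
  then show *: "integrable M (\<lambda>w. norm (?D w) ^ 4)"
  proof (rule Bochner_Integration.integrable_bound)
    show "AE w in M. norm (norm (?D w) ^ 4) \<le> norm (real CARD('n) * (\<Sum>i\<in>UNIV. ?D w $ i ^ 4))"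
    proof (rule AE_I2)
      show "norm (norm (?D w) ^ 4) \<le> norm (real CARD('n) * (\<Sum>i\<in>UNIV. ?D w $ i ^ 4))" for w
        using order_trans[OF n4[of "?D w"] abs_ge_self] by (simp del: vector_minus_component)
    qed
  qed measurable
  have "(\<integral>w. norm (?D w) ^ 4 \<partial>M) \<le> (\<integral>w. real CARD('n) * (\<Sum>i\<in>UNIV. ?D w $ i ^ 4) \<partial>M)"
    by (rule integral_mono[OF * i4 n4])
  also have "\<dots> = 3 * (real CARD('n) * (t - s))\<^sup>2"
    using int by (simp add: Bochner_Integration.integral_sum increment_component_moments(4)[OF st, unfolded vector_minus_component] power2_eq_square)
  finally show "(\<integral>w. norm (?D w) ^ 4 \<partial>M) \<le> 3 * (real CARD('n) * (t - s))\<^sup>2" .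
qed

text \<open>The Gaussian density is positive everywhere. It serves to improve an almost sure
  identity between continuous functions of the increment to an identity at every point.\<close>

lemma increment_charges_open:
  assumes st: "0 \<le> s" "s < t" "t \<le> 1" and U: "open U" and ae: "AE w in M. B t w - B s w \<notin> U"
  shows "U = {}"
proof (rule ccontr)
  assume "U \<noteq> {}"
  have [measurable]: "U \<in> sets borel" using U by simp
  have "AE x in lborel. 0 < ennreal (\<Prod>i\<in>UNIV. normal_density 0 (sqrt (t - s)) (x $ i)) \<longrightarrow> x \<notin> U"
    using ae by (subst (asm) distributed_AE2[OF increment_distributed[OF st]]) auto
  then have "AE x in lborel. x \<notin> U"
    using st by (auto simp: prod_pos normal_density_pos)
  then have "U \<in> null_sets lborel" using AE_iff_null_sets[of U lborel] by simp
  then have "negligible U" by (simp add: negligible_iff_null_sets null_sets_completionI)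
  then show False using open_not_negligible[OF U \<open>U \<noteq> {}\<close>] by simp
qed

subsection \<open>Leaving a ball\<close>

definition exit_event :: "real \<Rightarrow> real \<Rightarrow> real \<Rightarrow> 'w set" where
  "exit_event t d r = {w\<in>space M. \<exists>q\<in>{t..t + d}. r < norm (B q w - B t w)}"

text \<open>First passage on a grid. The last condition keeps only paths that have not left the ball
  of radius \<open>2 * r\<close> up to the passage, so the position at that time is bounded; by
  continuity every exiting path meets it on fine grids.\<close>

definition grid_exit :: "real \<Rightarrow> real \<Rightarrow> real \<Rightarrow> nat \<Rightarrow> nat \<Rightarrow> 'w set" where
  "grid_exit t d r m j =
     {w\<in>space M. (\<forall>i<j. norm (B (t + d * (real i / real m)) w - B t w) \<le> r) \<and>
       r < norm (B (t + d * (real j / real m)) w - B t w) \<and>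
       (\<forall>q\<in>{t..t + d * (real j / real m)}. norm (B q w - B t w) \<le> 2 * r)}"

lemma stays_in_ball_past:
  assumes "0 \<le> t" "r \<le> 1"
  shows "{w\<in>space M. \<forall>q\<in>{t..r}. norm (B q w - B t w) \<le> k} \<in> sets (past_algebra r)"
proof -
  have "{w\<in>space (past_algebra r). \<forall>q\<in>{t..r}. norm (B q w - B t w) \<le> k} \<in> sets (past_algebra r)"
  proof (rule sets_continuous_process_le)
    fix q assume "q \<in> {t..r}"
    then show "(\<lambda>w. norm (B q w - B t w)) \<in> borel_measurable (past_algebra r)"
      using assms by (intro measurable_compose[OF _ borel_measurable_norm] borel_measurable_diff measurable_past_B) auto
  next
    fix w assume "w \<in> space (past_algebra r)"
    then show "continuous_on {t..r} (\<lambda>q. norm (B q w - B t w))"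
      using assms by (intro continuous_on_norm continuous_on_diff continuous_on_const
          continuous_on_subset[OF continuous_on_B]) auto
  qed
  then show ?thesis by simp
qed

lemma stays_in_ball_future:
  assumes "0 \<le> t" "r \<le> 1"
  shows "{w\<in>space M. \<forall>q\<in>{t..r}. norm (B q w - B t w) \<le> k} \<in> sets (future_algebra t)"
proof -
  have "{w\<in>space (future_algebra t). \<forall>q\<in>{t..r}. norm (B q w - B t w) \<le> k} \<in> sets (future_algebra t)"
  proof (rule sets_continuous_process_le)
    fix q assume "q \<in> {t..r}"
    then show "(\<lambda>w. norm (B q w - B t w)) \<in> borel_measurable (future_algebra t)"
      using assms by (intro measurable_compose[OF _ borel_measurable_norm] measurable_future_increment) auto
  next
    fix w assume "w \<in> space (future_algebra t)"
    then show "continuous_on {t..r} (\<lambda>q. norm (B q w - B t w))"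
      using assms by (intro continuous_on_norm continuous_on_diff continuous_on_const
          continuous_on_subset[OF continuous_on_B]) auto
  qed
  then show ?thesis by simp
qed

lemma exit_event_eq:
  "exit_event t d r = space M - {w\<in>space M. \<forall>q\<in>{t..t + d}. norm (B q w - B t w) \<le> r}"
  unfolding exit_event_def by (auto simp: not_le)

lemma exit_event_measurable:
  assumes "0 \<le> t" "t + d \<le> 1"
  shows "exit_event t d r \<in> sets (past_algebra (t + d))" "exit_event t d r \<in> sets (future_algebra t)"
    "exit_event t d r \<in> events"
proof -
  show p: "exit_event t d r \<in> sets (past_algebra (t + d))"
    unfolding exit_event_eq using sets.compl_sets[OF stays_in_ball_past[OF assms, of r]] by simp
  show "exit_event t d r \<in> sets (future_algebra t)"
    unfolding exit_event_eq using sets.compl_sets[OF stays_in_ball_future[OF assms, of r]] by simp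
  show "exit_event t d r \<in> events" using p past_subset[OF assms(2)] by blast
qed

lemma grid_time_le:
  assumes "0 \<le> d" "j \<le> m" "0 < m"
  shows "0 \<le> d * (real j / real m)" "d * (real j / real m) \<le> d"
proof -
  have "0 \<le> real j / real m" "real j / real m \<le> 1" using assms by auto
  then show "0 \<le> d * (real j / real m)" "d * (real j / real m) \<le> d"
    using assms(1) mult_left_le[of "real j / real m" d] by simp_all
qed

lemma grid_time_mono:
  "0 \<le> d \<Longrightarrow> i \<le> j \<Longrightarrow> d * (real i / real m) \<le> d * (real j / real m)"
  by (intro mult_left_mono divide_right_mono) auto

lemma grid_exit_past:
  assumes t: "0 \<le> t" "t + d \<le> 1" "0 \<le> d" and j: "j \<le> m" "0 < m"
  shows "grid_exit t d k m j \<in> sets (past_algebra (t + d * (real j / real m)))"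
proof -
  define r where "r = t + d * (real j / real m)"
  define N where "N = past_algebra r"
  have r: "t \<le> r" "r \<le> 1" using grid_time_le[OF t(3) j] t by (auto simp: r_def)
  have m: "(\<lambda>w. norm (B (t + d * (i / m)) w - B t w)) \<in> borel_measurable N" if "i \<le> j" for i :: nat
  proof -
    have "0 \<le> d * (real i / real m)" "d * (real i / real m) \<le> d * (real j / real m)"
      using grid_time_le[OF t(3), of i m] grid_time_mono[OF t(3) that, of m] that j by auto
    then show ?thesis
      unfolding N_def using t(1) r
      by (intro measurable_compose[OF _ borel_measurable_norm] borel_measurable_diff measurable_past_B) (auto simp: r_def)
  qed
  have "{w\<in>space N. \<forall>i\<in>{..<j}. norm (B (t + d * (real i / real m)) w - B t w) \<le> k} \<in> sets N"
    by (intro sets.sets_Collect_countable_All' borel_measurable_le m) auto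
  moreover have "{w\<in>space N. k < norm (B (t + d * (real j / real m)) w - B t w)} \<in> sets N"
    by (intro borel_measurable_less m) auto
  moreover have "{w\<in>space N. \<forall>q\<in>{t..r}. norm (B q w - B t w) \<le> 2 * k} \<in> sets N"
    using stays_in_ball_past[OF t(1) r(2)] by (simp add: N_def)
  ultimately have "{w\<in>space N. \<forall>i\<in>{..<j}. norm (B (t + d * (real i / real m)) w - B t w) \<le> k} \<inter>
    ({w\<in>space N. k < norm (B (t + d * (real j / real m)) w - B t w)} \<inter>
     {w\<in>space N. \<forall>q\<in>{t..r}. norm (B q w - B t w) \<le> 2 * k}) \<in> sets N"
    by (intro sets.Int)
  also have "\<dots> = sets (past_algebra (t + d * (real j / real m)))" unfolding N_def r_def ..
  finally show ?thesis
    unfolding grid_exit_def N_def r_def by (rule back_subst[where P = "\<lambda>A. A \<in> _"]) auto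
qed

lemma disjoint_grid_exit: "i \<noteq> j \<Longrightarrow> grid_exit t d r m i \<inter> grid_exit t d r m j = {}"
  unfolding grid_exit_def by (cases i j rule: linorder_cases) (auto simp: not_less[symmetric])

text \<open>On a fine grid, a path that leaves the ball is seen outside it at some grid time, and by
  the first such time it cannot have gone beyond twice the radius, since the preceding grid time was
  inside.\<close>

lemma eventually_grid_exit:
  assumes t: "0 \<le> t" "t + h \<le> 1" "0 < h" and b: "0 < b" and w: "w \<in> exit_event t h b"
  shows "\<forall>\<^sub>F m in sequentially. w \<in> (\<Union>j\<le>m. grid_exit t h b m j)"
proof -
  have sp: "w \<in> space M" using w by (simp add: exit_event_def)
  define g where "g q = norm (B q w - B t w)" for q
  obtain q where q: "q \<in> {t..t + h}" "b < g q" using w by (auto simp: exit_event_def g_def)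
  have g: "continuous_on {t..t + h} g"
    unfolding g_def using t by (intro continuous_on_norm continuous_on_diff continuous_on_const
          continuous_on_subset[OF continuous_on_B[OF sp]]) auto
  \<comment> \<open>The bound \<open>g q - b\<close> makes a grid time close to \<open>q\<close> lie
    outside the ball; the bound \<open>b\<close> limits the excursion between neighbouring grid
    times.\<close>
  obtain d where d: "d > 0" "\<And>r s. r \<in> {t..t+h} \<Longrightarrow> s \<in> {t..t+h} \<Longrightarrow> dist r s < d \<Longrightarrow>
      dist (g r) (g s) < min b (g q - b)"
  proof -
    have "uniformly_continuous_on {t..t+h} g" by (rule compact_uniformly_continuous[OF g]) simp
    moreover have "0 < min b (g q - b)" using b q by auto
    ultimately show thesis using that unfolding uniformly_continuous_on_def by metis
  qed
  have "\<forall>\<^sub>F m in sequentially. h * inverse (real m) < d"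
  proof -
    have "(\<lambda>m. h * inverse (real m)) \<longlonglongrightarrow> h * 0" by (intro tendsto_intros lim_inverse_n)
    then show ?thesis using order_tendstoD(2) d(1) by fastforce
  qed
  then show ?thesis
    using eventually_gt_at_top[of 0]
  proof eventually_elim
    fix m :: nat assume m: "h * inverse (real m) < d" "0 < m"
    define \<tau> where "\<tau> i = t + h * (real i / real m)" for i :: nat
    have \<tau>: "\<tau> i \<in> {t..t+h}" if "i \<le> m" for i
      using grid_time_le[of h i m] that m t by (auto simp: \<tau>_def)
    have \<tau>_Suc: "\<tau> (Suc i) = \<tau> i + h * inverse m" for i
      by (simp add: \<tau>_def add_divide_distrib distrib_left inverse_eq_divide)
    have near: "\<exists>i\<le>m. \<tau> i \<le> r \<and> dist r (\<tau> i) < d \<and> (\<forall>j. r \<le> \<tau> j \<longrightarrow> r \<noteq> \<tau> j \<longrightarrow> i < j)" if r: "r \<in> {t..t+h}" for r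
    proof -
      define i where "i = nat \<lfloor>(r - t) / h * m\<rfloor>"
      have pos: "0 \<le> (r - t) / h * m" using r t by auto
      then have i: "real i \<le> (r - t) / h * m" "(r - t) / h * m < real i + 1"
        unfolding i_def by linarith+
      have "(r - t) / h \<le> 1" using r t by auto
      then have "(r - t) / h * m \<le> m" using mult_right_mono[of "(r - t) / h" 1 "real m"] by simp
      then have im: "i \<le> m" using i by linarith
      have "h * (real i / m) \<le> h * ((r - t) / h * m / m)"
        using i t m by (intro mult_left_mono divide_right_mono) auto
      then have le: "\<tau> i \<le> r" using t m by (simp add: \<tau>_def)
      have "h * ((r - t) / h * m / m) < h * ((real i + 1) / m)"
        using i t m by (intro mult_strict_left_mono divide_strict_right_mono) auto
      then have lt: "r < \<tau> (Suc i)" using t m by (simp add: \<tau>_def add.commute)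
      have "i < j" if "r \<le> \<tau> j" "r \<noteq> \<tau> j" for j
      proof (rule ccontr)
        assume "\<not> i < j"
        then have "\<tau> j \<le> \<tau> i" unfolding \<tau>_def using grid_time_mono[of h j i m] t by auto
        then show False using le that by auto
      qed
      then show ?thesis using le lt im m(1) \<tau>_Suc[of i] by (intro exI[of _ i]) (auto simp: dist_real_def)
    qed
    obtain i where i: "i \<le> m" "dist q (\<tau> i) < d" using near[OF q(1)] by blast
    have "b < g (\<tau> i)" using d(2)[OF q(1) \<tau>[OF i(1)] i(2)] by (auto simp: dist_real_def)
    define j where "j = (LEAST j. b < g (\<tau> j))"
    have j: "b < g (\<tau> j)" "j \<le> i"
      unfolding j_def by (rule LeastI, fact, rule Least_le, fact)
    have jk: "g (\<tau> k) \<le> b" if "k < j" for k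
      using not_less_Least[OF that[unfolded j_def]] by (simp add: not_less)
    have j0: "0 < j" using j(1) b by (cases j) (auto simp: \<tau>_def g_def)
    have jm: "j \<le> m" using i(1) j(2) by simp
    \<comment> \<open>Each time up to the passage is close to a strictly earlier grid time
      \<open>k < j\<close>, where the path was within \<open>b\<close>. At \<open>\<tau> j\<close>
      itself the preceding grid time serves.\<close>
    have bd: "g r \<le> 2 * b" if r: "r \<in> {t..\<tau> j}" for r
    proof -
      have r': "r \<in> {t..t+h}" using r \<tau>[OF jm] by auto
      have "\<exists>k<j. dist r (\<tau> k) < d"
      proof (cases "r = \<tau> j")
        case True
        obtain k where k: "j = Suc k" using j0 gr0_implies_Suc by blast
        have "dist r (\<tau> k) = h * inverse m" using True \<tau>_Suc[of k] k t m by (simp add: dist_real_def)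
        then show ?thesis using k m by (intro exI[of _ k]) auto
      next
        case False
        then show ?thesis using near[OF r'] r by auto
      qed
      then obtain k where k: "k < j" "dist r (\<tau> k) < d" by blast
      have "dist (g r) (g (\<tau> k)) < b" using d(2)[OF r' \<tau> k(2)] k jm by auto
      then show ?thesis using jk[OF k(1)] by (auto simp: dist_real_def)
    qed
    have "w \<in> grid_exit t h b m j"
      unfolding grid_exit_def using sp j(1) jk bd by (auto simp: g_def \<tau>_def)
    then show "w \<in> (\<Union>j\<le>m. grid_exit t h b m j)" using jm by auto
  qed
qed

text \<open>A first passage on a finite grid is decided at a single time of the grid, where the past is
  independent of the future; bounds for it pass to the exit event in the limit.\<close>

lemma exit_event_bound:
  assumes t: "0 \<le> t" "t + d \<le> 1" "0 < d" and r: "0 < r" and [measurable]: "g \<in> borel_measurable M"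
    and bound: "\<And>m. 0 < m \<Longrightarrow> (\<Sum>j\<le>m. \<integral>\<^sup>+w. g w * indicator (grid_exit t d r m j) w \<partial>M) \<le> c"
  shows "(\<integral>\<^sup>+w. g w * indicator (exit_event t d r) w \<partial>M) \<le> c"
proof -
  have G: "grid_exit t d r m j \<in> events" if "j \<le> m" "0 < m" for j m
    using grid_exit_past[of t d j m r] past_subset[of "t + d * (real j / real m)"] grid_time_le[of d j m] t that by auto
  define A where "A m = (\<Union>j\<le>Suc m. grid_exit t d r (Suc m) j)" for m
  have A[measurable]: "A m \<in> events" for m unfolding A_def by (intro sets.finite_UN G) auto
  have [measurable]: "exit_event t d r \<in> events" using exit_event_measurable(3) t by auto
  have le: "(\<integral>\<^sup>+w. g w * indicator (A m) w \<partial>M) \<le> c" for m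
  proof -
    have "(\<integral>\<^sup>+w. g w * indicator (A m) w \<partial>M) =
      (\<integral>\<^sup>+w. (\<Sum>j\<le>Suc m. g w * indicator (grid_exit t d r (Suc m) j) w) \<partial>M)"
    proof (intro nn_integral_cong)
      fix w
      have "indicator (A m) w = (\<Sum>j\<le>Suc m. indicator (grid_exit t d r (Suc m) j) w :: ennreal)"
        unfolding A_def by (rule indicator_UN_disjoint) (auto simp: disjoint_family_on_def disjoint_grid_exit)
      then show "g w * indicator (A m) w = (\<Sum>j\<le>Suc m. g w * indicator (grid_exit t d r (Suc m) j) w)"
        by (simp only: sum_distrib_left)
    qed
    also have "\<dots> = (\<Sum>j\<le>Suc m. \<integral>\<^sup>+w. g w * indicator (grid_exit t d r (Suc m) j) w \<partial>M)"
      by (rule nn_integral_sum) (auto intro!: borel_measurable_times_ennreal borel_measurable_indicator G)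
    also have "\<dots> \<le> c" by (rule bound) simp
    finally show ?thesis .
  qed
  \<comment> \<open>The events \<open>A m\<close> are not monotone in \<open>m\<close>, but each
    exiting path lies in all of them from some \<open>m\<close> on; hence Fatou's lemma.\<close>
  have "(\<integral>\<^sup>+w. g w * indicator (exit_event t d r) w \<partial>M) \<le> (\<integral>\<^sup>+w. liminf (\<lambda>m. g w * indicator (A m) w) \<partial>M)"
  proof (rule nn_integral_mono)
    fix w
    show "g w * indicator (exit_event t d r) w \<le> liminf (\<lambda>m. g w * indicator (A m) w)"
    proof (cases "w \<in> exit_event t d r")
      case True
      have "\<forall>\<^sub>F m in sequentially. w \<in> A m"
        using eventually_grid_exit[OF t r True] unfolding A_def
        by (subst eventually_sequentially_Suc)
      then have "\<forall>\<^sub>F m in sequentially. g w \<le> g w * indicator (A m) w"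
        by eventually_elim simp
      then show ?thesis using True by (simp add: Liminf_bounded)
    qed simp
  qed
  also have "\<dots> \<le> liminf (\<lambda>m. \<integral>\<^sup>+w. g w * indicator (A m) w \<partial>M)"
    by (rule nn_integral_liminf) measurable
  also have "\<dots> \<le> liminf (\<lambda>m. c)" by (rule Liminf_mono) (simp add: le)
  finally show ?thesis by (simp add: Liminf_const)
qed

lemma prob_increment_ge:
  assumes st: "0 \<le> s" "s \<le> t" "t \<le> 1" and c: "0 < c"
  shows "prob {w\<in>space M. c < norm (B t w - B s w)} \<le> real CARD('n) * (t - s) / c\<^sup>2"
    and "prob {w\<in>space M. c < norm (B t w - B s w)} \<le> 3 * (real CARD('n) * (t - s))\<^sup>2 / c ^ 4"
proof -
  have [measurable]: "B t \<in> borel_measurable M" "B s \<in> borel_measurable M" using st by auto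
  have "prob {w\<in>space M. c < norm (B t w - B s w)} \<le> real CARD('n) * (t - s) / c\<^sup>2 \<and>
    prob {w\<in>space M. c < norm (B t w - B s w)} \<le> 3 * (real CARD('n) * (t - s))\<^sup>2 / c ^ 4"
  proof (cases "s = t")
    case True
    then show ?thesis using c by simp
  next
    case False
    then have st': "0 \<le> s" "s < t" "t \<le> 1" using st by auto
    have *: "prob {w\<in>space M. c < norm (B t w - B s w)} \<le> (\<integral>w. norm (B t w - B s w) ^ k \<partial>M) / c ^ k"
      if "integrable M (\<lambda>w. norm (B t w - B s w) ^ k)" for k
    proof -
      have "prob {w\<in>space M. c < norm (B t w - B s w)} \<le> prob {w\<in>space M. c ^ k \<le> norm (B t w - B s w) ^ k}"
        using c by (intro finite_measure_mono) (auto intro!: power_mono)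
      also have "\<dots> \<le> (\<integral>w. norm (B t w - B s w) ^ k \<partial>M) / c ^ k"
        using c by (intro integral_Markov_inequality_measure[OF that, where A = "{}"]) auto
      finally show ?thesis .
    qed
    note m = increment_norm_moments[OF st']
    show ?thesis
    proof
      show "prob {w\<in>space M. c < norm (B t w - B s w)} \<le> real CARD('n) * (t - s) / c\<^sup>2"
        using *[OF m(1)] m(2) by simp
      have "(\<integral>w. norm (B t w - B s w) ^ 4 \<partial>M) / c ^ 4 \<le> 3 * (real CARD('n) * (t - s))\<^sup>2 / c ^ 4"
        using m(4) c by (intro divide_right_mono) auto
      then show "prob {w\<in>space M. c < norm (B t w - B s w)} \<le> 3 * (real CARD('n) * (t - s))\<^sup>2 / c ^ 4"
        using *[OF m(3)] by linarith
    qed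
  qed
  then show "prob {w\<in>space M. c < norm (B t w - B s w)} \<le> real CARD('n) * (t - s) / c\<^sup>2"
    "prob {w\<in>space M. c < norm (B t w - B s w)} \<le> 3 * (real CARD('n) * (t - s))\<^sup>2 / c ^ 4" by auto
qed

text \<open>A maximal inequality of Ottaviani type. After the first passage the independent
  remaining increment is at most \<open>k / 2\<close> with probability at least 1/2, and then the
  endpoint is beyond \<open>k / 2\<close>, which the fourth moment makes unlikely: 96 = 2 * 3 *
  2^4.\<close>

lemma prob_exit_event:
  assumes t: "0 \<le> t" "t + d \<le> 1" "0 < d" and k: "0 < k"
  shows "prob (exit_event t d k) \<le> 96 * (real CARD('n) * d)\<^sup>2 / k ^ 4"
proof (cases "8 * (real CARD('n) * d) \<le> k\<^sup>2")
  case False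
  \<comment> \<open>If \<open>d\<close> is too large for Chebyshev's bound to give 1/2, the
    right-hand side of the claim exceeds 1.\<close>
  define x where "x = real CARD('n) * d"
  have "k\<^sup>2 < 8 * x" using False by (simp add: x_def)
  then have "(k\<^sup>2)\<^sup>2 \<le> (8 * x)\<^sup>2" using k by (intro power_mono) auto
  also have "(k\<^sup>2)\<^sup>2 = k ^ 4" by simp
  finally have "k ^ 4 \<le> 64 * x\<^sup>2" by (simp add: power_mult_distrib)
  then have "k ^ 4 \<le> 96 * x\<^sup>2" using zero_le_power2[of x] by linarith
  then have "1 \<le> 96 * x\<^sup>2 / k ^ 4" using k by simp
  then show ?thesis using prob_le_1[of "exit_event t d k"] unfolding x_def by linarith
next
  case True
  define F where "F = {w\<in>space M. k / 2 < norm (B (t + d) w - B t w)}"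
  have [measurable]: "B t \<in> borel_measurable M" "B (t + d) \<in> borel_measurable M" using t by auto
  have F[measurable]: "F \<in> events" unfolding F_def by measurable
  have half: "prob (grid_exit t d k m j) \<le> 2 * prob (grid_exit t d k m j \<inter> F)" if j: "j \<le> m" "0 < m" for j m
  proof -
    define r where "r = t + d * (real j / real m)"
    have r: "t \<le> r" "r \<le> t + d" using grid_time_le[of d j m] t j by (auto simp: r_def)
    have r01: "r \<in> {0..1}" using r t by auto
    have G: "grid_exit t d k m j \<in> sets (past_algebra r)"
      unfolding r_def using t j by (intro grid_exit_past) auto
    have [measurable]: "grid_exit t d k m j \<in> events" using G past_subset[of r] r01 by auto
    \<comment> \<open>The event that the increment after the grid time is small; it belongs to the
      future and so is independent of the passage.\<close>
    define L where "L = {w\<in>space M. norm (B (t + d) w - B r w) \<le> k / 2}"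
    have "{w\<in>space (future_algebra r). norm (B (t + d) w - B r w) \<le> k / 2} \<in> sets (future_algebra r)"
      using r t by (intro borel_measurable_le measurable_compose[OF _ borel_measurable_norm] measurable_future_increment) auto
    then have L: "L \<in> sets (future_algebra r)" by (simp add: L_def)
    have [measurable]: "L \<in> events" using L future_subset[of r] r01 by auto
    have "prob (grid_exit t d k m j \<inter> L) = prob (grid_exit t d k m j) * prob L"
    proof -
      have "prob ((\<lambda>w. (w, w)) -` (grid_exit t d k m j \<times> L) \<inter> space M) =
        prob ((\<lambda>w. w) -` grid_exit t d k m j \<inter> space M) * prob ((\<lambda>w. w) -` L \<inter> space M)"
        by (rule indep_varD[OF indep_past_future[OF r01] G L])
      moreover have "(\<lambda>w. (w, w)) -` (grid_exit t d k m j \<times> L) \<inter> space M = grid_exit t d k m j \<inter> L"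
        "(\<lambda>w. w) -` grid_exit t d k m j \<inter> space M = grid_exit t d k m j"
        "(\<lambda>w. w) -` L \<inter> space M = L" unfolding grid_exit_def L_def by blast+
      ultimately show ?thesis by (simp only:)
    qed
    moreover have "grid_exit t d k m j \<inter> L \<subseteq> grid_exit t d k m j \<inter> F"
    proof
      fix w assume w: "w \<in> grid_exit t d k m j \<inter> L"
      then have "k < norm (B r w - B t w)" "norm (B (t + d) w - B r w) \<le> k / 2"
        by (auto simp: grid_exit_def L_def r_def)
      moreover have "norm (B r w - B t w) \<le> norm (B (t + d) w - B t w) + norm (B (t + d) w - B r w)"
        using norm_triangle_ineq4[of "B (t + d) w - B t w" "B (t + d) w - B r w"] by simp
      ultimately show "w \<in> grid_exit t d k m j \<inter> F" using w by (auto simp: F_def grid_exit_def)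
    qed
    then have "prob (grid_exit t d k m j \<inter> L) \<le> prob (grid_exit t d k m j \<inter> F)"
      by (intro finite_measure_mono) auto
    moreover have "1 / 2 \<le> prob L"
    proof -
      have "prob {w\<in>space M. k / 2 < norm (B (t + d) w - B r w)} \<le> real CARD('n) * (t + d - r) / (k / 2)\<^sup>2"
        using r01 r t k by (intro prob_increment_ge) auto
      also have "\<dots> \<le> real CARD('n) * d / (k / 2)\<^sup>2"
        using r by (intro divide_right_mono mult_left_mono) auto
      also have "\<dots> \<le> 1 / 2" using True k by (simp add: power_divide field_simps)
      also have "{w\<in>space M. k / 2 < norm (B (t + d) w - B r w)} = space M - L" by (auto simp: L_def)
      finally show ?thesis by (simp add: prob_compl)
    qed
    ultimately have "prob (grid_exit t d k m j) * (1 / 2) \<le> prob (grid_exit t d k m j \<inter> F)"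
      using mult_left_mono[of "1/2" "prob L" "prob (grid_exit t d k m j)"] measure_nonneg[of M "grid_exit t d k m j"]
      by linarith
    then show ?thesis by simp
  qed
  have "(\<integral>\<^sup>+w. 1 * indicator (exit_event t d k) w \<partial>M) \<le> ennreal (2 * prob F)"
  proof (rule exit_event_bound[OF t k])
    fix m :: nat assume m: "0 < m"
    have G: "grid_exit t d k m j \<in> events" if "j \<le> m" for j
      using grid_exit_past[of t d j m k] past_subset[of "t + d * (real j / real m)"] grid_time_le[of d j m] t that m by auto
    have "(\<Sum>j\<le>m. \<integral>\<^sup>+w. 1 * indicator (grid_exit t d k m j) w \<partial>M) = (\<Sum>j\<le>m. ennreal (prob (grid_exit t d k m j)))"
      using G by (intro sum.cong refl) (simp add: emeasure_eq_measure)
    also have "\<dots> = ennreal (\<Sum>j\<le>m. prob (grid_exit t d k m j))" by (rule sum_ennreal) simp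
    also have "\<dots> \<le> ennreal (2 * prob F)"
    proof (rule ennreal_leI)
      have "(\<Sum>j\<le>m. prob (grid_exit t d k m j)) \<le> (\<Sum>j\<le>m. 2 * prob (grid_exit t d k m j \<inter> F))"
        using half m by (intro sum_mono) auto
      also have "\<dots> = 2 * prob (\<Union>j\<in>{..m}. grid_exit t d k m j \<inter> F)"
        using G disjoint_grid_exit[of _ _ t d k m]
        by (subst finite_measure_finite_Union)
          (auto simp: disjoint_family_on_def sum_distrib_left)
      also have "\<dots> \<le> 2 * prob F" by (intro mult_left_mono finite_measure_mono) auto
      finally show "(\<Sum>j\<le>m. prob (grid_exit t d k m j)) \<le> 2 * prob F" .
    qed
    finally show "(\<Sum>j\<le>m. \<integral>\<^sup>+w. 1 * indicator (grid_exit t d k m j) w \<partial>M) \<le> ennreal (2 * prob F)" .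
  qed simp
  then have "prob (exit_event t d k) \<le> 2 * prob F"
    using exit_event_measurable(3)[of t d k] t by (simp add: emeasure_eq_measure)
  also have "\<dots> \<le> 2 * (3 * (real CARD('n) * (t + d - t))\<^sup>2 / (k / 2) ^ 4)"
    unfolding F_def using t k by (intro mult_left_mono prob_increment_ge) auto
  also have "\<dots> = 96 * (real CARD('n) * d)\<^sup>2 / k ^ 4" by (simp add: power_divide)
  finally show ?thesis .
qed

subsection \<open>Second-order expansion of expectations over a short time\<close>

text \<open>This is 3 n^2 (3/2 P + Q/2), where 96 n^2 / r^4 and 3 a^2 n^2 are the coefficients of
  d^2 in the bounds P for the exit probability and Q for the fourth moment of the
  displacement.\<close>

definition expansion_bound :: "real \<Rightarrow> real \<Rightarrow> real" where
  "expansion_bound a r = (let n = real CARD('n) in 9 / 2 * n\<^sup>2 * (96 * n\<^sup>2 / r ^ 4 + a\<^sup>2 * n\<^sup>2))"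

text \<open>A quadratic polynomial in the displacement integrates exactly: first moments vanish and
  the covariance is \<open>a * d\<close> times the identity, which leaves half of \<open>a\<close>
  times the trace of \<open>H\<close>. The first error integrates the local remainder; the second is
  the contribution of the polynomial on the exit event, where the expansion is not assumed.\<close>

lemma short_time_expansion:
  fixes \<beta> :: "real^'n" and H :: "'n \<Rightarrow> 'n \<Rightarrow> real" and \<Theta> :: "'w \<Rightarrow> real"
  assumes t: "0 \<le> t" "t + d \<le> 1" "0 < d" and r: "0 < r" and a: "0 < a"
    and \<Theta>[measurable]: "\<Theta> \<in> borel_measurable M"
    and K: "\<bar>\<alpha>\<bar> \<le> K" "\<And>i. \<bar>\<beta> $ i\<bar> \<le> K" "\<And>i j. \<bar>H i j\<bar> \<le> K" "\<bar>\<gamma>\<bar> \<le> K" and k: "0 \<le> k"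
    and W: "\<And>v. W v = sqrt a *\<^sub>R (B (t + d) v - B t v)"
    and approx: "\<And>v. v \<in> space M \<Longrightarrow> v \<notin> exit_event t d r \<Longrightarrow>
      \<bar>\<Theta> v - (\<alpha> + (\<Sum>i\<in>UNIV. \<beta> $ i * W v $ i) + (\<Sum>i\<in>UNIV. \<Sum>j\<in>UNIV. H i j * (W v $ i * W v $ j)) / 2 + \<gamma> * d)\<bar>
        \<le> k * (d + (norm (W v))\<^sup>2)"
  shows "\<bar>(\<integral>v. indicator (space M - exit_event t d r) v * \<Theta> v \<partial>M) - \<alpha> - d * (\<gamma> + a / 2 * (\<Sum>i\<in>UNIV. H i i))\<bar>
      \<le> k * d * (1 + real CARD('n) * a) + K * expansion_bound a r * d\<^sup>2"
proof -
  define n where "n = real CARD('n)"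
  define c where "c = 96 * n\<^sup>2 / r ^ 4"
  define X where "X = exit_event t d r"
  define N where "N = space M - X"
  define G where "G v = \<alpha> + (\<Sum>i\<in>UNIV. \<beta> $ i * W v $ i) + (\<Sum>i\<in>UNIV. \<Sum>j\<in>UNIV. H i j * (W v $ i * W v $ j)) / 2 + \<gamma> * d" for v
  have K0: "0 \<le> K" using K(1) by linarith
  have n0: "0 \<le> n" by (simp add: n_def)
  have d1: "d \<le> 1" using t by linarith
  have st: "0 \<le> t" "t < t + d" "t + d \<le> 1" using t by auto
  have [measurable]: "X \<in> events" unfolding X_def using exit_event_measurable(3) t by auto
  then have [measurable]: "N \<in> events" unfolding N_def by auto
  have "B t \<in> borel_measurable M" "B (t + d) \<in> borel_measurable M" using t by auto
  then have [measurable]: "W \<in> borel_measurable M" unfolding W by measurable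
  have Wi: "W v $ i = sqrt a * (B (t + d) v - B t v) $ i" for v i unfolding W by simp
  have i1: "integrable M (\<lambda>v. W v $ i)" for i
    unfolding Wi using increment_component_moments(1)[OF st, of i 1] by simp
  have e1: "(\<integral>v. W v $ i \<partial>M) = 0" for i
    unfolding Wi integral_mult_right_zero increment_component_moments(2)[OF st] by simp
  have Wij: "W v $ i * W v $ j = a * ((B (t + d) v - B t v) $ i * (B (t + d) v - B t v) $ j)" for v i j
  proof -
    have "sqrt a * sqrt a = a" using a by simp
    moreover have "W v $ i * W v $ j = (sqrt a * sqrt a) * ((B (t + d) v - B t v) $ i * (B (t + d) v - B t v) $ j)"
      unfolding Wi by (simp only: mult_ac)
    ultimately show ?thesis by simp
  qed
  have ij: "integrable M (\<lambda>v. W v $ i * W v $ j) \<and> (\<integral>v. W v $ i * W v $ j \<partial>M) = (if i = j then a * d else 0)" for i j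
  proof (cases "i = j")
    case True
    have eq: "(B (t + d) v - B t v) $ i * (B (t + d) v - B t v) $ i = ((B (t + d) v - B t v) $ i)\<^sup>2" for v
      by (rule power2_eq_square[symmetric])
    have "integrable M (\<lambda>v. ((B (t + d) v - B t v) $ i)\<^sup>2)"
      "(\<integral>v. ((B (t + d) v - B t v) $ i)\<^sup>2 \<partial>M) = d"
      using increment_component_moments(1)[OF st, of i 2] increment_component_moments(3)[OF st, of i] by simp_all
    then show ?thesis unfolding Wij True[symmetric] eq by simp
  next
    case False
    show ?thesis unfolding Wij
      using increment_component_covariance[OF st False] False by (simp del: vector_minus_component)
  qed
  have nW: "norm (W v) = sqrt a * norm (B (t + d) v - B t v)" for v unfolding W using a by simp
  have nW2: "(norm (W v))\<^sup>2 = a * (norm (B (t + d) v - B t v))\<^sup>2" for v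
    unfolding nW using a by (simp add: power_mult_distrib)
  have nW4: "norm (W v) ^ 4 = a\<^sup>2 * norm (B (t + d) v - B t v) ^ 4" for v
  proof -
    have "norm (W v) ^ 4 = ((norm (W v))\<^sup>2)\<^sup>2" by simp
    then show ?thesis unfolding nW2 by (simp add: power_mult_distrib)
  qed
  have i2: "integrable M (\<lambda>v. (norm (W v))\<^sup>2)" "(\<integral>v. (norm (W v))\<^sup>2 \<partial>M) = n * a * d"
    unfolding nW2 using increment_norm_moments(1,2)[OF st] by (simp_all add: n_def)
  have i4: "integrable M (\<lambda>v. norm (W v) ^ 4)" unfolding nW4 using increment_norm_moments(3)[OF st] by simp
  have e4: "(\<integral>v. norm (W v) ^ 4 \<partial>M) \<le> 3 * a\<^sup>2 * n\<^sup>2 * d\<^sup>2"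
  proof -
    have "(\<integral>v. norm (W v) ^ 4 \<partial>M) \<le> a\<^sup>2 * (3 * (n * (t + d - t))\<^sup>2)"
      unfolding nW4 integral_mult_right_zero n_def by (intro mult_left_mono increment_norm_moments(4)[OF st]) simp
    then show ?thesis by (simp add: power_mult_distrib mult_ac)
  qed
  have iX: "integrable M (indicator X :: 'w \<Rightarrow> real)" "(\<integral>v. indicator X v \<partial>M) \<le> c * d\<^sup>2"
  proof -
    have "prob X \<le> c * d\<^sup>2"
      using prob_exit_event[OF t r] unfolding X_def c_def n_def by (simp add: power_mult_distrib)
    moreover have "X \<inter> space M = X" unfolding X_def exit_event_def by auto
    ultimately show "(\<integral>v. indicator X v \<partial>M) \<le> c * d\<^sup>2" by simp
    show "integrable M (indicator X :: 'w \<Rightarrow> real)" by (simp add: emeasure_eq_measure)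
  qed
  have iG: "integrable M G"
    unfolding G_def using i1 ij by (intro Bochner_Integration.integrable_add integrable_divide_zero
      Bochner_Integration.integrable_sum integrable_mult_right integrable_const) auto
  have eG: "(\<integral>v. G v \<partial>M) = \<alpha> + d * (\<gamma> + a / 2 * (\<Sum>i\<in>UNIV. H i i))"
  proof -
    have s1: "(\<integral>v. (\<Sum>i\<in>UNIV. \<beta> $ i * W v $ i) \<partial>M) = 0"
      using i1 e1 by (subst Bochner_Integration.integral_sum) auto
    have s2: "(\<integral>v. (\<Sum>i\<in>UNIV. \<Sum>j\<in>UNIV. H i j * (W v $ i * W v $ j)) \<partial>M) = (\<Sum>i\<in>UNIV. H i i * (a * d))"
    proof -
      have "(\<integral>v. (\<Sum>i\<in>UNIV. \<Sum>j\<in>UNIV. H i j * (W v $ i * W v $ j)) \<partial>M) =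
        (\<Sum>i\<in>UNIV. \<Sum>j\<in>UNIV. H i j * (\<integral>v. W v $ i * W v $ j \<partial>M))"
        using ij by (subst Bochner_Integration.integral_sum, (auto intro!: sum.cong)[1],
            subst Bochner_Integration.integral_sum) auto
      also have "\<dots> = (\<Sum>i\<in>UNIV. H i i * (a * d))"
        using ij by (intro sum.cong refl) (auto simp: if_distrib[of "\<lambda>x. _ * x"] cong: if_cong)
      finally show ?thesis .
    qed
    have j1: "integrable M (\<lambda>v. \<Sum>i\<in>UNIV. \<beta> $ i * W v $ i)"
      using i1 by (intro Bochner_Integration.integrable_sum integrable_mult_right)
    have j2: "integrable M (\<lambda>v. \<Sum>i\<in>UNIV. \<Sum>j\<in>UNIV. H i j * (W v $ i * W v $ j))"
      using ij by (intro Bochner_Integration.integrable_sum integrable_mult_right) auto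
    have "(\<integral>v. G v \<partial>M) = \<alpha> + 0 + (\<Sum>i\<in>UNIV. H i i * (a * d)) / 2 + \<gamma> * d"
      unfolding G_def using j1 j2 s1 s2 by (simp add: prob_space)
    moreover have "(\<Sum>i\<in>UNIV. H i i * (a * d)) = (\<Sum>i\<in>UNIV. H i i) * (a * d)"
      by (rule sum_distrib_right[symmetric])
    ultimately show ?thesis by (simp add: algebra_simps)
  qed
  have G_le: "\<bar>G v\<bar> \<le> K * (2 + n * norm (W v) + n\<^sup>2 / 2 * (norm (W v))\<^sup>2)" for v
  proof -
    have "\<bar>\<Sum>i\<in>UNIV. \<beta> $ i * W v $ i\<bar> \<le> (\<Sum>i\<in>(UNIV::'n set). K * norm (W v))"
      by (rule order_trans[OF sum_abs sum_mono])
        (use K0 K(2) component_le_norm_cart[of "W v"] in \<open>auto simp: abs_mult intro!: mult_mono\<close>)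
    also have "\<dots> = K * (n * norm (W v))" by (simp add: n_def)
    finally have 1: "\<bar>\<Sum>i\<in>UNIV. \<beta> $ i * W v $ i\<bar> \<le> K * (n * norm (W v))" .
    have "\<bar>\<Sum>i\<in>UNIV. \<Sum>j\<in>UNIV. H i j * (W v $ i * W v $ j)\<bar> \<le> (\<Sum>i\<in>(UNIV::'n set). \<Sum>j\<in>(UNIV::'n set). K * (norm (W v))\<^sup>2)"
      by (rule order_trans[OF sum_abs sum_mono], rule order_trans[OF sum_abs sum_mono])
        (use K0 K(3) component_le_norm_cart[of "W v"] in \<open>auto simp: abs_mult power2_eq_square intro!: mult_mono\<close>)
    also have "\<dots> = K * (n\<^sup>2 * (norm (W v))\<^sup>2)" by (simp add: n_def power2_eq_square)
    finally have 2: "\<bar>\<Sum>i\<in>UNIV. \<Sum>j\<in>UNIV. H i j * (W v $ i * W v $ j)\<bar> / 2 \<le> K * (n\<^sup>2 / 2 * (norm (W v))\<^sup>2)" by simp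
    have 3: "\<bar>\<gamma> * d\<bar> \<le> K" using mult_mono[OF K(4) d1] t(3) K0 by (simp add: abs_mult)
    have "\<bar>G v\<bar> \<le> \<bar>\<alpha>\<bar> + \<bar>\<Sum>i\<in>UNIV. \<beta> $ i * W v $ i\<bar>
        + \<bar>\<Sum>i\<in>UNIV. \<Sum>j\<in>UNIV. H i j * (W v $ i * W v $ j)\<bar> / 2 + \<bar>\<gamma> * d\<bar>"
      unfolding G_def by linarith
    also have "\<dots> \<le> K + K * (n * norm (W v)) + K * (n\<^sup>2 / 2 * (norm (W v))\<^sup>2) + K"
      using 1 2 3 K(1) by (intro add_mono)
    finally show ?thesis by (simp add: algebra_simps)
  qed
  \<comment> \<open>On the exit event, powers of the displacement up to 2 are dominated by a
    constant plus the fourth power. The constant carries the indicator and the fourth moment is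
    already of order \<open>d\<^sup>2\<close>.\<close>
  define D where "D v = K * (3 * n\<^sup>2 * (3 / 2 * indicator X v + norm (W v) ^ 4 / 2))" for v
  have XG: "\<bar>indicator X v * G v\<bar> \<le> D v" for v
  proof (cases "v \<in> X")
    case True
    have n1: "1 \<le> n" unfolding n_def by (simp add: Suc_leI)
    then have nn: "1 \<le> n\<^sup>2" "n \<le> n\<^sup>2" by (auto simp: one_le_power self_le_power)
    define q where "q = norm (W v)"
    have q: "q \<le> 1 + q\<^sup>2" "q\<^sup>2 \<le> (q ^ 4 + 1) / 2"
    proof -
      have "2 * q \<le> q\<^sup>2 + 1" using sum_power2_ge_zero[of "q - 1" 0] by (simp add: power2_diff)
      then show "q \<le> 1 + q\<^sup>2" using zero_le_power2[of q] by linarith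
      have "0 \<le> (q\<^sup>2 - 1)\<^sup>2" by simp
      then show "q\<^sup>2 \<le> (q ^ 4 + 1) / 2" by (simp add: power2_diff power_mult[symmetric])
    qed
    have "2 + n * q + n\<^sup>2 / 2 * q\<^sup>2 \<le> n\<^sup>2 * 2 + n\<^sup>2 * (1 + q\<^sup>2) + n\<^sup>2 / 2 * q\<^sup>2"
      using nn q n0 by (intro add_mono mult_mono order_refl) (auto simp: q_def)
    also have "\<dots> \<le> 3 * n\<^sup>2 * (1 + q\<^sup>2)" by (simp add: algebra_simps)
    also have "\<dots> \<le> 3 * n\<^sup>2 * (3 / 2 + q ^ 4 / 2)" using q(2) by (intro mult_left_mono) auto
    finally have "K * (2 + n * q + n\<^sup>2 / 2 * q\<^sup>2) \<le> D v"
      unfolding D_def using True K0 by (intro mult_left_mono) (auto simp: q_def)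
    then show ?thesis using G_le[of v] True by (simp add: q_def)
  next
    case False
    then show ?thesis unfolding D_def using K0 by simp
  qed
  have iD: "integrable M D"
    unfolding D_def using iX i4
    by (intro integrable_mult_right Bochner_Integration.integrable_add integrable_divide_zero) auto
  have eD: "(\<integral>v. D v \<partial>M) \<le> K * expansion_bound a r * d\<^sup>2"
  proof -
    have "(\<integral>v. D v \<partial>M) = K * (3 * n\<^sup>2 * (3 / 2 * (\<integral>v. indicator X v \<partial>M) + (\<integral>v. norm (W v) ^ 4 \<partial>M) / 2))"
      unfolding D_def using iX(1) i4 by simp
    also have "\<dots> \<le> K * (3 * n\<^sup>2 * (3 / 2 * (c * d\<^sup>2) + 3 * a\<^sup>2 * n\<^sup>2 * d\<^sup>2 / 2))"
      using K0 iX(2) e4 by (intro mult_left_mono add_mono divide_right_mono) auto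
    also have "\<dots> = K * expansion_bound a r * d\<^sup>2"
      unfolding expansion_bound_def Let_def n_def[symmetric] c_def[symmetric] by (simp add: algebra_simps)
    finally show ?thesis .
  qed
  have iXG: "integrable M (\<lambda>v. indicator X v * G v)"
    by (rule Bochner_Integration.integrable_bound[OF iD])
      (use iG XG in \<open>auto intro!: AE_I2 order_trans[OF XG abs_ge_self]\<close>)
  have split: "G v = indicator N v * G v + indicator X v * G v" if "v \<in> space M" for v
    using that by (auto simp: N_def indicator_def)
  have iNG: "integrable M (\<lambda>v. indicator N v * G v)"
  proof -
    have "integrable M (\<lambda>v. G v - indicator X v * G v)" using iG iXG by auto
    then show ?thesis using split
      by (subst Bochner_Integration.integrable_cong[of M M _ "\<lambda>v. G v - indicator X v * G v"]) (auto simp: algebra_simps)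
  qed
  have ap: "\<bar>indicator N v * (\<Theta> v - G v)\<bar> \<le> k * (d + (norm (W v))\<^sup>2)" for v
  proof (cases "v \<in> N")
    case True
    then have "v \<in> space M" "v \<notin> exit_event t d r" by (auto simp: N_def X_def)
    from approx[OF this] True show ?thesis by (simp add: G_def)
  next
    case False
    then show ?thesis using k t by simp
  qed
  have iE: "integrable M (\<lambda>v. k * (d + (norm (W v))\<^sup>2))" using i2 by auto
  have iN: "integrable M (\<lambda>v. indicator N v * (\<Theta> v - G v))"
    by (rule Bochner_Integration.integrable_bound[OF iE])
      (use iG in \<open>auto intro!: AE_I2 order_trans[OF ap abs_ge_self]\<close>)
  have eq: "indicator N v * \<Theta> v = indicator N v * (\<Theta> v - G v) + indicator N v * G v" for v
    by (simp add: algebra_simps)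
  have "(\<integral>v. indicator N v * \<Theta> v \<partial>M) = (\<integral>v. indicator N v * (\<Theta> v - G v) \<partial>M) + (\<integral>v. indicator N v * G v \<partial>M)"
    unfolding eq by (rule Bochner_Integration.integral_add[OF iN iNG])
  moreover have "(\<integral>v. indicator N v * G v \<partial>M) = (\<integral>v. G v \<partial>M) - (\<integral>v. indicator X v * G v \<partial>M)"
  proof -
    have "(\<integral>v. G v \<partial>M) = (\<integral>v. indicator N v * G v + indicator X v * G v \<partial>M)"
      by (intro Bochner_Integration.integral_cong refl split)
    also have "\<dots> = (\<integral>v. indicator N v * G v \<partial>M) + (\<integral>v. indicator X v * G v \<partial>M)"
      by (rule Bochner_Integration.integral_add[OF iNG iXG])
    finally show ?thesis by simp
  qed
  moreover have "\<bar>\<integral>v. indicator N v * (\<Theta> v - G v) \<partial>M\<bar> \<le> k * d * (1 + n * a)"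
  proof -
    have "\<bar>\<integral>v. indicator N v * (\<Theta> v - G v) \<partial>M\<bar> \<le> (\<integral>v. k * (d + (norm (W v))\<^sup>2) \<partial>M)"
      by (rule order_trans[OF integral_abs_bound integral_mono[OF integrable_abs[OF iN] iE ap]])
    also have "\<dots> = k * d * (1 + n * a)" using i2 by (simp add: prob_space algebra_simps)
    finally show ?thesis .
  qed
  moreover have "\<bar>\<integral>v. indicator X v * G v \<partial>M\<bar> \<le> K * expansion_bound a r * d\<^sup>2"
    by (rule order_trans[OF order_trans[OF integral_abs_bound integral_mono[OF integrable_abs[OF iXG] iD XG]] eD])
  ultimately show "\<bar>(\<integral>v. indicator (space M - exit_event t d r) v * \<Theta> v \<partial>M) - \<alpha> - d * (\<gamma> + a / 2 * (\<Sum>i\<in>UNIV. H i i))\<bar>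
      \<le> k * d * (1 + real CARD('n) * a) + K * expansion_bound a r * d\<^sup>2"
    using eG unfolding N_def X_def n_def by linarith
qed

end

section \<open>The Markov property of the weighted Brownian motion\<close>

locale bredinger = flat_quotient pr \<Lambda> + brownian M B
  for pr :: "real^'n \<Rightarrow> 'x::{second_countable_topology, t2_space}" and \<Lambda>
    and M :: "'w measure" and B :: "real \<Rightarrow> 'w \<Rightarrow> real^'n" +
  fixes a :: real and T S :: "real set" and \<eta> :: "'x \<Rightarrow> 'x \<Rightarrow> real" and p \<theta> :: "real \<Rightarrow> 'x \<Rightarrow> real"
    and F :: "'x \<Rightarrow> real \<Rightarrow> (real \<Rightarrow> 'x) \<Rightarrow> real"
  assumes a_pos: "0 < a" and finite_S: "finite S" and S_subset: "S \<subseteq> {0<..<1}"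
    and sets_T: "T \<in> sets borel" and T_subset: "T \<subseteq> {0..1}"
    and continuous_\<eta>: "continuous_on UNIV (\<lambda>(x, y). \<eta> x y)"
    and continuous_\<theta>: "\<And>s. s \<in> S \<Longrightarrow> continuous_on UNIV (\<theta> s)"
    and continuous_p: "continuous_on (T \<times> UNIV) (\<lambda>(t, z). p t z)"
    and F_eq: "\<And>x t \<omega>. F x t \<omega> = exp (\<eta> x (\<omega> 1) + (\<Sum>s\<in>{s\<in>S. s > t}. \<theta> s (\<omega> s))
                + (LBINT r:T \<inter> {t<..1}. p r (\<omega> r)))"
    and well_defined: "\<And>x z t. t \<in> {0..1} \<Longrightarrow>
           (AE \<omega> in brownian_law_through pr a M B t z.
              set_integrable lborel (T \<inter> {t<..1}) (\<lambda>r. p r (\<omega> r))) \<and>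
           integrable (brownian_law_through pr a M B t z) (F x t)"
begin

definition lift :: "real \<Rightarrow> real^'n \<Rightarrow> 'w \<Rightarrow> real \<Rightarrow> real^'n" where
  "lift t y w r = y + sqrt a *\<^sub>R (B r w - B t w)"

definition path :: "real \<Rightarrow> real^'n \<Rightarrow> 'w \<Rightarrow> real \<Rightarrow> 'x" where
  "path t y w = (\<lambda>r\<in>{0..1}. pr (lift t y w r))"

text \<open>Jumps and integral are taken over the half-open interval (s, r], so weights multiply
  over adjacent intervals and the value at a jump time excludes that jump.\<close>

definition weight :: "real \<Rightarrow> real \<Rightarrow> (real \<Rightarrow> 'x) \<Rightarrow> real" where
  "weight s r \<xi> = exp ((\<Sum>c\<in>{c\<in>S. s < c \<and> c \<le> r}. \<theta> c (\<xi> c))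
     + (LBINT q:T \<inter> {s<..r}. p q (\<xi> q)))"

definition value_fun :: "'x \<Rightarrow> real \<Rightarrow> real^'n \<Rightarrow> real" where
  "value_fun x t y = (\<integral>w. F x t (path t y w) \<partial>M)"

lemma F_weight: "F x t \<xi> = exp (\<eta> x (\<xi> 1)) * weight t 1 \<xi>"
proof -
  have "{s \<in> S. t < s} = {c \<in> S. t < c \<and> c \<le> 1}" using S_subset by auto
  then show ?thesis unfolding F_eq weight_def by (simp add: exp_add mult_ac)
qed

lemma F_pos: "0 < F x t \<xi>"
  unfolding F_eq by simp

lemma weight_pos: "0 < weight s r \<xi>"
  unfolding weight_def by simp

lemma weight_split:
  assumes "s \<le> r" "r \<le> t" "set_integrable lborel (T \<inter> {s<..t}) (\<lambda>q. p q (\<xi> q))"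
  shows "weight s t \<xi> = weight s r \<xi> * weight r t \<xi>"
proof -
  have "(LBINT q:T \<inter> {s<..t}. p q (\<xi> q)) =
    (LBINT q:(T \<inter> {s<..r}) \<union> (T \<inter> {r<..t}). p q (\<xi> q))"
    using assms by (intro arg_cong2[where f = "set_lebesgue_integral lborel"]) auto
  also have "\<dots> = (LBINT q:T \<inter> {s<..r}. p q (\<xi> q)) +
      (LBINT q:T \<inter> {r<..t}. p q (\<xi> q))"
  proof (rule set_integral_Un)
    show "T \<inter> {s<..r} \<inter> (T \<inter> {r<..t}) = {}" by auto
    show "set_integrable lborel (T \<inter> {s<..r}) (\<lambda>q. p q (\<xi> q))" "set_integrable lborel (T \<inter> {r<..t}) (\<lambda>q. p q (\<xi> q))"
      using assms(1,2) sets_T by (auto intro!: set_integrable_subset[OF assms(3)])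
  qed
  finally have 1: "(LBINT q:T \<inter> {s<..t}. p q (\<xi> q)) =
    (LBINT q:T \<inter> {s<..r}. p q (\<xi> q)) +
      (LBINT q:T \<inter> {r<..t}. p q (\<xi> q))" .
  have un: "{c\<in>S. s < c \<and> c \<le> t} = {c\<in>S. s < c \<and> c \<le> r} \<union> {c\<in>S. r < c \<and> c \<le> t}"
    using assms(1,2) by auto
  have 2: "(\<Sum>c\<in>{c\<in>S. s < c \<and> c \<le> t}. \<theta> c (\<xi> c)) =
      (\<Sum>c\<in>{c\<in>S. s < c \<and> c \<le> r}. \<theta> c (\<xi> c)) + (\<Sum>c\<in>{c\<in>S. r < c \<and> c \<le> t}. \<theta> c (\<xi> c))"
    unfolding un by (rule sum.union_disjoint) (auto intro: finite_subset[OF _ finite_S])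
  show ?thesis unfolding weight_def 1 2 by (simp add: exp_add[symmetric] algebra_simps)
qed

text \<open>\<open>p\<close> is continuous only on \<open>T \<times> UNIV\<close>; extended by zero
  it is measurable because \<open>T\<close> is Borel.\<close>

lemma measurable_p: "(\<lambda>(t, z). indicator T t * p t z) \<in> borel_measurable (borel \<Otimes>\<^sub>M borel)"
proof -
  have "(\<lambda>x. indicator (T \<times> UNIV) x *\<^sub>R (case x of (t, z) \<Rightarrow> p t z)) \<in> borel_measurable borel"
  proof (rule borel_measurable_continuous_on_indicator[OF _ continuous_p])
    have "T \<times> (UNIV :: 'x set) \<in> sets (borel \<Otimes>\<^sub>M borel)" using sets_T by auto
    then show "T \<times> (UNIV :: 'x set) \<in> sets borel" by (simp only: borel_prod)
  qed
  moreover have "(\<lambda>x. indicator (T \<times> UNIV) x *\<^sub>R (case x of (t, z) \<Rightarrow> p t z)) = (\<lambda>(t, z). indicator T t * p t z)"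
    by (auto simp: fun_eq_iff indicator_def)
  ultimately show ?thesis by (simp only: borel_prod)
qed

lemma measurable_\<eta>: "(\<lambda>(x, y). \<eta> x y) \<in> borel_measurable (borel \<Otimes>\<^sub>M borel)"
  using borel_measurable_continuous_onI[OF continuous_\<eta>] by (simp only: borel_prod)

lemma measurable_\<theta>: "s \<in> S \<Longrightarrow> \<theta> s \<in> borel_measurable borel"
  using borel_measurable_continuous_onI[OF continuous_\<theta>] .

lemma measurable_weight:
  fixes Z :: "'b \<Rightarrow> real \<Rightarrow> 'x"
  assumes sr: "s \<le> r" and Z: "\<And>q. q \<in> {s..r} \<Longrightarrow> (\<lambda>w. Z w q) \<in> N \<rightarrow>\<^sub>M borel"
    and cont: "\<And>w. w \<in> space N \<Longrightarrow> continuous_on {s..r} (Z w)"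
  shows "(\<lambda>w. weight s r (Z w)) \<in> borel_measurable N"
proof -
  \<comment> \<open>Clamping the time extends the path continuously to all real times, so that joint
    measurability applies.\<close>
  define Y where "Y q w = Z w (max s (min r q))" for q w
  have Y: "(\<lambda>(q, w). Y q w) \<in> borel \<Otimes>\<^sub>M N \<rightarrow>\<^sub>M borel"
    unfolding Y_def using Z cont by (intro measurable_continuous_process[OF sr, of "\<lambda>q w. Z w q"]) auto
  have 1: "(\<lambda>(w, q). (q, Y q w)) \<in> N \<Otimes>\<^sub>M lborel \<rightarrow>\<^sub>M borel \<Otimes>\<^sub>M borel"
  proof -
    have "(\<lambda>x. (snd x, (case (snd x, fst x) of (q, w) \<Rightarrow> Y q w))) \<in> N \<Otimes>\<^sub>M lborel \<rightarrow>\<^sub>M borel \<Otimes>\<^sub>M borel"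
      by (intro measurable_Pair measurable_compose[OF _ Y]) measurable
    then show ?thesis by (simp add: case_prod_beta)
  qed
  have "(\<lambda>w. LINT q|lborel. indicator {s<..r} q * (indicator T q * p q (Y q w))) \<in> borel_measurable N"
  proof (rule lborel.borel_measurable_lebesgue_integral)
    have "(\<lambda>x. indicator {s<..r} (snd x) * (case (case x of (w, q) \<Rightarrow> (q, Y q w)) of (t, z) \<Rightarrow> indicator T t * p t z))
      \<in> borel_measurable (N \<Otimes>\<^sub>M lborel)"
      by (intro borel_measurable_times measurable_compose[OF 1 measurable_p]) measurable
    then show "(\<lambda>(w, q). indicator {s<..r} q * (indicator T q * p q (Y q w))) \<in> borel_measurable (N \<Otimes>\<^sub>M lborel)"
      by (simp add: case_prod_beta)
  qed
  moreover have "(LBINT q:T \<inter> {s<..r}. p q (Z w q)) =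
      (LINT q|lborel. indicator {s<..r} q * (indicator T q * p q (Y q w)))" for w
    unfolding set_lebesgue_integral_def
  proof (intro Bochner_Integration.integral_cong refl)
    fix q
    have "max s (min r q) = q" if "q \<in> {s<..r}" using that by auto
    then show "indicator (T \<inter> {s<..r}) q *\<^sub>R p q (Z w q) = indicator {s<..r} q * (indicator T q * p q (Y q w))"
      by (cases "q \<in> {s<..r}"; cases "q \<in> T") (simp_all add: Y_def)
  qed
  ultimately have 2: "(\<lambda>w. (LBINT q:T \<inter> {s<..r}. p q (Z w q))) \<in> borel_measurable N"
    by simp
  have 3: "(\<lambda>w. \<Sum>c\<in>{c\<in>S. s < c \<and> c \<le> r}. \<theta> c (Z w c)) \<in> borel_measurable N"
    by (intro borel_measurable_sum measurable_compose[OF Z measurable_\<theta>]) auto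
  show ?thesis unfolding weight_def using 2 3 by measurable
qed

lemma lift_lift: "lift s y w q = lift r (lift s y w r) w q"
  by (simp add: lift_def algebra_simps)

lemma lift_same [simp]: "lift t y w t = y"
  by (simp add: lift_def)

lemma path_path: "path s y w = path r (lift s y w r) w"
  unfolding path_def using lift_lift by simp

lemma path_eq: "q \<in> {0..1} \<Longrightarrow> path t y w q = pr (lift t y w q)"
  by (simp add: path_def)

lemma path_pr_cong: "pr y = pr y' \<Longrightarrow> path t y w = path t y' w"
  unfolding path_def lift_def by (intro restrict_ext translate)

lemma continuous_on_lift:
  "w \<in> space M \<Longrightarrow> A \<subseteq> {0..1} \<Longrightarrow> continuous_on A (lift t y w)"
  unfolding lift_def by (intro continuous_intros) auto

lemma continuous_on_path:
  assumes "w \<in> space M" "A \<subseteq> {0..1}" shows "continuous_on A (path t y w)"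
proof -
  have "continuous_on A (\<lambda>r. pr (lift t y w r))" using assms by (intro continuous_on_pr continuous_on_lift)
  then show ?thesis
    by (rule continuous_on_cong[THEN iffD2, rotated 2]) (use assms in \<open>auto simp: path_def\<close>)
qed

lemma measurable_lift_past:
  assumes "t \<in> {0..r}" "q \<in> {0..r}" shows "(\<lambda>w. lift t y w q) \<in> borel_measurable (past_algebra r)"
  unfolding lift_def using measurable_past_B[OF assms(1)] measurable_past_B[OF assms(2)] by measurable

lemma measurable_lift_future:
  assumes "q \<in> {t..1}" shows "(\<lambda>(y, w). lift t y w q) \<in> borel_measurable (borel \<Otimes>\<^sub>M future_algebra t)"
  unfolding lift_def using measurable_future_increment[OF assms] by measurable

lemma measurable_path_past:
  assumes "t \<in> {0..r}" "q \<in> {0..r}" "r \<le> 1" shows "(\<lambda>w. path t y w q) \<in> past_algebra r \<rightarrow>\<^sub>M borel"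
proof -
  have "q \<in> {0..1}" using assms by auto
  show ?thesis
    unfolding path_eq[OF \<open>q \<in> {0..1}\<close>] by (rule measurable_compose[OF measurable_lift_past[OF assms(1,2)] measurable_pr])
qed

lemma measurable_path_future:
  assumes "0 \<le> t" "q \<in> {t..1}" shows "(\<lambda>(y, w). path t y w q) \<in> borel \<Otimes>\<^sub>M future_algebra t \<rightarrow>\<^sub>M borel"
proof -
  have q: "q \<in> {0..1}" using assms by auto
  have "(\<lambda>x. pr (case x of (y, w) \<Rightarrow> lift t y w q)) \<in> borel \<Otimes>\<^sub>M future_algebra t \<rightarrow>\<^sub>M borel"
    by (rule measurable_compose[OF measurable_lift_future[OF assms(2)] measurable_pr])
  then show ?thesis by (simp add: path_eq[OF q] case_prod_beta)
qed

lemma measurable_path: "t \<in> {0..1} \<Longrightarrow> path t y \<in> M \<rightarrow>\<^sub>M path_space"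
  unfolding path_space_def
proof (rule measurable_restrict_space2)
  assume t: "t \<in> {0..1}"
  show "path t y \<in> space M \<rightarrow> {w. continuous_on {0..1} w}" using continuous_on_path by auto
  have "(\<lambda>w. pr (lift t y w r)) \<in> M \<rightarrow>\<^sub>M borel" if "r \<in> {0..1}" for r
    using t that by (intro measurable_from_past[of 1] measurable_compose[OF measurable_lift_past measurable_pr]) auto
  then show "path t y \<in> M \<rightarrow>\<^sub>M PiM {0..1} (\<lambda>_. borel)"
    unfolding path_def[abs_def] by (intro measurable_restrict)
qed

text \<open>The law through a point is defined with the representative \<open>inv pr\<close>; paths
  from two lifts of the same point project to the same path, so any lift will do.\<close>

lemma brownian_law_through_eq: "brownian_law_through pr a M B t (pr y) = distr M path_space (path t y)"
proof -
  have "brownian_law_through pr a M B t (pr y) = distr M path_space (path t (inv pr (pr y)))"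
    unfolding brownian_law_through_def path_def[abs_def] lift_def ..
  also have "path t (inv pr (pr y)) = path t y" by (intro ext path_pr_cong[THEN fun_cong]) simp
  finally show ?thesis .
qed

text \<open>After \<open>t\<close>, a path placed at \<open>y\<close> at time \<open>t\<close>
  depends on the sample point only through increments from \<open>t\<close> on. This makes
  \<open>F x t\<close> a future factor that can be resampled.\<close>

lemma measurable_F_future:
  assumes t: "t \<in> {0..1}"
  shows "(\<lambda>(y, v). F x t (path t y v)) \<in> borel_measurable (borel \<Otimes>\<^sub>M future_algebra t)"
proof -
  let ?N = "borel \<Otimes>\<^sub>M future_algebra t"
  have Z: "(\<lambda>z. path t (fst z) (snd z) q) \<in> ?N \<rightarrow>\<^sub>M borel" if "q \<in> {t..1}" for q
    using measurable_path_future[of t q] that t by (simp add: case_prod_beta)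
  have w: "(\<lambda>z. weight t 1 (path t (fst z) (snd z))) \<in> borel_measurable ?N"
    using t by (intro measurable_weight Z continuous_on_path) (auto simp: space_pair_measure)
  have "(\<lambda>y. \<eta> x y) \<in> borel_measurable borel" using measurable_Pair2[OF measurable_\<eta>, of x] by simp
  then have "(\<lambda>z. \<eta> x (path t (fst z) (snd z) 1)) \<in> borel_measurable ?N"
    using t by (intro measurable_compose[OF Z]) auto
  with w show ?thesis unfolding F_weight case_prod_beta by measurable
qed

lemma measurable_F_M [measurable]:
  assumes t: "t \<in> {0..1}" shows "(\<lambda>w. F x t (path t y w)) \<in> borel_measurable M"
proof -
  have "(\<lambda>w. F x t (path t y w)) \<in> borel_measurable (future_algebra t)"
    using measurable_Pair2[OF measurable_F_future[OF t], of y] by simp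
  then show ?thesis using t by (intro measurable_from_future) auto
qed

lemma integrable_F:
  assumes t: "t \<in> {0..1}" shows "integrable M (\<lambda>w. F x t (path t y w))"
proof -
  have "integrable (distr M path_space (path t y)) (F x t)"
    using well_defined[OF t, of "pr y" x] by (simp add: brownian_law_through_eq)
  from integrable_distr[OF measurable_path[OF t] this] show ?thesis .
qed

lemma AE_set_integrable_p:
  assumes t: "t \<in> {0..1}"
  shows "AE w in M. set_integrable lborel (T \<inter> {t<..1}) (\<lambda>r. p r (path t y w r))"
proof -
  have "AE w in distr M path_space (path t y). set_integrable lborel (T \<inter> {t<..1}) (\<lambda>r. p r (w r))"
    using conjunct1[OF well_defined[OF t, of "pr y"]] unfolding brownian_law_through_eq .
  from AE_distrD[OF measurable_path[OF t] this] show ?thesis .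
qed

lemma value_fun_pos: assumes t: "t \<in> {0..1}" shows "0 < value_fun x t y"
proof -
  have "0 \<le> value_fun x t y" unfolding value_fun_def by (intro Bochner_Integration.integral_nonneg less_imp_le F_pos)
  moreover have "value_fun x t y \<noteq> 0"
  proof
    assume "value_fun x t y = 0"
    then have "AE w in M. F x t (path t y w) = 0"
      unfolding value_fun_def using integrable_F[OF t]
      by (subst (asm) integral_nonneg_eq_0_iff_AE) (auto intro: less_imp_le F_pos)
    then have "AE w in M. False" by eventually_elim (use F_pos in \<open>simp add: less_imp_neq[symmetric]\<close>)
    then show False by simp
  qed
  ultimately show ?thesis by simp
qed

lemma value_fun_nn_integral:
  assumes t: "t \<in> {0..1}" shows "(\<integral>\<^sup>+w. ennreal (F x t (path t y w)) \<partial>M) = ennreal (value_fun x t y)"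
  unfolding value_fun_def using integrable_F[OF t] by (intro nn_integral_eq_integral) (auto intro: less_imp_le F_pos)

lemma measurable_value_fun [measurable]:
  assumes t: "t \<in> {0..1}" shows "value_fun x t \<in> borel_measurable borel"
proof -
  have "(\<lambda>(y, w). F x t (path t y w)) \<in> borel_measurable (borel \<Otimes>\<^sub>M M)"
  proof -
    have "(\<lambda>x. x) \<in> borel \<Otimes>\<^sub>M M \<rightarrow>\<^sub>M borel \<Otimes>\<^sub>M future_algebra t"
    proof -
      have "(\<lambda>x. (fst x, snd x)) \<in> borel \<Otimes>\<^sub>M M \<rightarrow>\<^sub>M borel \<Otimes>\<^sub>M future_algebra t"
        using measurable_from_future[OF _ measurable_ident_sets[OF refl], of t] t
        by (intro measurable_Pair measurable_compose[OF measurable_snd]) auto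
      then show ?thesis by simp
    qed
    from measurable_compose[OF this measurable_F_future[OF t]] show ?thesis .
  qed
  then show ?thesis unfolding value_fun_def[abs_def] by (rule borel_measurable_lebesgue_integral)
qed

lemma measurable_weight_past:
  assumes "s \<in> {0..r}" "s \<le> r'" "r' \<le> r" "r \<le> 1"
  shows "(\<lambda>w. weight s r' (path s y w)) \<in> borel_measurable (past_algebra r)"
  using assms by (intro measurable_weight measurable_path_past continuous_on_path) auto

text \<open>Only almost sure, because splitting the integral of \<open>p\<close> requires it to
  exist along the path.\<close>

lemma AE_F_split:
  assumes sr: "0 \<le> s" "s \<le> r" "r \<le> 1"
  shows "AE w in M. F x s (path s y w) = weight s r (path s y w) * F x r (path r (lift s y w r) w)"
proof -
  have "AE w in M. set_integrable lborel (T \<inter> {s<..1}) (\<lambda>q. p q (path s y w q))"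
    using sr by (intro AE_set_integrable_p) auto
  then show ?thesis
  proof eventually_elim
    fix w assume *: "set_integrable lborel (T \<inter> {s<..1}) (\<lambda>q. p q (path s y w q))"
    show "F x s (path s y w) = weight s r (path s y w) * F x r (path r (lift s y w r) w)"
      unfolding path_path[of s y w r, symmetric] F_weight weight_split[OF sr(2,3) *] by simp
  qed
qed

lemma measurable_past_future:
  assumes r: "r \<in> {0..1}" and Y: "Y \<in> past_algebra r \<rightarrow>\<^sub>M borel"
    and f: "(\<lambda>(y, w). f y w) \<in> borel_measurable (borel \<Otimes>\<^sub>M future_algebra r)"
  shows "(\<lambda>(w, w'). f (Y w) w') \<in> borel_measurable (past_algebra r \<Otimes>\<^sub>M future_algebra r)"
proof -
  have "(\<lambda>x. (Y (fst x), snd x)) \<in> past_algebra r \<Otimes>\<^sub>M future_algebra r \<rightarrow>\<^sub>M borel \<Otimes>\<^sub>M future_algebra r"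
    by (intro measurable_Pair measurable_compose[OF measurable_fst Y] measurable_snd)
  from measurable_compose[OF this f] show ?thesis by (simp add: case_prod_beta)
qed

text \<open>The weight up to \<open>r\<close> is known at \<open>r\<close>; what remains is a
  function of the position at \<open>r\<close> and of future increments, and averaging it over a
  resampled future gives the value function.\<close>

lemma markov_nn_integral:
  assumes sr: "0 \<le> s" "s \<le> r" "r \<le> 1" and G: "G \<in> borel_measurable (past_algebra r)"
  shows "(\<integral>\<^sup>+v. G v * ennreal (F x s (path s y v)) \<partial>M) =
    (\<integral>\<^sup>+v. G v * ennreal (weight s r (path s y v) * value_fun x r (lift s y v r)) \<partial>M)"
proof -
  have r: "r \<in> {0..1}" using sr by auto
  have L: "(\<lambda>v. lift s y v r) \<in> past_algebra r \<rightarrow>\<^sub>M borel" using sr by (intro measurable_lift_past) auto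
  have w: "(\<lambda>v. weight s r (path s y v)) \<in> borel_measurable (past_algebra r)"
    using sr by (intro measurable_weight_past) auto
  define h where "h = (\<lambda>x'. (G (fst x') * ennreal (weight s r (path s y (fst x')))) *
    ennreal (case x' of (v, v') \<Rightarrow> F x r (path r (lift s y v r) v')))"
  have h: "h \<in> borel_measurable (past_algebra r \<Otimes>\<^sub>M future_algebra r)"
    unfolding h_def using G w measurable_past_future[OF r L measurable_F_future[OF r, of x]] by measurable
  have "(\<integral>\<^sup>+v. G v * ennreal (F x s (path s y v)) \<partial>M) = (\<integral>\<^sup>+v. h (v, v) \<partial>M)"
    using AE_F_split[OF sr, of x y]
    by (intro nn_integral_cong_AE)
      (auto simp: h_def ennreal_mult less_imp_le[OF weight_pos] less_imp_le[OF F_pos] mult.assoc elim!: eventually_mono)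
  also have "\<dots> = (\<integral>\<^sup>+v. \<integral>\<^sup>+v'. h (v, v') \<partial>M \<partial>M)" by (rule resample_nn_integral[OF r h])
  also have "\<dots> = (\<integral>\<^sup>+v. G v * ennreal (weight s r (path s y v) * value_fun x r (lift s y v r)) \<partial>M)"
  proof (rule nn_integral_cong)
    fix v
    have "(\<integral>\<^sup>+v'. h (v, v') \<partial>M) = G v * ennreal (weight s r (path s y v)) * ennreal (value_fun x r (lift s y v r))"
      unfolding h_def fst_conv split using r
      by (subst nn_integral_cmult) (auto simp: value_fun_nn_integral)
    then show "(\<integral>\<^sup>+v'. h (v, v') \<partial>M) = G v * ennreal (weight s r (path s y v) * value_fun x r (lift s y v r))"
      by (simp add: ennreal_mult less_imp_le[OF weight_pos] less_imp_le[OF value_fun_pos[OF r]] mult.assoc)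
  qed
  finally show ?thesis .
qed

text \<open>The extra factor \<open>\<Theta>\<close> may depend on the position at \<open>r\<close>
  and on future increments; it will be the drift increment over the next grid step, restricted to
  paths that stay close. The integral of \<open>\<Theta>\<close> against the weight is then a
  function \<open>g\<close> of the position alone.\<close>

lemma markov_integral_product:
  fixes G :: "'w \<Rightarrow> real" and \<Theta> :: "real^'n \<Rightarrow> 'w \<Rightarrow> real"
  assumes sr: "0 \<le> s" "s \<le> r" "r \<le> 1" and G: "G \<in> borel_measurable (past_algebra r)"
    and \<Theta>: "(\<lambda>(y, v). \<Theta> y v) \<in> borel_measurable (borel \<Otimes>\<^sub>M future_algebra r)"
    and int: "integrable M (\<lambda>v. G v * \<Theta> (lift s y v r) v * F x s (path s y v))"
  defines "g \<equiv> \<lambda>z. \<integral>v. \<Theta> z v * F x r (path r z v) \<partial>M"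
  shows "(\<integral>v. G v * \<Theta> (lift s y v r) v * F x s (path s y v) \<partial>M) =
      (\<integral>v. G v * weight s r (path s y v) * g (lift s y v r) \<partial>M)"
    and "integrable M (\<lambda>v. G v * weight s r (path s y v) * g (lift s y v r))"
proof -
  have r: "r \<in> {0..1}" using sr by auto
  have s: "s \<in> {0..1}" using sr by auto
  have L: "(\<lambda>v. lift s y v r) \<in> past_algebra r \<rightarrow>\<^sub>M borel" using sr by (intro measurable_lift_past) auto
  have w: "(\<lambda>v. weight s r (path s y v)) \<in> borel_measurable (past_algebra r)"
    using sr by (intro measurable_weight_past) auto
  define h where "h = (\<lambda>x'. (G (fst x') * weight s r (path s y (fst x'))) *
    ((case x' of (v, v') \<Rightarrow> \<Theta> (lift s y v r) v') * (case x' of (v, v') \<Rightarrow> F x r (path r (lift s y v r) v'))))"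
  have h: "h \<in> borel_measurable (past_algebra r \<Otimes>\<^sub>M future_algebra r)"
    unfolding h_def using G w measurable_past_future[OF r L measurable_F_future[OF r, of x]]
      measurable_past_future[OF r L \<Theta>] by measurable
  have hd: "(\<lambda>v. h (v, v)) \<in> borel_measurable M" by (rule measurable_compose[OF measurable_diagonal[OF r] h])
  have ae: "AE v in M. G v * \<Theta> (lift s y v r) v * F x s (path s y v) = h (v, v)"
    using AE_F_split[OF sr, of x y] by eventually_elim (simp add: h_def)
  have ih: "integrable M (\<lambda>v. h (v, v))" by (rule Bochner_Integration.integrable_cong_AE_imp[OF int hd ae])
  have eq: "(\<integral>v'. h (v, v') \<partial>M) = G v * weight s r (path s y v) * g (lift s y v r)" for v
    unfolding h_def g_def fst_conv split by simp
  have "(\<integral>v. G v * \<Theta> (lift s y v r) v * F x s (path s y v) \<partial>M) = (\<integral>v. h (v, v) \<partial>M)"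
    by (rule integral_cong_AE[OF borel_measurable_integrable[OF int] hd ae])
  also have "\<dots> = (\<integral>v. G v * weight s r (path s y v) * g (lift s y v r) \<partial>M)"
    using resample_integral(1)[OF r h ih] unfolding eq .
  finally show "(\<integral>v. G v * \<Theta> (lift s y v r) v * F x s (path s y v) \<partial>M) =
      (\<integral>v. G v * weight s r (path s y v) * g (lift s y v r) \<partial>M)" .
  show "integrable M (\<lambda>v. G v * weight s r (path s y v) * g (lift s y v r))"
    using resample_integral(2)[OF r h ih] unfolding eq .
qed

lemma markov_integral:
  fixes G :: "'w \<Rightarrow> real"
  assumes sr: "0 \<le> s" "s \<le> r" "r \<le> 1" and G: "G \<in> borel_measurable (past_algebra r)"
    and int: "integrable M (\<lambda>w. G w * F x s (path s y w))"
  shows "(\<integral>w. G w * F x s (path s y w) \<partial>M) =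
      (\<integral>w. G w * (weight s r (path s y w) * value_fun x r (lift s y w r)) \<partial>M)"
    and "integrable M (\<lambda>w. G w * (weight s r (path s y w) * value_fun x r (lift s y w r)))"
  using markov_integral_product[OF sr G, of "\<lambda>_ _. 1" y x] int by (simp_all add: value_fun_def mult.assoc)

lemma value_fun_markov:
  assumes sr: "0 \<le> s" "s \<le> r" "r \<le> 1"
  shows "ennreal (value_fun x s y) = (\<integral>\<^sup>+w. ennreal (weight s r (path s y w) * value_fun x r (lift s y w r)) \<partial>M)"
  using markov_nn_integral[OF sr, of "\<lambda>_. 1" x y] value_fun_nn_integral[of s x y] sr by simp

end

section \<open>The Hamilton-Jacobi equation between jump times\<close>

lemma abs_exp_remainder:
  fixes x :: real assumes "\<bar>x\<bar> \<le> 1" shows "\<bar>exp x - 1 - x - x\<^sup>2 / 2\<bar> \<le> \<bar>x\<bar> ^ 3"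
proof -
  obtain t where t: "\<bar>t\<bar> \<le> \<bar>x\<bar>" "exp x = (\<Sum>m<3. x ^ m / fact m) + exp t / fact 3 * x ^ 3"
    using Maclaurin_exp_le[of x 3] by blast
  have "exp t \<le> 3" using t assms exp_le by (intro order_trans[OF _ exp_le]) auto
  moreover have "exp x - 1 - x - x\<^sup>2 / 2 = exp t / 6 * x ^ 3"
    using t(2) by (simp add: eval_nat_numeral fact_numeral)
  ultimately have "\<bar>exp x - 1 - x - x\<^sup>2 / 2\<bar> \<le> 1 * \<bar>x\<bar> ^ 3"
    by (simp only: abs_mult power_abs) (intro mult_right_mono, auto)
  then show ?thesis by simp
qed

text \<open>In the exponent, \<open>g\<close> has the size of the square root of \<open>d\<close>,
  \<open>A\<close> the size of \<open>d\<close>, and \<open>R\<close> is negligible, so only the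
  square of \<open>g\<close> survives at second order. The condition
  \<open>5 * h * r \<le> 1\<close> keeps the exponent in [-1, 1] for the cubic remainder. The
  constant is 27 = 20 (cubic term) + 1 (\<open>R\<close>) + 6 (cross terms of the square).\<close>

lemma exp_second_order:
  fixes g A R k r d h :: real
  assumes "g\<^sup>2 \<le> h * d" "\<bar>g\<bar> \<le> h * r" "\<bar>A\<bar> \<le> h * d" "\<bar>R\<bar> \<le> k * d" "d \<le> 2 * r" "0 \<le> d"
    and "r \<le> k" "k \<le> 1" "1 \<le> h" "5 * h * r \<le> 1"
  shows "\<bar>exp (g + A + R) - (1 + g + A + g\<^sup>2 / 2)\<bar> \<le> 27 * h\<^sup>2 * k * d"
proof -
  define s where "s = A + R"
  define l where "l = g + s"
  have r0: "0 \<le> r" using assms(5,6) by linarith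
  have "k * d \<le> h * d" using assms by (intro mult_right_mono) auto
  then have s: "\<bar>s\<bar> \<le> 2 * (h * d)" using assms(3,4) unfolding s_def by linarith
  have kd: "h * d \<le> 2 * (h * r)" using mult_left_mono[OF assms(5), of h] assms(9) by (simp add: mult_ac)
  have l: "\<bar>l\<bar> \<le> 5 * (h * r)" using s kd assms(2) unfolding l_def by linarith
  then have l1: "\<bar>l\<bar> \<le> 1" using assms(10) by (simp add: mult.assoc)
  have "\<bar>l\<^sup>2 - g\<^sup>2\<bar> = \<bar>s\<bar> * \<bar>2 * g + s\<bar>"
    unfolding abs_mult[symmetric] l_def by (simp add: power2_eq_square algebra_simps)
  also have "\<dots> \<le> (2 * (h * d)) * (6 * (h * r))"
    using s kd assms(2) by (intro mult_mono) auto
  finally have lg: "\<bar>l\<^sup>2 - g\<^sup>2\<bar> \<le> 12 * (h\<^sup>2 * r * d)" by (simp add: power2_eq_square mult_ac)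
  have kk: "12 * (h\<^sup>2 * r * d) \<le> 3 * (h * d)"
  proof -
    have "(h * d) * (5 * h * r) \<le> (h * d) * 1" using assms by (intro mult_left_mono) auto
    then have "5 * (h\<^sup>2 * r * d) \<le> h * d" by (simp add: power2_eq_square mult_ac)
    moreover have "0 \<le> h * d" using assms by auto
    ultimately show ?thesis by linarith
  qed
  have l2: "l\<^sup>2 \<le> 4 * (h * d)" using lg kk assms(1) by linarith
  have "\<bar>l\<bar> ^ 3 = \<bar>l\<bar> * l\<^sup>2" by (simp add: power3_eq_cube power2_eq_square)
  also have "\<dots> \<le> (5 * (h * r)) * (4 * (h * d))" using l l2 by (intro mult_mono) auto
  finally have l3: "\<bar>l\<bar> ^ 3 \<le> 20 * (h\<^sup>2 * r * d)" by (simp add: power2_eq_square mult_ac)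
  have half: "u / 2 \<le> 6 * v" if "u \<le> 12 * v" for u v :: real
    using that by simp
  have tri: "\<bar>u\<bar> \<le> \<bar>v\<bar> + \<bar>w\<bar> + \<bar>z\<bar> / 2" if "u = v + w + z / 2" for u v w z :: real
    using that by linarith
  have "l = g + A + R" by (simp add: l_def s_def)
  then have "exp (g + A + R) - (1 + g + A + g\<^sup>2 / 2) = (exp l - 1 - l - l\<^sup>2 / 2) + R + (l\<^sup>2 - g\<^sup>2) / 2"
    by (simp only:) (simp add: diff_divide_distrib)
  then have "\<bar>exp (g + A + R) - (1 + g + A + g\<^sup>2 / 2)\<bar> \<le> \<bar>exp l - 1 - l - l\<^sup>2 / 2\<bar> + \<bar>R\<bar> + \<bar>l\<^sup>2 - g\<^sup>2\<bar> / 2"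
    by (rule tri)
  also have "\<dots> \<le> 20 * (h\<^sup>2 * r * d) + k * d + 6 * (h\<^sup>2 * r * d)"
  proof (intro add_mono assms(4))
    show "\<bar>exp l - 1 - l - l\<^sup>2 / 2\<bar> \<le> 20 * (h\<^sup>2 * r * d)"
      by (rule order_trans[OF abs_exp_remainder[OF l1] l3])
    show "\<bar>l\<^sup>2 - g\<^sup>2\<bar> / 2 \<le> 6 * (h\<^sup>2 * r * d)" by (rule half[OF lg])
  qed
  also have "\<dots> \<le> 20 * (h\<^sup>2 * k * d) + h\<^sup>2 * k * d + 6 * (h\<^sup>2 * k * d)"
  proof (intro add_mono mult_left_mono)
    show "h\<^sup>2 * r * d \<le> h\<^sup>2 * k * d" using assms by (intro mult_right_mono mult_left_mono) auto
    then show "h\<^sup>2 * r * d \<le> h\<^sup>2 * k * d" .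
    have "1 \<le> h\<^sup>2" using assms(9) by (simp add: one_le_power)
    then have "1 * (k * d) \<le> h\<^sup>2 * (k * d)" using assms r0 by (intro mult_right_mono) auto
    then show "k * d \<le> h\<^sup>2 * k * d" by (simp add: mult.assoc)
  qed auto
  finally show ?thesis by (simp add: mult_ac)
qed

lemma matrix_quadratic_form:
  fixes A :: "real^'n^'n" shows "k \<bullet> (A *v h) = (\<Sum>i\<in>UNIV. \<Sum>j\<in>UNIV. A $ i $ j * (k $ i * h $ j))"
  by (simp add: inner_vec_def matrix_vector_mult_def sum_distrib_left mult_ac)

lemma matrix_entry_le: "\<bar>(A :: real^'n^'m) $ i $ j\<bar> \<le> norm A"
proof -
  have "norm (A $ i) \<le> L2_set (\<lambda>i. norm (A $ i)) UNIV" by (rule member_le_L2_set) auto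
  then have "norm (A $ i) \<le> norm A" by (simp only: norm_vec_def[of A])
  then show ?thesis using component_le_norm_cart[of "A $ i" j] by linarith
qed

lemma abs_matrix_quadratic_form_le:
  fixes A :: "real^'n^'n" shows "\<bar>k \<bullet> (A *v h)\<bar> \<le> (real CARD('n))\<^sup>2 * norm A * (norm k * norm h)"
proof -
  have "\<bar>k \<bullet> (A *v h)\<bar> \<le> (\<Sum>i\<in>(UNIV::'n set). \<Sum>j\<in>(UNIV::'n set). norm A * (norm k * norm h))"
    unfolding matrix_quadratic_form
    by (rule order_trans[OF sum_abs sum_mono], rule order_trans[OF sum_abs sum_mono])
      (auto simp: abs_mult intro!: mult_mono matrix_entry_le component_le_norm_cart)
  then show ?thesis by (simp add: power2_eq_square mult_ac)
qed

text \<open>Here \<open>f\<close> is a continuous version of the integrand, which has to agree with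
  it only inside the interval, since the two ends are null. This absorbs half-open intervals and
  membership of the ends in \<open>T\<close>.\<close>

lemma set_integral_near_const:
  fixes f g :: "real \<Rightarrow> real"
  assumes f: "continuous_on {c..d} f" "c \<le> d"
    and g: "A \<subseteq> {c..d}" "\<And>q. q \<in> {c<..<d} \<Longrightarrow> indicator A q * g q = f q"
  shows "set_integrable lborel A g"
    and "(\<And>q. q \<in> {c..d} \<Longrightarrow> \<bar>f q - m\<bar> \<le> k) \<Longrightarrow> \<bar>(LBINT q:A. g q) - m * (d - c)\<bar> \<le> k * (d - c)"
proof -
  have int: "set_integrable lborel {c..d} f"
    using borel_integrable_compact[OF compact_Icc f(1)] unfolding set_integrable_def by simp
  have eq: "indicator A q *\<^sub>R g q = indicator {c..d} q *\<^sub>R f q" if "q \<notin> {c, d}" for q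
    using g(1) g(2)[of q] that by (cases "q \<in> {c..d}") (auto simp: indicator_def)
  note diff = integrable_discrete_difference[of "{c, d}" lborel "\<lambda>q. indicator A q *\<^sub>R g q" "\<lambda>q. indicator {c..d} q *\<^sub>R f q"]
    integral_discrete_difference[of "{c, d}" lborel "\<lambda>q. indicator A q *\<^sub>R g q" "\<lambda>q. indicator {c..d} q *\<^sub>R f q"]
  show "set_integrable lborel A g"
    using int eq diff(1) unfolding set_integrable_def by auto
  assume b: "\<And>q. q \<in> {c..d} \<Longrightarrow> \<bar>f q - m\<bar> \<le> k"
  have "(LBINT q:A. g q) = (LBINT q:{c..d}. f q)"
    using eq diff(2) unfolding set_lebesgue_integral_def by auto
  moreover have const: "set_integrable lborel {c..d} (\<lambda>_. v)" "(LBINT _:{c..d}. v) = v * (d - c)" for v :: real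
    using f(2) unfolding set_integrable_def set_lebesgue_integral_def by simp_all
  have fb: "m - k \<le> f q" "f q \<le> m + k" if "q \<in> {c..d}" for q using b[OF that] by (auto simp: abs_le_iff)
  moreover have "(LBINT q:{c..d}. f q) \<le> (LBINT _:{c..d}. m + k)" "(LBINT _:{c..d}. m - k) \<le> (LBINT q:{c..d}. f q)"
    by (auto intro!: set_integral_mono int const(1) fb)
  ultimately show "\<bar>(LBINT q:A. g q) - m * (d - c)\<bar> \<le> k * (d - c)"
    unfolding const(2) by (simp add: algebra_simps abs_le_iff)
qed

text \<open>The interval between consecutive times of \<open>D\<close>: no jump inside, and
  \<open>T\<close> covers all or nothing of it. \<open>Tm\<close>, \<open>G\<close> and
  \<open>H\<close> are the time derivative, gradient and Hessian of the lifted \<psi>; at the ends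
  only their continuity is known.\<close>

locale strip = bredinger +
  fixes x :: 'b and e e' :: real and Tm :: "real \<Rightarrow> real^'a \<Rightarrow> real" and G :: "real \<Rightarrow> real^'a \<Rightarrow> real^'a"
    and H :: "real \<Rightarrow> real^'a \<Rightarrow> real^'a^'a"
  assumes e: "0 \<le> e" "e < e'" "e' \<le> 1" and S_strip: "S \<inter> {e<..<e'} = {}"
    and T_strip: "T \<inter> {e<..<e'} = {} \<or> {e<..<e'} \<subseteq> T"
    and continuous_Tm: "continuous_on ({e..e'} \<times> UNIV) (\<lambda>(r, y). Tm r y)"
    and continuous_G: "continuous_on ({e..e'} \<times> UNIV) (\<lambda>(r, y). G r y)"
    and continuous_H: "continuous_on ({e..e'} \<times> UNIV) (\<lambda>(r, y). H r y)"
    and deriv_Tm: "\<And>r y. r \<in> {e<..<e'} \<Longrightarrow> ((\<lambda>r. ln (value_fun x r y)) has_real_derivative Tm r y) (at r)"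
    and deriv_G: "\<And>r y. r \<in> {e<..<e'} \<Longrightarrow> GDERIV (\<lambda>y. ln (value_fun x r y)) y :> G r y"
    and deriv_H: "\<And>r y. r \<in> {e<..<e'} \<Longrightarrow> (G r has_derivative (\<lambda>h. H r y *v h)) (at y)"
begin

definition log_value :: "real \<Rightarrow> real^'a \<Rightarrow> real" where
  "log_value r y = ln (value_fun x r y)"

definition potential :: "real \<Rightarrow> real^'a \<Rightarrow> real" where
  "potential r y = indicator T r * p r (pr y)"

lemma exp_log_value: "r \<in> {0..1} \<Longrightarrow> exp (log_value r y) = value_fun x r y"
  unfolding log_value_def by (simp add: value_fun_pos)

lemma strip_subset: "r \<in> {e<..<e'} \<Longrightarrow> r \<in> {0..1}" "r \<in> {e<..<e'} \<Longrightarrow> r \<in> {e..e'}"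
  using e by auto

lemma mvt_time:
  assumes "r \<in> {e<..<e'}" "r' \<in> {e<..<e'}" "r \<le> r'"
  shows "\<exists>z\<in>{r..r'}. log_value r' y - log_value r y = (r' - r) * Tm z y"
proof (cases "r = r'")
  case False
  then have "\<exists>z. r < z \<and> z < r' \<and> log_value r' y - log_value r y = (r' - r) * Tm z y"
    unfolding log_value_def using assms by (intro MVT2 deriv_Tm) auto
  then show ?thesis by force
qed auto

lemma deriv_segment:
  assumes r: "r \<in> {e<..<e'}"
  shows "((\<lambda>s. log_value r (y + s *\<^sub>R w)) has_real_derivative w \<bullet> G r (y + s *\<^sub>R w)) (at s)"
    and "((\<lambda>s. w \<bullet> G r (y + s *\<^sub>R w)) has_real_derivative w \<bullet> (H r (y + s *\<^sub>R w) *v w)) (at s)"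
proof -
  have l: "((\<lambda>s. y + s *\<^sub>R w) has_derivative (\<lambda>h. h *\<^sub>R w)) (at s)"
    by (auto intro!: derivative_eq_intros)
  have "((\<lambda>s. log_value r (y + s *\<^sub>R w)) has_derivative (\<lambda>h. (h *\<^sub>R w) \<bullet> G r (y + s *\<^sub>R w))) (at s)"
    using has_derivative_compose[OF l, of "log_value r"] deriv_G[OF r, of "y + s *\<^sub>R w"]
    unfolding gderiv_def log_value_def by fastforce
  then show "((\<lambda>s. log_value r (y + s *\<^sub>R w)) has_real_derivative w \<bullet> G r (y + s *\<^sub>R w)) (at s)"
    unfolding has_field_derivative_def by (simp add: mult_commute_abs)
  have "((\<lambda>s. w \<bullet> G r (y + s *\<^sub>R w)) has_derivative (\<lambda>h. w \<bullet> (H r (y + s *\<^sub>R w) *v (h *\<^sub>R w)))) (at s)"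
    by (intro has_derivative_inner_right has_derivative_compose[OF l deriv_H[OF r]])
  then show "((\<lambda>s. w \<bullet> G r (y + s *\<^sub>R w)) has_real_derivative w \<bullet> (H r (y + s *\<^sub>R w) *v w)) (at s)"
    unfolding has_field_derivative_def by (simp add: matrix_vector_mult_scaleR mult_commute_abs)
qed

lemma mvt_space:
  assumes r: "r \<in> {e<..<e'}"
  shows "\<exists>s\<in>{0..1}. log_value r (y + w) - log_value r y = w \<bullet> G r (y + s *\<^sub>R w)"
proof -
  have "\<exists>s>0. s < 1 \<and> log_value r (y + 1 *\<^sub>R w) - log_value r (y + 0 *\<^sub>R w) = (1 - 0) * (w \<bullet> G r (y + s *\<^sub>R w))"
    by (rule MVT2) (auto intro!: deriv_segment(1)[OF r])
  then show ?thesis by force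
qed

lemma taylor_space:
  assumes r: "r \<in> {e<..<e'}"
  shows "\<exists>s\<in>{0..1}. log_value r (y + w) - log_value r y = w \<bullet> G r y + (w \<bullet> (H r (y + s *\<^sub>R w) *v w)) / 2"
proof -
  define df where "df m s = (if m = 0 then log_value r (y + s *\<^sub>R w) else if m = 1 then w \<bullet> G r (y + s *\<^sub>R w)
      else w \<bullet> (H r (y + s *\<^sub>R w) *v w))" for m :: nat and s :: real
  have "\<exists>s. 0 < s \<and> s \<le> 1 \<and> log_value r (y + 1 *\<^sub>R w) = (\<Sum>m<2. df m 0 / fact m * 1 ^ m) + df 2 s / fact 2 * 1 ^ 2"
  proof (rule Maclaurin2[where f = "\<lambda>s. log_value r (y + s *\<^sub>R w)"])
    show "\<forall>m s. m < 2 \<and> 0 \<le> s \<and> s \<le> 1 \<longrightarrow> (df m has_real_derivative df (Suc m) s) (at s)"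
    proof (intro allI impI)
      fix m :: nat and s :: real assume "m < 2 \<and> 0 \<le> s \<and> s \<le> 1"
      then have "m = 0 \<or> m = 1" by auto
      then show "(df m has_real_derivative df (Suc m) s) (at s)"
        using deriv_segment(1)[OF r, of y w s] deriv_segment(2)[OF r, of w y s] by (auto simp: df_def[abs_def])
    qed
  qed (auto simp: df_def)
  then obtain s where "0 < s" "s \<le> 1"
    "log_value r (y + w) = (\<Sum>m<2. df m 0 / fact m * 1 ^ m) + df 2 s / fact 2 * 1 ^ 2" by auto
  then show ?thesis by (intro bexI[of _ s]) (auto simp: df_def eval_nat_numeral)
qed

lemma continuous_potential: "continuous_on ({e<..<e'} \<times> UNIV) (\<lambda>(r, y). potential r y)"
  using T_strip
proof
  assume T: "T \<inter> {e<..<e'} = {}"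
  have "continuous_on ({e<..<e'} \<times> UNIV) (\<lambda>_. 0 :: real)" by simp
  then show ?thesis
    by (rule continuous_on_cong[THEN iffD1, rotated 2]) (use T in \<open>auto simp: potential_def indicator_def\<close>)
next
  assume T: "{e<..<e'} \<subseteq> T"
  have "continuous_on ({e<..<e'} \<times> UNIV) (\<lambda>ry. case (fst ry, pr (snd ry)) of (t, z) \<Rightarrow> p t z)"
    by (rule continuous_on_compose2[OF continuous_p]) (use T in \<open>auto intro!: continuous_intros\<close>)
  then show ?thesis
    by (rule continuous_on_cong[THEN iffD1, rotated 2]) (use T in \<open>auto simp: potential_def indicator_def\<close>)
qed

lemma ln_weight:
  assumes w: "continuous_on {t..r} w" "\<And>c. c \<in> {t..r} \<Longrightarrow> \<xi> c = pr (w c)"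
    and tr: "t \<in> {e<..<e'}" "r \<in> {e<..<e'}" "t \<le> r"
    and q: "\<And>c. c \<in> {t..r} \<Longrightarrow> \<bar>potential c (w c) - q0\<bar> \<le> k"
  shows "\<bar>ln (weight t r \<xi>) - q0 * (r - t)\<bar> \<le> k * (r - t)"
proof -
  have sub: "{t..r} \<subseteq> {e<..<e'}" using tr by auto
  have S: "{c\<in>S. t < c \<and> c \<le> r} = {}" using S_strip tr by auto
  have "continuous_on {t..r} (\<lambda>c. case (c, w c) of (r, y) \<Rightarrow> potential r y)"
    by (rule continuous_on_compose2[OF continuous_potential]) (use sub in \<open>auto intro!: continuous_intros w(1)\<close>)
  then have "\<bar>(LBINT c:T \<inter> {t<..r}. p c (\<xi> c)) - q0 * (r - t)\<bar> \<le> k * (r - t)"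
    by (intro set_integral_near_const(2)[where f = "\<lambda>c. potential c (w c)"])
      (use tr(3) q w(2) in \<open>auto simp: potential_def indicator_inter_arith\<close>)
  then show ?thesis unfolding weight_def S by simp
qed

lemma bounded_on_box:
  fixes f :: "real \<Rightarrow> real^'a \<Rightarrow> 'z::real_normed_vector"
  assumes "continuous_on (A \<times> UNIV) (\<lambda>(r, y). f r y)" "compact C" "C \<subseteq> A"
  obtains K where "1 \<le> K" "\<And>r y. r \<in> C \<Longrightarrow> y \<in> cball y0 R \<Longrightarrow> norm (f r y) \<le> K"
proof -
  have "compact ((\<lambda>(r, y). f r y) ` (C \<times> cball y0 R))"
    by (intro compact_continuous_image continuous_on_subset[OF assms(1)] compact_Times assms(2))
      (use assms(3) in auto)
  then have "bounded ((\<lambda>(r, y). f r y) ` (C \<times> cball y0 R))" by (rule compact_imp_bounded)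
  then obtain K where K: "\<And>z. z \<in> (\<lambda>(r, y). f r y) ` (C \<times> cball y0 R) \<Longrightarrow> norm z \<le> K"
    unfolding bounded_iff by blast
  show thesis
  proof (rule that[of "max 1 K"])
    fix r y assume "r \<in> C" "y \<in> cball y0 R"
    then have "f r y \<in> (\<lambda>(r, y). f r y) ` (C \<times> cball y0 R)" by (intro image_eqI[of _ _ "(r, y)"]) auto
    from K[OF this] show "norm (f r y) \<le> max 1 K" by simp
  qed simp
qed

lemma near_box:
  fixes f :: "real \<Rightarrow> real^'a \<Rightarrow> 'z::real_normed_vector"
  assumes "continuous_on (A \<times> UNIV) (\<lambda>(r, y). f r y)" "compact C" "C \<subseteq> A" "0 < h"
  obtains k where "0 < k" "\<And>r r' y y'. r \<in> C \<Longrightarrow> r' \<in> C \<Longrightarrow> y \<in> cball y0 R \<Longrightarrow> y' \<in> cball y0 R \<Longrightarrow>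
    \<bar>r' - r\<bar> \<le> k \<Longrightarrow> norm (y' - y) \<le> k \<Longrightarrow> norm (f r' y' - f r y) \<le> h"
proof -
  have "uniformly_continuous_on (C \<times> cball y0 R) (\<lambda>(r, y). f r y)"
    by (intro compact_uniformly_continuous continuous_on_subset[OF assms(1)] compact_Times assms(2))
      (use assms(3) in auto)
  then obtain d where d: "d > 0" "\<And>z z'. z \<in> C \<times> cball y0 R \<Longrightarrow> z' \<in> C \<times> cball y0 R \<Longrightarrow> dist z' z < d \<Longrightarrow>
      dist (case z' of (r, y) \<Rightarrow> f r y) (case z of (r, y) \<Rightarrow> f r y) < h"
    using assms(4) unfolding uniformly_continuous_on_def by metis
  show thesis
  proof (rule that[of "d / 3"])
    show "0 < d / 3" using d by simp
    fix r r' y y' assume *: "r \<in> C" "r' \<in> C" "y \<in> cball y0 R" "y' \<in> cball y0 R" "\<bar>r' - r\<bar> \<le> d / 3" "norm (y' - y) \<le> d / 3"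
    have "dist (r', y') (r, y) \<le> dist r' r + dist y' y"
      unfolding dist_Pair_Pair by (rule sqrt_sum_squares_le_sum) auto
    also have "\<dots> < d" using * d(1) by (simp add: dist_norm)
    finally show "norm (f r' y' - f r y) \<le> h" using d(2)[of "(r, y)" "(r', y')"] * by (simp add: dist_norm)
  qed
qed

text \<open>Joint continuity of \<open>log_value\<close> is not part of the locale; the bound comes
  from the mean value theorem, in space at the time \<open>b0\<close> and in time from
  there.\<close>

lemma value_fun_bounded:
  assumes b: "b0 \<in> {e<..<e'}" "b1 \<in> {e<..<e'}"
  obtains K where "1 \<le> K" "\<And>r y. r \<in> {b0..b1} \<Longrightarrow> y \<in> cball y0 R \<Longrightarrow> \<bar>log_value r y\<bar> \<le> K"
proof -
  obtain K1 where K1: "1 \<le> K1" "\<And>r y. r \<in> {e..e'} \<Longrightarrow> y \<in> cball y0 R \<Longrightarrow> norm (Tm r y) \<le> K1"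
    by (rule bounded_on_box[OF continuous_Tm, of "{e..e'}" y0 R]) auto
  obtain K2 where K2: "1 \<le> K2" "\<And>r y. r \<in> {e..e'} \<Longrightarrow> y \<in> cball y0 R \<Longrightarrow> norm (G r y) \<le> K2"
    by (rule bounded_on_box[OF continuous_G, of "{e..e'}" y0 R]) auto
  define K where "K = \<bar>log_value b0 y0\<bar> + K1 + K2 * \<bar>R\<bar> + 1"
  show thesis
  proof (rule that[of K])
    show "1 \<le> K" unfolding K_def using K1 K2 by auto
    fix r y assume r: "r \<in> {b0..b1}" and y: "y \<in> cball y0 R"
    have rs: "r \<in> {e<..<e'}" using r b by auto
    have "b0 \<le> r" using r by simp
    then obtain z where z: "z \<in> {b0..r}" "log_value r y - log_value b0 y = (r - b0) * Tm z y"
      using mvt_time[OF b(1) rs, of y] by blast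
    have "\<bar>(r - b0) * Tm z y\<bar> \<le> 1 * K1"
      unfolding abs_mult using K1(2)[of z y] z rs r b e y by (intro mult_mono) auto
    moreover obtain s where s: "s \<in> {0..1}" "log_value b0 (y0 + (y - y0)) - log_value b0 y0 = (y - y0) \<bullet> G b0 (y0 + s *\<^sub>R (y - y0))"
      using mvt_space[OF b(1)] by blast
    have yR: "norm (y - y0) \<le> R" using y by (simp add: dist_norm norm_minus_commute)
    have "norm (s *\<^sub>R (y - y0)) \<le> R"
      using s(1) yR mult_left_le_one_le[of "norm (y - y0)" s] by auto
    then have "y0 + s *\<^sub>R (y - y0) \<in> cball y0 R" by (simp add: dist_norm)
    then have "norm (G b0 (y0 + s *\<^sub>R (y - y0))) \<le> K2" using K2 strip_subset[OF b(1)] by auto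
    then have "\<bar>(y - y0) \<bullet> G b0 (y0 + s *\<^sub>R (y - y0))\<bar> \<le> R * K2"
      using yR order_trans[OF norm_ge_zero yR] by (intro order_trans[OF Cauchy_Schwarz_ineq2] mult_mono) auto
    moreover have "R * K2 \<le> K2 * \<bar>R\<bar>" using K2 by (simp add: mult.commute mult_left_mono)
    ultimately show "\<bar>log_value r y\<bar> \<le> K" using s(2) z(2) unfolding K_def by simp
  qed
qed

text \<open>Optional stopping at the first exit on a grid: until then the path is in a bounded region, where
  the value function is bounded.\<close>

lemma exit_expectation_bound:
  assumes t: "t \<in> {e<..<e'}" "t + d0 \<in> {e<..<e'}" "0 < d0" and k: "0 < k"
  obtains C where "0 \<le> C" "\<And>d. 0 < d \<Longrightarrow> d \<le> d0 \<Longrightarrow>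
    (\<integral>v. indicator (exit_event t d k) v * F x t (path t y v) \<partial>M) \<le> C * d\<^sup>2"
proof -
  \<comment> \<open>Up to a passage of \<open>grid_exit\<close> the Brownian increment is at most
    \<open>2 * k\<close>, and the lift scales it by \<open>sqrt a\<close>.\<close>
  define R where "R = sqrt a * (2 * k)"
  obtain K where K: "1 \<le> K" "\<And>r y'. r \<in> {t..t + d0} \<Longrightarrow> y' \<in> cball y R \<Longrightarrow> \<bar>log_value r y'\<bar> \<le> K"
    by (rule value_fun_bounded[OF t(1,2), of y R]) blast
  obtain Q where Q: "1 \<le> Q" "\<And>r y'. r \<in> {t..t + d0} \<Longrightarrow> y' \<in> cball y R \<Longrightarrow> norm (potential r y') \<le> Q"
    by (rule bounded_on_box[OF continuous_potential, of "{t..t + d0}" y R]) (use t in auto)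
  define C where "C = exp Q * exp K * (96 * (real CARD('a))\<^sup>2 / k ^ 4)"
  have t01: "t \<in> {0..1}" using strip_subset[OF t(1)] by simp
  show thesis
  proof (rule that[of C])
    show "0 \<le> C" by (simp add: C_def)
    fix d assume d: "0 < d" "d \<le> d0"
    have td: "0 \<le> t" "t + d \<le> 1" using t e d by auto
    have d1: "d \<le> 1" using td by linarith
    have X: "exit_event t d k \<in> events" using exit_event_measurable(3) td by auto
    have "(\<integral>\<^sup>+v. ennreal (F x t (path t y v)) * indicator (exit_event t d k) v \<partial>M) \<le> ennreal (C * d\<^sup>2)"
    proof (rule exit_event_bound[OF td d(1) k])
      show "(\<lambda>v. ennreal (F x t (path t y v))) \<in> borel_measurable M" using t01 by measurable
      fix m :: nat assume m: "0 < m"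
      define \<tau> where "\<tau> j = t + d * (real j / real m)" for j
      have \<tau>: "t \<le> \<tau> j" "\<tau> j \<le> t + d" if "j \<le> m" for j
        using grid_time_le[of d j m] that m d by (auto simp: \<tau>_def)
      have Gp: "grid_exit t d k m j \<in> sets (past_algebra (\<tau> j))" if "j \<le> m" for j
        unfolding \<tau>_def using grid_exit_past[OF td _ that m] d by auto
      have GM: "grid_exit t d k m j \<in> events" if "j \<le> m" for j
        using Gp[OF that] past_subset[of "\<tau> j"] \<tau>[OF that] td by auto
      have one: "(\<integral>\<^sup>+v. ennreal (F x t (path t y v)) * indicator (grid_exit t d k m j) v \<partial>M)
        \<le> ennreal (exp Q * exp K) * emeasure M (grid_exit t d k m j)" if j: "j \<le> m" for j
      proof -
        have ts: "\<tau> j \<in> {e<..<e'}" "\<tau> j \<in> {t..t + d0}" using \<tau>[OF j] t d by auto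
        have "(\<integral>\<^sup>+v. ennreal (F x t (path t y v)) * indicator (grid_exit t d k m j) v \<partial>M) =
          (\<integral>\<^sup>+v. indicator (grid_exit t d k m j) v * ennreal (F x t (path t y v)) \<partial>M)"
          by (simp add: mult.commute)
        \<comment> \<open>The passage is decided at \<open>\<tau> j\<close>, so the weight collected
          later may be replaced by the value function at a position in the bounded region.\<close>
        also have "\<dots> = (\<integral>\<^sup>+v. indicator (grid_exit t d k m j) v *
            ennreal (weight t (\<tau> j) (path t y v) * value_fun x (\<tau> j) (lift t y v (\<tau> j))) \<partial>M)"
          using td \<tau>[OF j] Gp[OF j] by (intro markov_nn_integral) auto
        also have "\<dots> \<le> (\<integral>\<^sup>+v. ennreal (exp Q * exp K) * indicator (grid_exit t d k m j) v \<partial>M)"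
        proof (rule nn_integral_mono)
          fix v assume v: "v \<in> space M"
          show "indicator (grid_exit t d k m j) v * ennreal (weight t (\<tau> j) (path t y v) * value_fun x (\<tau> j) (lift t y v (\<tau> j)))
            \<le> ennreal (exp Q * exp K) * indicator (grid_exit t d k m j) v"
          proof (cases "v \<in> grid_exit t d k m j")
            case True
            have ball: "lift t y v q \<in> cball y R" if "q \<in> {t..\<tau> j}" for q
            proof -
              have "norm (B q v - B t v) \<le> 2 * k" using True that by (simp add: grid_exit_def \<tau>_def)
              then have "norm (sqrt a *\<^sub>R (B q v - B t v)) \<le> R" unfolding R_def using a_pos by simp
              then show ?thesis by (simp add: lift_def dist_norm norm_minus_commute)
            qed
            have "\<bar>ln (weight t (\<tau> j) (path t y v)) - 0 * (\<tau> j - t)\<bar> \<le> Q * (\<tau> j - t)"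
            proof (rule ln_weight)
              show "continuous_on {t..\<tau> j} (lift t y v)" using v td \<tau>[OF j] by (intro continuous_on_lift) auto
              show "path t y v c = pr (lift t y v c)" if "c \<in> {t..\<tau> j}" for c
                using that td \<tau>[OF j] by (intro path_eq) auto
              show "\<bar>potential c (lift t y v c) - 0\<bar> \<le> Q" if "c \<in> {t..\<tau> j}" for c
                using Q(2)[OF _ ball[OF that]] that \<tau>[OF j] d by auto
            qed (use t ts \<tau>[OF j] in auto)
            also have "\<dots> \<le> Q * 1" using Q \<tau>[OF j] d1 by (intro mult_left_mono) auto
            finally have "ln (weight t (\<tau> j) (path t y v)) \<le> Q" by simp
            then have w: "weight t (\<tau> j) (path t y v) \<le> exp Q"
              using exp_ln[OF weight_pos, of t "\<tau> j" "path t y v"] by (metis exp_le_cancel_iff)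
            have "log_value (\<tau> j) (lift t y v (\<tau> j)) \<le> K" using K(2)[OF ts(2) ball] \<tau>[OF j] by force
            then have "value_fun x (\<tau> j) (lift t y v (\<tau> j)) \<le> exp K"
              using exp_log_value[OF strip_subset(1)[OF ts(1)], symmetric] by simp
            with w have "weight t (\<tau> j) (path t y v) * value_fun x (\<tau> j) (lift t y v (\<tau> j)) \<le> exp Q * exp K"
              using less_imp_le[OF value_fun_pos[OF strip_subset(1)[OF ts(1)]]] by (intro mult_mono) auto
            then show ?thesis using True by (simp add: ennreal_leI)
          qed simp
        qed
        also have "\<dots> = ennreal (exp Q * exp K) * emeasure M (grid_exit t d k m j)"
          using GM[OF j] by (subst nn_integral_cmult) auto
        finally show ?thesis .
      qed
      have "(\<Sum>j\<le>m. \<integral>\<^sup>+v. ennreal (F x t (path t y v)) * indicator (grid_exit t d k m j) v \<partial>M)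
        \<le> (\<Sum>j\<le>m. ennreal (exp Q * exp K) * emeasure M (grid_exit t d k m j))"
        by (intro sum_mono one) auto
      also have "\<dots> = ennreal (exp Q * exp K) * emeasure M (\<Union>j\<in>{..m}. grid_exit t d k m j)"
        using GM disjoint_grid_exit unfolding sum_distrib_left[symmetric]
        by (subst sum_emeasure) (auto simp: disjoint_family_on_def)
      also have "\<dots> \<le> ennreal (exp Q * exp K) * emeasure M (exit_event t d k)"
      proof (intro mult_left_mono emeasure_mono X)
        show "(\<Union>j\<in>{..m}. grid_exit t d k m j) \<subseteq> exit_event t d k"
        proof (rule UN_least)
          fix j assume "j \<in> {..m}"
          then have "t + d * (real j / real m) \<in> {t..t + d}" using \<tau>[of j] by (simp add: \<tau>_def)
          then show "grid_exit t d k m j \<subseteq> exit_event t d k" unfolding grid_exit_def exit_event_def by blast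
        qed
      qed simp
      also have "\<dots> = ennreal (exp Q * exp K * prob (exit_event t d k))"
        by (simp add: emeasure_eq_measure ennreal_mult)
      also have "\<dots> \<le> ennreal (exp Q * exp K * (96 * (real CARD('a) * d)\<^sup>2 / k ^ 4))"
        by (intro ennreal_leI mult_left_mono prob_exit_event td d k) auto
      also have "\<dots> = ennreal (C * d\<^sup>2)" unfolding C_def by (simp add: power_mult_distrib mult_ac)
      finally show "(\<Sum>j\<le>m. \<integral>\<^sup>+v. ennreal (F x t (path t y v)) * indicator (grid_exit t d k m j) v \<partial>M) \<le> ennreal (C * d\<^sup>2)" .
    qed
    moreover have "(\<integral>\<^sup>+v. ennreal (F x t (path t y v)) * indicator (exit_event t d k) v \<partial>M) =
      ennreal (\<integral>v. indicator (exit_event t d k) v * F x t (path t y v) \<partial>M)"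
    proof -
      have "integrable M (\<lambda>v. indicator (exit_event t d k) v * F x t (path t y v))"
        by (rule integrable_real_mult_indicator[OF X integrable_F[OF t01], unfolded mult.commute[of _ "indicator _ _"]])
      then have "(\<integral>\<^sup>+v. ennreal (indicator (exit_event t d k) v * F x t (path t y v)) \<partial>M) =
        ennreal (\<integral>v. indicator (exit_event t d k) v * F x t (path t y v) \<partial>M)"
        by (rule nn_integral_eq_integral) (auto intro!: AE_I2 mult_nonneg_nonneg less_imp_le[OF F_pos])
      then show ?thesis
        by (subst nn_integral_cong[of M _ "\<lambda>v. ennreal (indicator (exit_event t d k) v * F x t (path t y v))"])
          (auto simp: indicator_def)
    qed
    ultimately show "(\<integral>v. indicator (exit_event t d k) v * F x t (path t y v) \<partial>M) \<le> C * d\<^sup>2"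
      using \<open>0 \<le> C\<close> by (simp add: ennreal_le_iff)
  qed
qed

text \<open>Exit events are stated for \<open>B\<close>; dividing the radius by
  \<open>sqrt a\<close> converts them into radius \<open>k\<close> for the lift.\<close>

lemma no_exit_lift:
  assumes "w \<in> space M" "w \<notin> exit_event r d (k / sqrt a)" "q \<in> {r..r + d}"
  shows "sqrt a * norm (B q w - B r w) \<le> k" "norm (lift r y w q - y) \<le> k"
proof -
  have "norm (B q w - B r w) \<le> k / sqrt a" using assms by (auto simp: exit_event_def not_less)
  then show "sqrt a * norm (B q w - B r w) \<le> k" using a_pos by (simp add: pos_le_divide_eq mult.commute)
  then show "norm (lift r y w q - y) \<le> k" using a_pos by (simp add: lift_def)
qed

section \<open>Expansion of the value over one step\<close>

text \<open>The conditional expectation of \<open>F x r\<close> given the path up to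
  \<open>r'\<close>, by the Markov property.\<close>

definition step_value :: "real \<Rightarrow> real \<Rightarrow> real^'a \<Rightarrow> 'c \<Rightarrow> real" where
  "step_value r r' y w = weight r r' (path r y w) * value_fun x r' (lift r y w r')"

lemma step_value_past:
  assumes "0 \<le> r" "r \<le> r'" "r' \<le> 1" shows "step_value r r' y \<in> borel_measurable (past_algebra r')"
proof -
  have "(\<lambda>w. weight r r' (path r y w)) \<in> borel_measurable (past_algebra r')"
    using assms by (intro measurable_weight_past) auto
  moreover have "(\<lambda>w. value_fun x r' (lift r y w r')) \<in> borel_measurable (past_algebra r')"
    using assms by (intro measurable_compose[OF measurable_lift_past measurable_value_fun]) auto
  ultimately show ?thesis unfolding step_value_def[abs_def] by (rule borel_measurable_times)
qed

text \<open>The logarithm of the step is a time increment (mean value theorem), a space increment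
  (Taylor) and the logarithm of the weight (nearly constant potential);
  \<open>exp_second_order\<close> exponentiates their sum. The estimates are uniform over the
  starting point in a compact set, as the sum over a grid demands. The coarser second estimate
  serves the drift, where the step is multiplied by a small increment.\<close>

lemma step_value_expansion:
  assumes b: "b0 \<in> {e<..<e'}" "b1 \<in> {e<..<e'}" and k: "0 < k"
  obtains \<rho> Q where "0 < \<rho>" "\<rho> \<le> 1" "0 \<le> Q" "\<And>r h y w W. b0 \<le> r \<Longrightarrow> 0 < h \<Longrightarrow> h \<le> \<rho> \<Longrightarrow> r + h \<le> b1 \<Longrightarrow> y \<in> cball y0 R \<Longrightarrow>
      w \<in> space M \<Longrightarrow> (\<And>q. q \<in> {r..r + h} \<Longrightarrow> norm (lift r y w q - y) \<le> \<rho>) \<Longrightarrow> lift r y w (r + h) = y + W \<Longrightarrow>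
      \<bar>step_value r (r + h) y w - value_fun x r y * (1 + W \<bullet> G r y
          + (h * (potential r y + Tm r y) + (W \<bullet> (H r y *v W)) / 2) + (W \<bullet> G r y)\<^sup>2 / 2)\<bar> \<le> k * (h + (norm W)\<^sup>2) \<and>
      \<bar>step_value r (r + h) y w - value_fun x r y * (1 + W \<bullet> G r y)\<bar> \<le> Q * (h + (norm W)\<^sup>2)"
proof -
  define n where "n = real CARD('a)"
  have n1: "1 \<le> n" unfolding n_def by (simp add: Suc_leI)
  let ?C = "{b0..b1}" and ?B = "cball y0 (R + 1)"
  have sub: "?C \<subseteq> {e..e'}" "?C \<subseteq> {e<..<e'}" using b by auto
  obtain K1 where K1: "1 \<le> K1" "\<And>r y. r \<in> ?C \<Longrightarrow> y \<in> ?B \<Longrightarrow> norm (Tm r y) \<le> K1"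
    using bounded_on_box[OF continuous_Tm compact_Icc sub(1)] by blast
  obtain K2 where K2: "1 \<le> K2" "\<And>r y. r \<in> ?C \<Longrightarrow> y \<in> ?B \<Longrightarrow> norm (G r y) \<le> K2"
    using bounded_on_box[OF continuous_G compact_Icc sub(1)] by blast
  obtain K3 where K3: "1 \<le> K3" "\<And>r y. r \<in> ?C \<Longrightarrow> y \<in> ?B \<Longrightarrow> norm (H r y) \<le> K3"
    using bounded_on_box[OF continuous_H compact_Icc sub(1)] by blast
  obtain K4 where K4: "1 \<le> K4" "\<And>r y. r \<in> ?C \<Longrightarrow> y \<in> ?B \<Longrightarrow> norm (potential r y) \<le> K4"
    using bounded_on_box[OF continuous_potential compact_Icc sub(2)] by blast
  obtain K5 where K5: "1 \<le> K5" "\<And>r y. r \<in> ?C \<Longrightarrow> y \<in> ?B \<Longrightarrow> \<bar>log_value r y\<bar> \<le> K5"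
    by (rule value_fun_bounded[OF b, of y0 "R + 1"]) blast
  \<comment> \<open>One bound for all coefficients of the expansion; it plays the role of
    \<open>h\<close> in \<open>exp_second_order\<close>.\<close>
  define l where "l = K2\<^sup>2 + K2 + (K1 + K4) + n\<^sup>2 * K3"
  have l: "1 \<le> l" "K2\<^sup>2 \<le> l" "K2 \<le> l" "K1 + K4 \<le> l" "n\<^sup>2 * K3 \<le> l"
  proof -
    have "0 \<le> K2\<^sup>2" "0 \<le> n\<^sup>2 * K3" using K3 by auto
    then show "1 \<le> l" "K2\<^sup>2 \<le> l" "K2 \<le> l" "K1 + K4 \<le> l" "n\<^sup>2 * K3 \<le> l"
      unfolding l_def using K1(1) K2(1) K4(1) by linarith+
  qed
  \<comment> \<open>The factor 27 \<open>l\<^sup>2\<close> comes from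
    \<open>exp_second_order\<close> and \<open>exp K5\<close> bounds the value function;
    \<open>c\<close> is then the oscillation that brings the error below \<open>k\<close>.\<close>
  define C1 where "C1 = exp K5 * (27 * l\<^sup>2)"
  have C1: "0 < C1" using l by (simp add: C1_def)
  define c where "c = min 1 (k / C1)"
  have c: "0 < c" "c \<le> 1" "C1 * c \<le> k"
  proof -
    show "0 < c" "c \<le> 1" using k C1 by (auto simp: c_def)
    have "C1 * c \<le> C1 * (k / C1)" unfolding c_def using C1 by (intro mult_left_mono) auto
    then show "C1 * c \<le> k" using C1 by simp
  qed
  have c4: "0 < c / 4" "0 < c / n\<^sup>2" using c n1 by auto
  obtain \<rho>1 where \<rho>1: "0 < \<rho>1" "\<And>r r' y y'. r \<in> ?C \<Longrightarrow> r' \<in> ?C \<Longrightarrow> y \<in> ?B \<Longrightarrow> y' \<in> ?B \<Longrightarrow>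
      \<bar>r' - r\<bar> \<le> \<rho>1 \<Longrightarrow> norm (y' - y) \<le> \<rho>1 \<Longrightarrow> norm (Tm r' y' - Tm r y) \<le> c / 4"
    using near_box[OF continuous_Tm compact_Icc sub(1) c4(1)] by blast
  obtain \<rho>2 where \<rho>2: "0 < \<rho>2" "\<And>r r' y y'. r \<in> ?C \<Longrightarrow> r' \<in> ?C \<Longrightarrow> y \<in> ?B \<Longrightarrow> y' \<in> ?B \<Longrightarrow>
      \<bar>r' - r\<bar> \<le> \<rho>2 \<Longrightarrow> norm (y' - y) \<le> \<rho>2 \<Longrightarrow> norm (potential r' y' - potential r y) \<le> c / 4"
    using near_box[OF continuous_potential compact_Icc sub(2) c4(1)] by blast
  obtain \<rho>3 where \<rho>3: "0 < \<rho>3" "\<And>r r' y y'. r \<in> ?C \<Longrightarrow> r' \<in> ?C \<Longrightarrow> y \<in> ?B \<Longrightarrow> y' \<in> ?B \<Longrightarrow>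
      \<bar>r' - r\<bar> \<le> \<rho>3 \<Longrightarrow> norm (y' - y) \<le> \<rho>3 \<Longrightarrow> norm (H r' y' - H r y) \<le> c / n\<^sup>2"
    using near_box[OF continuous_H compact_Icc sub(1) c4(2)] by blast
  \<comment> \<open>The first three radii control the oscillation of the coefficients,
    \<open>1 / (5 * l)\<close> keeps the exponent small, and \<open>c\<close> also bounds the step
    itself.\<close>
  define \<rho> where "\<rho> = Min {\<rho>1, \<rho>2, \<rho>3, 1 / (5 * l), c}"
  have "\<rho> \<in> {\<rho>1, \<rho>2, \<rho>3, 1 / (5 * l), c}" unfolding \<rho>_def by (rule Min_in) auto
  then have \<rho>0: "0 < \<rho>" using \<rho>1(1) \<rho>2(1) \<rho>3(1) l c by auto
  have \<rho>: "\<rho> \<le> \<rho>1" "\<rho> \<le> \<rho>2" "\<rho> \<le> \<rho>3" "\<rho> \<le> 1 / (5 * l)" "\<rho> \<le> c"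
    unfolding \<rho>_def by (rule Min_le, simp, simp)+
  have l\<rho>: "5 * l * \<rho> \<le> 1" using \<rho>(4) l(1) by (simp add: field_simps)
  have \<rho>le1: "\<rho> \<le> 1" using \<rho>(5) c by linarith
  have Q: "0 \<le> k + exp K5 * (2 * l)" using k l by simp
  show thesis
  proof (rule that[OF \<rho>0 \<rho>le1 Q])
    fix r h y w W
    assume r: "b0 \<le> r" and h: "0 < h" "h \<le> \<rho>" and rh: "r + h \<le> b1" and y: "y \<in> cball y0 R" and w: "w \<in> space M"
      and stay: "\<And>q. q \<in> {r..r + h} \<Longrightarrow> norm (lift r y w q - y) \<le> \<rho>" and lf: "lift r y w (r + h) = y + W"
    have rb: "r \<in> ?C" "r + h \<in> ?C" using r rh h by auto
    have rs: "r \<in> {e<..<e'}" "r + h \<in> {e<..<e'}" using rb sub(2) by auto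
    have r01: "r \<in> {0..1}" "r + h \<in> {0..1}" using rs strip_subset by auto
    have yb: "y' \<in> ?B" if "norm (y' - y) \<le> \<rho>" for y'
    proof -
      have "dist y0 y' \<le> dist y0 y + dist y y'" by (rule dist_triangle)
      also have "\<dots> \<le> R + 1" using y that \<rho>le1 by (intro add_mono) (auto simp: dist_norm norm_minus_commute)
      finally show ?thesis by simp
    qed
    have yb0: "y \<in> ?B" using yb[of y] \<rho>0 by simp
    define u0 where "u0 = value_fun x r y"
    have u0: "0 < u0" "u0 \<le> exp K5"
    proof -
      show "0 < u0" unfolding u0_def by (rule value_fun_pos[OF r01(1)])
      have "log_value r y \<le> K5" using K5(2)[OF rb(1) yb0] by simp
      then show "u0 \<le> exp K5" unfolding u0_def exp_log_value[OF r01(1), symmetric] by simp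
    qed
    have W\<rho>: "norm W \<le> \<rho>" using stay[of "r + h"] h lf by simp
    have yW: "y + W \<in> ?B" using yb[of "y + W"] W\<rho> by simp
    define d where "d = h + (norm W)\<^sup>2"
    have d: "h \<le> d" "(norm W)\<^sup>2 \<le> d" "0 \<le> d" using h by (auto simp: d_def)
    have d2: "d \<le> 2 * \<rho>"
    proof -
      have "(norm W)\<^sup>2 \<le> \<rho> * 1" unfolding power2_eq_square using W\<rho> \<rho>le1 \<rho>0 by (intro mult_mono) auto
      then show ?thesis using h by (simp add: d_def)
    qed
    define qT where "qT = potential r y + Tm r y"
    define g where "g = W \<bullet> G r y"
    define A where "A = h * qT + (W \<bullet> (H r y *v W)) / 2"
    obtain z where z: "z \<in> {r..r + h}" "log_value (r + h) (y + W) - log_value r (y + W) = h * Tm z (y + W)"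
      using mvt_time[OF rs, of "y + W"] h by auto
    obtain s where s: "s \<in> {0..1}" "log_value r (y + W) - log_value r y = W \<bullet> G r y + (W \<bullet> (H r (y + s *\<^sub>R W) *v W)) / 2"
      using taylor_space[OF rs(1)] by blast
    define R1 where "R1 = ln (weight r (r + h) (path r y w)) - potential r y * h"
    define R2 where "R2 = h * (Tm z (y + W) - Tm r y)"
    define R3 where "R3 = (W \<bullet> ((H r (y + s *\<^sub>R W) - H r y) *v W)) / 2"
    have near: "q \<in> ?C" "\<bar>q - r\<bar> \<le> \<rho>" if "q \<in> {r..r + h}" for q using that rb h by auto
    have "\<bar>ln (weight r (r + h) (path r y w)) - potential r y * (r + h - r)\<bar> \<le> c / 4 * (r + h - r)"
    proof (rule ln_weight)
      show "continuous_on {r..r + h} (lift r y w)" using w r01 by (intro continuous_on_lift) auto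
      show "path r y w q = pr (lift r y w q)" if "q \<in> {r..r + h}" for q
        using that r01 by (intro path_eq) auto
      show "\<bar>potential q (lift r y w q) - potential r y\<bar> \<le> c / 4" if "q \<in> {r..r + h}" for q
        using \<rho>2(2)[OF rb(1) near(1)[OF that] yb0 yb[OF stay[OF that]]] near(2)[OF that] stay[OF that] \<rho>(2) by simp
    qed (use rs h in auto)
    then have R1: "\<bar>R1\<bar> \<le> c / 4 * h" by (simp add: R1_def)
    have R2: "\<bar>R2\<bar> \<le> c / 4 * h"
    proof -
      have "\<bar>Tm z (y + W) - Tm r y\<bar> \<le> c / 4"
        using \<rho>1(2)[OF rb(1) near(1)[OF z(1)] yb0 yW] near(2)[OF z(1)] W\<rho> \<rho>(1) by simp
      then have "h * \<bar>Tm z (y + W) - Tm r y\<bar> \<le> h * (c / 4)" using h by (intro mult_left_mono) auto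
      then show ?thesis using h by (simp add: R2_def abs_mult mult.commute)
    qed
    have R3: "\<bar>R3\<bar> \<le> c / 2 * (norm W)\<^sup>2"
    proof -
      have sW: "norm (s *\<^sub>R W) \<le> \<rho>" using s(1) W\<rho> mult_left_le_one_le[of "norm W" s] by auto
      then have "norm (H r (y + s *\<^sub>R W) - H r y) \<le> c / n\<^sup>2"
        using \<rho>3(2)[OF rb(1) rb(1) yb0 yb[of "y + s *\<^sub>R W"]] \<rho>(3) \<rho>3(1) by simp
      then have "n\<^sup>2 * norm (H r (y + s *\<^sub>R W) - H r y) \<le> c" using n1 by (simp add: field_simps)
      then have "n\<^sup>2 * norm (H r (y + s *\<^sub>R W) - H r y) * (norm W * norm W) \<le> c * (norm W * norm W)"
        by (intro mult_right_mono) auto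
      with abs_matrix_quadratic_form_le[of W "H r (y + s *\<^sub>R W) - H r y" W]
      have "\<bar>W \<bullet> ((H r (y + s *\<^sub>R W) - H r y) *v W)\<bar> \<le> c * (norm W * norm W)"
        unfolding n_def by linarith
      then show ?thesis by (simp add: R3_def power2_eq_square)
    qed
    have "\<bar>R1 + R2 + R3\<bar> \<le> \<bar>R1\<bar> + \<bar>R2\<bar> + \<bar>R3\<bar>" by linarith
    also have "\<dots> \<le> c / 4 * h + c / 4 * h + c / 2 * (norm W)\<^sup>2" using R1 R2 R3 by (intro add_mono)
    also have "\<dots> \<le> c * d"
    proof -
      have "0 \<le> c * h" "0 \<le> c * (norm W)\<^sup>2" using c h by auto
      then show ?thesis unfolding d_def distrib_left by linarith
    qed
    finally have Rb: "\<bar>R1 + R2 + R3\<bar> \<le> c * d" .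
    have val: "step_value r (r + h) y w = u0 * exp (g + A + (R1 + R2 + R3))"
    proof -
      have "log_value (r + h) (y + W) + ln (weight r (r + h) (path r y w)) = log_value r y + (g + A + (R1 + R2 + R3))"
        using z(2) s(2) unfolding R1_def R2_def R3_def g_def A_def qT_def
        by (simp add: matrix_vector_mult_diff_rdistrib inner_diff_right algebra_simps diff_divide_distrib)
      then have "exp (log_value (r + h) (y + W)) * exp (ln (weight r (r + h) (path r y w))) = exp (log_value r y) * exp (g + A + (R1 + R2 + R3))"
        unfolding exp_add[symmetric] by simp
      then show ?thesis
        unfolding step_value_def u0_def lf exp_log_value[OF r01(1)] exp_log_value[OF r01(2)] exp_ln[OF weight_pos]
        by (simp add: mult.commute)
    qed
    have gA: "g\<^sup>2 \<le> l * d" "\<bar>g\<bar> \<le> l * \<rho>" "\<bar>A\<bar> \<le> l * d"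
    proof -
      have GK: "norm (G r y) \<le> K2" by (rule K2(2)[OF rb(1) yb0])
      have gl: "\<bar>g\<bar> \<le> norm W * K2" unfolding g_def
        by (rule order_trans[OF Cauchy_Schwarz_ineq2 mult_left_mono[OF GK norm_ge_zero]])
      then have "g\<^sup>2 \<le> (norm W * K2)\<^sup>2" by (metis abs_ge_zero power2_abs power_mono)
      also have "\<dots> = K2\<^sup>2 * (norm W)\<^sup>2" by (simp add: power_mult_distrib)
      also have "\<dots> \<le> l * d" using d(2) l by (intro mult_mono) auto
      finally show "g\<^sup>2 \<le> l * d" .
      have "norm W * K2 \<le> \<rho> * l" using W\<rho> \<rho>0 l K2(1) by (intro mult_mono) auto
      then show "\<bar>g\<bar> \<le> l * \<rho>" using gl by (simp add: mult.commute)
      have "\<bar>A\<bar> \<le> h * (K1 + K4) + n\<^sup>2 * K3 * (norm W)\<^sup>2"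
      proof -
        have "\<bar>A\<bar> \<le> \<bar>h * qT\<bar> + \<bar>W \<bullet> (H r y *v W)\<bar> / 2" unfolding A_def by linarith
        moreover have "\<bar>W \<bullet> (H r y *v W)\<bar> \<le> n\<^sup>2 * K3 * (norm W)\<^sup>2"
        proof -
          have "n\<^sup>2 * norm (H r y) * (norm W * norm W) \<le> n\<^sup>2 * K3 * (norm W * norm W)"
            using K3(2)[OF rb(1) yb0] by (intro mult_right_mono mult_left_mono) auto
          with abs_matrix_quadratic_form_le[of W "H r y" W] show ?thesis
            unfolding n_def power2_eq_square[of "norm W"] by linarith
        qed
        moreover have "\<bar>h * qT\<bar> \<le> h * (K1 + K4)"
        proof -
          have "\<bar>qT\<bar> \<le> K1 + K4" using K1(2)[OF rb(1) yb0] K4(2)[OF rb(1) yb0] unfolding qT_def real_norm_def by linarith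
          then show ?thesis using h by (simp add: abs_mult)
        qed
        ultimately show ?thesis by linarith
      qed
      also have "\<dots> \<le> l * h + l * (norm W)\<^sup>2"
        unfolding mult.commute[of h] using h l by (intro add_mono mult_right_mono) auto
      finally show "\<bar>A\<bar> \<le> l * d" by (simp add: d_def distrib_left)
    qed
    have "\<bar>exp (g + A + (R1 + R2 + R3)) - (1 + g + A + g\<^sup>2 / 2)\<bar> \<le> 27 * l\<^sup>2 * c * d"
      by (rule exp_second_order[OF gA Rb d2 d(3) \<rho>(5) c(2) l(1) l\<rho>])
    then have "u0 * \<bar>exp (g + A + (R1 + R2 + R3)) - (1 + g + A + g\<^sup>2 / 2)\<bar> \<le> exp K5 * (27 * l\<^sup>2 * c * d)"
      using u0 by (intro mult_mono) auto
    also have "\<dots> = (C1 * c) * d" by (simp add: C1_def)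
    also have "\<dots> \<le> k * d" using c(3) d(3) by (intro mult_right_mono)
    finally have e: "\<bar>step_value r (r + h) y w - u0 * (1 + g + A + g\<^sup>2 / 2)\<bar> \<le> k * d"
      using u0 unfolding val right_diff_distrib[symmetric] abs_mult by simp
    have "\<bar>A + g\<^sup>2 / 2\<bar> \<le> 2 * l * d" using gA zero_le_power2[of g] by linarith
    then have "u0 * \<bar>A + g\<^sup>2 / 2\<bar> \<le> exp K5 * (2 * l * d)" using u0 by (intro mult_mono) auto
    then have "\<bar>u0 * (A + g\<^sup>2 / 2)\<bar> \<le> exp K5 * (2 * l) * d" using u0 by (simp add: abs_mult)
    moreover have "step_value r (r + h) y w - u0 * (1 + g) =
      (step_value r (r + h) y w - u0 * (1 + g + A + g\<^sup>2 / 2)) + u0 * (A + g\<^sup>2 / 2)" by (simp add: algebra_simps)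
    ultimately have "\<bar>step_value r (r + h) y w - u0 * (1 + g)\<bar> \<le> (k + exp K5 * (2 * l)) * d"
      using e unfolding distrib_right by linarith
    with e show "\<bar>step_value r (r + h) y w - value_fun x r y * (1 + W \<bullet> G r y
          + (h * (potential r y + Tm r y) + (W \<bullet> (H r y *v W)) / 2) + (W \<bullet> G r y)\<^sup>2 / 2)\<bar> \<le> k * (h + (norm W)\<^sup>2) \<and>
      \<bar>step_value r (r + h) y w - value_fun x r y * (1 + W \<bullet> G r y)\<bar> \<le> (k + exp K5 * (2 * l)) * (h + (norm W)\<^sup>2)"
      by (simp only: u0_def g_def qT_def A_def d_def)
  qed
qed

text \<open>The expected step equals the value at the start, up to the exit event, while its
  expansion is that value times 1 + h c + o(h), with c the left-hand side of the equation. Hence c =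
  0. The square of the gradient comes from the second-order term of the exponential.\<close>

lemma hamilton_jacobi:
  assumes t: "t \<in> {e<..<e'}"
  shows "Tm t y + a * (\<Sum>i\<in>UNIV. H t y $ i $ i) / 2 + a * (norm (G t y))\<^sup>2 / 2 + potential t y = 0" (is "?c = 0")
proof -
  define n where "n = real CARD('a)"
  define u0 where "u0 = value_fun x t y"
  define qT where "qT = potential t y + Tm t y"
  define l where "l = 1 + norm (G t y) + (norm (H t y) + norm (G t y) * norm (G t y)) + \<bar>qT\<bar>"
  define b where "b = (t + e') / 2"
  have b: "b \<in> {e<..<e'}" "t < b" using t by (auto simp: b_def)
  have t01: "t \<in> {0..1}" using strip_subset[OF t] by simp
  have u0: "0 < u0" unfolding u0_def by (rule value_fun_pos[OF t01])
  have na: "0 < 1 + n * a" using a_pos by (simp add: n_def add_pos_nonneg)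
  have bound: "u0 * \<bar>?c\<bar> \<le> k * (1 + n * a)" if k: "0 < k" for k
  proof -
    \<comment> \<open>The ball of radius 0: a single starting point is enough for the
      equation.\<close>
    obtain \<rho>' Q where \<rho>': "0 < \<rho>'" "\<And>r h y' w W. t \<le> r \<Longrightarrow> 0 < h \<Longrightarrow> h \<le> \<rho>' \<Longrightarrow> r + h \<le> b \<Longrightarrow> y' \<in> cball y 0 \<Longrightarrow>
        w \<in> space M \<Longrightarrow> (\<And>q. q \<in> {r..r + h} \<Longrightarrow> norm (lift r y' w q - y') \<le> \<rho>') \<Longrightarrow> lift r y' w (r + h) = y' + W \<Longrightarrow>
        \<bar>step_value r (r + h) y' w - value_fun x r y' * (1 + W \<bullet> G r y'
          + (h * (potential r y' + Tm r y') + (W \<bullet> (H r y' *v W)) / 2) + (W \<bullet> G r y')\<^sup>2 / 2)\<bar> \<le> k * (h + (norm W)\<^sup>2) \<and>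
        \<bar>step_value r (r + h) y' w - value_fun x r y' * (1 + W \<bullet> G r y')\<bar> \<le> Q * (h + (norm W)\<^sup>2)"
      by (rule step_value_expansion[OF t b(1) k, of y 0]) blast
    define \<rho> where "\<rho> = min \<rho>' (b - t)"
    have \<rho>: "0 < \<rho>" "\<rho> \<le> \<rho>'" "t + \<rho> \<le> b" using \<rho>'(1) b(2) by (auto simp: \<rho>_def)
    define r0 where "r0 = \<rho> / sqrt a"
    have r0: "0 < r0" using \<rho> a_pos by (auto simp: r0_def)
    have td0: "t + \<rho> \<in> {e<..<e'}" using \<rho> b t by auto
    obtain C where C: "0 \<le> C" "\<And>h. 0 < h \<Longrightarrow> h \<le> \<rho> \<Longrightarrow>
      (\<integral>w. indicator (exit_event t h r0) w * F x t (path t y w) \<partial>M) \<le> C * h\<^sup>2"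
      by (rule exit_expectation_bound[OF t td0 \<rho>(1) r0, of y]) blast
    define K where "K = u0 * l * expansion_bound a r0"
    have main: "u0 * \<bar>?c\<bar> \<le> k * (1 + n * a) + (C + K) * h" if h: "0 < h" "h \<le> \<rho>" for h
    proof -
      define X where "X = exit_event t h r0"
      define W where "W w = sqrt a *\<^sub>R (B (t + h) w - B t w)" for w
      define \<Theta> where "\<Theta> = step_value t (t + h) y"
      have td: "0 \<le> t" "t + h \<le> 1" using t e h td0 by auto
      have Xp: "X \<in> sets (past_algebra (t + h))" and XM[measurable]: "X \<in> events"
        unfolding X_def using exit_event_measurable(1,3)[OF td] by auto
      have \<Theta>m: "\<Theta> \<in> borel_measurable M"
        unfolding \<Theta>_def using td h by (intro measurable_from_past[OF td(2) step_value_past]) auto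
      have approx: "\<bar>\<Theta> w - (u0 + (\<Sum>i\<in>UNIV. (u0 *\<^sub>R G t y) $ i * W w $ i) +
          (\<Sum>i\<in>UNIV. \<Sum>j\<in>UNIV. (u0 * (H t y $ i $ j + G t y $ i * G t y $ j)) * (W w $ i * W w $ j)) / 2 + (u0 * qT) * h)\<bar>
          \<le> k * (h + (norm (W w))\<^sup>2)" if w: "w \<in> space M" "w \<notin> exit_event t h r0" for w
      proof -
        define g where "g = W w \<bullet> G t y"
        have "\<bar>\<Theta> w - u0 * (1 + g + (h * qT + (W w \<bullet> (H t y *v W w)) / 2) + g\<^sup>2 / 2)\<bar> \<le> k * (h + (norm (W w))\<^sup>2)"
          unfolding \<Theta>_def u0_def g_def qT_def
        proof (rule \<rho>'(2)[THEN conjunct1])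
          show "norm (lift t y w q - y) \<le> \<rho>'" if "q \<in> {t..t + h}" for q
            using no_exit_lift(2)[OF w(1) _ that, of \<rho> y] w(2) \<rho>(2) by (simp add: r0_def)
          show "lift t y w (t + h) = y + W w" by (simp add: lift_def W_def)
        qed (use h \<rho> w in auto)
        moreover have "u0 + (\<Sum>i\<in>UNIV. (u0 *\<^sub>R G t y) $ i * W w $ i) +
          (\<Sum>i\<in>UNIV. \<Sum>j\<in>UNIV. (u0 * (H t y $ i $ j + G t y $ i * G t y $ j)) * (W w $ i * W w $ j)) / 2 + (u0 * qT) * h
          = u0 * (1 + g + (h * qT + (W w \<bullet> (H t y *v W w)) / 2) + g\<^sup>2 / 2)"
        proof -
          have 1: "(\<Sum>i\<in>UNIV. (u0 *\<^sub>R G t y) $ i * W w $ i) = u0 * g"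
            unfolding g_def inner_vec_def by (simp add: sum_distrib_left mult_ac)
          have 2: "(\<Sum>i\<in>UNIV. \<Sum>j\<in>UNIV. (u0 * (H t y $ i $ j + G t y $ i * G t y $ j)) * (W w $ i * W w $ j)) =
            u0 * (W w \<bullet> (H t y *v W w)) + u0 * g\<^sup>2"
          proof -
            have "g\<^sup>2 = (\<Sum>i\<in>UNIV. \<Sum>j\<in>UNIV. (G t y $ i * G t y $ j) * (W w $ i * W w $ j))"
              unfolding g_def inner_vec_def power2_eq_square sum_product by (simp add: mult_ac)
            then show ?thesis unfolding matrix_quadratic_form
              by (simp add: sum_distrib_left sum.distrib distrib_left distrib_right mult_ac)
          qed
          show ?thesis unfolding 1 2 by (simp add: algebra_simps add_divide_distrib)
        qed
        ultimately show ?thesis by (simp only:)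
      qed
      have bounds: "\<bar>u0\<bar> \<le> u0 * l" "\<bar>(u0 *\<^sub>R G t y) $ i\<bar> \<le> u0 * l"
        "\<bar>u0 * (H t y $ i $ j + G t y $ i * G t y $ j)\<bar> \<le> u0 * l" "\<bar>u0 * qT\<bar> \<le> u0 * l" for i j
      proof -
        have le: "\<bar>u0 * q\<bar> \<le> u0 * l" if "\<bar>q\<bar> \<le> l" for q using u0 that by (simp add: abs_mult)
        have nn: "0 \<le> norm (G t y) * norm (G t y)" by simp
        note l = l_def norm_ge_zero[of "G t y"] norm_ge_zero[of "H t y"] nn abs_ge_zero[of qT]
        show "\<bar>u0\<bar> \<le> u0 * l" using le[of 1] l by simp
        have "\<bar>G t y $ i\<bar> \<le> l" using component_le_norm_cart[of "G t y" i] l by linarith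
        then show "\<bar>(u0 *\<^sub>R G t y) $ i\<bar> \<le> u0 * l" using le by simp
        show "\<bar>u0 * qT\<bar> \<le> u0 * l" using l by (intro le) linarith
        have "\<bar>G t y $ i * G t y $ j\<bar> \<le> norm (G t y) * norm (G t y)"
          unfolding abs_mult by (intro mult_mono component_le_norm_cart) auto
        then have "\<bar>H t y $ i $ j + G t y $ i * G t y $ j\<bar> \<le> l" using matrix_entry_le[of "H t y" i j] l by linarith
        then show "\<bar>u0 * (H t y $ i $ j + G t y $ i * G t y $ j)\<bar> \<le> u0 * l" by (rule le)
      qed
      have combine: "\<bar>h * s'\<bar> \<le> A3 + A1 + A2"
        if "\<bar>J - u0 - h * s\<bar> \<le> A1 + A2" "s = s'" "J = u0 - X'" "\<bar>X'\<bar> \<le> A3" for J s s' A1 A2 A3 X' :: real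
        using that(1,3,4) unfolding that(2)[symmetric] by linarith
      have "\<bar>(\<integral>w. indicator (space M - exit_event t h r0) w * \<Theta> w \<partial>M) - u0 -
         h * (u0 * qT + a / 2 * (\<Sum>i\<in>UNIV. u0 * (H t y $ i $ i + G t y $ i * G t y $ i)))\<bar>
        \<le> k * h * (1 + real CARD('a) * a) + (u0 * l) * expansion_bound a r0 * h\<^sup>2"
        by (rule short_time_expansion[OF td h(1) r0 a_pos \<Theta>m bounds _ W_def approx]) (use k in auto)
      \<comment> \<open>The second-order coefficients are those of the exponential of \<psi>, so
        their trace is the Laplacian plus the squared gradient.\<close>
      moreover have "u0 * qT + a / 2 * (\<Sum>i\<in>UNIV. u0 * (H t y $ i $ i + G t y $ i * G t y $ i)) = u0 * ?c"
      proof -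
        have "(\<Sum>i\<in>UNIV. u0 * (H t y $ i $ i + G t y $ i * G t y $ i)) = u0 * ((\<Sum>i\<in>UNIV. H t y $ i $ i) + G t y \<bullet> G t y)"
          unfolding inner_vec_def by (simp add: sum.distrib sum_distrib_left distrib_left)
        then show ?thesis unfolding qT_def by (simp add: power2_norm_eq_inner algebra_simps add_divide_distrib)
      qed
      \<comment> \<open>Staying in the ball is decided at \<open>t + h\<close>, so the Markov
        property turns the step back into the full weight there; what is missing from
        \<open>u0\<close> is the weight of the exit event, of order
        \<open>h\<^sup>2\<close>.\<close>
      moreover have "(\<integral>w. indicator (space M - exit_event t h r0) w * \<Theta> w \<partial>M) = u0 - (\<integral>w. indicator X w * F x t (path t y w) \<partial>M)"
      proof -
        have N: "space M - X \<in> sets (past_algebra (t + h))" using sets.compl_sets[OF Xp] by simp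
        have iX: "integrable M (\<lambda>w. indicator X w * F x t (path t y w))"
          and iN: "integrable M (\<lambda>w. indicator (space M - X) w * F x t (path t y w))"
          using XM by (auto intro!: integrable_real_mult_indicator[OF _ integrable_F[OF t01], unfolded mult.commute[of _ "indicator _ _"]])
        have "(\<integral>w. indicator (space M - X) w * \<Theta> w \<partial>M) = (\<integral>w. indicator (space M - X) w * F x t (path t y w) \<partial>M)"
          unfolding \<Theta>_def step_value_def using td h N iN by (intro markov_integral(1)[symmetric]) auto
        moreover have "u0 = (\<integral>w. indicator (space M - X) w * F x t (path t y w) + indicator X w * F x t (path t y w) \<partial>M)"
          unfolding u0_def value_fun_def by (intro Bochner_Integration.integral_cong) (auto simp: indicator_def)
        ultimately show ?thesis using iX iN by (simp add: X_def)
      qed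
      moreover have "\<bar>\<integral>w. indicator X w * F x t (path t y w) \<partial>M\<bar> \<le> C * h\<^sup>2"
        using C(2)[OF h] by (subst abs_of_nonneg)
          (auto simp: X_def intro!: Bochner_Integration.integral_nonneg mult_nonneg_nonneg less_imp_le[OF F_pos])
      ultimately have "\<bar>h * (u0 * ?c)\<bar> \<le> C * h\<^sup>2 + k * h * (1 + n * a) + K * h\<^sup>2"
        unfolding K_def n_def by (rule combine)
      moreover have "\<bar>h * (u0 * ?c)\<bar> = h * (u0 * \<bar>?c\<bar>)" using h u0 by (simp only: abs_mult abs_of_pos)
      moreover have "C * h\<^sup>2 + k * h * (1 + n * a) + K * h\<^sup>2 = h * (k * (1 + n * a) + (C + K) * h)"
        by (simp add: algebra_simps power2_eq_square)
      ultimately have "h * (u0 * \<bar>?c\<bar>) \<le> h * (k * (1 + n * a) + (C + K) * h)" by (simp only:)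
      then show ?thesis using h by (simp only: mult_le_cancel_left_pos)
    qed
    have "((\<lambda>h. k * (1 + n * a) + (C + K) * h) \<longlongrightarrow> k * (1 + n * a) + (C + K) * 0) (at_right 0)"
      by (intro tendsto_intros)
    moreover have "\<forall>\<^sub>F h in at_right 0. u0 * \<bar>?c\<bar> \<le> k * (1 + n * a) + (C + K) * h"
      unfolding eventually_at_right_field using \<rho>(1) main by (intro exI[of _ \<rho>]) auto
    ultimately have "u0 * \<bar>?c\<bar> \<le> k * (1 + n * a) + (C + K) * 0" by (rule tendsto_lowerbound) simp
    then show ?thesis by simp
  qed
  have "u0 * \<bar>?c\<bar> \<le> 0"
  proof (rule field_le_epsilon)
    fix k :: real assume "0 < k"
    then have "0 < k / (1 + n * a)" using na by simp
    from bound[OF this] show "u0 * \<bar>?c\<bar> \<le> 0 + k" using na by simp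
  qed
  then have "\<bar>?c\<bar> \<le> 0" using u0 by (simp add: mult_le_0_iff)
  then show ?thesis by simp
qed

end

section \<open>The drift between jump times\<close>

text \<open>Here \<open>c\<close> means that the process has not been stopped yet, so the sum of the
  surviving increments is the process at the stopping index.\<close>

lemma sum_antimono_telescope:
  fixes N :: "nat \<Rightarrow> real"
  assumes "\<And>j k. j \<le> k \<Longrightarrow> c k \<Longrightarrow> c j"
  obtains J where "J \<le> m" "\<And>j. j < m \<Longrightarrow> c j \<longleftrightarrow> j < J" "(\<Sum>j<m. of_bool (c j) * (N (Suc j) - N j)) = N J - N 0"
proof -
  have "\<exists>J\<le>m. (\<forall>j<m. c j \<longleftrightarrow> j < J) \<and> (\<Sum>j<m. of_bool (c j) * (N (Suc j) - N j)) = N J - N 0"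
  proof (induction m)
    case (Suc m)
    then obtain J where J: "J \<le> m" "\<forall>j<m. c j \<longleftrightarrow> j < J" "(\<Sum>j<m. of_bool (c j) * (N (Suc j) - N j)) = N J - N 0"
      by blast
    show ?case
    proof (cases "c m")
      case True
      then have "\<not> J < m" using J(2) assms[of J m] by auto
      then have "J = m" using J(1) by simp
      then show ?thesis using J True by (intro exI[of _ "Suc m"]) (auto simp: less_Suc_eq)
    next
      case False
      then show ?thesis using J by (intro exI[of _ J]) (auto simp: less_Suc_eq)
    qed
  qed simp
  then show thesis using that by blast
qed

lemma integrable_bounded_mult:
  fixes f g :: "'b \<Rightarrow> real"
  assumes f: "integrable N f" and g: "g \<in> borel_measurable N" "\<And>v. v \<in> space N \<Longrightarrow> \<bar>g v\<bar> \<le> c"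
  shows "integrable N (\<lambda>v. g v * f v)"
proof (rule Bochner_Integration.integrable_bound)
  show "integrable N (\<lambda>v. c * f v)" using f by simp
  show "(\<lambda>v. g v * f v) \<in> borel_measurable N" using f g(1) by measurable
  show "AE v in N. norm (g v * f v) \<le> norm (c * f v)"
    by (auto simp: abs_mult intro!: AE_I2 mult_right_mono order_trans[OF g(2) abs_ge_self])
qed

lemma measurable_continuous_process_integral:
  fixes Z :: "real \<Rightarrow> 'b \<Rightarrow> 'c::{banach, second_countable_topology}"
  assumes cd: "c \<le> d" and Z: "\<And>q. q \<in> {c..d} \<Longrightarrow> Z q \<in> borel_measurable N"
    and cont: "\<And>z. z \<in> space N \<Longrightarrow> continuous_on {c..d} (\<lambda>q. Z q z)"
  shows "(\<lambda>z. (LBINT q:{c..d}. Z q z)) \<in> borel_measurable N"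
proof -
  have "(\<lambda>(q, z). if q \<in> UNIV then Z (max c (min d q)) z else 0) \<in> borel_measurable (borel \<Otimes>\<^sub>M N)"
  proof (rule borel_measurable_continuous_process)
    show "Z (max c (min d q)) \<in> borel_measurable N" for q using Z cd by auto
    show "continuous_on UNIV (\<lambda>q. Z (max c (min d q)) z)" if "z \<in> space N" for z
      using cd by (intro continuous_on_compose2[OF cont[OF that]] continuous_intros) auto
  qed simp
  then have m: "(\<lambda>(q, z). Z (max c (min d q)) z) \<in> borel_measurable (borel \<Otimes>\<^sub>M N)" by simp
  have sw: "(\<lambda>x. (snd x, fst x)) \<in> N \<Otimes>\<^sub>M lborel \<rightarrow>\<^sub>M borel \<Otimes>\<^sub>M N" by measurable
  have "(\<lambda>z. LINT q|lborel. indicator {c..d} q *\<^sub>R Z (max c (min d q)) z) \<in> borel_measurable N"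
  proof (rule lborel.borel_measurable_lebesgue_integral)
    have "(\<lambda>x. indicator {c..d} (snd x) *\<^sub>R (case (snd x, fst x) of (q, z) \<Rightarrow> Z (max c (min d q)) z)) \<in> borel_measurable (N \<Otimes>\<^sub>M lborel)"
      by (intro borel_measurable_scaleR measurable_compose[OF sw m]) measurable
    then show "(\<lambda>(z, q). indicator {c..d} q *\<^sub>R Z (max c (min d q)) z) \<in> borel_measurable (N \<Otimes>\<^sub>M lborel)"
      by (simp add: case_prod_beta)
  qed
  moreover have "(LBINT q:{c..d}. Z q z) = (LINT q|lborel. indicator {c..d} q *\<^sub>R Z (max c (min d q)) z)" for z
    unfolding set_lebesgue_integral_def
    by (intro Bochner_Integration.integral_cong) (auto simp: indicator_def max_def min_def)
  ultimately show ?thesis by simp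
qed

context strip
begin

definition drift_increment :: "'a \<Rightarrow> real \<Rightarrow> real \<Rightarrow> real^'a \<Rightarrow> 'c \<Rightarrow> real" where
  "drift_increment i r r' y w = sqrt a * (B r' w - B r w) $ i
     - (LBINT q:{r..r'}. a * G q (lift r y w q) $ i)"

lemma continuous_on_G_compose:
  assumes "continuous_on A w" "A \<subseteq> {e..e'}"
  shows "continuous_on A (\<lambda>q. G q (w q))"
proof -
  have "continuous_on A (\<lambda>q. case (q, w q) of (r, y) \<Rightarrow> G r y)"
    by (rule continuous_on_compose2[OF continuous_G]) (use assms in \<open>auto intro!: continuous_intros\<close>)
  then show ?thesis by simp
qed

lemma continuous_on_G_space: "q \<in> {e..e'} \<Longrightarrow> continuous_on UNIV (G q)"
proof -
  assume "q \<in> {e..e'}"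
  then have "continuous_on UNIV (\<lambda>y. case (q, y) of (r, y) \<Rightarrow> G r y)"
    by (intro continuous_on_compose2[OF continuous_G]) (auto intro!: continuous_intros)
  then show ?thesis by simp
qed

lemma measurable_drift_integral:
  fixes Z :: "real \<Rightarrow> 'z \<Rightarrow> real^'a"
  assumes rr: "r \<le> r'" "{r..r'} \<subseteq> {e..e'}" and Z: "\<And>q. q \<in> {r..r'} \<Longrightarrow> Z q \<in> borel_measurable N"
    and cont: "\<And>z. z \<in> space N \<Longrightarrow> continuous_on {r..r'} (\<lambda>q. Z q z)"
  shows "(\<lambda>z. (LBINT q:{r..r'}. a * G q (Z q z) $ i)) \<in> borel_measurable N"
proof (rule measurable_continuous_process_integral[OF rr(1)])
  fix q assume q: "q \<in> {r..r'}"
  have "G q \<in> borel_measurable borel" by (rule borel_measurable_continuous_onI[OF continuous_on_G_space]) (use q rr in auto)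
  from measurable_compose[OF measurable_compose[OF Z[OF q] this] borel_measurable_nth[of i]]
  show "(\<lambda>z. a * G q (Z q z) $ i) \<in> borel_measurable N" by measurable
next
  fix z assume "z \<in> space N"
  then show "continuous_on {r..r'} (\<lambda>q. a * G q (Z q z) $ i)"
    using rr by (intro continuous_intros continuous_on_G_compose cont) auto
qed

lemma drift_increment_past:
  assumes "r \<le> r'" "{r..r'} \<subseteq> {e..e'}"
  shows "drift_increment i r r' y \<in> borel_measurable (past_algebra r')"
proof -
  have 1: "(\<lambda>w. (LBINT q:{r..r'}. a * G q (lift r y w q) $ i)) \<in> borel_measurable (past_algebra r')"
    using assms e by (intro measurable_drift_integral measurable_lift_past continuous_on_lift) auto
  have 2: "(\<lambda>w. (B r' w - B r w) $ i) \<in> borel_measurable (past_algebra r')"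
    using assms e by (intro measurable_compose[OF _ borel_measurable_nth] borel_measurable_diff measurable_past_B) auto
  show ?thesis unfolding drift_increment_def[abs_def]
    by (intro borel_measurable_diff 1 borel_measurable_times borel_measurable_const 2)
qed

lemma drift_increment_future:
  assumes "r \<le> r'" "{r..r'} \<subseteq> {e..e'}"
  shows "(\<lambda>(y, w). drift_increment i r r' y w) \<in> borel_measurable (borel \<Otimes>\<^sub>M future_algebra r)"
proof -
  have "(\<lambda>z. (LBINT q:{r..r'}. a * G q (lift r (fst z) (snd z) q) $ i))
      \<in> borel_measurable (borel \<Otimes>\<^sub>M future_algebra r)"
  proof (rule measurable_drift_integral[OF assms])
    fix q assume "q \<in> {r..r'}"
    then show "(\<lambda>z. lift r (fst z) (snd z) q) \<in> borel_measurable (borel \<Otimes>\<^sub>M future_algebra r)"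
      using measurable_lift_future[of q r] assms e by (auto simp: case_prod_beta)
  next
    fix z :: "(real^'a) \<times> 'c" assume "z \<in> space (borel \<Otimes>\<^sub>M future_algebra r)"
    then show "continuous_on {r..r'} (lift r (fst z) (snd z))"
      using assms e by (intro continuous_on_lift) (auto simp: space_pair_measure)
  qed
  moreover have "(\<lambda>z::(real^'a) \<times> 'c. (B r' (snd z) - B r (snd z)) $ i) \<in> borel_measurable (borel \<Otimes>\<^sub>M future_algebra r)"
    using assms e by (intro measurable_compose[OF _ borel_measurable_nth] measurable_compose[OF measurable_snd measurable_future_increment]) auto
  ultimately show ?thesis unfolding drift_increment_def[abs_def] case_prod_beta
    by (intro borel_measurable_diff borel_measurable_times borel_measurable_const)
qed

lemma set_integral_drift_bounds:
  assumes w: "continuous_on {r..r'} w" and rr: "r \<le> r'" "{r..r'} \<subseteq> {e..e'}"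
    and b: "\<And>q. q \<in> {r..r'} \<Longrightarrow> \<bar>a * G q (w q) $ i - c\<bar> \<le> k"
  shows "\<bar>(LBINT q:{r..r'}. a * G q (w q) $ i) - c * (r' - r)\<bar> \<le> k * (r' - r)"
  by (rule set_integral_near_const(2)[OF _ rr(1) _ _ b]) (use w rr in \<open>auto intro!: continuous_intros continuous_on_G_compose\<close>)

lemma drift_increment_bound:
  assumes w: "w \<in> space M" and rr: "r \<le> r'" "{r..r'} \<subseteq> {e..e'}"
    and K: "\<And>q. q \<in> {r..r'} \<Longrightarrow> norm (G q (lift r y w q)) \<le> K" and B: "sqrt a * norm (B r' w - B r w) \<le> k"
  shows "\<bar>drift_increment i r r' y w\<bar> \<le> k + a * K * (r' - r)"
proof -
  have "\<bar>(LBINT q:{r..r'}. a * G q (lift r y w q) $ i) - 0 * (r' - r)\<bar> \<le> (a * K) * (r' - r)"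
  proof (rule set_integral_drift_bounds[OF _ rr])
    show "continuous_on {r..r'} (lift r y w)" using w rr e by (intro continuous_on_lift) auto
    fix q assume q: "q \<in> {r..r'}"
    have "\<bar>G q (lift r y w q) $ i\<bar> \<le> K" using K[OF q] component_le_norm_cart order_trans by blast
    then show "\<bar>a * G q (lift r y w q) $ i - 0\<bar> \<le> a * K" using a_pos by (simp add: abs_mult)
  qed
  moreover have "\<bar>sqrt a * (B r' w - B r w) $ i\<bar> \<le> k"
  proof -
    have "\<bar>sqrt a * (B r' w - B r w) $ i\<bar> \<le> sqrt a * norm (B r' w - B r w)"
      unfolding abs_mult using a_pos component_le_norm_cart[of "B r' w - B r w" i]
      by (simp del: vector_minus_component)
    then show ?thesis using B by linarith
  qed
  ultimately show ?thesis unfolding drift_increment_def by (simp del: vector_minus_component)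
qed

text \<open>To leading order the increment is W_i - d v with v = a G_i, and the step is u (1 + W .
  G). The covariance of W_i with W . G is a d G_i = d v, so the leading terms cancel in the mean:
  this cancellation singles out \<open>a\<close> times the gradient as the drift.\<close>

lemma drift_one_step:
  assumes b: "b0 \<in> {e<..<e'}" "b1 \<in> {e<..<e'}" and h: "0 < h"
  obtains \<rho> C where "0 < \<rho>" "\<rho> \<le> 1" "0 \<le> C"
    "\<And>r d y. b0 \<le> r \<Longrightarrow> 0 < d \<Longrightarrow> d \<le> \<rho> \<Longrightarrow> r + d \<le> b1 \<Longrightarrow> y \<in> cball y0 R \<Longrightarrow>
      \<bar>\<integral>w. indicator (space M - exit_event r d (\<rho> / sqrt a)) w * drift_increment i r (r + d) y w * F x r (path r y w) \<partial>M\<bar>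
        \<le> h * d + C * d\<^sup>2"
proof -
  define n where "n = real CARD('a)"
  have n1: "1 \<le> n" unfolding n_def by (simp add: Suc_leI)
  let ?C = "{b0..b1}" and ?B = "cball y0 (R + 1)"
  have sub: "?C \<subseteq> {e..e'}" "?C \<subseteq> {e<..<e'}" using b by auto
  obtain K2 where K2: "1 \<le> K2" "\<And>r y. r \<in> ?C \<Longrightarrow> y \<in> ?B \<Longrightarrow> norm (G r y) \<le> K2"
    using bounded_on_box[OF continuous_G compact_Icc sub(1)] by blast
  obtain K5 where K5: "1 \<le> K5" "\<And>r y. r \<in> ?C \<Longrightarrow> y \<in> ?B \<Longrightarrow> \<bar>log_value r y\<bar> \<le> K5"
    by (rule value_fun_bounded[OF b, of y0 "R + 1"]) blast
  obtain \<rho>0 Q where \<rho>0: "0 < \<rho>0" and Q: "0 \<le> Q" and expand: "\<And>r h y w W. b0 \<le> r \<Longrightarrow> 0 < h \<Longrightarrow> h \<le> \<rho>0 \<Longrightarrow> r + h \<le> b1 \<Longrightarrow> y \<in> cball y0 R \<Longrightarrow>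
      w \<in> space M \<Longrightarrow> (\<And>q. q \<in> {r..r + h} \<Longrightarrow> norm (lift r y w q - y) \<le> \<rho>0) \<Longrightarrow> lift r y w (r + h) = y + W \<Longrightarrow>
      \<bar>step_value r (r + h) y w - value_fun x r y * (1 + W \<bullet> G r y)\<bar> \<le> Q * (h + (norm W)\<^sup>2)"
    by (rule step_value_expansion[OF b zero_less_one, of y0 R]) blast
  define U where "U = exp K5"
  define V where "V = a * K2 + 1"
  define C1 where "C1 = U + U * K2 * V + Q * (1 + V)"
  have pos: "0 < U" "1 \<le> V" "0 \<le> a * K2" unfolding U_def V_def using a_pos K2(1) by auto
  have C1: "0 < C1" unfolding C1_def using pos Q K2(1) by (intro add_pos_nonneg) auto
  have na: "0 < 1 + n * a" using a_pos n1 by (simp add: add_pos_nonneg)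
  \<comment> \<open>The remainder \<open>C1 * c\<close> times d + |W|^2 integrates to
    \<open>C1 * c * d * (1 + n * a)\<close>, which must not exceed \<open>h * d\<close>.\<close>
  define c where "c = min 1 (h / (C1 * (1 + n * a)))"
  have c: "0 < c" "c \<le> 1" "C1 * c * (1 + n * a) \<le> h"
  proof -
    show "0 < c" "c \<le> 1" using h C1 na by (auto simp: c_def)
    have "c \<le> h / (C1 * (1 + n * a))" by (simp add: c_def)
    then show "C1 * c * (1 + n * a) \<le> h" using C1 na by (simp add: pos_le_divide_eq mult_ac)
  qed
  have ca: "0 < c / a" using c a_pos by simp
  obtain \<rho>1 where \<rho>1: "0 < \<rho>1" "\<And>r r' y y'. r \<in> ?C \<Longrightarrow> r' \<in> ?C \<Longrightarrow> y \<in> ?B \<Longrightarrow> y' \<in> ?B \<Longrightarrow>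
      \<bar>r' - r\<bar> \<le> \<rho>1 \<Longrightarrow> norm (y' - y) \<le> \<rho>1 \<Longrightarrow> norm (G r' y' - G r y) \<le> c / a"
    using near_box[OF continuous_G compact_Icc sub(1) ca] by blast
  define \<rho> where "\<rho> = Min {\<rho>0, \<rho>1, c}"
  have "\<rho> \<in> {\<rho>0, \<rho>1, c}" unfolding \<rho>_def by (rule Min_in) auto
  then have \<rho>_pos: "0 < \<rho>" using \<rho>0 \<rho>1(1) c by auto
  have \<rho>: "\<rho> \<le> \<rho>0" "\<rho> \<le> \<rho>1" "\<rho> \<le> c" unfolding \<rho>_def by (rule Min_le, simp, simp)+
  have \<rho>le1: "\<rho> \<le> 1" using \<rho>(3) c by linarith
  define r0 where "r0 = \<rho> / sqrt a"
  have r0: "0 < r0" using \<rho>_pos a_pos by (auto simp: r0_def)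
  define K where "K = U * (1 + 2 * K2 + a * K2)"
  define C where "C = K * expansion_bound a r0"
  have C0: "0 \<le> C"
  proof -
    have "0 \<le> expansion_bound a r0" unfolding expansion_bound_def Let_def by simp
    then show ?thesis unfolding C_def K_def using pos K2(1) by simp
  qed
  show thesis
  proof (rule that[OF \<rho>_pos \<rho>le1 C0])
    fix r d y assume r: "b0 \<le> r" and d: "0 < d" "d \<le> \<rho>" and rd': "r + d \<le> b1" and y: "y \<in> cball y0 R"
    have rb: "r \<in> ?C" "r + d \<in> ?C" using r rd' d by auto
    have rs: "r \<in> {e<..<e'}" "r + d \<in> {e<..<e'}" using rb sub(2) by auto
    have rd: "0 \<le> r" "r + d \<le> 1" using rs e by auto
    have r01: "r \<in> {0..1}" using rs strip_subset by auto
    have seg: "r \<le> r + d" "{r..r + d} \<subseteq> {e..e'}" using d rs by auto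
    have yb: "y' \<in> ?B" if "norm (y' - y) \<le> \<rho>" for y'
    proof -
      have "dist y0 y' \<le> dist y0 y + dist y y'" by (rule dist_triangle)
      also have "\<dots> \<le> R + 1" using y that \<rho>le1 by (intro add_mono) (auto simp: dist_norm norm_minus_commute)
      finally show ?thesis by simp
    qed
    have yb0: "y \<in> ?B" using yb[of y] \<rho>_pos by simp
    define u0 where "u0 = value_fun x r y"
    have u0: "0 < u0" "u0 \<le> U"
    proof -
      show "0 < u0" unfolding u0_def by (rule value_fun_pos[OF r01])
      have "log_value r y \<le> K5" using K5(2)[OF rb(1) yb0] by simp
      then show "u0 \<le> U" unfolding u0_def U_def exp_log_value[OF r01, symmetric] by simp
    qed
    have GK: "norm (G r y) \<le> K2" by (rule K2(2)[OF rb(1) yb0])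
    have Gk: "\<bar>G r y $ k\<bar> \<le> K2" for k using component_le_norm_cart[of "G r y" k] GK by linarith
    define v where "v = a * G r y $ i"
    have v: "\<bar>v\<bar> \<le> a * K2" using Gk[of i] a_pos by (simp add: v_def abs_mult)
    define X where "X = exit_event r d r0"
    define N where "N = space M - X"
    have Xp: "X \<in> sets (past_algebra (r + d))" and XM: "X \<in> events"
      unfolding X_def using exit_event_measurable(1,3)[OF rd] by auto
    have Np: "N \<in> sets (past_algebra (r + d))" using sets.compl_sets[OF Xp] by (simp add: N_def)
    define W where "W w = sqrt a *\<^sub>R (B (r + d) w - B r w)" for w
    have lf: "lift r y w (r + d) = y + W w" for w by (simp add: lift_def W_def)
    define dN where "dN = drift_increment i r (r + d) y"
    have dNp: "dN \<in> borel_measurable (past_algebra (r + d))" unfolding dN_def by (rule drift_increment_past[OF seg])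
    define \<Theta> where "\<Theta> w = dN w * step_value r (r + d) y w" for w
    have \<Theta>m: "\<Theta> \<in> borel_measurable M"
      unfolding \<Theta>_def using rd seg by (intro measurable_from_past[OF rd(2)] borel_measurable_times dNp step_value_past) auto
    have stay: "norm (lift r y w q - y) \<le> \<rho>" if "w \<in> space M" "w \<notin> X" "q \<in> {r..r + d}" for w q
      using no_exit_lift(2)[OF that(1) _ that(3), of \<rho> y] that(2) by (simp add: X_def r0_def)
    \<comment> \<open>The quadratic coefficients are concentrated in row \<open>i\<close> and
      doubled, so half of the form is \<open>u0 * g * W w $ i\<close>; the matrix need not be
      symmetric.\<close>
    have approx: "\<bar>\<Theta> w - (0 + (\<Sum>j\<in>UNIV. (u0 *\<^sub>R axis i 1) $ j * W w $ j) +
        (\<Sum>j\<in>UNIV. \<Sum>k\<in>UNIV. (if j = i then 2 * (u0 * G r y $ k) else 0) * (W w $ j * W w $ k)) / 2 + (- (u0 * v)) * d)\<bar>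
        \<le> (C1 * c) * (d + (norm (W w))\<^sup>2)" if w: "w \<in> space M" "w \<notin> exit_event r d r0" for w
    proof -
      have wX: "w \<notin> X" using w by (simp add: X_def)
      define D where "D = d + (norm (W w))\<^sup>2"
      have D: "d \<le> D" "(norm (W w))\<^sup>2 \<le> D" "0 \<le> D" using d by (auto simp: D_def)
      have W\<rho>: "norm (W w) \<le> \<rho>" using stay[OF w(1) wX, of "r + d"] d lf[of w] by simp
      define g where "g = W w \<bullet> G r y"
      have g: "\<bar>g\<bar> \<le> norm (W w) * K2" unfolding g_def
        by (rule order_trans[OF Cauchy_Schwarz_ineq2 mult_left_mono[OF GK norm_ge_zero]])
      define s where "s = step_value r (r + d) y w - u0 * (1 + g)"
      have s: "\<bar>s\<bar> \<le> Q * D"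
        using expand[OF r d(1) _ rd' y w(1) _ lf] d(2) \<rho>(1) order_trans[OF stay[OF w(1) wX] \<rho>(1)]
        unfolding s_def D_def u0_def g_def by simp
      define m where "m = (LBINT q:{r..r + d}. a * G q (lift r y w q) $ i) - v * d"
      have m: "\<bar>m\<bar> \<le> c * d"
      proof -
        have "\<bar>(LBINT q:{r..r + d}. a * G q (lift r y w q) $ i) - v * (r + d - r)\<bar> \<le> c * (r + d - r)"
        proof (rule set_integral_drift_bounds[OF _ seg])
          show "continuous_on {r..r + d} (lift r y w)" using w rd by (intro continuous_on_lift) auto
          fix q assume q: "q \<in> {r..r + d}"
          then have q': "q \<in> ?C" "\<bar>q - r\<bar> \<le> \<rho>1" using rb d \<rho>(2) by auto
          have "norm (G q (lift r y w q) - G r y) \<le> c / a"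
            using stay[OF w(1) wX q] \<rho>(2) by (intro \<rho>1(2) rb(1) q' yb0 yb[OF stay[OF w(1) wX q]]) auto
          then have "a * \<bar>(G q (lift r y w q) - G r y) $ i\<bar> \<le> c"
            using component_le_norm_cart[of "G q (lift r y w q) - G r y" i] a_pos
            by (simp add: pos_le_divide_eq mult.commute[of a] order_trans[OF mult_right_mono])
          then have "\<bar>a * (G q (lift r y w q) - G r y) $ i\<bar> \<le> c" using a_pos by (simp only: abs_mult abs_of_pos)
          then show "\<bar>a * G q (lift r y w q) $ i - v\<bar> \<le> c" by (simp add: v_def right_diff_distrib)
        qed
        then show ?thesis by (simp add: m_def)
      qed
      have dN_eq: "dN w = W w $ i - d * v - m"
        unfolding dN_def drift_increment_def m_def W_def by simp
      have poly: "0 + (\<Sum>j\<in>UNIV. (u0 *\<^sub>R axis i 1) $ j * W w $ j) +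
        (\<Sum>j\<in>UNIV. \<Sum>k\<in>UNIV. (if j = i then 2 * (u0 * G r y $ k) else 0) * (W w $ j * W w $ k)) / 2 + (- (u0 * v)) * d
        = u0 * (W w $ i + g * W w $ i - d * v)"
      proof -
        have 1: "(\<Sum>j\<in>UNIV. (u0 *\<^sub>R axis i 1) $ j * W w $ j) = u0 * W w $ i"
        proof -
          have "(\<Sum>j\<in>UNIV. (u0 *\<^sub>R axis i 1) $ j * W w $ j) = (\<Sum>j\<in>UNIV. if j = i then u0 * W w $ j else 0)"
            by (intro sum.cong refl) (auto simp: axis_def)
          then show ?thesis by simp
        qed
        have "(\<Sum>j\<in>UNIV. \<Sum>k\<in>UNIV. (if j = i then 2 * (u0 * G r y $ k) else 0) * (W w $ j * W w $ k)) =
          (\<Sum>j\<in>UNIV. if j = i then 2 * (u0 * g * W w $ i) else 0)"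
          unfolding g_def inner_vec_def by (intro sum.cong refl) (auto simp: sum_distrib_left sum_distrib_right mult_ac)
        then show ?thesis unfolding 1 by (simp add: algebra_simps)
      qed
      \<comment> \<open>Three errors: the oscillation \<open>m\<close> of the drift, the product of
        the first-order term \<open>g\<close> with the drift, and the error \<open>s\<close> of the
        step times the small increment.\<close>
      have eq: "\<Theta> w - u0 * (W w $ i + g * W w $ i - d * v) = - (u0 * m) + - (u0 * g * (d * v + m)) + s * (W w $ i - d * v - m)"
        unfolding \<Theta>_def dN_eq s_def by (simp add: algebra_simps)
      have dv: "\<bar>d * v\<bar> \<le> (a * K2) * d" using v d by (simp add: abs_mult mult.commute mult_left_mono)
      have m1: "\<bar>m\<bar> \<le> d" by (rule order_trans[OF m]) (use c d in simp)
      have dvm: "\<bar>d * v\<bar> + \<bar>m\<bar> \<le> V * d" using dv m1 unfolding V_def distrib_right by linarith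
      have t1: "\<bar>- (u0 * m)\<bar> \<le> U * (c * D)"
      proof -
        have "u0 * \<bar>m\<bar> \<le> U * (c * D)"
          using u0 order_trans[OF m mult_left_mono[OF D(1), of c]] c(1) by (intro mult_mono) auto
        then show ?thesis using u0 by (simp add: abs_mult)
      qed
      have t2: "\<bar>- (u0 * g * (d * v + m))\<bar> \<le> U * K2 * V * (c * D)"
      proof -
        have "norm (W w) * K2 \<le> c * K2" using W\<rho> \<rho>(3) K2(1) by (intro mult_right_mono) auto
        then have "\<bar>g\<bar> \<le> c * K2" using g by linarith
        moreover have "\<bar>d * v + m\<bar> \<le> V * D"
          using dvm mult_left_mono[OF D(1), of V] pos by linarith
        ultimately have "(u0 * \<bar>g\<bar>) * \<bar>d * v + m\<bar> \<le> (U * (c * K2)) * (V * D)"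
          using u0 c K2(1) by (intro mult_mono) auto
        then show ?thesis using u0 by (simp add: abs_mult mult_ac)
      qed
      have t3: "\<bar>s * (W w $ i - d * v - m)\<bar> \<le> Q * (1 + V) * (c * D)"
      proof -
        have "V * d \<le> V * c" using d(2) \<rho>(3) pos by (intro mult_left_mono) auto
        then have "\<bar>W w $ i - d * v - m\<bar> \<le> (1 + V) * c"
          using component_le_norm_cart[of "W w" i] W\<rho> \<rho>(3) dvm unfolding distrib_right by linarith
        then have "\<bar>s\<bar> * \<bar>W w $ i - d * v - m\<bar> \<le> (Q * D) * ((1 + V) * c)" using s Q D(3) by (intro mult_mono) auto
        then show ?thesis by (simp add: abs_mult mult_ac)
      qed
      have tri: "\<bar>p1 + p2 + p3\<bar> \<le> q1 + q2 + q3" if "\<bar>p1\<bar> \<le> q1" "\<bar>p2\<bar> \<le> q2" "\<bar>p3\<bar> \<le> q3" for p1 p2 p3 q1 q2 q3 :: real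
        using that by linarith
      have "\<bar>\<Theta> w - u0 * (W w $ i + g * W w $ i - d * v)\<bar> \<le> U * (c * D) + U * K2 * V * (c * D) + Q * (1 + V) * (c * D)"
        unfolding eq by (rule tri[OF t1 t2 t3])
      also have "\<dots> = (C1 * c) * D" by (simp add: C1_def algebra_simps)
      finally show ?thesis unfolding poly D_def .
    qed
    have bounds: "\<bar>0\<bar> \<le> K" "\<bar>(u0 *\<^sub>R axis i 1) $ j\<bar> \<le> K"
      "\<bar>if j = i then 2 * (u0 * G r y $ k) else 0\<bar> \<le> K" "\<bar>- (u0 * v)\<bar> \<le> K" for j k
    proof -
      have *: "\<bar>u0 * q\<bar> \<le> K" if "\<bar>q\<bar> \<le> 1 + 2 * K2 + a * K2" for q
        unfolding K_def abs_mult using u0 that by (intro mult_mono) auto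
      show "\<bar>0\<bar> \<le> K" using *[of 0] pos K2(1) by simp
      show "\<bar>(u0 *\<^sub>R axis i 1) $ j\<bar> \<le> K" using *[of "axis i 1 $ j"] pos K2(1) by (simp add: axis_def)
      have "\<bar>u0 * (2 * G r y $ k)\<bar> \<le> K" by (rule *) (use Gk[of k] pos K2(1) in linarith)
      then show "\<bar>if j = i then 2 * (u0 * G r y $ k) else 0\<bar> \<le> K"
        using *[of 0] pos K2(1) by (simp only: mult.left_commute[of u0]) auto
      show "\<bar>- (u0 * v)\<bar> \<le> K" using *[of v] v K2(1) by simp
    qed
    have "\<bar>(\<integral>w. indicator (space M - exit_event r d r0) w * \<Theta> w \<partial>M) - 0 -
       d * (- (u0 * v) + a / 2 * (\<Sum>j\<in>UNIV. if j = i then 2 * (u0 * G r y $ j) else 0))\<bar>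
      \<le> (C1 * c) * d * (1 + real CARD('a) * a) + K * expansion_bound a r0 * d\<^sup>2"
      by (rule short_time_expansion[OF rd d(1) r0 a_pos \<Theta>m bounds _ W_def approx])
        (use C1 c in auto)
    \<comment> \<open>The drift is chosen for this: the trace contributes
      \<open>a * u0 * G r y $ i\<close>, which is \<open>u0 * v\<close>.\<close>
    moreover have "- (u0 * v) + a / 2 * (\<Sum>j\<in>UNIV. if j = i then 2 * (u0 * G r y $ j) else 0) = 0" by (simp add: v_def)
    moreover have "(C1 * c) * d * (1 + real CARD('a) * a) \<le> h * d"
      using mult_right_mono[OF c(3), of d] d by (simp add: n_def mult_ac)
    ultimately have main: "\<bar>\<integral>w. indicator N w * \<Theta> w \<partial>M\<bar> \<le> h * d + C * d\<^sup>2"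
      unfolding N_def X_def C_def by (simp only: mult_zero_right diff_zero)
    have G: "(\<lambda>w. indicator N w * dN w) \<in> borel_measurable (past_algebra (r + d))"
      using Np dNp by (intro borel_measurable_times borel_measurable_indicator)
    have dNb: "\<bar>indicator N w * dN w\<bar> \<le> \<rho> + a * K2 * d" for w
    proof (cases "w \<in> N")
      case True
      then have w: "w \<in> space M" "w \<notin> X" by (auto simp: N_def)
      have "\<bar>dN w\<bar> \<le> \<rho> + a * K2 * (r + d - r)"
        unfolding dN_def
      proof (rule drift_increment_bound[OF w(1) seg])
        show "norm (G q (lift r y w q)) \<le> K2" if "q \<in> {r..r + d}" for q
          using K2(2)[OF _ yb[OF stay[OF w that]]] that rb by auto
        show "sqrt a * norm (B (r + d) w - B r w) \<le> \<rho>"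
          using no_exit_lift(1)[OF w(1), of r d \<rho> "r + d"] w(2) d by (simp add: X_def r0_def)
      qed
      then show ?thesis using True by simp
    next
      case False
      then show ?thesis using \<rho>_pos pos d by simp
    qed
    have int: "integrable M (\<lambda>w. indicator N w * dN w * F x r (path r y w))"
      by (rule integrable_bounded_mult[OF integrable_F[OF r01] measurable_from_past[OF rd(2) G] dNb])
    have "(\<integral>w. indicator N w * dN w * F x r (path r y w) \<partial>M) = (\<integral>w. indicator N w * \<Theta> w \<partial>M)"
      using markov_integral(1)[OF rd(1) seg(1) rd(2) G int] unfolding \<Theta>_def step_value_def by (simp only: mult.assoc)
    then show "\<bar>\<integral>w. indicator (space M - exit_event r d (\<rho> / sqrt a)) w * drift_increment i r (r + d) y w * F x r (path r y w) \<partial>M\<bar>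
        \<le> h * d + C * d\<^sup>2"
      using main unfolding N_def X_def r0_def dN_def by simp
  qed
qed

text \<open>The martingale property of the stopped process is obtained from sums over a grid that are
  stopped at the first large increment; their conditional increments are controlled by
  \<open>drift_one_step\<close>.\<close>

lemma strip_martingale:
  fixes N :: "real \<Rightarrow> 'c \<Rightarrow> real" and \<tau> :: "'c \<Rightarrow> real"
  assumes st: "s \<in> {e<..<e'}" "t \<in> {e<..<e'}" "s \<le> t"
    and A: "A \<in> sets (past_algebra s)"
    and \<tau>: "\<And>q. q \<in> {s..t} \<Longrightarrow> {v\<in>space M. q < \<tau> v} \<in> sets (past_algebra q)"
    and R: "\<And>v q. v \<in> space M \<Longrightarrow> q \<in> {s..t} \<Longrightarrow> q < \<tau> v \<Longrightarrow> norm (lift 0 y0 v q - y0) \<le> R \<and> \<bar>N q v\<bar> \<le> R"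
    and incr: "\<And>v r r'. v \<in> space M \<Longrightarrow> r \<in> {s..t} \<Longrightarrow> r' \<in> {s..t} \<Longrightarrow> r \<le> r' \<Longrightarrow>
      N r' v - N r v = drift_increment i r r' (lift 0 y0 v r) v"
    and cont: "\<And>v. v \<in> space M \<Longrightarrow> continuous_on {s..t} (\<lambda>q. N q v)"
    and meas: "\<And>q. q \<in> {s..t} \<Longrightarrow> N q \<in> borel_measurable (past_algebra q)"
  shows "(\<integral>v. indicator A v * (N (min t (\<tau> v)) v - N (min s (\<tau> v)) v) * F x 0 (path 0 y0 v) \<partial>M) = 0"
    (is "(\<integral>v. indicator A v * ?\<Delta> v * ?f v \<partial>M) = 0")
proof (cases "s = t")
  case True
  then show ?thesis by simp
next
  case False
  then have s_less_t: "s < t" using st by simp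
  have seg: "{s..t} \<subseteq> {e<..<e'}" using st by auto
  have z01: "(0::real) \<in> {0..1}" by simp
  have f_int: "integrable M ?f" by (rule integrable_F[OF z01])
  have u_pos: "0 < value_fun x 0 y0" by (rule value_fun_pos[OF z01])
  obtain K2 where K2: "1 \<le> K2" "\<And>r y. r \<in> {s..t} \<Longrightarrow> y \<in> cball y0 (R + 1) \<Longrightarrow> norm (G r y) \<le> K2"
    by (rule bounded_on_box[OF continuous_G, of "{s..t}" y0 "R + 1"]) (use st in auto)
  obtain K5 where K5: "1 \<le> K5" "\<And>r y. r \<in> {s..t} \<Longrightarrow> y \<in> cball y0 R \<Longrightarrow> \<bar>log_value r y\<bar> \<le> K5"
    by (rule value_fun_bounded[OF st(1,2), of y0 R]) blast
  define Cb where "Cb = 1 + a * K2"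
  have Cb: "0 \<le> Cb" unfolding Cb_def using a_pos K2 by simp
  define L where "L = (\<integral>v. indicator A v * ?\<Delta> v * ?f v \<partial>M)"
  let ?V = "exp K5 * value_fun x 0 y0"
  have small: "\<bar>L\<bar> \<le> (t - s) * \<epsilon> * ?V" if \<epsilon>: "0 < \<epsilon>" for \<epsilon>
  proof -
    obtain h C where h: "0 < h" "h \<le> 1" and C: "0 \<le> C"
      and step: "\<And>r d y. s \<le> r \<Longrightarrow> 0 < d \<Longrightarrow> d \<le> h \<Longrightarrow> r + d \<le> t \<Longrightarrow> y \<in> cball y0 R \<Longrightarrow>
      \<bar>\<integral>v. indicator (space M - exit_event r d (h / sqrt a)) v * drift_increment i r (r + d) y v * F x r (path r y v) \<partial>M\<bar>
        \<le> \<epsilon> * d + C * d\<^sup>2"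
      by (rule drift_one_step[OF st(1,2) \<epsilon>, of y0 R i]) blast
    define d where "d k = (t - s) / real (Suc k)" for k
    define T where "T k j = s + (t - s) * (real j / real (Suc k))" for k j
    have d: "0 < d k" for k using s_less_t by (simp add: d_def)
    have T_Suc: "T k (Suc j) = T k j + d k" for k j
      by (simp add: T_def d_def add_divide_distrib distrib_left del: of_nat_Suc) (simp add: add_divide_distrib distrib_left)
    have T_0: "T k 0 = s" for k by (simp add: T_def)
    have T_end: "T k (Suc k) = t" for k by (simp add: T_def del: of_nat_Suc)
    have T_mono: "T k i \<le> T k j" if "i \<le> j" for k i j
      unfolding T_def using grid_time_mono[of "t - s" i j "Suc k"] s_less_t that by simp
    have T_seg: "T k j \<in> {s..t}" if "j \<le> Suc k" for k j
      using T_mono[of 0 j k] T_mono[OF that, of k] by (simp add: T_0 T_end)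
    have T_seg2: "T k j \<in> {s..t}" "T k (Suc j) \<in> {s..t}" if "j < Suc k" for k j
      using T_seg[of j k] T_seg[of "Suc j" k] that by auto
    have d_lim: "d \<longlonglongrightarrow> 0"
      unfolding d_def[abs_def] using LIMSEQ_Suc[OF lim_const_over_n[of "t - s"]] by simp
    define r0 where "r0 = h / sqrt a"
    have r0: "0 < r0" using h a_pos by (simp add: r0_def)
    \<comment> \<open>Survival through step \<open>j\<close>: its starting time precedes
      \<open>\<tau>\<close> and no large increment has occurred, step \<open>j\<close>
      included.\<close>
    define c where "c k v j \<longleftrightarrow> T k j < \<tau> v \<and> (\<forall>i\<le>j. v \<notin> exit_event (T k i) (d k) r0)" for k v j
    have c_anti: "c k v j" if "j \<le> l" "c k v l" for k v j l
      using that T_mono[of j l k] unfolding c_def by auto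
    define S where "S k v = indicator A v * (\<Sum>j<Suc k. of_bool (c k v j) * (N (T k (Suc j)) v - N (T k j) v))" for k v
    have dN_le: "\<bar>drift_increment i (T k j) (T k (Suc j)) (lift 0 y0 v (T k j)) v\<bar> \<le> Cb"
      if k: "d k \<le> h" and j: "j < Suc k" and v: "v \<in> space M" "T k j < \<tau> v" "v \<notin> exit_event (T k j) (d k) r0" for k j v
    proof -
      note Tj = T_seg2[OF j]
      have le: "T k j \<le> T k (Suc j)" using T_mono by simp
      have sub: "{T k j..T k (Suc j)} \<subseteq> {s..t}" using Tj by auto
      have "\<bar>drift_increment i (T k j) (T k (Suc j)) (lift 0 y0 v (T k j)) v\<bar> \<le> h + a * K2 * (T k (Suc j) - T k j)"
      proof (rule drift_increment_bound[OF v(1) le])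
        show "{T k j..T k (Suc j)} \<subseteq> {e..e'}" using Tj st(1,2) by auto
        show "sqrt a * norm (B (T k (Suc j)) v - B (T k j) v) \<le> h"
          using no_exit_lift(1)[OF v(1), of "T k j" "d k" h "T k (Suc j)"] v(3) d[of k] T_Suc[of k j] by (simp add: r0_def)
        fix q assume q: "q \<in> {T k j..T k (Suc j)}"
        have "norm (lift (T k j) (lift 0 y0 v (T k j)) v q - lift 0 y0 v (T k j)) \<le> h"
          using no_exit_lift(2)[OF v(1), of "T k j" "d k" h q] v(3) q T_Suc[of k j] by (simp add: r0_def)
        moreover have "norm (lift 0 y0 v (T k j) - y0) \<le> R" using R[OF v(1) Tj(1) v(2)] by simp
        ultimately have "norm (lift (T k j) (lift 0 y0 v (T k j)) v q - y0) \<le> R + 1"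
          using norm_triangle_ineq[of "lift (T k j) (lift 0 y0 v (T k j)) v q - lift 0 y0 v (T k j)" "lift 0 y0 v (T k j) - y0"] h(2)
          by simp
        then show "norm (G q (lift (T k j) (lift 0 y0 v (T k j)) v q)) \<le> K2"
          using q sub by (intro K2(2)) (auto simp: dist_norm norm_minus_commute)
      qed
      also have "\<dots> \<le> 1 + a * K2 * 1"
        using h k T_Suc[of k j] a_pos K2 by (intro add_mono mult_left_mono) auto
      finally show ?thesis by (simp add: Cb_def)
    qed
    \<comment> \<open>The sum stops on the grid and may pass \<open>\<tau>\<close>, but by a single
      increment, which is at most \<open>Cb\<close> because no exit happens during that step. This
      yields the dominating function for the limit.\<close>
    have S_le: "\<bar>S k v\<bar> \<le> 2 * \<bar>R\<bar> + Cb" if k: "d k \<le> h" and v: "v \<in> space M" for k v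
    proof -
      obtain J where J: "J \<le> Suc k" "\<And>j. j < Suc k \<Longrightarrow> c k v j \<longleftrightarrow> j < J"
        "(\<Sum>j<Suc k. of_bool (c k v j) * (N (T k (Suc j)) v - N (T k j) v)) = N (T k J) v - N (T k 0) v"
        by (rule sum_antimono_telescope[of "c k v" "Suc k" "\<lambda>j. N (T k j) v"]) (use c_anti in blast)+
      have "\<bar>N (T k J) v - N (T k 0) v\<bar> \<le> 2 * \<bar>R\<bar> + Cb"
      proof (cases J)
        case 0
        then show ?thesis using Cb by simp
      next
        case (Suc j)
        have cj: "c k v j" "c k v 0" using J(1) J(2)[of j] J(2)[of 0] Suc by auto
        then have tj: "T k j < \<tau> v" "T k 0 < \<tau> v" "v \<notin> exit_event (T k j) (d k) r0" by (auto simp: c_def)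
        have js: "T k j \<in> {s..t}" "T k (Suc j) \<in> {s..t}" "T k 0 \<in> {s..t}" using T_seg Suc J(1) by auto
        have "\<bar>N (T k (Suc j)) v - N (T k j) v\<bar> \<le> Cb"
          unfolding incr[OF v js(1,2) T_mono[OF le_SucI[OF order_refl]]] using Suc J(1) by (intro dN_le k v tj) auto
        moreover have "\<bar>N (T k j) v\<bar> \<le> R" "\<bar>N (T k 0) v\<bar> \<le> R" using R[OF v js(1) tj(1)] R[OF v js(3) tj(2)] by auto
        ultimately show ?thesis unfolding Suc by linarith
      qed
      then show ?thesis unfolding S_def J(3) using Cb by (cases "v \<in> A") auto
    qed
    \<comment> \<open>On fine grids a continuous path has no large increment, so the sum stops at
      the grid time following \<open>\<tau>\<close>, or at \<open>t\<close>.\<close>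
    have S_lim: "(\<lambda>k. S k v) \<longlonglongrightarrow> indicator A v * ?\<Delta> v" if v: "v \<in> space M" for v
    proof (cases "s < \<tau> v")
      case False
      then have "\<not> c k v j" for k j using T_mono[of 0 j k] unfolding c_def T_0 by auto
      then have "S k v = 0" for k by (simp add: S_def)
      moreover have "?\<Delta> v = 0" using False s_less_t by (simp add: min_def)
      ultimately show ?thesis by simp
    next
      case True
      define m where "m = min t (\<tau> v)"
      have m: "m \<in> {s..t}" "min s (\<tau> v) = s" using True s_less_t by (auto simp: m_def)
      show ?thesis
      proof (rule LIMSEQ_I)
        fix \<eta>' :: real assume \<eta>': "0 < \<eta>'"
        have "uniformly_continuous_on {s..t} (\<lambda>q. N q v)" by (intro compact_uniformly_continuous cont v) auto
        then obtain d1 where d1: "d1 > 0" "\<And>q r. q \<in> {s..t} \<Longrightarrow> r \<in> {s..t} \<Longrightarrow> dist r q < d1 \<Longrightarrow> dist (N r v) (N q v) < \<eta>'"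
          using \<eta>' unfolding uniformly_continuous_on_def by metis
        have "uniformly_continuous_on {0..1} (\<lambda>q. B q v)" by (intro compact_uniformly_continuous continuous_on_B v) auto
        then obtain d2 where d2: "d2 > 0" "\<And>q r. q \<in> {0..1} \<Longrightarrow> r \<in> {0..1} \<Longrightarrow> dist r q < d2 \<Longrightarrow> dist (B r v) (B q v) < r0"
          using r0 unfolding uniformly_continuous_on_def by metis
        have "\<forall>\<^sub>F k in sequentially. d k < min d1 d2" using order_tendstoD(2)[OF d_lim, of "min d1 d2"] d1 d2 by auto
        then obtain k0 where k0: "\<And>k. k \<ge> k0 \<Longrightarrow> d k < min d1 d2" unfolding eventually_sequentially by blast
        show "\<exists>k0. \<forall>k\<ge>k0. norm (S k v - indicator A v * ?\<Delta> v) < \<eta>'"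
        proof (intro exI allI impI)
          fix k assume "k0 \<le> k"
          then have k: "d k < d1" "d k < d2" using k0 by auto
          have noexit: "v \<notin> exit_event (T k j) (d k) r0" if "j < Suc k" for j
          proof -
            have "norm (B q v - B (T k j) v) \<le> r0" if "q \<in> {T k j..T k j + d k}" for q
            proof -
              have "T k j \<in> {0..1}" "q \<in> {0..1}" using T_seg2[OF \<open>j < Suc k\<close>] that T_Suc[of k j] st e by auto
              moreover have "dist q (T k j) < d2" using that k by (simp add: dist_real_def)
              ultimately show ?thesis using d2(2)[of "T k j" q] by (simp add: dist_norm)
            qed
            then show ?thesis by (force simp: exit_event_def not_less)
          qed
          obtain J where J: "J \<le> Suc k" "\<And>j. j < Suc k \<Longrightarrow> c k v j \<longleftrightarrow> j < J"
            "(\<Sum>j<Suc k. of_bool (c k v j) * (N (T k (Suc j)) v - N (T k j) v)) = N (T k J) v - N (T k 0) v"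
            by (rule sum_antimono_telescope[of "c k v" "Suc k" "\<lambda>j. N (T k j) v"]) (use c_anti in blast)+
          have cJ: "T k j < \<tau> v \<longleftrightarrow> j < J" if "j < Suc k" for j
            using J(2)[OF that] noexit that unfolding c_def by auto
          have J0: "0 < J" using cJ[of 0] True by (simp add: T_0)
          then obtain j where j: "J = Suc j" using gr0_implies_Suc by blast
          have tj: "T k j < \<tau> v" using cJ[of j] J(1) j by auto
          have TJ: "T k J = T k j + d k" unfolding j T_Suc ..
          have TJs: "T k J \<in> {s..t}" "T k j \<in> {s..t}" using T_seg J(1) j by auto
          have "dist (T k J) m < d1"
          proof (cases "J = Suc k")
            case True
            then have "T k J = t" by (simp add: T_end)
            then show ?thesis using tj TJ TJs k d[of k] unfolding m_def dist_real_def by (auto simp: min_def)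
          next
            case False
            then have "\<not> T k J < \<tau> v" using cJ[of J] J(1) by simp
            then have "m = \<tau> v" "\<tau> v \<le> T k J" using TJs by (auto simp: m_def)
            then show ?thesis using tj TJ k by (simp add: dist_real_def)
          qed
          then have "dist (N (T k J) v) (N m v) < \<eta>'" by (rule d1(2)[OF m(1) TJs(1)])
          moreover have "S k v - indicator A v * ?\<Delta> v = indicator A v * (N (T k J) v - N m v)"
            unfolding S_def J(3) T_0 m(2) m_def[symmetric] by (simp add: algebra_simps)
          ultimately show "norm (S k v - indicator A v * ?\<Delta> v) < \<eta>'"
            using \<eta>' by (cases "v \<in> A") (auto simp: dist_real_def)
        qed
      qed
    qed
    \<comment> \<open>Survival up to the start of step \<open>j\<close> is past information; the
      absence of an exit during step \<open>j\<close> is future information and goes into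
      \<open>X\<close>. This matches the shape of \<open>markov_integral_product\<close>.\<close>
    define Aj where "Aj k j = A \<inter> {v\<in>space M. T k j < \<tau> v} \<inter> {v\<in>space M. \<forall>i\<in>{..<j}. v \<notin> exit_event (T k i) (d k) r0}" for k j
    have Aj: "Aj k j \<in> sets (past_algebra (T k j))" if j: "j < Suc k" for k j
    proof -
      have js: "T k j \<in> {s..t}" using T_seg[of j k] j by simp
      have 1: "A \<in> sets (past_algebra (T k j))" using A past_mono[of s "T k j"] js by auto
      have 2: "{v\<in>space M. T k j < \<tau> v} \<in> sets (past_algebra (T k j))" by (rule \<tau>[OF js])
      have "{v\<in>space (past_algebra (T k j)). \<forall>i\<in>{..<j}. v \<notin> exit_event (T k i) (d k) r0} \<in> sets (past_algebra (T k j))"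
      proof (rule sets.sets_Collect_countable_All')
        fix i assume i: "i \<in> {..<j}"
        have ts: "T k i \<in> {s..t}" "T k (Suc i) \<in> {s..t}" using T_seg[of i k] T_seg[of "Suc i" k] i j by auto
        then have "exit_event (T k i) (d k) r0 \<in> sets (past_algebra (T k i + d k))"
          using st e T_Suc[of k i] by (intro exit_event_measurable) auto
        moreover have "T k i + d k \<le> T k j" unfolding T_Suc[symmetric] using i by (intro T_mono) auto
        ultimately have "exit_event (T k i) (d k) r0 \<in> sets (past_algebra (T k j))" using past_mono by blast
        from sets.compl_sets[OF this]
        show "{v\<in>space (past_algebra (T k j)). v \<notin> exit_event (T k i) (d k) r0} \<in> sets (past_algebra (T k j))"
          by (simp add: set_diff_eq)
      qed simp
      then have 3: "{v\<in>space M. \<forall>i\<in>{..<j}. v \<notin> exit_event (T k i) (d k) r0} \<in> sets (past_algebra (T k j))" by simp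
      show ?thesis unfolding Aj_def by (intro sets.Int 1 2 3)
    qed
    define X where "X k j = space M - exit_event (T k j) (d k) r0" for k j
    define \<Theta> where "\<Theta> k j z v = indicator (X k j) v * drift_increment i (T k j) (T k (Suc j)) z v" for k j z v
    let ?Q = "\<lambda>k j v. indicator (Aj k j) v * \<Theta> k j (lift 0 y0 v (T k j)) v"
    have S_eq: "S k v = (\<Sum>j<Suc k. ?Q k j v)" if v: "v \<in> space M" for k v
      unfolding S_def sum_distrib_left
    proof (intro sum.cong refl)
      fix j assume "j \<in> {..<Suc k}"
      then have js: "T k j \<in> {s..t}" "T k (Suc j) \<in> {s..t}" using T_seg2 by auto
      have "indicator A v * (of_bool (c k v j) :: real) = indicator (Aj k j) v * indicator (X k j) v"
        using v by (auto simp: c_def Aj_def X_def indicator_def le_less)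
      then show "indicator A v * (of_bool (c k v j) * (N (T k (Suc j)) v - N (T k j) v)) =
        ?Q k j v"
        unfolding incr[OF v js T_mono[OF le_SucI[OF order_refl]]] \<Theta>_def by (simp add: mult.assoc[symmetric])
    qed
    have X: "X k j \<in> sets (future_algebra (T k j))" if "j < Suc k" for k j
    proof -
      have "exit_event (T k j) (d k) r0 \<in> sets (future_algebra (T k j))"
        using T_seg2[OF that] st e T_Suc[of k j] by (intro exit_event_measurable) auto
      from sets.compl_sets[OF this] show ?thesis by (simp add: X_def)
    qed
    have \<Theta>: "(\<lambda>(y, v). \<Theta> k j y v) \<in> borel_measurable (borel \<Otimes>\<^sub>M future_algebra (T k j))" if j: "j < Suc k" for k j
    proof -
      have "{T k j..T k (Suc j)} \<subseteq> {e..e'}" using T_seg2[OF j] st by auto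
      note m = drift_increment_future[OF T_mono[OF le_SucI[OF order_refl]] this]
      have "(\<lambda>\<zeta>. indicator (X k j) (snd \<zeta>) * (case \<zeta> of (y, v) \<Rightarrow> drift_increment i (T k j) (T k (Suc j)) y v))
          \<in> borel_measurable (borel \<Otimes>\<^sub>M future_algebra (T k j))"
        by (intro borel_measurable_times m measurable_compose[OF measurable_snd borel_measurable_indicator[OF X[OF j]]])
      then show ?thesis by (simp add: \<Theta>_def case_prod_beta)
    qed
    have AM: "indicator (Aj k j) \<in> borel_measurable M"
      and Gl: "(\<lambda>v. \<Theta> k j (lift 0 y0 v (T k j)) v) \<in> borel_measurable M" if j: "j < Suc k" for k j
    proof -
      have r01: "T k j \<in> {0..1}" using T_seg2[OF j] st e by auto
      show "indicator (Aj k j) \<in> borel_measurable M"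
        using r01 by (intro measurable_from_past[OF _ borel_measurable_indicator[OF Aj[OF j]]]) simp
      have L: "(\<lambda>v. lift 0 y0 v (T k j)) \<in> past_algebra (T k j) \<rightarrow>\<^sub>M borel" using r01 by (intro measurable_lift_past) auto
      have "(\<lambda>v. case (v, v) of (v, v') \<Rightarrow> \<Theta> k j (lift 0 y0 v (T k j)) v') \<in> borel_measurable M"
        by (rule measurable_compose[OF measurable_diagonal[OF r01] measurable_past_future[OF r01 L \<Theta>[OF j]]])
      then show "(\<lambda>v. \<Theta> k j (lift 0 y0 v (T k j)) v) \<in> borel_measurable M" by simp
    qed
    have S_meas: "S k \<in> borel_measurable M" for k
      by (rule measurable_cong[THEN iffD2], erule S_eq) (intro borel_measurable_sum borel_measurable_times AM Gl, auto)
    have summand: "integrable M (\<lambda>v. ?Q k j v * ?f v)"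
      "\<bar>\<integral>v. ?Q k j v * ?f v \<partial>M\<bar> \<le>
        (\<epsilon> * d k + C * (d k)\<^sup>2) * ?V"
      if k: "d k \<le> h" and j: "j < Suc k" for k j
    proof -
      define r where "r = T k j"
      have js: "r \<in> {s..t}" "T k (Suc j) \<in> {s..t}" using T_seg2[OF j] by (auto simp: r_def)
      have r01: "0 \<le> r" "r \<le> 1" "r \<in> {0..1}" using js st e by auto
      have G: "indicator (Aj k j) \<in> borel_measurable (past_algebra r)"
        unfolding r_def by (rule borel_measurable_indicator[OF Aj[OF j]])
      note \<Theta> = \<Theta>[OF j, folded r_def] and Gl = Gl[OF j, folded r_def] and AM = AM[OF j]
      have b: "\<bar>indicator (Aj k j) v * \<Theta> k j (lift 0 y0 v r) v\<bar> \<le> Cb" if v: "v \<in> space M" for v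
      proof (cases "v \<in> Aj k j \<and> v \<in> X k j")
        case True
        then have "T k j < \<tau> v" "v \<notin> exit_event (T k j) (d k) r0" by (auto simp: Aj_def X_def)
        from dN_le[OF k j v this] show ?thesis using True by (simp add: \<Theta>_def r_def)
      next
        case False
        then show ?thesis using Cb by (auto simp: \<Theta>_def)
      qed
      have int: "integrable M (\<lambda>v. indicator (Aj k j) v * \<Theta> k j (lift 0 y0 v r) v * ?f v)"
        by (rule integrable_bounded_mult[OF f_int borel_measurable_times[OF AM Gl] b])
      then show "integrable M (\<lambda>v. ?Q k j v * ?f v)" by (simp add: r_def)
      define g where "g z = (\<integral>v. \<Theta> k j z v * F x r (path r z v) \<partial>M)" for z
      define \<eta>k where "\<eta>k = \<epsilon> * d k + C * (d k)\<^sup>2"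
      have \<eta>k: "0 \<le> \<eta>k" unfolding \<eta>k_def using \<epsilon> C d[of k] by simp
      have g: "\<bar>g z\<bar> \<le> \<eta>k" if "z \<in> cball y0 R" for z
        using step[of r "d k" z] js T_Suc[of k j] d[of k] k that
        unfolding g_def \<Theta>_def X_def \<eta>k_def r_def r0_def by simp
      have eq: "(\<integral>v. indicator (Aj k j) v * \<Theta> k j (lift 0 y0 v r) v * ?f v \<partial>M) =
          (\<integral>v. indicator (Aj k j) v * weight 0 r (path 0 y0 v) * g (lift 0 y0 v r) \<partial>M)"
        and ig: "integrable M (\<lambda>v. indicator (Aj k j) v * weight 0 r (path 0 y0 v) * g (lift 0 y0 v r))"
        using markov_integral_product[OF order_refl r01(1,2) G \<Theta> int] unfolding g_def by auto
      have iA: "integrable M (\<lambda>v. indicator (Aj k j) v * ?f v)"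
        by (rule integrable_bounded_mult[OF f_int AM, where c = 1]) (simp add: indicator_def)
      note mA = markov_integral[OF order_refl r01(1,2) G iA]
      \<comment> \<open>On \<open>Aj\<close> the position is in the ball, where the value function
        is at least \<open>exp (- K5)\<close>. Inserting it lets the Markov property turn the weight
        back into \<open>F\<close>, whose integral is at most the total value.\<close>
      have pt: "\<bar>indicator (Aj k j) v * weight 0 r (path 0 y0 v) * g (lift 0 y0 v r)\<bar> \<le>
        \<eta>k * exp K5 * (indicator (Aj k j) v * (weight 0 r (path 0 y0 v) * value_fun x r (lift 0 y0 v r)))" if v: "v \<in> space M" for v
      proof (cases "v \<in> Aj k j")
        case True
        then have "T k j < \<tau> v" by (simp add: Aj_def)
        then have ball: "lift 0 y0 v r \<in> cball y0 R"
          using R[OF v js(1)] by (simp add: r_def dist_norm norm_minus_commute)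
        have "- K5 \<le> log_value r (lift 0 y0 v r)" using K5(2)[OF js(1) ball] by linarith
        then have "1 \<le> exp K5 * value_fun x r (lift 0 y0 v r)"
          unfolding exp_log_value[OF r01(3), symmetric] exp_add[symmetric] by simp
        then have "\<bar>g (lift 0 y0 v r)\<bar> * 1 \<le> \<eta>k * (exp K5 * value_fun x r (lift 0 y0 v r))"
          using g[OF ball] \<eta>k by (intro mult_mono) auto
        then have "weight 0 r (path 0 y0 v) * \<bar>g (lift 0 y0 v r)\<bar> \<le>
          weight 0 r (path 0 y0 v) * (\<eta>k * (exp K5 * value_fun x r (lift 0 y0 v r)))"
          using weight_pos[of 0 r] by (intro mult_left_mono) (auto intro: less_imp_le)
        moreover have "\<bar>indicator (Aj k j) v * weight 0 r (path 0 y0 v) * g (lift 0 y0 v r)\<bar> =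
          weight 0 r (path 0 y0 v) * \<bar>g (lift 0 y0 v r)\<bar>"
          using True weight_pos[of 0 r "path 0 y0 v"] by (simp add: abs_mult)
        ultimately show ?thesis using True by (simp add: mult_ac)
      qed simp
      have "\<bar>\<integral>v. indicator (Aj k j) v * weight 0 r (path 0 y0 v) * g (lift 0 y0 v r) \<partial>M\<bar> \<le>
        (\<integral>v. \<eta>k * exp K5 * (indicator (Aj k j) v * (weight 0 r (path 0 y0 v) * value_fun x r (lift 0 y0 v r))) \<partial>M)"
        by (rule order_trans[OF integral_abs_bound integral_mono[OF integrable_abs[OF ig] integrable_mult_right[OF mA(2)] pt]])
      also have "\<dots> = \<eta>k * exp K5 * (\<integral>v. indicator (Aj k j) v * ?f v \<partial>M)"
        unfolding mA(1) by (rule integral_mult_right_zero)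
      also have "\<dots> \<le> \<eta>k * exp K5 * value_fun x 0 y0"
        unfolding value_fun_def
      proof (intro mult_left_mono integral_mono[OF iA f_int])
        show "indicator (Aj k j) v * ?f v \<le> ?f v" for v using F_pos[of x 0 "path 0 y0 v"] by (simp add: indicator_def)
      qed (use \<eta>k in auto)
      finally show "\<bar>\<integral>v. ?Q k j v * ?f v \<partial>M\<bar> \<le>
        (\<epsilon> * d k + C * (d k)\<^sup>2) * ?V"
        using eq unfolding r_def[symmetric] \<eta>k_def by (simp only: mult.assoc)
    qed
    \<comment> \<open>The number of steps times the mesh is \<open>t - s\<close>, so the linear
      errors add up to \<open>\<epsilon>\<close> times that length and the quadratic ones vanish
      with the mesh.\<close>
    have ES: "\<bar>\<integral>v. S k v * ?f v \<partial>M\<bar> \<le> (t - s) * (\<epsilon> + C * d k) * ?V" if k: "d k \<le> h" for k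
    proof -
      have "(\<integral>v. S k v * ?f v \<partial>M) = (\<integral>v. (\<Sum>j<Suc k. ?Q k j v * ?f v) \<partial>M)"
        by (intro Bochner_Integration.integral_cong refl) (simp only: S_eq sum_distrib_right)
      also have "\<dots> = (\<Sum>j<Suc k. \<integral>v. ?Q k j v * ?f v \<partial>M)"
        by (rule Bochner_Integration.integral_sum) (use summand(1)[OF k] in auto)
      finally have "\<bar>\<integral>v. S k v * ?f v \<partial>M\<bar> \<le> (\<Sum>j<Suc k. (\<epsilon> * d k + C * (d k)\<^sup>2) * ?V)"
        using summand(2)[OF k] by (simp only:) (rule order_trans[OF sum_abs sum_mono], auto)
      also have "\<dots> = (real (Suc k) * d k) * (\<epsilon> + C * d k) * ?V"
        by (simp add: algebra_simps power2_eq_square)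
      also have "real (Suc k) * d k = t - s" by (simp add: d_def)
      finally show ?thesis .
    qed
    have ev: "\<forall>\<^sub>F k in sequentially. d k \<le> h"
      using order_tendstoD(2)[OF d_lim h(1)] by (auto elim: eventually_mono)
    then obtain k0 where k0: "\<And>k. k \<ge> k0 \<Longrightarrow> d k \<le> h" unfolding eventually_sequentially by blast
    have "(\<lambda>k. \<integral>v. S (k + k0) v * ?f v \<partial>M) \<longlonglongrightarrow> L"
      unfolding L_def
    proof (rule integral_dominated_convergence[where w = "\<lambda>v. (2 * \<bar>R\<bar> + Cb) * ?f v"])
      have lim: "(\<lambda>k. S k v) \<longlonglongrightarrow> indicator A v * ?\<Delta> v" if "v \<in> space M" for v by (rule S_lim[OF that])
      show "(\<lambda>v. indicator A v * ?\<Delta> v * ?f v) \<in> borel_measurable M"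
        by (intro borel_measurable_times measurable_F_M[OF z01] borel_measurable_LIMSEQ_metric[OF S_meas lim]) auto
      show "(\<lambda>v. S (k + k0) v * ?f v) \<in> borel_measurable M" for k
        by (intro borel_measurable_times measurable_F_M[OF z01] S_meas)
      show "integrable M (\<lambda>v. (2 * \<bar>R\<bar> + Cb) * ?f v)" using f_int by simp
      show "AE v in M. (\<lambda>k. S (k + k0) v * ?f v) \<longlonglongrightarrow> indicator A v * ?\<Delta> v * ?f v"
        by (rule AE_I2) (intro tendsto_intros LIMSEQ_ignore_initial_segment lim)
      show "AE v in M. norm (S (k + k0) v * ?f v) \<le> (2 * \<bar>R\<bar> + Cb) * ?f v" for k
        using S_le[OF k0[of "k + k0"]] less_imp_le[OF F_pos]
        by (intro AE_I2) (auto simp: abs_mult intro!: mult_right_mono)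
    qed
    then have "(\<lambda>k. \<bar>\<integral>v. S (k + k0) v * ?f v \<partial>M\<bar>) \<longlonglongrightarrow> \<bar>L\<bar>" by (rule tendsto_rabs)
    moreover have "(\<lambda>k. (t - s) * (\<epsilon> + C * d (k + k0)) * ?V) \<longlonglongrightarrow>
        (t - s) * (\<epsilon> + C * 0) * ?V"
      by (intro tendsto_intros LIMSEQ_ignore_initial_segment d_lim)
    ultimately have "\<bar>L\<bar> \<le> (t - s) * (\<epsilon> + C * 0) * ?V"
      by (rule LIMSEQ_le) (use ES k0 in auto)
    then show ?thesis by simp
  qed
  have "\<bar>L\<bar> \<le> 0"
  proof (rule field_le_epsilon)
    fix \<epsilon> :: real assume \<epsilon>: "0 < \<epsilon>"
    define c where "c = (t - s) * ?V"
    have c: "0 < c" unfolding c_def using s_less_t u_pos by simp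
    have "\<bar>L\<bar> \<le> (t - s) * (\<epsilon> / c) * ?V" by (rule small) (use \<epsilon> c in simp)
    also have "\<dots> = c * (\<epsilon> / c)" by (simp add: c_def mult_ac)
    also have "\<dots> = \<epsilon>" using c by simp
    finally show "\<bar>L\<bar> \<le> 0 + \<epsilon>" by simp
  qed
  then show ?thesis unfolding L_def by simp
qed

section \<open>One-sided limits at the ends of a strip\<close>

text \<open>The potential solved from the equation. Unlike \<open>p\<close>, it is continuous up to
  the ends of the strip; so the equation itself provides the one-sided limits of the potential at
  ends that do not belong to \<open>T\<close>.\<close>

definition hj_potential :: "real \<Rightarrow> real^'a \<Rightarrow> real" where
  "hj_potential r y = - (Tm r y + a * (\<Sum>i\<in>UNIV. H r y $ i $ i) / 2 + a * (norm (G r y))\<^sup>2 / 2)"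

lemma potential_eq: "r \<in> {e<..<e'} \<Longrightarrow> potential r y = hj_potential r y"
  using hamilton_jacobi[of r y] unfolding hj_potential_def by linarith

lemma continuous_hj_potential: "continuous_on ({e..e'} \<times> UNIV) (\<lambda>(r, y). hj_potential r y)"
proof -
  have "continuous_on ({e..e'} \<times> UNIV) (\<lambda>z. - ((case z of (r, y) \<Rightarrow> Tm r y) +
      a * (\<Sum>i\<in>UNIV. (case z of (r, y) \<Rightarrow> H r y) $ i $ i) / 2 + a * (norm (case z of (r, y) \<Rightarrow> G r y))\<^sup>2 / 2))"
    by (intro continuous_intros continuous_Tm continuous_H continuous_G) auto
  then show ?thesis by (simp add: case_prod_beta hj_potential_def)
qed

lemma within_strip_not_bot:
  assumes "c \<in> {e..e'}" shows "at c within {e<..<e'} \<noteq> bot"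
proof -
  consider "c = e" | "c = e'" | "c \<in> {e<..<e'}" using assms by fastforce
  then show ?thesis
  proof cases
    case 1 then show ?thesis using islimpt_greaterThanLessThan1[OF e(2)] by (simp add: trivial_limit_within)
  next
    case 2 then show ?thesis using islimpt_greaterThanLessThan2[OF e(2)] by (simp add: trivial_limit_within)
  next
    case 3 then show ?thesis using at_within_open[OF 3] by simp
  qed
qed

lemma continuous_tendsto_within:
  fixes f :: "real \<Rightarrow> real^'a \<Rightarrow> 'z::real_normed_vector"
  assumes "continuous_on ({e..e'} \<times> UNIV) (\<lambda>(r, y). f r y)" "c \<in> {e..e'}"
  shows "((\<lambda>r. f r y) \<longlongrightarrow> f c y) (at c within {e<..<e'})"
proof -
  have "continuous_on {e..e'} (\<lambda>r. case (r, y) of (r, y) \<Rightarrow> f r y)"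
    by (rule continuous_on_compose2[OF assms(1)]) (auto intro!: continuous_intros)
  then have "((\<lambda>r. f r y) \<longlongrightarrow> f c y) (at c within {e..e'})"
    using assms(2) unfolding continuous_on_def by auto
  then show ?thesis by (rule tendsto_within_subset) auto
qed

section \<open>Derivatives at the ends of a strip\<close>

text \<open>Differentiation of a limit: \<open>Df\<close> varies with time only through the
  coefficient \<open>g\<close>, the gradient or the Hessian, whose uniform continuity on compact
  boxes makes the derivatives converge locally uniformly along a sequence of interior times.\<close>

lemma limit_derivative:
  fixes f :: "real \<Rightarrow> real^'a \<Rightarrow> 'z::banach" and g :: "real \<Rightarrow> real^'a \<Rightarrow> 'y::real_normed_vector"
  assumes c: "c \<in> {e..e'}" and Df: "\<And>r y. r \<in> {e<..<e'} \<Longrightarrow> (f r has_derivative Df r y) (at y)"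
    and g: "continuous_on ({e..e'} \<times> UNIV) (\<lambda>(r, y). g r y)" "0 < K"
      "\<And>r y h. norm (Df r y h - Df c y h) \<le> K * norm (g r y - g c y) * norm h"
    and f: "\<And>y. ((\<lambda>r. f r y) \<longlongrightarrow> fc y) (at c within {e<..<e'})"
  shows "(fc has_derivative Df c y) (at y)"
proof -
  have "c islimpt {e<..<e'}" using within_strip_not_bot[OF c] by (simp add: trivial_limit_within)
  then obtain R where R: "\<And>n. R n \<in> {e<..<e'} - {c}" "R \<longlonglongrightarrow> c" unfolding islimpt_sequential by blast
  have lim: "(\<lambda>n. f (R n) y') \<longlonglongrightarrow> fc y'" for y'
    using R by (intro filterlim_compose[OF f]) (auto simp: filterlim_at)
  have "\<exists>g. \<forall>x\<in>ball y 1. (\<lambda>n. f (R n) x) \<longlonglongrightarrow> g x \<and> (g has_derivative Df c x) (at x within ball y 1)"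
  proof (rule has_derivative_sequence)
    fix b :: real assume b: "0 < b"
    obtain k where k: "0 < k" "\<And>r r' y1 y2. r \<in> {e..e'} \<Longrightarrow> r' \<in> {e..e'} \<Longrightarrow> y1 \<in> cball y 1 \<Longrightarrow> y2 \<in> cball y 1 \<Longrightarrow>
        \<bar>r' - r\<bar> \<le> k \<Longrightarrow> norm (y2 - y1) \<le> k \<Longrightarrow> norm (g r' y2 - g r y1) \<le> b / K"
      using near_box[OF g(1) compact_Icc order_refl, of "b / K" y 1] b g(2) by auto
    show "\<forall>\<^sub>F n in sequentially. \<forall>x\<in>ball y 1. \<forall>h. norm (Df (R n) x h - Df c x h) \<le> b * norm h"
      using tendstoD[OF R(2) k(1)]
    proof eventually_elim
      case (elim n)
      show ?case
      proof (intro ballI allI)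
        fix x h assume "x \<in> ball y 1"
        then have "norm (g (R n) x - g c x) \<le> b / K" using k(2)[of c "R n" x x] c R(1)[of n] elim k(1) by (auto simp: dist_real_def)
        then have "K * norm (g (R n) x - g c x) \<le> b" using g(2) by (simp add: field_simps)
        then show "norm (Df (R n) x h - Df c x h) \<le> b * norm h"
          by (intro order_trans[OF g(3)] mult_right_mono) auto
      qed
    qed
  qed (use R(1) in \<open>auto intro!: has_derivative_at_withinI Df lim[of y]\<close>)
  then obtain f' where f': "\<And>x. x \<in> ball y 1 \<Longrightarrow> (\<lambda>n. f (R n) x) \<longlonglongrightarrow> f' x"
    "\<And>x. x \<in> ball y 1 \<Longrightarrow> (f' has_derivative Df c x) (at x within ball y 1)" by blast
  have "f' x = fc x" if "x \<in> ball y 1" for x by (rule LIMSEQ_unique[OF f'(1)[OF that] lim])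
  then have "(fc has_derivative Df c y) (at y within ball y 1)"
    by (intro has_derivative_transform[OF _ _ f'(2)]) auto
  then show ?thesis by (simp add: at_within_open[OF _ open_ball])
qed

lemma limit_gradient:
  assumes c: "c \<in> {e..e'}" and f: "\<And>y. ((\<lambda>r. log_value r y) \<longlongrightarrow> f y) (at c within {e<..<e'})"
  shows "GDERIV f y :> G c y"
  unfolding gderiv_def
proof (rule limit_derivative[OF c _ continuous_G zero_less_one _ f, where Df = "\<lambda>r y h. h \<bullet> G r y"])
  show "norm (h \<bullet> G r y - h \<bullet> G c y) \<le> 1 * norm (G r y - G c y) * norm h" for r y h
    using Cauchy_Schwarz_ineq2[of "G r y - G c y" h] by (simp add: inner_diff_right[symmetric] inner_commute)
qed (use deriv_G in \<open>simp add: gderiv_def log_value_def\<close>)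

lemma limit_hessian:
  assumes c: "c \<in> {e..e'}"
  shows "(G c has_derivative (\<lambda>h. H c y *v h)) (at y)"
proof (rule limit_derivative[OF c deriv_H continuous_H _ _ continuous_tendsto_within[OF continuous_G c], where K = "(real CARD('a))\<^sup>2"])
  fix r y h
  define A v where "A = H r y - H c y" and "v = A *v h"
  have "norm v * norm v \<le> norm v * ((real CARD('a))\<^sup>2 * norm A * norm h)"
    using abs_matrix_quadratic_form_le[of v A h] unfolding v_def[symmetric]
    by (simp add: power2_norm_eq_inner[symmetric] power2_eq_square mult_ac)
  then have "norm v \<le> (real CARD('a))\<^sup>2 * norm A * norm h" by (cases "v = 0") (auto simp: mult_le_cancel_left)
  then show "norm (H r y *v h - H c y *v h) \<le> (real CARD('a))\<^sup>2 * norm (H r y - H c y) * norm h"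
    by (simp add: v_def A_def matrix_vector_mult_diff_rdistrib)
qed simp_all

text \<open>After subtracting the linear function of slope \<open>Tm c y\<close>, the derivative is
  small near \<open>c\<close>. The mean value inequality between two interior times survives letting
  one of them tend to \<open>c\<close>.\<close>

lemma limit_time_derivative:
  assumes c: "c \<in> {e..e'}" and \<phi>: "\<And>r. r \<in> {e<..<e'} \<Longrightarrow> \<phi> r = log_value r y"
    and lim: "((\<lambda>r. log_value r y) \<longlongrightarrow> \<phi> c) (at c within {e<..<e'})"
  shows "(\<phi> has_real_derivative Tm c y) (at c within {e<..<e'})"
  unfolding has_field_derivative_def has_derivative_within_alt
proof (intro conjI allI impI)
  show "bounded_linear ((*) (Tm c y))" by (rule bounded_linear_mult_right)
  fix h :: real assume h: "0 < h"
  obtain k where k: "k > 0" "\<And>r. r \<in> {e<..<e'} \<Longrightarrow> r \<noteq> c \<and> dist r c < k \<Longrightarrow> dist (Tm r y) (Tm c y) < h"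
    using tendstoD[OF continuous_tendsto_within[OF continuous_Tm c] h, of y] unfolding eventually_at by blast
  show "\<exists>d>0. \<forall>r\<in>{e<..<e'}. norm (r - c) < d \<longrightarrow> norm (\<phi> r - \<phi> c - Tm c y * (r - c)) \<le> h * norm (r - c)"
  proof (intro exI[of _ k] conjI ballI impI)
    fix r assume r: "r \<in> {e<..<e'}" "norm (r - c) < k"
    have l1: "((\<lambda>r'. norm (log_value r y - log_value r' y - Tm c y * (r - r'))) \<longlongrightarrow> norm (\<phi> r - \<phi> c - Tm c y * (r - c))) (at c within {e<..<e'})"
      unfolding \<phi>[OF r(1)] by (intro tendsto_intros lim)
    have l2: "((\<lambda>r'. h * norm (r - r')) \<longlongrightarrow> h * norm (r - c)) (at c within {e<..<e'})"
      by (intro tendsto_intros)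
    show "norm (\<phi> r - \<phi> c - Tm c y * (r - c)) \<le> h * norm (r - c)"
    proof (rule tendsto_le[OF within_strip_not_bot[OF c] l2 l1])
      show "\<forall>\<^sub>F r' in at c within {e<..<e'}. norm (log_value r y - log_value r' y - Tm c y * (r - r')) \<le> h * norm (r - r')"
        unfolding eventually_at
      proof (intro exI[of _ k] conjI ballI impI)
        fix r' assume r': "r' \<in> {e<..<e'}" "r' \<noteq> c \<and> dist r' c < k"
        have "norm ((log_value r y - Tm c y * r) - (log_value r' y - Tm c y * r')) \<le> h * norm (r - r')"
        proof (rule field_differentiable_bound)
          show "convex ({e<..<e'} \<inter> ball c k)" by (intro convex_Int convex_ball convex_real_interval)
          fix z assume z: "z \<in> {e<..<e'} \<inter> ball c k"
          then have "dist z c < k" by (simp add: dist_commute)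
          then show "norm (Tm z y - Tm c y) \<le> h" using k(2)[of z] h z by (cases "z = c") (auto simp: dist_norm)
          have "((\<lambda>r. log_value r y) has_real_derivative Tm z y) (at z)" unfolding log_value_def using z by (intro deriv_Tm) auto
          from DERIV_subset[OF DERIV_diff[OF this DERIV_cmult_Id]]
          show "((\<lambda>r. log_value r y - Tm c y * r) has_field_derivative Tm z y - Tm c y) (at z within {e<..<e'} \<inter> ball c k)" by auto
        qed (use r r' in \<open>auto simp: dist_norm norm_minus_commute\<close>)
        then show "norm (log_value r y - log_value r' y - Tm c y * (r - r')) \<le> h * norm (r - r')"
          by (simp add: algebra_simps)
      qed (rule k(1))
    qed
  qed (rule k(1))
qed

lemma limit_potential:
  assumes c: "c \<in> {e..e'}"
  shows "((\<lambda>r. potential r y) \<longlongrightarrow> hj_potential c y) (at c within {e<..<e'})"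
proof -
  have "((\<lambda>r. hj_potential r y) \<longlongrightarrow> hj_potential c y) (at c within {e<..<e'})"
    by (rule continuous_tendsto_within[OF continuous_hj_potential c])
  then show ?thesis
    by (rule Lim_transform_eventually) (auto simp: eventually_at potential_eq intro!: exI[of _ 1])
qed

lemma log_value_lipschitz:
  obtains K where "0 \<le> K" "\<And>r y y'. r \<in> {e<..<e'} \<Longrightarrow> y \<in> cball y0 R \<Longrightarrow> y' \<in> cball y0 R \<Longrightarrow>
    \<bar>log_value r y' - log_value r y\<bar> \<le> K * norm (y' - y)"
proof -
  obtain K where K: "1 \<le> K" "\<And>r y. r \<in> {e..e'} \<Longrightarrow> y \<in> cball y0 R \<Longrightarrow> norm (G r y) \<le> K"
    by (rule bounded_on_box[OF continuous_G, of "{e..e'}" y0 R]) auto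
  show thesis
  proof (rule that[of K])
    show "0 \<le> K" using K by simp
    fix r y y' assume r: "r \<in> {e<..<e'}" and y: "y \<in> cball y0 R" "y' \<in> cball y0 R"
    obtain s where s: "s \<in> {0..1}" "log_value r (y + (y' - y)) - log_value r y = (y' - y) \<bullet> G r (y + s *\<^sub>R (y' - y))"
      using mvt_space[OF r] by blast
    have "(1 - s) *\<^sub>R y + s *\<^sub>R y' \<in> cball y0 R"
      using convexD_alt[OF convex_cball y, of s] s(1) by auto
    then have "norm (G r (y + s *\<^sub>R (y' - y))) \<le> K" using K(2)[of r] r by (auto simp: algebra_simps)
    then have "norm (y' - y) * norm (G r (y + s *\<^sub>R (y' - y))) \<le> norm (y' - y) * K" by (intro mult_left_mono) auto
    then show "\<bar>log_value r y' - log_value r y\<bar> \<le> K * norm (y' - y)"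
      using s(2) Cauchy_Schwarz_ineq2[of "y' - y" "G r (y + s *\<^sub>R (y' - y))"] by (simp add: mult.commute)
  qed
qed

section \<open>The jump of the value function\<close>

text \<open>Through \<open>hj_potential\<close> the integrand is bounded up to the right end, so
  near a jump time the integral of \<open>p\<close> exists along every continuous path and vanishes
  with the length of the interval.\<close>

lemma integral_p_strip:
  assumes w: "continuous_on {r..e'} w" "\<And>q. q \<in> {r..e'} \<Longrightarrow> \<xi> q = pr (w q)" and r: "r \<in> {e<..<e'}"
  shows "set_integrable lborel (T \<inter> {r<..e'}) (\<lambda>q. p q (\<xi> q))"
    and "(\<And>q. q \<in> {r..e'} \<Longrightarrow> \<bar>hj_potential q (w q)\<bar> \<le> K) \<Longrightarrow> \<bar>(LBINT q:T \<inter> {r<..e'}. p q (\<xi> q))\<bar> \<le> K * (e' - r)"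
proof -
  have "continuous_on {r..e'} (\<lambda>q. case (q, w q) of (r, y) \<Rightarrow> hj_potential r y)"
    by (rule continuous_on_compose2[OF continuous_hj_potential]) (use r in \<open>auto intro!: continuous_intros w(1)\<close>)
  then have c: "continuous_on {r..e'} (\<lambda>q. hj_potential q (w q))" by simp
  have eq: "indicator (T \<inter> {r<..e'}) q * p q (\<xi> q) = hj_potential q (w q)" if "q \<in> {r<..<e'}" for q
    using potential_eq[of q "w q"] w(2)[of q] that r by (simp add: potential_def indicator_inter_arith)
  have r': "r \<le> e'" "T \<inter> {r<..e'} \<subseteq> {r..e'}" using r by auto
  show "set_integrable lborel (T \<inter> {r<..e'}) (\<lambda>q. p q (\<xi> q))" by (rule set_integral_near_const(1)[OF c r' eq])
  show "\<bar>(LBINT q:T \<inter> {r<..e'}. p q (\<xi> q))\<bar> \<le> K * (e' - r)" if "\<And>q. q \<in> {r..e'} \<Longrightarrow> \<bar>hj_potential q (w q)\<bar> \<le> K"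
    using set_integral_near_const(2)[OF c r' eq, of 0 K] that by simp
qed

lemma weight_end:
  assumes c: "e' \<in> S" and r: "r \<in> {e<..<e'}"
  shows "weight r e' \<xi> = exp (\<theta> e' (\<xi> e') + (LBINT q:T \<inter> {r<..e'}. p q (\<xi> q)))"
proof -
  have "{c\<in>S. r < c \<and> c \<le> e'} = {e'}"
  proof (intro equalityI subsetI)
    fix c assume c': "c \<in> {c\<in>S. r < c \<and> c \<le> e'}"
    then have "c \<notin> {e<..<e'}" using S_strip by blast
    then show "c \<in> {e'}" using c' r by auto
  qed (use assms in auto)
  then show ?thesis unfolding weight_def by simp
qed

lemma weight_end_limit:
  assumes c: "e' \<in> S" and r: "\<And>n. r n \<in> {e<..<e'}" "r \<longlonglongrightarrow> e'"
    and w: "\<And>n. continuous_on {r n..e'} (w n)" "\<And>n q. q \<in> {r n..e'} \<Longrightarrow> w n q \<in> cball y0 R"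
    and \<xi>: "\<And>n q. q \<in> {r n..e'} \<Longrightarrow> \<xi> n q = pr (w n q)"
    and lim: "(\<lambda>n. w n e') \<longlonglongrightarrow> y"
  shows "(\<lambda>n. weight (r n) e' (\<xi> n)) \<longlonglongrightarrow> exp (\<theta> e' (pr y))"
proof -
  obtain K where K: "1 \<le> K" "\<And>q y. q \<in> {e..e'} \<Longrightarrow> y \<in> cball y0 R \<Longrightarrow> norm (hj_potential q y) \<le> K"
    by (rule bounded_on_box[OF continuous_hj_potential, of "{e..e'}" y0 R]) auto
  have bound: "norm (LBINT q:T \<inter> {r n<..e'}. p q (\<xi> n q)) \<le> K * (e' - r n)" for n
    unfolding real_norm_def
  proof (rule integral_p_strip(2)[OF w(1) \<xi> r(1)])
    show "\<bar>hj_potential q (w n q)\<bar> \<le> K" if "q \<in> {r n..e'}" for q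
      using K(2)[of q "w n q"] w(2)[OF that] that r(1)[of n] by simp
  qed
  have "(\<lambda>n. K * (e' - r n)) \<longlonglongrightarrow> K * (e' - e')" by (intro tendsto_intros r(2))
  then have 1: "(\<lambda>n. (LBINT q:T \<inter> {r n<..e'}. p q (\<xi> n q))) \<longlonglongrightarrow> 0"
    by (intro Lim_null_comparison[OF always_eventually[OF allI[OF bound]]]) simp
  have "continuous_on UNIV (\<lambda>y. \<theta> e' (pr y))"
    by (rule continuous_on_compose2[OF continuous_\<theta>[OF c] continuous_on_pr[OF continuous_on_id]]) auto
  then have "isCont (\<lambda>y. \<theta> e' (pr y)) y" by (simp add: continuous_on_eq_continuous_at)
  from isCont_tendsto_compose[OF this lim]
  have 2: "(\<lambda>n. \<theta> e' (\<xi> n e')) \<longlonglongrightarrow> \<theta> e' (pr y)"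
    using \<xi>[of e'] r(1) by (simp add: less_imp_le)
  have "(\<lambda>n. exp (\<theta> e' (\<xi> n e') + (LBINT q:T \<inter> {r n<..e'}. p q (\<xi> n q)))) \<longlonglongrightarrow> exp (\<theta> e' (pr y) + 0)"
    by (intro tendsto_intros 1 2)
  then show ?thesis unfolding weight_end[OF c r(1)] by simp
qed

lemma lift_bounded:
  assumes "w \<in> space M"
  obtains R where "\<And>r q. r \<in> {0..1} \<Longrightarrow> q \<in> {0..1} \<Longrightarrow> lift r y w q \<in> cball y R"
proof -
  have "bounded ((\<lambda>q. B q w) ` {0..1})"
    by (intro compact_imp_bounded compact_continuous_image continuous_on_B assms compact_Icc)
  then obtain b where b: "\<And>q. q \<in> {0..1} \<Longrightarrow> norm (B q w) \<le> b" unfolding bounded_iff by blast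
  show thesis
  proof (rule that[of "sqrt a * (b + b)"])
    fix r q :: real assume "r \<in> {0..1}" "q \<in> {0..1}"
    then have "norm (B q w - B r w) \<le> b + b"
      by (intro order_trans[OF norm_triangle_ineq4 add_mono] b)
    then show "lift r y w q \<in> cball y (sqrt a * (b + b))"
      using a_pos by (simp add: lift_def dist_norm mult_left_mono)
  qed
qed

lemma continuous_lift_end:
  assumes w: "w \<in> space M" and r: "\<And>n. r n \<in> {e<..<e'}" "r \<longlonglongrightarrow> e'"
  shows "(\<lambda>n. B (r n) w) \<longlonglongrightarrow> B e' w"
proof -
  have "((\<lambda>q. B q w) \<longlongrightarrow> B e' w) (at e' within {0..1})"
    using continuous_on_B[OF w] e unfolding continuous_on_def by auto
  moreover have "filterlim r (at e' within {0..1}) sequentially"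
    unfolding filterlim_at using r strip_subset(1)[OF r(1)]
    by (auto intro!: always_eventually simp: less_le)
  ultimately show ?thesis by (rule filterlim_compose)
qed

text \<open>The value decomposes at time \<open>r\<close> into the weight up to the jump and the value there. Letting
  \<open>r\<close> increase to the jump time, Fatou's lemma gives one inequality at every point; started from a fixed
  earlier time, it gives the opposite inequality in the mean, hence equality almost everywhere.\<close>

lemma jump:
  assumes c: "e' \<in> S" and lim: "\<And>y. ((\<lambda>r. log_value r y) \<longlongrightarrow> l y) (at e' within {e<..<e'})"
    and cont: "continuous_on UNIV (value_fun x e')"
  shows "l y = ln (value_fun x e' y) + \<theta> e' (pr y)"
proof -
  have c01: "e' \<in> {0..1}" using e by auto
  \<comment> \<open>The summand 2 keeps even \<open>r 0\<close> strictly inside the strip.\<close>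
  define r where "r n = e' - (e' - e) / (real n + 2)" for n
  have r: "r n \<in> {e<..<e'}" for n
  proof -
    have "(e' - e) / (real n + 2) < e' - e" using e(2) by (simp add: divide_less_eq)
    moreover have "0 < (e' - e) / (real n + 2)" using e(2) by simp
    ultimately show ?thesis by (simp add: r_def)
  qed
  have "(\<lambda>n. (e' - e) / (real n + 2)) \<longlonglongrightarrow> 0" by real_asymp
  then have "(\<lambda>n. e' - (e' - e) / (real n + 2)) \<longlonglongrightarrow> e' - 0" by (intro tendsto_intros)
  then have rlim: "r \<longlonglongrightarrow> e'" by (simp add: r_def[abs_def])
  have r_at: "filterlim r (at e' within {e<..<e'}) sequentially"
    unfolding filterlim_at using r rlim by (auto intro!: always_eventually simp: less_le)
  note rl = filterlim_compose[OF lim r_at]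
  have r01: "0 \<le> r n" "r n \<le> 1" "r n \<le> e'" "r n \<in> {0..1}" for n using r[of n] e by auto
  have ucont: "isCont (value_fun x e') y" for y using cont by (simp add: continuous_on_eq_continuous_at)
  \<comment> \<open>Fatou's lemma with paths at \<open>y\<close> at time \<open>r n\<close>: the
    mean is the value at \<open>r n\<close>, which tends to \<open>exp (l y)\<close>.\<close>
  have le: "exp (\<theta> e' (pr y)) * value_fun x e' y \<le> exp (l y)" for y
  proof -
    have fl: "(\<lambda>n. weight (r n) e' (path (r n) y v) * value_fun x e' (lift (r n) y v e')) \<longlonglongrightarrow>
        exp (\<theta> e' (pr y)) * value_fun x e' y" if v: "v \<in> space M" for v
    proof -
      obtain R where R: "\<And>r q. r \<in> {0..1} \<Longrightarrow> q \<in> {0..1} \<Longrightarrow> lift r y v q \<in> cball y R"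
        using lift_bounded[OF v] by blast
      have "(\<lambda>n. y + sqrt a *\<^sub>R (B e' v - B (r n) v)) \<longlonglongrightarrow> y + sqrt a *\<^sub>R (B e' v - B e' v)"
        by (intro tendsto_intros continuous_lift_end[OF v r rlim])
      then have ll: "(\<lambda>n. lift (r n) y v e') \<longlonglongrightarrow> y" by (simp add: lift_def)
      have "(\<lambda>n. weight (r n) e' (path (r n) y v)) \<longlonglongrightarrow> exp (\<theta> e' (pr y))"
      proof (rule weight_end_limit[OF c r rlim, where w = "\<lambda>n. lift (r n) y v" and y0 = y and R = R])
        have sub: "{r n..e'} \<subseteq> {0..1}" for n using r01[of n] e by auto
        show "continuous_on {r n..e'} (lift (r n) y v)" for n using sub by (rule continuous_on_lift[OF v])
        show "lift (r n) y v q \<in> cball y R" if "q \<in> {r n..e'}" for n q by (intro R r01 subsetD[OF sub that])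
        show "path (r n) y v q = pr (lift (r n) y v q)" if "q \<in> {r n..e'}" for n q
          by (intro path_eq subsetD[OF sub that])
      qed (rule ll)
      then show ?thesis by (intro tendsto_mult isCont_tendsto_compose[OF ucont] ll)
    qed
    have meas: "(\<lambda>v. ennreal (weight (r n) e' (path (r n) y v) * value_fun x e' (lift (r n) y v e'))) \<in> borel_measurable M" for n
    proof -
      have "(\<lambda>v. weight (r n) e' (path (r n) y v)) \<in> borel_measurable M"
        using r01[of n] e by (intro measurable_from_past[of 1] measurable_weight_past) auto
      moreover have "(\<lambda>v. value_fun x e' (lift (r n) y v e')) \<in> borel_measurable M"
        using r01[of n] e by (intro measurable_compose[OF _ measurable_value_fun[OF c01]] measurable_from_past[of 1] measurable_lift_past) auto
      ultimately show ?thesis by measurable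
    qed
    have "ennreal (exp (\<theta> e' (pr y)) * value_fun x e' y) =
      (\<integral>\<^sup>+v. liminf (\<lambda>n. ennreal (weight (r n) e' (path (r n) y v) * value_fun x e' (lift (r n) y v e'))) \<partial>M)"
    proof -
      have "(\<integral>\<^sup>+v. liminf (\<lambda>n. ennreal (weight (r n) e' (path (r n) y v) * value_fun x e' (lift (r n) y v e'))) \<partial>M) =
        (\<integral>\<^sup>+v. ennreal (exp (\<theta> e' (pr y)) * value_fun x e' y) \<partial>M)"
        by (intro nn_integral_cong lim_imp_Liminf tendsto_ennrealI fl) auto
      then show ?thesis by (simp add: emeasure_space_1)
    qed
    also have "\<dots> \<le> liminf (\<lambda>n. \<integral>\<^sup>+v. ennreal (weight (r n) e' (path (r n) y v) * value_fun x e' (lift (r n) y v e')) \<partial>M)"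
      by (rule nn_integral_liminf[OF meas])
    also have "\<dots> = liminf (\<lambda>n. ennreal (value_fun x (r n) y))"
      using value_fun_markov[of "r n" e' x y for n, OF r01(1) r01(3) e(3)] by simp
    also have "\<dots> = ennreal (exp (l y))"
    proof (intro lim_imp_Liminf tendsto_ennrealI)
      have "(\<lambda>n. exp (log_value (r n) y)) \<longlonglongrightarrow> exp (l y)" by (intro tendsto_intros rl)
      then show "(\<lambda>n. value_fun x (r n) y) \<longlonglongrightarrow> exp (l y)" by (simp add: exp_log_value r01)
    qed simp
    finally show ?thesis by (simp add: ennreal_le_iff)
  qed
  have "GDERIV l y :> G e' y" for y by (rule limit_gradient[OF _ lim]) (use e in auto)
  then have lcont: "continuous_on UNIV l"
    by (intro continuous_at_imp_continuous_on ballI) (auto simp: gderiv_def intro: has_derivative_continuous)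
  have \<theta>cont: "continuous_on UNIV (\<lambda>y. \<theta> e' (pr y))"
    by (rule continuous_on_compose2[OF continuous_\<theta>[OF c] continuous_on_pr[OF continuous_on_id]]) auto
  define W where "W v = weight (r 0) e' (path (r 0) y v)" for v
  define Y where "Y v = lift (r 0) y v e'" for v
  define h1 where "h1 v = W v * value_fun x e' (Y v)" for v
  \<comment> \<open>What \<open>h1\<close> would be if the claim held; dividing out the exponential
    of \<theta> leaves the weight before the jump times the left limit of the value. The previous
    step gives \<open>h1 \<le> h2\<close>.\<close>
  define h2 where "h2 v = W v * (exp (- \<theta> e' (pr (Y v))) * exp (l (Y v)))" for v
  have W_pos: "0 < W v" for v by (simp add: W_def weight_pos)
  have Wm [measurable]: "W \<in> borel_measurable M"
    unfolding W_def using r01[of 0] e by (intro measurable_from_past[of 1] measurable_weight_past) auto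
  have Ym [measurable]: "Y \<in> borel_measurable M"
    unfolding Y_def using r01[of 0] e by (intro measurable_from_past[of 1] measurable_lift_past) auto
  have h1m [measurable]: "h1 \<in> borel_measurable M"
    unfolding h1_def using measurable_compose[OF Ym measurable_value_fun[OF c01]] by measurable
  have h2m [measurable]: "h2 \<in> borel_measurable M"
    unfolding h2_def using measurable_compose[OF Ym borel_measurable_continuous_onI[OF lcont]]
      measurable_compose[OF Ym borel_measurable_continuous_onI[OF \<theta>cont]] by measurable
  have h12: "h1 v \<le> h2 v" for v
  proof -
    have "exp (- \<theta> e' (pr (Y v))) * (exp (\<theta> e' (pr (Y v))) * value_fun x e' (Y v)) \<le> exp (- \<theta> e' (pr (Y v))) * exp (l (Y v))"
      by (intro mult_left_mono le) simp
    then have "value_fun x e' (Y v) \<le> exp (- \<theta> e' (pr (Y v))) * exp (l (Y v))"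
      by (simp add: mult.assoc[symmetric] exp_add[symmetric])
    then show ?thesis unfolding h1_def h2_def using W_pos[of v] by (intro mult_left_mono) auto
  qed
  have h1_pos: "0 \<le> h1 v" for v unfolding h1_def using W_pos[of v] value_fun_pos[OF c01, of x] by (simp add: less_imp_le)
  have r0n: "r 0 \<le> r n" for n
  proof -
    have "(e' - e) / (real n + 2) \<le> (e' - e) / 2" using e(2) by (intro divide_left_mono) auto
    then show ?thesis by (simp add: r_def)
  qed
  \<comment> \<open>The value seen at time \<open>r n\<close> along the path from the fixed starting
    point; its mean does not depend on \<open>n\<close>, and it tends to \<open>h2\<close>.\<close>
  define k where "k n v = weight (r 0) (r n) (path (r 0) y v) * value_fun x (r n) (lift (r 0) y v (r n))" for n v
  have km: "k n \<in> borel_measurable M" for n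
  proof -
    have "(\<lambda>v. weight (r 0) (r n) (path (r 0) y v)) \<in> borel_measurable M"
      using r01[of 0] r01[of n] r0n[of n] by (intro measurable_from_past[of 1] measurable_weight_past) auto
    moreover have "(\<lambda>v. value_fun x (r n) (lift (r 0) y v (r n))) \<in> borel_measurable M"
      using r01[of n] r01[of 0] by (intro measurable_compose[OF _ measurable_value_fun] measurable_from_past[of 1] measurable_lift_past) auto
    ultimately show ?thesis unfolding k_def by measurable
  qed
  have kl: "(\<lambda>n. k n v) \<longlonglongrightarrow> h2 v" if v: "v \<in> space M" for v
  proof -
    define \<xi> where "\<xi> = path (r 0) y v"
    define w where "w = lift (r 0) y v"
    have sub: "{r n..e'} \<subseteq> {0..1}" for n using r01[of n] e by auto
    have wc: "continuous_on {r n..e'} w" for n unfolding w_def using sub by (rule continuous_on_lift[OF v])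
    have \<xi>w: "\<xi> q = pr (w q)" if "q \<in> {r n..e'}" for n q
      unfolding \<xi>_def w_def by (intro path_eq subsetD[OF sub that])
    obtain R where R: "\<And>r q. r \<in> {0..1} \<Longrightarrow> q \<in> {0..1} \<Longrightarrow> lift r y v q \<in> cball y R"
      using lift_bounded[OF v] by blast
    have "(\<lambda>n. y + sqrt a *\<^sub>R (B (r n) v - B (r 0) v)) \<longlonglongrightarrow> y + sqrt a *\<^sub>R (B e' v - B (r 0) v)"
      by (intro tendsto_intros continuous_lift_end[OF v r rlim])
    then have wl: "(\<lambda>n. w (r n)) \<longlonglongrightarrow> Y v" unfolding w_def Y_def lift_def .
    have ww: "w q \<in> cball y R" if "q \<in> {r n..e'}" for n q unfolding w_def by (intro R r01 subsetD[OF sub that])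
    have wY: "(\<lambda>n::nat. w e') \<longlonglongrightarrow> Y v" by (simp add: w_def Y_def)
    have "(\<lambda>n. weight (r n) e' \<xi>) \<longlonglongrightarrow> exp (\<theta> e' (pr (Y v)))"
      using weight_end_limit[of r "\<lambda>_. w" y R "\<lambda>_. \<xi>" "Y v", OF c r rlim wc ww \<xi>w wY] .
    then have "(\<lambda>n. W v / weight (r n) e' \<xi>) \<longlonglongrightarrow> W v / exp (\<theta> e' (pr (Y v)))"
      by (intro tendsto_intros) auto
    \<comment> \<open>The weight stopping short of the jump is the full weight divided by its last
      piece, whose limit is known.\<close>
    moreover have "W v / weight (r n) e' \<xi> = weight (r 0) (r n) \<xi>" for n
    proof -
      have "W v = weight (r 0) (r n) \<xi> * weight (r n) e' \<xi>"
        unfolding W_def \<xi>_def[symmetric]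
        by (rule weight_split[OF r0n r01(3) integral_p_strip(1)[OF wc \<xi>w r]])
      then show ?thesis using weight_pos[of "r n" e' \<xi>] by simp
    qed
    ultimately have 1: "(\<lambda>n. weight (r 0) (r n) \<xi>) \<longlonglongrightarrow> W v / exp (\<theta> e' (pr (Y v)))" by simp
    obtain K where K: "0 \<le> K" "\<And>q y1 y2. q \<in> {e<..<e'} \<Longrightarrow> y1 \<in> cball y R \<Longrightarrow> y2 \<in> cball y R \<Longrightarrow>
        \<bar>log_value q y2 - log_value q y1\<bar> \<le> K * norm (y2 - y1)"
      using log_value_lipschitz by blast
    have b: "norm (log_value (r n) (w (r n)) - log_value (r n) (Y v)) \<le> K * norm (w (r n) - Y v)" for n
      unfolding real_norm_def w_def Y_def by (intro K(2) r R r01 c01)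
    have "(\<lambda>n. K * norm (w (r n) - Y v)) \<longlonglongrightarrow> K * norm (Y v - Y v)" by (intro tendsto_intros wl)
    then have "(\<lambda>n. log_value (r n) (w (r n)) - log_value (r n) (Y v)) \<longlonglongrightarrow> 0"
      by (intro Lim_null_comparison[OF always_eventually[OF allI[OF b]]]) simp
    from tendsto_add[OF this rl[of "Y v"]]
    have "(\<lambda>n. log_value (r n) (w (r n))) \<longlonglongrightarrow> l (Y v)" by simp
    then have "(\<lambda>n. exp (log_value (r n) (w (r n)))) \<longlonglongrightarrow> exp (l (Y v))" by (intro tendsto_intros)
    then have 2: "(\<lambda>n. value_fun x (r n) (w (r n))) \<longlonglongrightarrow> exp (l (Y v))" by (simp add: exp_log_value r01)
    from tendsto_mult[OF 1 2] show ?thesis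
      unfolding k_def \<xi>_def w_def h2_def by (simp add: exp_minus divide_inverse mult.assoc)
  qed
  have u0: "(\<integral>\<^sup>+v. ennreal (h1 v) \<partial>M) = ennreal (value_fun x (r 0) y)"
    unfolding h1_def W_def Y_def by (rule value_fun_markov[OF r01(1,3) e(3), symmetric])
  have "(\<integral>\<^sup>+v. ennreal (h2 v) \<partial>M) = (\<integral>\<^sup>+v. liminf (\<lambda>n. ennreal (k n v)) \<partial>M)"
    by (intro nn_integral_cong lim_imp_Liminf[symmetric] tendsto_ennrealI kl) auto
  also have "\<dots> \<le> liminf (\<lambda>n. \<integral>\<^sup>+v. ennreal (k n v) \<partial>M)"
    by (rule nn_integral_liminf) (use km in measurable)
  also have "\<dots> = ennreal (value_fun x (r 0) y)"
    using value_fun_markov[of "r 0" "r n" x y for n, OF r01(1) r0n r01(2)] by (simp add: k_def Liminf_const)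
  finally have h2_le: "(\<integral>\<^sup>+v. ennreal (h2 v) \<partial>M) \<le> (\<integral>\<^sup>+v. ennreal (h1 v) \<partial>M)" unfolding u0 .
  \<comment> \<open>The second use of Fatou's lemma bounds the mean of \<open>h2\<close> by that of
    \<open>h1\<close>, which is finite; with \<open>h1 \<le> h2\<close> they agree almost
    surely.\<close>
  have "(\<integral>\<^sup>+v. ennreal (h2 v) - ennreal (h1 v) \<partial>M) = (\<integral>\<^sup>+v. ennreal (h2 v) \<partial>M) - (\<integral>\<^sup>+v. ennreal (h1 v) \<partial>M)"
    using u0 h12 by (intro nn_integral_diff) (auto intro!: ennreal_leI)
  also have "\<dots> = 0" using h2_le u0 by (simp add: diff_eq_0_iff_ennreal le_less_trans[OF h2_le])
  finally have "AE v in M. ennreal (h2 v) - ennreal (h1 v) = 0"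
    by (subst (asm) nn_integral_0_iff_AE) auto
  then have ae: "AE v in M. exp (l (Y v)) = exp (\<theta> e' (pr (Y v))) * value_fun x e' (Y v)"
  proof eventually_elim
    fix v assume "ennreal (h2 v) - ennreal (h1 v) = 0"
    then have "ennreal (h2 v) \<le> ennreal (h1 v)" by (simp add: diff_eq_0_iff_ennreal)
    then have "h2 v \<le> h1 v" using h1_pos[of v] by (simp add: ennreal_le_iff)
    then have "exp (- \<theta> e' (pr (Y v))) * exp (l (Y v)) \<le> value_fun x e' (Y v)"
      unfolding h1_def h2_def using W_pos[of v] by (simp add: mult_le_cancel_left_pos)
    from mult_left_mono[OF this, of "exp (\<theta> e' (pr (Y v)))"]
    have "exp (l (Y v)) \<le> exp (\<theta> e' (pr (Y v))) * value_fun x e' (Y v)"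
      by (simp add: mult.assoc[symmetric] exp_add[symmetric])
    then show "exp (l (Y v)) = exp (\<theta> e' (pr (Y v))) * value_fun x e' (Y v)" using le by (intro antisym)
  qed
  \<comment> \<open>\<open>g\<close> is continuous and vanishes almost surely at a Gaussian
    increment, hence everywhere; the increment 0 gives the claim at \<open>y\<close>.\<close>
  define g where "g w = exp (l (y + sqrt a *\<^sub>R w)) - exp (\<theta> e' (pr (y + sqrt a *\<^sub>R w))) * value_fun x e' (y + sqrt a *\<^sub>R w)" for w
  have "continuous_on UNIV g"
    unfolding g_def
    by (intro continuous_intros continuous_on_compose2[OF lcont] continuous_on_compose2[OF \<theta>cont] continuous_on_compose2[OF cont]) auto
  then have "open {w. g w \<noteq> 0}" by (intro open_Collect_neq) auto
  moreover have "AE v in M. B e' v - B (r 0) v \<notin> {w. g w \<noteq> 0}"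
    using ae by eventually_elim (simp add: g_def Y_def lift_def)
  ultimately have "{w. g w \<noteq> 0} = {}"
    using r[of 0] by (intro increment_charges_open[OF r01(1) _ e(3)]) auto
  then have "g 0 = 0" by blast
  then have "exp (l y) = exp (\<theta> e' (pr y)) * value_fun x e' y" by (simp add: g_def)
  then have "l y = ln (exp (\<theta> e' (pr y)) * value_fun x e' y)" by (metis ln_exp)
  then show ?thesis using value_fun_pos[OF c01, of x y] by (simp add: ln_mult)
qed

end

section \<open>The Hamilton-Jacobi equation\<close>

lemma at_within_Ioo_right:
  assumes "a < (b::real)" shows "at a within {a<..<b} = at_right a"
  by (rule at_within_nhd[of _ "{..<b}"]) (use assms in auto)

lemma at_within_Ioo_left:
  assumes "a < (b::real)" shows "at b within {a<..<b} = at_left b"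
  by (rule at_within_nhd[of _ "{a<..}"]) (use assms in auto)

lemma has_derivative_translate:
  assumes "(f has_derivative f') (at (y + d))" shows "((\<lambda>v. f (v + d)) has_derivative f') (at y)"
proof -
  have "((\<lambda>v. v + d) has_derivative (\<lambda>h. h)) (at y)" by (auto intro!: derivative_eq_intros)
  then show ?thesis by (rule has_derivative_compose[of "\<lambda>v. v + d" "\<lambda>h. h" y UNIV f f']) (fact assms)
qed

context flat_quotient
begin

text \<open>\<open>gradient\<close> is evaluated at the chosen lift \<open>inv pr\<close>; lattice
  invariance of the gradient makes the choice immaterial.\<close>

lemma gderiv_translate:
  assumes g: "\<And>y. GDERIV (f \<circ> pr) y :> g y" and eq: "pr y = pr y'"
  shows "g y = g y'"
proof -
  have "((f \<circ> pr) has_derivative (\<lambda>h. h \<bullet> g y')) (at (y + (y' - y)))" using g[of y'] by (simp add: gderiv_def)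
  from has_derivative_translate[OF this]
  have "((\<lambda>v. f (pr (v + (y' - y)))) has_derivative (\<lambda>h. h \<bullet> g y')) (at y)" by (simp add: comp_def)
  moreover have "pr (v + (y' - y)) = pr v" for v
  proof -
    have "pr (y + (v - y)) = pr (y' + (v - y))" by (rule translate[OF eq])
    then show ?thesis by (simp add: algebra_simps)
  qed
  ultimately have "((\<lambda>v. f (pr v)) has_derivative (\<lambda>h. h \<bullet> g y')) (at y)" by simp
  moreover have "((\<lambda>v. f (pr v)) has_derivative (\<lambda>h. h \<bullet> g y)) (at y)"
    using g[of y] by (simp add: gderiv_def comp_def)
  ultimately have "(\<lambda>h. h \<bullet> g y') = (\<lambda>h. h \<bullet> g y)" by (rule has_derivative_unique)
  then have "h \<bullet> g y = h \<bullet> g y'" for h by (metis)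
  then show ?thesis using vector_eq_ldot by blast
qed

lemma gradient_eq:
  assumes g: "\<And>y. GDERIV (f \<circ> pr) y :> g y"
  shows "gradient pr f (pr y) = g y"
proof -
  have "frechet_derivative (f \<circ> pr) (at (inv pr (pr y))) = (\<lambda>h. h \<bullet> g (inv pr (pr y)))"
    using g[of "inv pr (pr y)"] unfolding gderiv_def by (rule frechet_derivative_at[symmetric])
  moreover have "g (inv pr (pr y)) = g y" by (rule gderiv_translate[OF g]) simp
  ultimately show ?thesis
    unfolding gradient_def by (simp add: vec_eq_iff inner_axis')
qed

lemma laplacian_eq:
  fixes H :: "real^'n \<Rightarrow> real^'n^'n"
  assumes g: "\<And>y. GDERIV (f \<circ> pr) y :> g y" and H: "\<And>y. (g has_derivative (\<lambda>h. H y *v h)) (at y)"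
  shows "laplacian pr f (pr y) = (\<Sum>i\<in>UNIV. H (inv pr (pr y)) $ i $ i)"
proof -
  have "frechet_derivative (\<lambda>y. gradient pr f (pr y) $ i) (at (inv pr (pr y))) (axis i 1) = H (inv pr (pr y)) $ i $ i" for i
  proof -
    have "((\<lambda>y. g y $ i) has_derivative (\<lambda>h. (H (inv pr (pr y)) *v h) $ i)) (at (inv pr (pr y)))"
      by (rule bounded_linear.has_derivative[OF bounded_linear_vec_nth H])
    then have "frechet_derivative (\<lambda>y. g y $ i) (at (inv pr (pr y))) = (\<lambda>h. (H (inv pr (pr y)) *v h) $ i)"
      by (rule frechet_derivative_at[symmetric])
    then show ?thesis by (simp add: gradient_eq[OF g] matrix_vector_mult_basis column_def)
  qed
  then show ?thesis unfolding laplacian_def by simp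
qed

end

context strip
begin

lemma hessian_translate:
  assumes "\<And>y. GDERIV (f \<circ> pr) y :> G c y" "c \<in> {e..e'}" "pr y = pr y'"
  shows "H c y = H c y'"
proof -
  have "(G c has_derivative (\<lambda>h. H c y' *v h)) (at (y + (y' - y)))" using limit_hessian[OF assms(2), of y'] by simp
  from has_derivative_translate[OF this]
  have "((\<lambda>v. G c (v + (y' - y))) has_derivative (\<lambda>h. H c y' *v h)) (at y)" .
  moreover have "G c (v + (y' - y)) = G c v" for v
  proof (rule gderiv_translate[OF assms(1)])
    have "pr (y + (v - y)) = pr (y' + (v - y))" by (rule translate[OF assms(3)])
    then show "pr (v + (y' - y)) = pr v" by (simp add: algebra_simps)
  qed
  ultimately have "(G c has_derivative (\<lambda>h. H c y' *v h)) (at y)" by simp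
  from has_derivative_unique[OF limit_hessian[OF assms(2)] this]
  have "H c y *v h = H c y' *v h" for h by metis
  then show ?thesis by (simp add: matrix_eq)
qed

text \<open>\<open>c\<close> may be an end of the strip: there \<open>u c\<close> enters only as the
  one-sided limit from inside, which excludes the right end at a jump.\<close>

context
  fixes u :: "real \<Rightarrow> 'b \<Rightarrow> real" and c :: real
  assumes u: "\<And>r y. r \<in> {e<..<e'} \<Longrightarrow> u r (pr y) = log_value r y" and c: "c \<in> {e..e'}"
    and lim: "\<And>z. ((\<lambda>r. u r z) \<longlongrightarrow> u c z) (at c within {e<..<e'})"
begin

lemma limit_value: "((\<lambda>r. log_value r y) \<longlongrightarrow> u c (pr y)) (at c within {e<..<e'})"
  using lim[of "pr y"]
  by (rule Lim_transform_eventually) (auto simp: eventually_at u intro!: exI[of _ 1])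

lemma limit_gderiv: "GDERIV (u c \<circ> pr) y :> G c y"
  unfolding comp_def by (rule limit_gradient[OF c limit_value])

lemma gradient_limit: "gradient pr (u c) (pr y) = G c y"
  by (rule gradient_eq[OF limit_gderiv])

lemma twice_cont_diff_limit: "twice_cont_diff pr (u c)"
  unfolding twice_cont_diff_def
proof (intro exI[of _ "G c"] exI[of _ "H c"] conjI allI limit_gderiv limit_hessian[OF c])
  have "continuous_on UNIV (\<lambda>y. case (c, y) of (r, y) \<Rightarrow> H r y)"
    by (rule continuous_on_compose2[OF continuous_H]) (use c in \<open>auto intro!: continuous_intros\<close>)
  then show "continuous_on UNIV (H c)" by simp
qed

text \<open>With \<open>hj_potential\<close> as the potential the equation holds by construction;
  the content is that the time derivative and the limit of the actual potential are the right
  ones.\<close>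

lemma hamilton_jacobi_limit:
  "\<exists>d q. ((\<lambda>r. u r z) has_real_derivative d) (at c within {e<..<e'}) \<and>
    ((\<lambda>r. indicator T r * p r z) \<longlongrightarrow> q) (at c within {e<..<e'}) \<and>
    (c \<in> {e<..<e'} \<longrightarrow> q = indicator T c * p c z) \<and>
    hj_operator pr a d (u c) q z = 0"
proof -
  define y where "y = inv pr z"
  have z: "z = pr y" by (simp add: y_def)
  have "((\<lambda>r. u r z) has_real_derivative Tm c y) (at c within {e<..<e'})"
    unfolding z by (rule limit_time_derivative[OF c u limit_value])
  moreover have "((\<lambda>r. indicator T r * p r z) \<longlongrightarrow> hj_potential c y) (at c within {e<..<e'})"
    using limit_potential[OF c, of y] by (simp add: potential_def z)
  moreover have "hj_potential c y = indicator T c * p c z" if "c \<in> {e<..<e'}"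
    using potential_eq[OF that, of y] by (simp add: potential_def z)
  moreover have "hj_operator pr a (Tm c y) (u c) (hj_potential c y) z = 0"
    unfolding hj_operator_def z gradient_limit laplacian_eq[OF limit_gderiv limit_hessian[OF c]] hj_potential_def
    using hessian_translate[OF limit_gderiv c, of "inv pr (pr y)" y] by simp
  ultimately show ?thesis by blast
qed

end

end

section \<open>Gluing the strips\<close>

locale smooth_bredinger = bredinger +
  fixes D :: "real set" and \<psi> :: "'b \<Rightarrow> real \<Rightarrow> 'b \<Rightarrow> real"
  assumes finite_D: "finite D" and D_subset: "D \<subseteq> {0..1}" and S_subset_D: "S \<subseteq> D" and frontier_T: "frontier T \<subseteq> D"
    and \<psi>_value: "\<And>x t y. t \<in> {0..1} \<Longrightarrow> \<psi> x t (pr y) = ln (value_fun x t y)"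
    and smooth: "\<And>x. piecewise_smooth pr (D \<union> {0, 1}) (\<psi> x)"
    and cadlag: "\<And>x. right_continuous_with_jumps_in S (\<psi> x)"
begin

abbreviation "smooth_strip \<equiv> strip pr \<Lambda> M B a T S \<eta> p \<theta> F"

definition segment :: "real \<Rightarrow> real \<Rightarrow> bool" where
  "segment e e' \<longleftrightarrow> e \<in> D \<union> {0, 1} \<and> e' \<in> D \<union> {0, 1} \<and> e < e' \<and> (D \<union> {0, 1}) \<inter> {e<..<e'} = {}"

lemma segment_bounds: assumes "segment e e'" shows "0 \<le> e" "e < e'" "e' \<le> 1"
  using assms D_subset unfolding segment_def by auto

text \<open>For a down-set of times, the last point of the partition inside and the first one
  outside are consecutive. Closed and open half-lines give the segments to the right and to the left
  of a time.\<close>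

lemma segment_cut:
  assumes L: "0 \<in> L" "1 \<notin> L" "\<And>q r. q \<le> r \<Longrightarrow> r \<in> L \<Longrightarrow> q \<in> L"
  obtains e e' where "segment e e'" "e \<in> L" "e' \<notin> L"
proof -
  let ?E = "D \<union> {0, 1}"
  define e where "e = Max (?E \<inter> L)"
  define e' where "e' = Min (?E - L)"
  have f: "finite (?E \<inter> L)" "finite (?E - L)" using finite_D by auto
  have e: "e \<in> ?E \<inter> L" unfolding e_def by (rule Max_in[OF f(1)]) (use L in auto)
  have e': "e' \<in> ?E - L" unfolding e'_def by (rule Min_in[OF f(2)]) (use L in auto)
  have "q \<notin> {e<..<e'}" if "q \<in> ?E" for q
    using that Max_ge[OF f(1), of q] Min_le[OF f(2), of q] by (cases "q \<in> L") (auto simp: e_def e'_def)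
  moreover have "e < e'" using e e' L(3)[of e' e] by force
  ultimately show thesis using e e' by (intro that[of e e']) (auto simp: segment_def)
qed

lemma segment_right:
  assumes "t \<in> {0..<1}" obtains e e' where "segment e e'" "e \<le> t" "t < e'"
  by (rule segment_cut[of "{..t}"]) (use assms that in auto)

lemma segment_left:
  assumes "t \<in> {0<..1}" obtains e e' where "segment e e'" "e < t" "t \<le> e'"
  by (rule segment_cut[of "{..<t}"]) (use assms that in auto)

lemma segment_strip:
  assumes seg: "segment e e'"
  obtains Tm G H where "smooth_strip x e e' Tm G H"
proof -
  have "\<exists>T G (H :: real \<Rightarrow> real^'a \<Rightarrow> real^'a^'a).
      continuous_on ({e..e'} \<times> UNIV) (\<lambda>(r, y). T r y) \<and>
      continuous_on ({e..e'} \<times> UNIV) (\<lambda>(r, y). G r y) \<and>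
      continuous_on ({e..e'} \<times> UNIV) (\<lambda>(r, y). H r y) \<and>
      (\<forall>r\<in>{e<..<e'}. \<forall>y. ((\<lambda>r. \<psi> x r (pr y)) has_real_derivative T r y) (at r) \<and>
        GDERIV (\<psi> x r \<circ> pr) y :> G r y \<and> (G r has_derivative (\<lambda>h. H r y *v h)) (at y))"
    using smooth[of x, unfolded piecewise_smooth_def] seg unfolding segment_def by blast
  then obtain Tm G and H :: "real \<Rightarrow> real^'a \<Rightarrow> real^'a^'a" where *:
      "continuous_on ({e..e'} \<times> UNIV) (\<lambda>(r, y). Tm r y)"
      "continuous_on ({e..e'} \<times> UNIV) (\<lambda>(r, y). G r y)"
      "continuous_on ({e..e'} \<times> UNIV) (\<lambda>(r, y). H r y)"
      "\<And>r y. r \<in> {e<..<e'} \<Longrightarrow> ((\<lambda>r. \<psi> x r (pr y)) has_real_derivative Tm r y) (at r)"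
      "\<And>r y. r \<in> {e<..<e'} \<Longrightarrow> GDERIV (\<psi> x r \<circ> pr) y :> G r y"
      "\<And>r y. r \<in> {e<..<e'} \<Longrightarrow> (G r has_derivative (\<lambda>h. H r y *v h)) (at y)"
    by blast
  have sub: "r \<in> {0..1}" if "r \<in> {e<..<e'}" for r using that segment_bounds[OF seg] by auto
  show thesis
  proof (rule that, unfold_locales)
    show "0 \<le> e" "e < e'" "e' \<le> 1" by (fact segment_bounds[OF seg])+
    show "S \<inter> {e<..<e'} = {}" using seg S_subset_D unfolding segment_def by auto
    \<comment> \<open>A connected set that misses the frontier of \<open>T\<close> is contained in
      \<open>T\<close> or in its complement.\<close>
    have "frontier T \<inter> {e<..<e'} = {}" using seg frontier_T unfolding segment_def by auto
    then show "T \<inter> {e<..<e'} = {} \<or> {e<..<e'} \<subseteq> T"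
      using connected_Int_frontier[of "{e<..<e'}" T] by auto
    show "((\<lambda>r. ln (value_fun x r y)) has_real_derivative Tm r y) (at r)" if "r \<in> {e<..<e'}" for r y
      by (rule has_field_derivative_transform_within_open[OF *(4)[OF that, of y] open_greaterThanLessThan that])
        (rule \<psi>_value[OF sub])
    show "GDERIV (\<lambda>y. ln (value_fun x r y)) y :> G r y" if "r \<in> {e<..<e'}" for r y
      using *(5)[OF that, of y] by (simp add: \<psi>_value[OF sub[OF that]] comp_def)
  qed (fact *)+
qed

lemma \<psi>_limit:
  assumes seg: "segment e e'" and c: "c \<in> {e..<e'} \<or> c = e' \<and> e' \<notin> S"
  shows "((\<lambda>r. \<psi> x r z) \<longlongrightarrow> \<psi> x c z) (at c within {e<..<e'})"
proof -
  note b = segment_bounds[OF seg]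
  note cad = cadlag[of x, unfolded right_continuous_with_jumps_in_def]
  consider "c = e" | "c = e'" "e' \<notin> S" | "c \<in> {e<..<e'}" using c by fastforce
  then show ?thesis
  proof cases
    case 1
    have "((\<lambda>r. \<psi> x r z) \<longlongrightarrow> \<psi> x e z) (at_right e)" using cad b by simp
    then show ?thesis using at_within_Ioo_right[OF b(2)] by (simp add: 1)
  next
    case 2
    have "((\<lambda>r. \<psi> x r z) \<longlongrightarrow> \<psi> x e' z) (at_left e')" using cad b 2 by simp
    then show ?thesis using at_within_Ioo_left[OF b(2)] by (simp add: 2)
  next
    case 3
    obtain Tm G H where s: "smooth_strip x e e' Tm G H" by (rule segment_strip[OF seg])
    interpret st: strip pr \<Lambda> M B a T S \<eta> p \<theta> F x e e' Tm G H by (fact s)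
    have "((\<lambda>r. \<psi> x r z) has_real_derivative Tm c (inv pr z)) (at c)"
    proof (rule has_field_derivative_transform_within_open[OF st.deriv_Tm[OF 3] open_greaterThanLessThan 3])
      show "ln (value_fun x r (inv pr z)) = \<psi> x r z" if "r \<in> {e<..<e'}" for r
        using \<psi>_value[of r x "inv pr z"] st.strip_subset(1)[OF that] by simp
    qed
    then have "isCont (\<lambda>r. \<psi> x r z) c" by (rule DERIV_isCont)
    then have "((\<lambda>r. \<psi> x r z) \<longlongrightarrow> \<psi> x c z) (at c)" by (simp add: isCont_def)
    then show ?thesis by (simp add: at_within_open[OF 3])
  qed
qed

lemma gradient_segment:
  assumes s: "smooth_strip x e e' Tm G H" and seg: "segment e e'"
    and c: "c \<in> {e..<e'} \<or> c = e' \<and> e' \<notin> S"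
  shows "gradient pr (\<psi> x c) (pr y) = G c y" "GDERIV (\<psi> x c \<circ> pr) y :> G c y"
    and "twice_cont_diff pr (\<psi> x c)"
    and "\<exists>d q. ((\<lambda>r. \<psi> x r z) has_real_derivative d) (at c within {e<..<e'}) \<and>
      ((\<lambda>r. indicator T r * p r z) \<longlongrightarrow> q) (at c within {e<..<e'}) \<and>
      (c \<in> {e<..<e'} \<longrightarrow> q = indicator T c * p c z) \<and> hj_operator pr a d (\<psi> x c) q z = 0" (is ?hj)
proof -
  interpret st: strip pr \<Lambda> M B a T S \<eta> p \<theta> F x e e' Tm G H by (fact s)
  have u: "\<psi> x r (pr y) = st.log_value r y" if "r \<in> {e<..<e'}" for r y
    using \<psi>_value[OF st.strip_subset(1)[OF that]] by (simp add: st.log_value_def)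
  have c': "c \<in> {e..e'}" using c segment_bounds[OF seg] by auto
  note * = u c' \<psi>_limit[OF seg c]
  show "gradient pr (\<psi> x c) (pr y) = G c y" by (rule st.gradient_limit[OF *])
  show "GDERIV (\<psi> x c \<circ> pr) y :> G c y" by (rule st.limit_gderiv[OF *])
  show "twice_cont_diff pr (\<psi> x c)" by (rule st.twice_cont_diff_limit[OF *])
  show ?hj by (rule st.hamilton_jacobi_limit[OF *])
qed

text \<open>Right-continuity identifies the value at the left end of a segment with its limit, so
  differentiability there, and hence continuity, also hold at jump times, as \<open>jump\<close>
  requires.\<close>

lemma continuous_value_fun:
  assumes "t \<in> {0..<1}" shows "continuous_on UNIV (value_fun x t)"
proof -
  obtain e e' where seg: "segment e e'" "e \<le> t" "t < e'" by (rule segment_right[OF assms])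
  obtain Tm G H where s: "smooth_strip x e e' Tm G H" by (rule segment_strip[OF seg(1)])
  have "GDERIV (\<psi> x t \<circ> pr) y :> G t y" for y
    by (rule gradient_segment(2)[OF s seg(1)]) (use seg in auto)
  then have "continuous_on UNIV (\<lambda>y. \<psi> x t (pr y))"
    by (intro continuous_at_imp_continuous_on ballI) (auto simp: gderiv_def comp_def intro: has_derivative_continuous)
  then have "continuous_on UNIV (\<lambda>y. exp (\<psi> x t (pr y)))" by (intro continuous_intros)
  then show ?thesis using assms by (simp add: \<psi>_value value_fun_pos)
qed

text \<open>Regularity supplies the existence of the left limit; its value comes from
  \<open>jump\<close>.\<close>

lemma \<psi>_jump:
  assumes "t \<in> S" shows "((\<lambda>r. \<psi> x r z) \<longlongrightarrow> \<psi> x t z + \<theta> t z) (at_left t)"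
proof -
  have t: "t \<in> {0<..<1}" using assms S_subset by auto
  obtain e e' where seg: "segment e e'" "e < t" "t \<le> e'" by (rule segment_left[of t]) (use t in auto)
  have "t = e'"
  proof (rule ccontr)
    assume "t \<noteq> e'"
    then have "t \<in> {e<..<e'}" using seg by auto
    then show False using seg(1) S_subset_D assms unfolding segment_def by auto
  qed
  obtain Tm G H where s: "smooth_strip x e e' Tm G H" by (rule segment_strip[OF seg(1)])
  interpret st: strip pr \<Lambda> M B a T S \<eta> p \<theta> F x e e' Tm G H by (fact s)
  have "\<forall>z. \<exists>l. ((\<lambda>r. \<psi> x r z) \<longlongrightarrow> l) (at_left t)"
    using cadlag[of x, unfolded right_continuous_with_jumps_in_def] t by auto
  then obtain l where l: "\<And>z. ((\<lambda>r. \<psi> x r z) \<longlongrightarrow> l z) (at_left t)" by metis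
  have "((\<lambda>r. st.log_value r y) \<longlongrightarrow> l (pr y)) (at e' within {e<..<e'})" for y
  proof (rule Lim_transform_eventually)
    show "((\<lambda>r. \<psi> x r (pr y)) \<longlongrightarrow> l (pr y)) (at e' within {e<..<e'})"
      using l[of "pr y"] at_within_Ioo_left[OF segment_bounds(2)[OF seg(1)]] by (simp add: \<open>t = e'\<close>)
    show "\<forall>\<^sub>F r in at e' within {e<..<e'}. \<psi> x r (pr y) = st.log_value r y"
      unfolding eventually_at st.log_value_def
      by (intro exI[of _ 1]) (use \<psi>_value st.strip_subset(1) in simp)
  qed
  from st.jump[OF _ this continuous_value_fun, of "inv pr z"]
  have "l z = \<psi> x t z + \<theta> t z" using assms t \<psi>_value[of t x "inv pr z"] by (simp add: \<open>t = e'\<close>)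
  then show ?thesis using l[of z] by simp
qed

lemma \<psi>_final: "\<psi> x 1 z = \<eta> x z"
proof -
  have S1: "{s\<in>S. s > 1} = {}" using S_subset by auto
  have "F x 1 (path 1 (inv pr z) w) = exp (\<eta> x z)" for w
    unfolding F_eq S1 by (simp add: path_eq set_lebesgue_integral_def)
  then have "value_fun x 1 (inv pr z) = exp (\<eta> x z)" by (simp add: value_fun_def prob_space)
  then show ?thesis using \<psi>_value[of 1 x "inv pr z"] by simp
qed

theorem hj_classical_solution_\<psi>: "hj_classical_solution pr a T S D p \<theta> (\<eta> x) (\<psi> x)"
  unfolding hj_classical_solution_def
proof (intro conjI ballI allI)
  fix t assume t: "t \<in> {0..<1} - S"
  obtain e e' where seg: "segment e e'" "e \<le> t" "t < e'" by (rule segment_right[of t]) (use t in auto)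
  obtain Tm G H where s: "smooth_strip x e e' Tm G H" by (rule segment_strip[OF seg(1)])
  show "twice_cont_diff pr (\<psi> x t)" by (rule gradient_segment(3)[OF s seg(1)]) (use seg in auto)
next
  fix t z assume t: "t \<in> {0..<1} - D"
  obtain e e' where seg: "segment e e'" "e \<le> t" "t < e'" by (rule segment_right[of t]) (use t in auto)
  obtain Tm G H where s: "smooth_strip x e e' Tm G H" by (rule segment_strip[OF seg(1)])
  have "t \<in> {e..<e'} \<or> t = e' \<and> e' \<notin> S" using seg by auto
  from gradient_segment(4)[OF s seg(1) this, of z]
  obtain d q where dq: "((\<lambda>r. \<psi> x r z) has_real_derivative d) (at t within {e<..<e'})"
    "((\<lambda>r. indicator T r * p r z) \<longlongrightarrow> q) (at t within {e<..<e'})"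
    "t \<in> {e<..<e'} \<longrightarrow> q = indicator T t * p t z" "hj_operator pr a d (\<psi> x t) q z = 0" by blast
  note b = segment_bounds[OF seg(1)]
  show "\<exists>d. ((\<lambda>r. \<psi> x r z) has_real_derivative d) (at t within {0..1}) \<and>
      hj_operator pr a d (\<psi> x t) (indicator T t * p t z) z = 0"
  proof (cases "t = e")
    case False
    then have t': "t \<in> {e<..<e'}" using seg by auto
    then have "((\<lambda>r. \<psi> x r z) has_real_derivative d) (at t)" using dq(1) by (simp add: at_within_open[OF t'])
    then have "((\<lambda>r. \<psi> x r z) has_real_derivative d) (at t within {0..1})" by (rule has_field_derivative_at_within)
    then show ?thesis using dq(3,4) t' by auto
  next
    case True
    \<comment> \<open>Only time 0 can start a segment without being in \<open>D\<close>. Then 0 is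
      not in the closure of \<open>T\<close>, so the potential vanishes on the first segment and its
      limit is also its value at 0.\<close>
    then have t0: "t = 0" "e = 0" using t seg(1) unfolding segment_def by auto
    have "0 \<notin> interior T" using interior_mono[OF T_subset] by (auto simp: interior_atLeastAtMost_real)
    moreover have "0 \<notin> frontier T" using frontier_T t t0 by auto
    ultimately have cl: "0 \<notin> closure T" by (auto simp: frontier_def)
    then have "0 \<notin> T" using closure_subset by auto
    have "T \<inter> {e<..<e'} = {}"
    proof (rule ccontr)
      assume "T \<inter> {e<..<e'} \<noteq> {}"
      then have "{0<..<e'} \<subseteq> T" using strip.T_strip[OF s] t0 by auto
      then have "closure {0<..<e'} \<subseteq> closure T" by (rule closure_mono)
      moreover have "0 \<in> closure {0<..<e'}" using b t0 by (simp add: closure_greaterThanLessThan)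
      ultimately show False using cl by blast
    qed
    then have "\<forall>\<^sub>F r in at t within {e<..<e'}. indicator T r * p r z = 0"
      unfolding eventually_at by (intro exI[of _ 1]) (auto simp: indicator_def)
    then have "((\<lambda>r. indicator T r * p r z) \<longlongrightarrow> 0) (at t within {e<..<e'})" by (rule tendsto_eventually)
    moreover have "at t within {e<..<e'} \<noteq> bot" using b by (simp add: True at_within_Ioo_right)
    ultimately have "q = 0" using dq(2) tendsto_unique by blast
    then have "hj_operator pr a d (\<psi> x t) (indicator T t * p t z) z = 0" using dq(4) \<open>0 \<notin> T\<close> by (simp add: t0)
    moreover have "((\<lambda>r. \<psi> x r z) has_real_derivative d) (at t within {0..1})"
      using dq(1) b by (simp add: t0 at_within_Ioo_right at_within_Icc_at_right)
    ultimately show ?thesis by blast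
  qed
next
  fix t z assume t: "t \<in> {0..<1} \<inter> D - S"
  obtain e e' where seg: "segment e e'" "e \<le> t" "t < e'" by (rule segment_right[of t]) (use t in auto)
  have "t = e"
  proof (rule ccontr)
    assume "t \<noteq> e" then have "t \<in> {e<..<e'}" using seg by auto
    then show False using seg(1) t unfolding segment_def by auto
  qed
  obtain Tm G H where s: "smooth_strip x e e' Tm G H" by (rule segment_strip[OF seg(1)])
  have "t \<in> {e..<e'} \<or> t = e' \<and> e' \<notin> S" using seg by auto
  from gradient_segment(4)[OF s seg(1) this, of z]
  show "\<exists>d q. ((\<lambda>r. \<psi> x r z) has_real_derivative d) (at_right t) \<and>
      ((\<lambda>r. indicator T r * p r z) \<longlongrightarrow> q) (at_right t) \<and> hj_operator pr a d (\<psi> x t) q z = 0"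
    unfolding \<open>t = e\<close> at_within_Ioo_right[OF segment_bounds(2)[OF seg(1)]] by blast
next
  fix t z assume t: "t \<in> {0<..<1} \<inter> D - S"
  obtain e e' where seg: "segment e e'" "e < t" "t \<le> e'" by (rule segment_left[of t]) (use t in auto)
  have "t = e'"
  proof (rule ccontr)
    assume "t \<noteq> e'" then have "t \<in> {e<..<e'}" using seg by auto
    then show False using seg(1) t unfolding segment_def by auto
  qed
  obtain Tm G H where s: "smooth_strip x e e' Tm G H" by (rule segment_strip[OF seg(1)])
  have "t \<in> {e..<e'} \<or> t = e' \<and> e' \<notin> S" using \<open>t = e'\<close> t by auto
  from gradient_segment(4)[OF s seg(1) this, of z]
  show "\<exists>d q. ((\<lambda>r. \<psi> x r z) has_real_derivative d) (at_left t) \<and>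
      ((\<lambda>r. indicator T r * p r z) \<longlongrightarrow> q) (at_left t) \<and> hj_operator pr a d (\<psi> x t) q z = 0"
    unfolding \<open>t = e'\<close> at_within_Ioo_left[OF segment_bounds(2)[OF seg(1)]] by blast
qed (auto intro: \<psi>_jump \<psi>_final)

end

section \<open>Measurability of the gradient\<close>

lemma borel_measurable_vecI:
  fixes f :: "'b \<Rightarrow> real^'n"
  assumes "\<And>i. (\<lambda>x. f x $ i) \<in> borel_measurable N" shows "f \<in> borel_measurable N"
proof -
  have "(\<lambda>x. \<Sum>i\<in>UNIV. f x $ i *\<^sub>R axis i (1::real)) \<in> borel_measurable N"
    using assms by measurable
  moreover have "(\<Sum>i\<in>UNIV. f x $ i *\<^sub>R axis i (1::real)) = f x" for x
    using basis_expansion[of "f x"] by (simp add: scalar_mult_eq_scaleR)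
  ultimately show ?thesis by simp
qed

section \<open>Predictable processes on path space\<close>

lemma space_predictable: "space (predictable_algebra :: (real \<times> (real \<Rightarrow> 'b::topological_space)) measure) = {0..1} \<times> space path_space"
  and sets_predictable: "sets (predictable_algebra :: (real \<times> (real \<Rightarrow> 'b)) measure) = sigma_sets ({0..1} \<times> space path_space)
     ({{0} \<times> A | A. A \<in> sets (path_filtration 0)} \<union>
      {{s<..t} \<times> A | s t A. 0 \<le> s \<and> s \<le> t \<and> t \<le> 1 \<and> A \<in> sets (path_filtration s)})"
proof -
  have "{{0} \<times> A | A. A \<in> sets (path_filtration 0)} \<union>
      {{s<..t} \<times> A | s t A. 0 \<le> s \<and> s \<le> t \<and> t \<le> 1 \<and> A \<in> sets (path_filtration s)} \<subseteq>
      Pow ({0..1::real} \<times> space (path_space :: (real \<Rightarrow> 'b) measure))"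
  proof (intro subsetI)
    fix X :: "(real \<times> (real \<Rightarrow> 'b)) set"
    assume X: "X \<in> {{0} \<times> A | A. A \<in> sets (path_filtration 0)} \<union>
      {{s<..t} \<times> A | s t A. 0 \<le> s \<and> s \<le> t \<and> t \<le> 1 \<and> A \<in> sets (path_filtration s)}"
    have sub: "A \<subseteq> space path_space" if "A \<in> sets (path_filtration s)" for A s
      using sets.sets_into_space[OF that] by simp
    from X consider A where "X = {0} \<times> A" "A \<in> sets (path_filtration 0)"
      | s t A where "X = {s<..t} \<times> A" "0 \<le> s" "t \<le> 1" "A \<in> sets (path_filtration s)" by blast
    then show "X \<in> Pow ({0..1::real} \<times> space path_space)"
    proof cases
      case 1 then show ?thesis using sub[OF 1(2)] by auto
    next
      case 2
      have "{s<..t} \<subseteq> {0..1}" using 2 by auto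
      then show ?thesis using sub[OF 2(4)] unfolding 2(1) by (intro PowI Sigma_mono)
    qed
  qed
  from space_measure_of[OF this] sets_measure_of[OF this]
  show "space (predictable_algebra :: (real \<times> (real \<Rightarrow> 'b)) measure) = {0..1} \<times> space path_space"
    and "sets (predictable_algebra :: (real \<times> (real \<Rightarrow> 'b)) measure) = sigma_sets ({0..1} \<times> space path_space)
     ({{0} \<times> A | A. A \<in> sets (path_filtration 0)} \<union>
      {{s<..t} \<times> A | s t A. 0 \<le> s \<and> s \<le> t \<and> t \<le> 1 \<and> A \<in> sets (path_filtration s)})"
    unfolding predictable_algebra_def by auto
qed

lemma predictable_initial: "A \<in> sets (path_filtration 0) \<Longrightarrow> {0} \<times> A \<in> sets predictable_algebra"
  unfolding sets_predictable by (rule sigma_sets.Basic) blast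

lemma predictable_rectangle:
  "0 \<le> s \<Longrightarrow> s \<le> t \<Longrightarrow> t \<le> 1 \<Longrightarrow> A \<in> sets (path_filtration s) \<Longrightarrow> {s<..t} \<times> A \<in> sets predictable_algebra"
  unfolding sets_predictable by (rule sigma_sets.Basic) blast

lemma measurable_predictable_step:
  fixes h :: "(real \<Rightarrow> 'b::topological_space) \<Rightarrow> real"
  assumes h: "h \<in> borel_measurable (path_filtration s)"
    and J: "\<And>A :: (real \<Rightarrow> 'b) set. A \<in> sets (path_filtration s) \<Longrightarrow> J \<times> A \<in> sets predictable_algebra"
  shows "(\<lambda>(t, w). if t \<in> J then h w else 0) \<in> borel_measurable predictable_algebra"
proof (rule measurableI)
  fix A :: "real set" assume A: "A \<in> sets borel"
  have X: "J \<times> (h -` A \<inter> space path_space) \<in> sets predictable_algebra"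
    by (rule J) (use measurable_sets[OF h A] in simp)
  have Y: "J \<times> space (path_space :: (real \<Rightarrow> 'b) measure) \<in> sets predictable_algebra"
    by (rule J) (use sets.top[of "path_filtration s"] in simp)
  have "(\<lambda>(t, w). if t \<in> J then h w else 0) -` A \<inter> space predictable_algebra =
    J \<times> (h -` A \<inter> space path_space) \<union> (if 0 \<in> A then space predictable_algebra - J \<times> space path_space else {})"
    using sets.sets_into_space[OF Y] by (auto simp: space_predictable split: if_splits)
  also have "\<dots> \<in> sets predictable_algebra" using X Y by auto
  finally show "(\<lambda>(t, w). if t \<in> J then h w else 0) -` A \<inter> space predictable_algebra \<in> sets predictable_algebra" .
qed auto

lemma measurable_predictable_time: "fst \<in> borel_measurable predictable_algebra"
proof (rule borel_measurableI_greater)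
  fix y :: real
  have "{w \<in> space predictable_algebra. y < fst w} =
    (if y < 0 then space predictable_algebra else if 1 \<le> y then {} else {y<..1} \<times> space path_space)"
    by (auto simp: space_predictable)
  also have "\<dots> \<in> sets predictable_algebra"
    using predictable_rectangle[of y 1 "space path_space"] sets.top[of "path_filtration y"] by auto
  finally show "{w \<in> space predictable_algebra. y < fst w} \<in> sets predictable_algebra" .
qed

context flat_quotient
begin

abbreviation "predictable_paths \<equiv> predictable_algebra :: (real \<times> (real \<Rightarrow> 'x)) measure"

lemma measurable_predictable_start:
  \<comment> \<open>The initial position is known at every time, but time 0 and the interval (0, 1]
    are covered by different generators and are treated separately.\<close>
  "(\<lambda>w. snd w 0) \<in> predictable_paths \<rightarrow>\<^sub>M borel"
proof (rule measurable_cozeroI)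
  fix f :: "'x \<Rightarrow> real" assume f: "continuous_on UNIV f"
  have h: "(\<lambda>v. f (v 0)) \<in> borel_measurable (path_filtration 0)"
    by (rule measurable_compose[OF measurable_path_filtration_eval borel_measurable_continuous_onI[OF f]]) auto
  have 1: "(\<lambda>(t, v). if t \<in> {0} then f (v 0) else 0) \<in> borel_measurable predictable_paths"
    by (rule measurable_predictable_step[OF h predictable_initial])
  have 2: "(\<lambda>(t, v). if t \<in> {0<..1} then f (v 0) else 0) \<in> borel_measurable predictable_paths"
    by (rule measurable_predictable_step[OF h predictable_rectangle]) auto
  show "(\<lambda>w. f (snd w 0)) \<in> borel_measurable predictable_paths"
    by (rule measurable_cong[THEN iffD1, OF _ borel_measurable_add[OF 1 2]]) (auto simp: space_predictable)
qed

text \<open>The path is frozen at the left end of each cell of a grid, where its value is already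
  known; these step processes converge by continuity.\<close>

lemma measurable_predictable_eval:
  "(\<lambda>w. snd w (fst w)) \<in> predictable_paths \<rightarrow>\<^sub>M borel"
proof (rule measurable_cozeroI)
  fix f :: "'x \<Rightarrow> real" assume f: "continuous_on UNIV f"
  define s where "s m k = real k / real (Suc m)" for m k :: nat
  define g where "g m w = (case w of (t, v) \<Rightarrow> if t \<in> {0} then f (v 0) else 0) +
    (\<Sum>k<Suc m. case w of (t, v) \<Rightarrow> if t \<in> {s m k<..s m (Suc k)} then f (v (s m k)) else 0)" for m and w :: "real \<times> (real \<Rightarrow> 'x)"
  have s01: "0 \<le> s m k" "s m k \<le> s m (Suc k)" "s m (Suc k) \<le> 1" if "k < Suc m" for m k
    using that by (auto simp: s_def divide_le_eq divide_right_mono)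
  have h: "(\<lambda>v. f (v q)) \<in> borel_measurable (path_filtration q)" if "q \<in> {0..1}" for q
    using that by (intro measurable_compose[OF measurable_path_filtration_eval borel_measurable_continuous_onI[OF f]]) auto
  show "(\<lambda>w. f (snd w (fst w))) \<in> borel_measurable predictable_paths"
  proof (rule borel_measurable_LIMSEQ_real)
    show "g m \<in> borel_measurable predictable_algebra" for m
      unfolding g_def
    proof (intro borel_measurable_add borel_measurable_sum)
      show "(\<lambda>(t, v). if t \<in> {0} then f (v 0) else 0) \<in> borel_measurable predictable_algebra"
        by (rule measurable_predictable_step[OF h predictable_initial]) auto
      fix k assume "k \<in> {..<Suc m}"
      then have k: "k < Suc m" by simp
      show "(\<lambda>(t, v). if t \<in> {s m k<..s m (Suc k)} then f (v (s m k)) else 0) \<in> borel_measurable predictable_algebra"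
        using s01[OF k] by (intro measurable_predictable_step[OF h predictable_rectangle]) auto
    qed
    fix w :: "real \<times> (real \<Rightarrow> 'x)" assume "w \<in> space predictable_algebra"
    then obtain t v where w: "w = (t, v)" "t \<in> {0..1}" "v \<in> space path_space" by (auto simp: space_predictable)
    show "(\<lambda>m. g m w) \<longlonglongrightarrow> f (snd w (fst w))"
    proof (cases "t = 0")
      case True
      have "g m w = f (v 0)" for m
      proof -
        have "(\<Sum>k<Suc m. case w of (t, v) \<Rightarrow> if t \<in> {s m k<..s m (Suc k)} then f (v (s m k)) else 0) = 0"
          using s01(1)[of _ m] by (intro sum.neutral) (auto simp: w True not_less[symmetric])
        then show ?thesis unfolding g_def by (simp add: w True)
      qed
      then show ?thesis by (simp add: w True)
    next
      case False
      then have t: "0 < t" "t \<le> 1" using w by auto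
      \<comment> \<open>Cells are open on the left and closed on the right, so the index of the cell
        containing \<open>t\<close> is a ceiling minus 1.\<close>
      define c where "c m = nat (\<lceil>real (Suc m) * t\<rceil> - 1)" for m
      have c: "real (c m) < real (Suc m) * t" "real (Suc m) * t \<le> real (c m) + 1" for m
      proof -
        have "0 < real (Suc m) * t" using t by simp
        then have "1 \<le> \<lceil>real (Suc m) * t\<rceil>" by (simp add: one_le_ceiling)
        then have "real (c m) = real_of_int \<lceil>real (Suc m) * t\<rceil> - 1" by (simp add: c_def)
        then show "real (c m) < real (Suc m) * t" "real (Suc m) * t \<le> real (c m) + 1"
          by linarith+
      qed
      have c_less: "c m < Suc m" for m
      proof -
        have "real (Suc m) * t \<le> real (Suc m)" using t by (simp add: mult_left_le)
        then have "real (c m) < real (Suc m)" using c(1)[of m] by linarith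
        then show ?thesis by simp
      qed
      have iff: "t \<in> {s m k<..s m (Suc k)} \<longleftrightarrow> k = c m" for m k
      proof -
        have "t \<in> {s m k<..s m (Suc k)} \<longleftrightarrow> real k < real (Suc m) * t \<and> real (Suc m) * t \<le> real k + 1"
          by (auto simp: s_def field_simps)
        also have "\<dots> \<longleftrightarrow> k = c m" using c[of m] by auto
        finally show ?thesis .
      qed
      have geq: "g m w = f (v (s m (c m)))" for m
      proof -
        have "(\<Sum>k<Suc m. case w of (t, v) \<Rightarrow> if t \<in> {s m k<..s m (Suc k)} then f (v (s m k)) else 0) =
          (\<Sum>k<Suc m. if k = c m then f (v (s m k)) else 0)"
          unfolding w split iff ..
        then show ?thesis unfolding g_def using c_less[of m] t by (simp add: w del: sum.lessThan_Suc)
      qed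
      have lim: "(\<lambda>m. s m (c m)) \<longlonglongrightarrow> t"
      proof (rule tendsto_sandwich)
        show "\<forall>\<^sub>F m in sequentially. t - 1 / real (Suc m) \<le> s m (c m)"
        proof (intro always_eventually allI)
          fix m have "t \<le> (real (c m) + 1) / real (Suc m)" using c(2)[of m] by (simp add: field_simps)
          then show "t - 1 / real (Suc m) \<le> s m (c m)" by (simp add: s_def add_divide_distrib)
        qed
        show "\<forall>\<^sub>F m in sequentially. s m (c m) \<le> t"
          using iff less_imp_le by (intro always_eventually allI) fastforce
        have "(\<lambda>m. t - 1 / real (Suc m)) \<longlonglongrightarrow> t - 0" by (intro tendsto_intros LIMSEQ_Suc lim_1_over_n)
        then show "(\<lambda>m. t - 1 / real (Suc m)) \<longlonglongrightarrow> t" by simp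
      qed simp
      have "continuous_on {0..1} (\<lambda>q. f (v q))"
        using w(3) by (intro continuous_on_compose2[OF f]) (auto simp: space_path_space)
      then have "(\<lambda>m. f (v (s m (c m)))) \<longlonglongrightarrow> f (v t)"
        by (rule continuous_on_tendsto_compose[OF _ lim w(2)])
          (intro always_eventually allI, use s01[OF c_less] in \<open>simp add: order_trans[OF s01(2,3)[OF c_less]]\<close>)
      then show ?thesis unfolding geq by (simp add: w)
    qed
  qed
qed

lemma measurable_predictable_state:
  "(\<lambda>w. (fst w, (snd w 0, snd w (fst w)))) \<in> predictable_paths \<rightarrow>\<^sub>M borel \<Otimes>\<^sub>M (borel \<Otimes>\<^sub>M borel)"
  by (intro measurable_Pair measurable_predictable_time measurable_predictable_start measurable_predictable_eval)

text \<open>\<open>inv pr\<close> need not be measurable, but the projected translate does not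
  depend on the chosen lift, so measurability can be tested on lifts.\<close>

lemma measurable_shift: "(\<lambda>z. pr (inv pr z + w)) \<in> borel \<rightarrow>\<^sub>M borel"
proof (rule measurable_quotient)
  have "pr (inv pr (pr y) + w) = pr (y + w)" for y by (rule translate) simp
  then show "(\<lambda>y. pr (inv pr (pr y) + w)) \<in> borel \<rightarrow>\<^sub>M borel" by simp
qed

end

context bredinger
begin

lemma measurable_F:
  assumes t: "t \<in> {0..1}" shows "(\<lambda>(x, w). F x t w) \<in> borel_measurable (borel \<Otimes>\<^sub>M path_space)"
proof -
  let ?b = "borel :: 'x measure"
  have Z: "(\<lambda>z. snd z q) \<in> ?b \<Otimes>\<^sub>M path_space \<rightarrow>\<^sub>M ?b" if "q \<in> {0..1}" for q
    by (rule measurable_compose[OF measurable_snd measurable_path_eval[OF that]])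
  have "(\<lambda>z. weight t 1 (snd z)) \<in> borel_measurable (?b \<Otimes>\<^sub>M path_space)"
  proof (rule measurable_weight)
    show "continuous_on {t..1} (snd z)" if "z \<in> space (?b \<Otimes>\<^sub>M path_space)" for z
    proof (rule continuous_on_subset[of "{0..1}"])
      have "snd z \<in> space path_space" using that by (auto simp: space_pair_measure)
      then show "continuous_on {0..1} (snd z)" unfolding space_path_space by blast
    qed (use t in simp)
  qed (use t Z in auto)
  moreover have "(\<lambda>z. \<eta> (fst z) (snd z 1)) \<in> borel_measurable (?b \<Otimes>\<^sub>M path_space)"
  proof -
    have "(\<lambda>z. (fst z, snd z 1)) \<in> ?b \<Otimes>\<^sub>M path_space \<rightarrow>\<^sub>M ?b \<Otimes>\<^sub>M ?b"
      by (intro measurable_Pair measurable_fst Z) simp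
    from measurable_compose[OF this measurable_\<eta>] show ?thesis by simp
  qed
  ultimately show ?thesis unfolding F_weight case_prod_beta by measurable
qed

lemma measurable_F_x: "t \<in> {0..1} \<Longrightarrow> F x t \<in> borel_measurable path_space"
  using measurable_Pair2[OF measurable_F, of t x] by simp

end

section \<open>Measurability of the value function and of the velocity in the state\<close>

locale regular_bredinger = smooth_bredinger +
  fixes vol :: "'b measure"
  assumes flat: "flat_space pr vol"
begin

abbreviation "law t \<equiv> brownian_law_through pr a M B t"

lemma sets_law: "sets (law t z) = sets path_space"
  by (simp add: brownian_law_through_def)

lemma sets_reversible: "sets (reversible_brownian pr vol a M B) = sets path_space"
proof -
  obtain \<Lambda>' C where "vol = distr (restrict_space lborel C) borel pr" by (rule flat_space_lattice[OF flat]) blast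
  then have "space vol \<noteq> {}" by simp
  then show ?thesis unfolding reversible_brownian_def
    by (intro sets_bind) (auto simp: brownian_law_def)
qed

lemma measurable_law: "t \<in> {0..1} \<Longrightarrow> law t \<in> borel \<rightarrow>\<^sub>M prob_algebra path_space"
proof -
  assume t: "t \<in> {0..1}"
  have "law t \<in> borel \<rightarrow>\<^sub>M prob_algebra (reversible_brownian pr vol a M B)"
    using regular_conditional_law_brownian(2)[OF flat brownian t, of a] by (simp add: regular_conditional_law_def)
  also have "prob_algebra (reversible_brownian pr vol a M B) = prob_algebra path_space"
    unfolding prob_algebra_def by (simp add: sets_reversible cong: subprob_algebra_cong)
  finally show ?thesis .
qed

lemma nn_integral_law:
  assumes "t \<in> {0..1}" "f \<in> borel_measurable path_space"
  shows "(\<integral>\<^sup>+w. f w \<partial>law t (pr y)) = (\<integral>\<^sup>+w. f (path t y w) \<partial>M)"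
  unfolding brownian_law_through_eq using assms by (intro nn_integral_distr measurable_path) auto

lemma exp_\<psi>:
  assumes "t \<in> {0..1}" shows "(\<integral>\<^sup>+w. ennreal (F x t w) \<partial>law t z) = ennreal (exp (\<psi> x t z))"
proof -
  have "(\<integral>\<^sup>+w. ennreal (F x t w) \<partial>law t (pr (inv pr z))) = ennreal (value_fun x t (inv pr z))"
    unfolding value_fun_nn_integral[OF assms, symmetric]
    by (intro nn_integral_law assms measurable_compose[OF measurable_F_x[OF assms] measurable_ennreal])
  moreover have "exp (\<psi> x t z) = value_fun x t (inv pr z)"
    using \<psi>_value[OF assms, of x "inv pr z"] value_fun_pos[OF assms] by simp
  ultimately show ?thesis by simp
qed

lemma measurable_\<psi>:
  assumes t: "t \<in> {0..1}" shows "(\<lambda>(x, z). \<psi> x t z) \<in> borel_measurable (borel \<Otimes>\<^sub>M borel)"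
proof -
  let ?b = "borel :: 'b measure"
  have "(\<lambda>s. \<integral>\<^sup>+v. ennreal (F (fst s) t v) \<partial>law t (snd s)) \<in> borel_measurable (?b \<Otimes>\<^sub>M borel)"
  proof (rule nn_integral_measurable_subprob_algebra2)
    have "(\<lambda>w. (fst (fst w), snd w)) \<in> (?b \<Otimes>\<^sub>M ?b) \<Otimes>\<^sub>M path_space \<rightarrow>\<^sub>M ?b \<Otimes>\<^sub>M (path_space :: (real \<Rightarrow> 'b) measure)"
      by measurable
    from measurable_compose[OF measurable_compose[OF this measurable_F[OF t]] measurable_ennreal]
    show "(\<lambda>(s, v). ennreal (F (fst s) t v)) \<in> borel_measurable ((?b \<Otimes>\<^sub>M ?b) \<Otimes>\<^sub>M path_space)"
      by (simp add: case_prod_beta)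
    show "(\<lambda>s. law t (snd s)) \<in> ?b \<Otimes>\<^sub>M borel \<rightarrow>\<^sub>M subprob_algebra path_space"
      by (rule measurable_compose[OF measurable_snd measurable_prob_algebraD[OF measurable_law[OF t]]])
  qed
  then have "(\<lambda>s. ln (enn2real (ennreal (exp (\<psi> (fst s) t (snd s)))))) \<in> borel_measurable (?b \<Otimes>\<^sub>M borel)"
    unfolding exp_\<psi>[OF t] by measurable
  then show ?thesis by (simp add: case_prod_beta)
qed

text \<open>Before time 1 a segment starting at or before \<open>t\<close> is used. At time 1 the
  segment ending there serves, because 1 is not a jump time.\<close>

lemma gderiv_\<psi>:
  assumes t: "t \<in> {0..1}" shows "GDERIV (\<psi> x t \<circ> pr) y :> gradient pr (\<psi> x t) (pr y)"
proof -
  obtain e e' where seg: "segment e e'" "t \<in> {e..<e'} \<or> t = e' \<and> e' \<notin> S"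
  proof (cases "t < 1")
    case True
    then show thesis using segment_right[of t] that t by auto
  next
    case False
    then have "t = 1" using t by simp
    then obtain e e' where "segment e e'" "e < 1" "1 \<le> e'" using segment_left[of 1] by auto
    moreover then have "e' = 1" using segment_bounds(3) by fastforce
    moreover have "1 \<notin> S" using S_subset by auto
    ultimately show thesis using that[of e e'] \<open>t = 1\<close> by simp
  qed
  obtain Tm G H where s: "smooth_strip x e e' Tm G H" by (rule segment_strip[OF seg(1)])
  show ?thesis using gradient_segment(1,2)[OF s seg] by simp
qed

text \<open>The components are limits of difference quotients, and these involve only projected
  translates of the state.\<close>

lemma measurable_gradient_at:
  assumes t: "t \<in> {0..1}"
  shows "(\<lambda>(x, z). gradient pr (\<psi> x t) z) \<in> borel_measurable (borel \<Otimes>\<^sub>M borel)"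
proof (rule borel_measurable_vecI, rule borel_measurable_LIMSEQ_real)
  fix i :: 'a
  let ?w = "\<lambda>m. (1 / real (Suc m)) *\<^sub>R axis i (1::real)"
  show "(\<lambda>v. (\<psi> (fst v) t (pr (inv pr (snd v) + ?w m)) - \<psi> (fst v) t (snd v)) / (1 / real (Suc m)))
    \<in> borel_measurable (borel \<Otimes>\<^sub>M borel)" for m
  proof -
    have "(\<lambda>v. (fst v, pr (inv pr (snd v) + ?w m))) \<in> (borel :: 'b measure) \<Otimes>\<^sub>M (borel :: 'b measure) \<rightarrow>\<^sub>M (borel :: 'b measure) \<Otimes>\<^sub>M (borel :: 'b measure)"
      by (intro measurable_Pair measurable_fst measurable_compose[OF measurable_snd measurable_shift])
    from measurable_compose[OF this measurable_\<psi>[OF t]] measurable_\<psi>[OF t]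
    show ?thesis unfolding case_prod_beta fst_conv snd_conv by measurable
  qed
  fix v :: "'b \<times> 'b"
  obtain x z where v: "v = (x, z)" by fastforce
  define y where "y = inv pr z"
  have z: "pr y = z" by (simp add: y_def)
  have l: "((\<lambda>s. y + s *\<^sub>R axis i (1::real)) has_derivative (\<lambda>h. h *\<^sub>R axis i 1)) (at 0)"
    by (auto intro!: derivative_eq_intros)
  have "((\<psi> x t \<circ> pr) has_derivative (\<lambda>h. h \<bullet> gradient pr (\<psi> x t) z)) (at (y + 0 *\<^sub>R axis i 1))"
    using gderiv_\<psi>[OF t, of x y] by (simp add: gderiv_def z)
  from has_derivative_compose[of "\<lambda>s. y + s *\<^sub>R axis i (1::real)", OF l this]
  have "((\<lambda>s. \<psi> x t (pr (y + s *\<^sub>R axis i 1))) has_derivative (\<lambda>h. (h *\<^sub>R axis i 1) \<bullet> gradient pr (\<psi> x t) z)) (at 0)"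
    by (simp only: comp_def)
  then have "((\<lambda>s. \<psi> x t (pr (y + s *\<^sub>R axis i 1))) has_real_derivative gradient pr (\<psi> x t) z $ i) (at 0)"
    unfolding has_field_derivative_def by (simp add: inner_axis' mult_commute_abs)
  then have "((\<lambda>h. (\<psi> x t (pr (y + (0 + h) *\<^sub>R axis i 1)) - \<psi> x t (pr (y + 0 *\<^sub>R axis i 1))) / h) \<longlongrightarrow> gradient pr (\<psi> x t) z $ i) (at 0)"
    by (rule DERIV_D)
  moreover have "filterlim (\<lambda>m. 1 / real (Suc m)) (at 0) sequentially"
    unfolding filterlim_at using LIMSEQ_Suc[OF lim_1_over_n] by auto
  ultimately have "(\<lambda>m. (\<psi> x t (pr (y + (0 + 1 / real (Suc m)) *\<^sub>R axis i 1)) - \<psi> x t (pr (y + 0 *\<^sub>R axis i 1))) / (1 / real (Suc m)))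
    \<longlonglongrightarrow> gradient pr (\<psi> x t) z $ i" by (rule filterlim_compose)
  then show "(\<lambda>m. (\<psi> (fst v) t (pr (inv pr (snd v) + ?w m)) - \<psi> (fst v) t (snd v)) / (1 / real (Suc m)))
    \<longlonglongrightarrow> (case v of (x, z) \<Rightarrow> gradient pr (\<psi> x t) z) $ i"
    by (simp add: v y_def)
qed

definition velocity :: "real \<Rightarrow> 'b \<Rightarrow> 'b \<Rightarrow> real^'a" where
  "velocity t x z = a *\<^sub>R gradient pr (\<psi> x t) z"

lemma velocity_strip:
  assumes "smooth_strip x e e' Tm G H" "segment e e'" "q \<in> {e<..<e'}"
  shows "velocity q x (pr y) = a *\<^sub>R G q y"
  unfolding velocity_def by (subst gradient_segment(1)[OF assms(1,2)]) (use assms in auto)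

lemma segment_free:
  assumes "q \<in> {0..1} - (D \<union> {0, 1})" obtains e e' where "segment e e'" "q \<in> {e<..<e'}"
proof -
  obtain e e' where seg: "segment e e'" "e \<le> q" "q < e'" by (rule segment_right[of q]) (use assms in auto)
  moreover have "e \<noteq> q" using assms seg(1) unfolding segment_def by auto
  ultimately show thesis by (intro that[of e e']) auto
qed

text \<open>The velocity is continuous in time away from finitely many times; each of these
  contributes a measurable slice.\<close>

lemma measurable_velocity:
  "(\<lambda>(t, (x, z)). if t \<in> {0..1} then velocity t x z else 0) \<in> borel_measurable (borel \<Otimes>\<^sub>M (borel \<Otimes>\<^sub>M borel))"
proof -
  let ?E = "D \<union> {0, 1}"
  let ?Z = "\<lambda>t v. velocity t (fst v) (snd v)"
  let ?N = "borel \<Otimes>\<^sub>M (borel \<Otimes>\<^sub>M borel) :: (real \<times> 'b \<times> 'b) measure"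
  define I where "I = {0<..<1} - ?E"
  have Z: "?Z t \<in> borel_measurable (borel \<Otimes>\<^sub>M borel)" if "t \<in> {0..1}" for t
    using measurable_gradient_at[OF that] unfolding velocity_def case_prod_beta by measurable
  have I: "open I" unfolding I_def using finite_D by (intro open_Diff finite_imp_closed) auto
  have "(\<lambda>(t, v). if t \<in> I then ?Z t v else 0) \<in> borel_measurable (borel \<Otimes>\<^sub>M (borel \<Otimes>\<^sub>M borel))"
  proof (rule borel_measurable_continuous_process[OF I])
    show "?Z t \<in> borel_measurable (borel \<Otimes>\<^sub>M borel)" if "t \<in> I" for t using that by (intro Z) (auto simp: I_def)
    fix v :: "'b \<times> 'b"
    show "continuous_on I (\<lambda>t. ?Z t v)"
      unfolding continuous_on_eq_continuous_at[OF I]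
    proof
      fix t assume "t \<in> I"
      then have "t \<in> {0..1} - ?E" by (auto simp: I_def)
      then obtain e e' where seg: "segment e e'" "t \<in> {e<..<e'}" by (rule segment_free)
      obtain Tm G H where s: "smooth_strip (fst v) e e' Tm G H" by (rule segment_strip[OF seg(1)])
      interpret st: strip pr \<Lambda> M B a T S \<eta> p \<theta> F "fst v" e e' Tm G H by (fact s)
      have "continuous_on {e<..<e'} (\<lambda>r. case (r, inv pr (snd v)) of (r, y) \<Rightarrow> G r y)"
        by (rule continuous_on_compose2[OF st.continuous_G]) (auto intro!: continuous_intros)
      then have "continuous_on {e<..<e'} (\<lambda>r. a *\<^sub>R G r (inv pr (snd v)))" by (intro continuous_intros) simp
      then have "continuous_on {e<..<e'} (\<lambda>r. ?Z r v)"
        by (rule continuous_on_cong[THEN iffD1, rotated 2])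
          (use velocity_strip[OF s seg(1), of _ "inv pr (snd v)"] in auto)
      then show "isCont (\<lambda>r. ?Z r v) t" using seg(2) by (simp add: continuous_on_eq_continuous_at)
    qed
  qed
  moreover have "(\<lambda>w. indicator {s} (fst w) *\<^sub>R ?Z s (snd w)) \<in> borel_measurable ?N" if "s \<in> ?E" for s
  proof -
    have "?Z s \<in> borel_measurable (borel \<Otimes>\<^sub>M borel)" using that D_subset by (intro Z) auto
    from measurable_compose[OF measurable_snd this] show ?thesis by measurable
  qed
  ultimately have "(\<lambda>w. (case w of (t, v) \<Rightarrow> if t \<in> I then ?Z t v else 0) +
      (\<Sum>s\<in>?E. indicator {s} (fst w) *\<^sub>R ?Z s (snd w))) \<in> borel_measurable ?N"
    by (intro borel_measurable_add borel_measurable_sum)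
  also have "(\<lambda>w. (case w of (t, v) \<Rightarrow> if t \<in> I then ?Z t v else 0) +
      (\<Sum>s\<in>?E. indicator {s} (fst w) *\<^sub>R ?Z s (snd w))) = (\<lambda>(t, (x, z)). if t \<in> {0..1} then velocity t x z else 0)"
  proof
    fix w :: "real \<times> 'b \<times> 'b"
    obtain t x z where w: "w = (t, (x, z))" by (cases w) auto
    have "(\<Sum>s\<in>?E. indicator {s} t *\<^sub>R velocity s x z) = (\<Sum>s\<in>?E. if s = t then velocity t x z else 0)"
      by (intro sum.cong refl) (auto simp: indicator_def)
    also have "\<dots> = (if t \<in> ?E then velocity t x z else 0)"
      using finite_D by (subst sum.delta) auto
    finally have sum: "(\<Sum>s\<in>?E. indicator {s} t *\<^sub>R velocity s x z) = (if t \<in> ?E then velocity t x z else 0)" .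
    have cases: "t \<in> {0..1} \<longleftrightarrow> t \<in> I \<or> t \<in> ?E" "\<not> (t \<in> I \<and> t \<in> ?E)" using D_subset by (auto simp: I_def)
    show "(case w of (t, v) \<Rightarrow> if t \<in> I then ?Z t v else 0) + (\<Sum>s\<in>?E. indicator {s} (fst w) *\<^sub>R ?Z s (snd w)) =
      (case w of (t, (x, z)) \<Rightarrow> if t \<in> {0..1} then velocity t x z else 0)"
      unfolding w split fst_conv snd_conv sum using cases by (cases "t \<in> I"; cases "t \<in> ?E") (simp_all del: atLeastAtMost_iff Un_iff insert_iff)
  qed
  finally show ?thesis .
qed

lemma predictable_velocity:
  "(\<lambda>(t, w). velocity t (w 0) (w t)) \<in> borel_measurable predictable_algebra"
  by (rule measurable_cong[THEN iffD1, OF _ measurable_compose[OF measurable_predictable_state measurable_velocity]])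
    (auto simp: space_predictable)

end

section \<open>Hitting times\<close>

text \<open>The value 2 for a level that is never reached separates this case from reaching it at
  time 1 and still counts as not stopped before time 1.\<close>

definition hitting_time :: "(real \<Rightarrow> 'b \<Rightarrow> real) \<Rightarrow> real \<Rightarrow> 'b \<Rightarrow> real" where
  "hitting_time h k w = (if \<exists>q\<in>{0..1}. k \<le> h q w then Inf {q\<in>{0..1}. k \<le> h q w} else 2)"

text \<open>By continuity the set of times at or above the level is closed, so the infimum is
  attained.\<close>

lemma hitting_time_le:
  assumes cont: "continuous_on {0..1} (\<lambda>q. h q w)" and t: "t \<in> {0..1}"
  shows "hitting_time h k w \<le> t \<longleftrightarrow> (\<exists>q\<in>{0..t}. k \<le> h q w)"
proof
  let ?C = "{q\<in>{0..1}. k \<le> h q w}"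
  have bdd: "bdd_below ?C" by (rule bdd_belowI[of _ 0]) auto
  {
    assume le: "hitting_time h k w \<le> t"
    have ne: "?C \<noteq> {}"
    proof
      assume "?C = {}"
      then have "hitting_time h k w = 2" unfolding hitting_time_def by auto
      then show False using le t by simp
    qed
    have "closed ({0..1} \<inter> (\<lambda>q. h q w) -` {k..})"
      by (intro continuous_closed_preimage cont) auto
    moreover have "{0..1} \<inter> (\<lambda>q. h q w) -` {k..} = ?C" by auto
    ultimately have "Inf ?C \<in> ?C" by (intro closed_contains_Inf ne bdd) simp
    moreover have "hitting_time h k w = Inf ?C" using ne unfolding hitting_time_def by auto
    ultimately show "\<exists>q\<in>{0..t}. k \<le> h q w" using le by auto
  next
    assume "\<exists>q\<in>{0..t}. k \<le> h q w"
    then obtain q where q: "q \<in> ?C" "q \<le> t" using t by auto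
    then have "hitting_time h k w = Inf ?C" unfolding hitting_time_def by auto
    then show "hitting_time h k w \<le> t" using cInf_lower[OF q(1) bdd] q(2) by simp
  }
qed

lemma hitting_time_nonneg: "0 \<le> hitting_time h k w"
  unfolding hitting_time_def by (auto intro!: cInf_greatest)

lemma hitting_time_cases: "hitting_time h k w \<le> 1 \<or> hitting_time h k w = 2"
proof (cases "\<exists>q\<in>{0..1}. k \<le> h q w")
  case True
  then obtain q where q: "q \<in> {q\<in>{0..1}. k \<le> h q w}" by auto
  have "Inf {q\<in>{0..1}. k \<le> h q w} \<le> q" by (rule cInf_lower[OF q]) (auto intro: bdd_belowI[of _ 0])
  then show ?thesis using True q by (auto simp: hitting_time_def)
qed (auto simp: hitting_time_def)

lemma hitting_time_mono:
  assumes cont: "continuous_on {0..1} (\<lambda>q. h q w)" and "k \<le> k'"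
  shows "hitting_time h k w \<le> hitting_time h k' w"
proof -
  consider "hitting_time h k' w = 2" | "hitting_time h k' w \<in> {0..1}"
    using hitting_time_cases[of h k' w] hitting_time_nonneg[of h k' w] by force
  then show ?thesis
  proof cases
    case 1
    then show ?thesis using hitting_time_cases[of h k w] by auto
  next
    case 2
    have "\<exists>q\<in>{0..hitting_time h k' w}. k' \<le> h q w" using hitting_time_le[of h w, OF cont 2, of k'] by simp
    then have "\<exists>q\<in>{0..hitting_time h k' w}. k \<le> h q w" using assms(2) order_trans by blast
    then show ?thesis using hitting_time_le[of h w, OF cont 2, of k] by simp
  qed
qed

text \<open>A value above the level would, by the intermediate value theorem, force the level to be
  met strictly earlier. The bound therefore includes the hitting time itself.\<close>

lemma le_hitting_time:
  assumes cont: "continuous_on {0..1} (\<lambda>q. h q w)" and q: "q \<in> {0..1}" "q \<le> hitting_time h k w" and 0: "h 0 w \<le> k"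
  shows "h q w \<le> k"
proof (rule ccontr)
  assume n: "\<not> h q w \<le> k"
  have "\<exists>r. 0 \<le> r \<and> r \<le> q \<and> h r w = k"
    using n 0 q(1) by (intro IVT' continuous_on_subset[OF cont]) auto
  then obtain r where r: "0 \<le> r" "r \<le> q" "h r w = k" by blast
  have "hitting_time h k w \<le> r" using hitting_time_le[of h w, OF cont, of r k] r q by auto
  then have "q = r" using r q by linarith
  then show False using r n by simp
qed

lemma hitting_time_eventually:
  assumes cont: "continuous_on {0..1} (\<lambda>q. h q w)"
  shows "\<exists>k. 1 \<le> hitting_time h (real k + 1) w"
proof -
  have "bounded ((\<lambda>q. h q w) ` {0..1})" by (intro compact_imp_bounded compact_continuous_image cont compact_Icc)
  then obtain b where b: "\<And>q. q \<in> {0..1} \<Longrightarrow> \<bar>h q w\<bar> \<le> b" unfolding bounded_iff real_norm_def by blast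
  obtain k where k: "b < real k" using reals_Archimedean2 by blast
  have "\<not> real k + 1 \<le> h q w" if "q \<in> {0..1}" for q using b[OF that] k by auto
  then have "hitting_time h (real k + 1) w = 2" unfolding hitting_time_def by auto
  then show ?thesis by (intro exI[of _ k]) simp
qed

text \<open>The filtration is indexed by all reals, while hitting times lie in [0, 1] or equal 2;
  negative times and times after 1 are handled separately.\<close>

lemma stopping_time_hitting_time:
  fixes h :: "real \<Rightarrow> (real \<Rightarrow> 'b::topological_space) \<Rightarrow> real"
  assumes meas: "\<And>q. q \<in> {0..1} \<Longrightarrow> h q \<in> borel_measurable (path_filtration q)"
    and cont: "\<And>w. w \<in> space path_space \<Longrightarrow> continuous_on {0..1} (\<lambda>q. h q w)"
  shows "stopping_time path_filtration (hitting_time h k)"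
proof
  fix t :: real
  have hit: "{w\<in>space path_space. hitting_time h k w \<le> s} \<in> sets (path_filtration s)" if s: "s \<in> {0..1}" for s
  proof -
    have "{w\<in>space (path_filtration s). \<exists>q\<in>{0..s}. k \<le> h q w} \<in> sets (path_filtration s)"
    proof (rule sets_continuous_process_hit)
      show "h q \<in> borel_measurable (path_filtration s)" if "q \<in> {0..s}" for q
        using s that by (intro measurable_path_filtration_mono[OF meas]) auto
      show "continuous_on {0..s} (\<lambda>q. h q w)" if "w \<in> space (path_filtration s)" for w
        using s that by (intro continuous_on_subset[OF cont]) auto
    qed
    also have "{w\<in>space (path_filtration s). \<exists>q\<in>{0..s}. k \<le> h q w} = {w\<in>space path_space. hitting_time h k w \<le> s}"
      using hitting_time_le[where h = h and k = k, OF cont s] by auto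
    finally show ?thesis .
  qed
  consider "t < 0" | "t \<in> {0..1}" | "1 < t" "t < 2" | "2 \<le> t" by fastforce
  then have "{w\<in>space path_space. hitting_time h k w \<le> t} \<in> sets (path_filtration t)"
  proof cases
    case 1
    then have "\<not> hitting_time h k w \<le> t" for w using hitting_time_nonneg[of h k w] by linarith
    then show ?thesis by simp
  next
    case 3
    have "hitting_time h k w \<le> t \<longleftrightarrow> hitting_time h k w \<le> 1" for w using 3 hitting_time_cases[of h k w] by auto
    then have "{w\<in>space path_space. hitting_time h k w \<le> t} = {w\<in>space path_space. hitting_time h k w \<le> 1}" by auto
    then show ?thesis using hit[of 1] path_filtration_mono[of 1 t] 3 by auto
  next
    case 4
    have "hitting_time h k w \<le> t" for w using 4 hitting_time_cases[of h k w] by auto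
    then have "{w\<in>space path_space. hitting_time h k w \<le> t} = space (path_filtration t)" by auto
    then show ?thesis by (simp only: sets.top)
  qed (rule hit)
  then show "Measurable.pred (path_filtration t) (\<lambda>w. hitting_time h k w \<le> t)"
    by (simp add: pred_def)
qed

text \<open>The clamped process is jointly measurable on \<open>path_filtration t\<close>, and
  evaluating it at the measurable time \<open>min t (\<tau> w)\<close> is a composition.\<close>

lemma measurable_stopped_process:
  fixes h :: "real \<Rightarrow> (real \<Rightarrow> 'b::topological_space) \<Rightarrow> 'c::metric_space"
  assumes meas: "\<And>q. q \<in> {0..1} \<Longrightarrow> h q \<in> borel_measurable (path_filtration q)"
    and cont: "\<And>w. w \<in> space path_space \<Longrightarrow> continuous_on {0..1} (\<lambda>q. h q w)"
    and \<tau>: "stopping_time path_filtration \<tau>" "\<And>w. w \<in> space path_space \<Longrightarrow> 0 \<le> \<tau> w"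
    and t: "t \<in> {0..1}"
  shows "(\<lambda>w. h (min t (\<tau> w)) w) \<in> borel_measurable (path_filtration t)"
proof -
  let ?N = "path_filtration t :: (real \<Rightarrow> 'b) measure"
  have \<tau>_meas: "(\<lambda>w. min t (\<tau> w)) \<in> borel_measurable ?N"
  proof (rule borel_measurableI_le)
    fix y
    show "{w \<in> space ?N. min t (\<tau> w) \<le> y} \<in> sets ?N"
    proof (cases "t \<le> y")
      case False
      then have "{w \<in> space ?N. min t (\<tau> w) \<le> y} = {w\<in>space (path_filtration y). \<tau> w \<le> y}" by (auto simp: min_le_iff_disj)
      also have "\<dots> \<in> sets (path_filtration y)" using stopping_timeD[OF \<tau>(1), of y] by (simp add: pred_def)
      finally show ?thesis using path_filtration_mono[of y t] False by auto
    next
      case True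
      then have "{w \<in> space ?N. min t (\<tau> w) \<le> y} = space ?N" by (auto simp: min_le_iff_disj)
      then show ?thesis by (simp only: sets.top)
    qed
  qed
  have "(\<lambda>(q, w). if q \<in> UNIV then h (max 0 (min t q)) w else h 0 undefined) \<in> borel_measurable (borel \<Otimes>\<^sub>M ?N)"
  proof (rule borel_measurable_continuous_process)
    show "h (max 0 (min t q)) \<in> borel_measurable ?N" for q
      using t by (intro measurable_path_filtration_mono[OF meas]) auto
    show "continuous_on UNIV (\<lambda>q. h (max 0 (min t q)) w)" if "w \<in> space ?N" for w
      using t that by (intro continuous_on_compose2[OF cont] continuous_intros) auto
  qed simp
  moreover have "(\<lambda>w. (min t (\<tau> w), w)) \<in> ?N \<rightarrow>\<^sub>M borel \<Otimes>\<^sub>M ?N"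
    using \<tau>_meas by (intro measurable_Pair) auto
  ultimately have "(\<lambda>w. case (min t (\<tau> w), w) of (q, w) \<Rightarrow> if q \<in> UNIV then h (max 0 (min t q)) w else h 0 undefined) \<in> borel_measurable ?N"
    by (rule measurable_compose[rotated])
  then show ?thesis
    by (rule measurable_cong[THEN iffD1, rotated]) (use \<tau>(2) t in \<open>simp add: max_def\<close>)
qed

section \<open>The local martingale\<close>

context regular_bredinger
begin

section \<open>Drift and martingale parts of the path increment\<close>

definition drift_part :: "real \<Rightarrow> (real \<Rightarrow> 'b) \<Rightarrow> real^'a" where
  "drift_part t w = (LBINT r:{0..t}. velocity r (w 0) (w r))"

definition martingale_part :: "real \<Rightarrow> (real \<Rightarrow> 'b) \<Rightarrow> real^'a" where
  "martingale_part t w = path_increment pr t w - drift_part t w"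

text \<open>Clamping the time to [0, t] keeps the evaluation of the path within the information at
  \<open>t\<close>; on the support of the indicator the clamp is the identity.\<close>

lemma measurable_velocity_path:
  assumes t: "t \<in> {0..1}"
  shows "(\<lambda>(q, v). indicator {0..t} q *\<^sub>R velocity q (v 0) (v q)) \<in> borel_measurable (borel \<Otimes>\<^sub>M path_filtration t)"
proof -
  let ?N = "path_filtration t :: (real \<Rightarrow> 'b) measure"
  have 1: "(\<lambda>(q, v). v (max 0 (min t q))) \<in> borel \<Otimes>\<^sub>M ?N \<rightarrow>\<^sub>M borel"
  proof (rule measurable_continuous_process)
    show "(\<lambda>v. v q) \<in> ?N \<rightarrow>\<^sub>M borel" if "q \<in> {0..t}" for q using that t by (intro measurable_path_filtration_eval) auto
    show "continuous_on {0..t} (\<lambda>q. v q)" if "v \<in> space ?N" for v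
    proof -
      have "continuous_on {0..1} v" using that unfolding space_path_filtration space_path_space by blast
      then show ?thesis by (rule continuous_on_subset) (use t in auto)
    qed
  qed (use t in simp)
  have "(\<lambda>w. (fst w, (snd w 0, case w of (q, v) \<Rightarrow> v (max 0 (min t q))))) \<in> borel \<Otimes>\<^sub>M ?N \<rightarrow>\<^sub>M borel \<Otimes>\<^sub>M (borel \<Otimes>\<^sub>M borel)"
  proof (intro measurable_Pair measurable_fst 1)
    have "(\<lambda>v. v 0) \<in> ?N \<rightarrow>\<^sub>M borel" using t by (intro measurable_path_filtration_eval) auto
    from measurable_compose[OF measurable_snd this] show "(\<lambda>w. snd w 0) \<in> borel \<Otimes>\<^sub>M ?N \<rightarrow>\<^sub>M borel" .
  qed
  from measurable_compose[OF this measurable_velocity]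
  have "(\<lambda>w. indicator {0..t} (fst w) *\<^sub>R (case (fst w, (snd w 0, case w of (q, v) \<Rightarrow> v (max 0 (min t q)))) of
      (t, (x, z)) \<Rightarrow> if t \<in> {0..1} then velocity t x z else 0)) \<in> borel_measurable (borel \<Otimes>\<^sub>M ?N)"
    by measurable
  moreover have "(\<lambda>w. indicator {0..t} (fst w) *\<^sub>R (case (fst w, (snd w 0, case w of (q, v) \<Rightarrow> v (max 0 (min t q)))) of
      (t, (x, z)) \<Rightarrow> if t \<in> {0..1} then velocity t x z else 0)) =
      (\<lambda>(q, v). indicator {0..t} q *\<^sub>R velocity q (v 0) (v q))"
  proof
    fix w :: "real \<times> (real \<Rightarrow> 'b)"
    obtain q v where w: "w = (q, v)" by fastforce
    show "indicator {0..t} (fst w) *\<^sub>R (case (fst w, (snd w 0, case w of (q, v) \<Rightarrow> v (max 0 (min t q)))) of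
      (t, (x, z)) \<Rightarrow> if t \<in> {0..1} then velocity t x z else 0) =
      (case w of (q, v) \<Rightarrow> indicator {0..t} q *\<^sub>R velocity q (v 0) (v q))"
    proof (cases "q \<in> {0..t}")
      case True
      then have "max 0 (min t q) = q" "q \<in> {0..1}" using t by auto
      then show ?thesis by (simp add: w)
    qed (simp add: w)
  qed
  ultimately show ?thesis by simp
qed

lemma velocity_path_segment:
  assumes z: "z \<in> space path_space" and seg: "segment e e'"
  shows "bounded ((\<lambda>q. velocity q (z 0) (z q)) ` {e<..<e'})"
proof -
  obtain w where w: "continuous_on {0..1} w" "\<And>r. r \<in> {0..1} \<Longrightarrow> pr (w r) = z r"
    by (rule path_space_lift[OF z]) blast
  obtain Tm G H where s: "smooth_strip (z 0) e e' Tm G H" by (rule segment_strip[OF seg])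
  interpret st: strip pr \<Lambda> M B a T S \<eta> p \<theta> F "z 0" e e' Tm G H by (fact s)
  have sub: "{e..e'} \<subseteq> {0..1}" using st.e by auto
  have "continuous_on {e..e'} (\<lambda>q. case (q, w q) of (r, y) \<Rightarrow> G r y)"
    by (rule continuous_on_compose2[OF st.continuous_G])
      (auto intro!: continuous_on_Pair continuous_on_id continuous_on_subset[OF w(1) sub])
  then have "continuous_on {e..e'} (\<lambda>q. a *\<^sub>R G q (w q))" by (intro continuous_intros) simp
  then have "bounded ((\<lambda>q. a *\<^sub>R G q (w q)) ` {e..e'})"
    by (intro compact_imp_bounded compact_continuous_image compact_Icc)
  moreover have "(\<lambda>q. velocity q (z 0) (z q)) ` {e<..<e'} \<subseteq> (\<lambda>q. a *\<^sub>R G q (w q)) ` {e..e'}"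
  proof (intro subsetI, elim imageE)
    fix v q assume q: "q \<in> {e<..<e'}" and v: "v = velocity q (z 0) (z q)"
    have "v = a *\<^sub>R G q (w q)" using velocity_strip[OF s seg q, of "w q"] w(2)[of q] q sub v by auto
    then show "v \<in> (\<lambda>q. a *\<^sub>R G q (w q)) ` {e..e'}" using q by auto
  qed
  ultimately show ?thesis by (rule bounded_subset)
qed

text \<open>On each segment the velocity along a path extends continuously to the closed interval.
  Hence the drift is integrable along every path, and its integral is Lipschitz in time.\<close>

lemma velocity_path_bounded:
  assumes w: "w \<in> space path_space"
  obtains C where "0 \<le> C" "\<And>q. q \<in> {0..1} \<Longrightarrow> norm (velocity q (w 0) (w q)) \<le> C"
proof -
  let ?E = "D \<union> {0, 1}" and ?v = "\<lambda>q. velocity q (w 0) (w q)"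
  define Q where "Q = {z \<in> ?E \<times> ?E. segment (fst z) (snd z)}"
  have "finite Q" using finite_D by (auto simp: Q_def)
  then have "bounded (\<Union>z\<in>Q. ?v ` {fst z<..<snd z})"
    by (intro bounded_UN ballI velocity_path_segment[OF w]) (auto simp: Q_def)
  moreover have "bounded (?v ` ?E)" using finite_D by (intro finite_imp_bounded) auto
  ultimately have b: "bounded ((\<Union>z\<in>Q. ?v ` {fst z<..<snd z}) \<union> ?v ` ?E)" by simp
  then obtain C where C: "\<And>v. v \<in> (\<Union>z\<in>Q. ?v ` {fst z<..<snd z}) \<union> ?v ` ?E \<Longrightarrow> norm v \<le> C"
    unfolding bounded_iff by blast
  have le: "norm (?v q) \<le> C" if q: "q \<in> {0..1}" for q
  proof (cases "q \<in> ?E")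
    case True
    then have "?v q \<in> ?v ` ?E" by (rule imageI)
    then show ?thesis by (intro C UnI2)
  next
    case False
    then have "q \<in> {0..1} - ?E" using q by blast
    then obtain e e' where seg: "segment e e'" "q \<in> {e<..<e'}" by (rule segment_free)
    then have "(e, e') \<in> Q" by (auto simp only: Q_def segment_def mem_Collect_eq mem_Sigma_iff fst_conv snd_conv)
    then have "?v q \<in> (\<Union>z\<in>Q. ?v ` {fst z<..<snd z})" using seg(2) by (intro UN_I[of "(e, e')"] imageI) auto
    then show ?thesis by (intro C UnI1)
  qed
  have "norm (?v 0) \<le> C" by (rule le) simp
  then have "0 \<le> C" by (rule order_trans[OF norm_ge_zero])
  then show thesis by (rule that[OF _ le])
qed

lemma set_integrable_velocity:
  assumes w: "w \<in> space path_space" and st: "0 \<le> s" "t \<le> 1"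
  shows "set_integrable lborel {s..t} (\<lambda>q. velocity q (w 0) (w q))"
proof -
  obtain C where C: "0 \<le> C" "\<And>q. q \<in> {0..1} \<Longrightarrow> norm (velocity q (w 0) (w q)) \<le> C"
    using velocity_path_bounded[OF w] by blast
  have "w \<in> space (path_filtration 1)" using w by simp
  from measurable_Pair1[OF measurable_velocity_path[of 1] this]
  have "(\<lambda>q. indicator {0..1} q *\<^sub>R velocity q (w 0) (w q)) \<in> borel_measurable lborel" by simp
  moreover have "integrable lborel (\<lambda>q. indicator {0..1::real} q * C)" by simp
  moreover have "AE q in lborel. norm (indicator {0..1} q *\<^sub>R velocity q (w 0) (w q)) \<le> norm (indicator {0..1} q * C)"
    using C by (intro AE_I2) (auto simp: indicator_def)
  ultimately have "integrable lborel (\<lambda>q. indicator {0..1} q *\<^sub>R velocity q (w 0) (w q))"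
    using Bochner_Integration.integrable_bound by blast
  then have "set_integrable lborel {0..1} (\<lambda>q. velocity q (w 0) (w q))" by (simp add: set_integrable_def)
  then show ?thesis by (rule set_integrable_subset) (use st in auto)
qed

lemma drift_part_diff:
  assumes w: "w \<in> space path_space" and st: "0 \<le> s" "s \<le> t" "t \<le> 1"
  shows "drift_part t w - drift_part s w = (LBINT q:{s..t}. velocity q (w 0) (w q))"
proof -
  have "drift_part t w = (LBINT q:{0..s} \<union> {s..t}. velocity q (w 0) (w q))"
    unfolding drift_part_def using st by (intro arg_cong2[where f = "set_lebesgue_integral lborel"]) auto
  also have "\<dots> = drift_part s w + (LBINT q:{s..t}. velocity q (w 0) (w q))"
    unfolding drift_part_def
  proof (rule set_integral_Un_AE)
    show "AE q in lborel. \<not> (q \<in> {0..s} \<and> q \<in> {s..t})"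
      using AE_lborel_singleton[of s] by eventually_elim auto
  qed (use st in \<open>auto intro!: set_integrable_velocity[OF w]\<close>)
  finally show ?thesis by simp
qed

lemma continuous_drift_part:
  assumes w: "w \<in> space path_space" shows "continuous_on {0..1} (\<lambda>t. drift_part t w)"
proof -
  obtain C where C: "0 \<le> C" "\<And>q. q \<in> {0..1} \<Longrightarrow> norm (velocity q (w 0) (w q)) \<le> C"
    using velocity_path_bounded[OF w] by blast
  have le: "norm (drift_part t w - drift_part s w) \<le> C * (t - s)" if st: "0 \<le> s" "s \<le> t" "t \<le> 1" for s t
  proof -
    have "norm (drift_part t w - drift_part s w) \<le> (LINT q|lborel. indicator {s..t} q * C)"
      unfolding drift_part_diff[OF w st] set_lebesgue_integral_def
    proof (rule order_trans[OF integral_norm_bound integral_mono])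
      show "integrable lborel (\<lambda>q. norm (indicator {s..t} q *\<^sub>R velocity q (w 0) (w q)))"
        using set_integrable_velocity[OF w st(1,3)] unfolding set_integrable_def by (rule integrable_norm)
      show "norm (indicator {s..t} q *\<^sub>R velocity q (w 0) (w q)) \<le> indicator {s..t} q * C" for q
        using st C by (auto simp: indicator_def)
    qed (use st in simp)
    also have "\<dots> = C * (t - s)" using st by simp
    finally show ?thesis .
  qed
  have "C-lipschitz_on {0..1} (\<lambda>t. drift_part t w)"
  proof (rule lipschitz_onI[OF _ C(1)])
    fix s t :: real assume "s \<in> {0..1}" "t \<in> {0..1}"
    then show "dist (drift_part s w) (drift_part t w) \<le> C * dist s t"
      using le[of s t] le[of t s] by (cases "s \<le> t") (auto simp: dist_norm norm_minus_commute dist_real_def)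
  qed
  then show ?thesis by (rule lipschitz_on_continuous_on)
qed

lemma measurable_drift_part:
  assumes t: "t \<in> {0..1}" shows "drift_part t \<in> borel_measurable (path_filtration t)"
proof -
  have "(\<lambda>w. (snd w, fst w)) \<in> path_filtration t \<Otimes>\<^sub>M lborel \<rightarrow>\<^sub>M borel \<Otimes>\<^sub>M path_filtration t"
    by measurable
  from measurable_compose[OF this measurable_velocity_path[OF t]]
  have "(\<lambda>(v, q). indicator {0..t} q *\<^sub>R velocity q (v 0) (v q)) \<in> borel_measurable (path_filtration t \<Otimes>\<^sub>M lborel)"
    by (simp add: case_prod_beta)
  from lborel.borel_measurable_lebesgue_integral[OF this]
  show ?thesis unfolding drift_part_def[abs_def] set_lebesgue_integral_def .
qed

lemma measurable_martingale_part:
  "t \<in> {0..1} \<Longrightarrow> martingale_part t \<in> borel_measurable (path_filtration t)"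
  unfolding martingale_part_def[abs_def] by (intro borel_measurable_diff measurable_path_increment measurable_drift_part)

lemma continuous_path_increment:
  assumes v: "v \<in> space path_space" shows "continuous_on {0..1} (\<lambda>t. path_increment pr t v)"
proof -
  obtain w where w: "continuous_on {0..1} w" "\<And>t. t \<in> {0..1} \<Longrightarrow> path_increment pr t v = w t - w 0"
    by (rule path_space_lift[OF v]) blast
  have "continuous_on {0..1} (\<lambda>t. w t - w 0)" by (intro continuous_intros w(1))
  then show ?thesis by (rule continuous_on_cong[THEN iffD2, rotated 2]) (use w(2) in auto)
qed

lemma continuous_martingale_part:
  assumes w: "w \<in> space path_space" shows "continuous_on {0..1} (\<lambda>t. martingale_part t w)"
  unfolding martingale_part_def by (intro continuous_on_diff continuous_path_increment continuous_drift_part w)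

lemma martingale_part_0:
  assumes v: "v \<in> space path_space" shows "path_increment pr 0 v = 0" "martingale_part 0 v = 0"
proof -
  obtain w where w: "\<And>t. t \<in> {0..1} \<Longrightarrow> path_increment pr t v = w t - (w 0 :: real^'a)"
    by (rule path_space_lift[OF v]) blast
  then show "path_increment pr 0 v = 0" by simp
  moreover have "drift_part 0 v = 0"
    unfolding drift_part_def set_lebesgue_integral_def
  proof (rule integral_eq_zero_AE)
    show "AE q in lborel. indicator {0..0} q *\<^sub>R velocity q (v 0) (v q) = 0"
      using AE_lborel_singleton[of "0::real"] by eventually_elim simp
  qed
  ultimately show "martingale_part 0 v = 0" by (simp add: martingale_part_def)
qed

section \<open>Localization\<close>

text \<open>Bounding the path increment confines the path to a ball where the strip estimates are
  uniform; bounding the martingale part makes the stopped process bounded.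
  \<open>strip_martingale\<close> needs both.\<close>

definition size_process :: "real \<Rightarrow> (real \<Rightarrow> 'b) \<Rightarrow> real" where
  "size_process t w = norm (path_increment pr t w) + norm (martingale_part t w)"

definition localizer :: "nat \<Rightarrow> (real \<Rightarrow> 'b) \<Rightarrow> real" where
  "localizer k = hitting_time size_process (real k + 1)"

lemma continuous_size_process: "w \<in> space path_space \<Longrightarrow> continuous_on {0..1} (\<lambda>t. size_process t w)"
  unfolding size_process_def by (intro continuous_intros continuous_path_increment continuous_martingale_part)

lemma measurable_size_process: "t \<in> {0..1} \<Longrightarrow> size_process t \<in> borel_measurable (path_filtration t)"
  unfolding size_process_def[abs_def]
  by (intro borel_measurable_add measurable_compose[OF _ borel_measurable_norm] measurable_path_increment measurable_martingale_part)

lemma stopping_time_localizer: "stopping_time path_filtration (localizer k)"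
  unfolding localizer_def by (intro stopping_time_hitting_time measurable_size_process continuous_size_process)

lemma localizer_nonneg: "0 \<le> localizer k w"
  unfolding localizer_def by (rule hitting_time_nonneg)

lemma le_localizer:
  assumes "w \<in> space path_space" "q \<in> {0..1}" "q \<le> localizer k w"
  shows "size_process q w \<le> real k + 1"
proof -
  have "size_process 0 w \<le> real k + 1" using martingale_part_0[OF assms(1)] by (simp add: size_process_def)
  from le_hitting_time[of size_process w, OF continuous_size_process[OF assms(1)] assms(2) assms(3)[unfolded localizer_def] this]
  show ?thesis .
qed

definition stopped_martingale :: "nat \<Rightarrow> real \<Rightarrow> (real \<Rightarrow> 'b) \<Rightarrow> real^'a" where
  "stopped_martingale k t w = martingale_part (min t (localizer k w)) w"

lemma measurable_stopped_martingale:
  "t \<in> {0..1} \<Longrightarrow> stopped_martingale k t \<in> borel_measurable (path_filtration t)"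
  unfolding stopped_martingale_def[abs_def]
  by (rule measurable_stopped_process[OF measurable_martingale_part continuous_martingale_part stopping_time_localizer localizer_nonneg])

lemma stopped_martingale_bounded:
  assumes "w \<in> space path_space" "t \<in> {0..1}" shows "norm (stopped_martingale k t w) \<le> real k + 1"
proof -
  have "min t (localizer k w) \<in> {0..1}" using assms(2) localizer_nonneg[of k w] by auto
  from le_localizer[OF assms(1) this min.cobounded2]
  have "norm (path_increment pr (min t (localizer k w)) w) + norm (stopped_martingale k t w) \<le> real k + 1"
    unfolding size_process_def stopped_martingale_def .
  then show ?thesis using norm_ge_zero[of "path_increment pr (min t (localizer k w)) w"] by linarith
qed

lemma continuous_stopped_martingale:
  assumes "w \<in> space path_space" shows "continuous_on {0..1} (\<lambda>t. stopped_martingale k t w)"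
  unfolding stopped_martingale_def
  by (rule continuous_on_compose2[OF continuous_martingale_part[OF assms]])
    (use localizer_nonneg[of k w] in \<open>auto intro!: continuous_intros\<close>)

section \<open>The martingale property under the conditional laws\<close>

lemma path_in_path_space: "w \<in> space M \<Longrightarrow> path t y w \<in> space path_space"
  unfolding space_path_space using continuous_on_path[of w "{0..1}" t y] by (auto simp: path_def)

lemma measurable_path_adapted:
  assumes q: "q \<in> {0..1}" shows "path 0 y \<in> past_algebra q \<rightarrow>\<^sub>M path_filtration q"
  unfolding path_filtration_def
proof (rule measurable_measure_of)
  show "path 0 y \<in> space (past_algebra q) \<rightarrow> space path_space" using path_in_path_space by auto
  fix X assume "X \<in> {(\<lambda>w. w r) -` A \<inter> space (path_space :: (real \<Rightarrow> 'b) measure) | r A. r \<in> {0..1} \<and> r \<le> q \<and> A \<in> sets borel}"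
  then obtain r A where X: "X = (\<lambda>w. w r) -` A \<inter> space path_space" "r \<in> {0..1}" "r \<le> q" "A \<in> sets borel" by blast
  have "(\<lambda>w. path 0 y w r) \<in> past_algebra q \<rightarrow>\<^sub>M borel" using X q by (intro measurable_path_past) auto
  from measurable_sets[OF this X(4)]
  show "path 0 y -` X \<inter> space (past_algebra q) \<in> sets (past_algebra q)"
    using path_in_path_space unfolding X(1) by (simp add: vimage_def Int_def conj_commute cong: conj_cong)
qed blast

lemma path_increment_path:
  assumes w: "w \<in> space M" and q: "q \<in> {0..1}"
  shows "path_increment pr q (path 0 y w) = lift 0 y w q - y"
proof -
  have "path_increment pr q (path 0 y w) = lift 0 y w q - lift 0 y w 0"
    by (rule path_increment_lift[OF continuous_on_lift[OF w order_refl] path_eq[symmetric] q])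
  then show ?thesis by simp
qed

context
  fixes x :: 'b and e e' :: real and Tm :: "real \<Rightarrow> real^'a \<Rightarrow> real" and G :: "real \<Rightarrow> real^'a \<Rightarrow> real^'a"
    and H :: "real \<Rightarrow> real^'a \<Rightarrow> real^'a^'a" and y :: "real^'a"
  assumes strip: "smooth_strip x e e' Tm G H" and seg: "segment e e'" and y: "pr y = x"
begin

interpretation st: strip pr \<Lambda> M B a T S \<eta> p \<theta> F x e e' Tm G H by (fact strip)

text \<open>Links the process on path space with \<open>drift_increment\<close> on the Brownian
  sample space, where the Markov property is available.\<close>

lemma martingale_part_increment:
  assumes w: "w \<in> space M" and r: "r \<in> {e<..<e'}" "r' \<in> {e<..<e'}" "r \<le> r'"
  shows "martingale_part r' (path 0 y w) $ i - martingale_part r (path 0 y w) $ i =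
    st.drift_increment i r r' (lift 0 y w r) w"
proof -
  let ?\<xi> = "path 0 y w"
  have \<xi>: "?\<xi> \<in> space path_space" by (rule path_in_path_space[OF w])
  have r01: "r \<in> {0..1}" "r' \<in> {0..1}" using r segment_bounds[OF seg] by auto
  have int: "set_integrable lborel {r..r'} (\<lambda>q. velocity q (?\<xi> 0) (?\<xi> q))"
    using r01 by (intro set_integrable_velocity[OF \<xi>]) auto
  have "(drift_part r' ?\<xi> - drift_part r ?\<xi>) $ i = (LBINT q:{r..r'}. velocity q (?\<xi> 0) (?\<xi> q)) $ i"
    using r01 r by (subst drift_part_diff[OF \<xi>]) auto
  also have "\<dots> = (LBINT q:{r..r'}. velocity q (?\<xi> 0) (?\<xi> q) $ i)"
    using integral_bounded_linear[OF bounded_linear_vec_nth int[unfolded set_integrable_def], of i]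
    unfolding set_lebesgue_integral_def by simp
  also have "\<dots> = (LBINT q:{r..r'}. a * G q (lift r (lift 0 y w r) w q) $ i)"
  proof (rule set_lebesgue_integral_cong)
    show "\<forall>q. q \<in> {r..r'} \<longrightarrow> velocity q (?\<xi> 0) (?\<xi> q) $ i = a * G q (lift r (lift 0 y w r) w q) $ i"
    proof (intro allI impI)
      fix q assume q: "q \<in> {r..r'}"
      then have q': "q \<in> {e<..<e'}" "q \<in> {0..1}" using r r01 by auto
      have "?\<xi> q = pr (lift 0 y w q)" by (rule path_eq[OF q'(2)])
      moreover have "?\<xi> 0 = x" using y by (simp add: path_eq)
      ultimately show "velocity q (?\<xi> 0) (?\<xi> q) $ i = a * G q (lift r (lift 0 y w r) w q) $ i"
        using velocity_strip[OF strip seg q'(1), of "lift 0 y w q"] by (simp add: lift_lift[of 0 y w q r, symmetric])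
    qed
  qed simp
  finally have drift: "(drift_part r' ?\<xi> - drift_part r ?\<xi>) $ i =
    (LBINT q:{r..r'}. a * G q (lift r (lift 0 y w r) w q) $ i)" .
  have "(path_increment pr r' ?\<xi> - path_increment pr r ?\<xi>) $ i = sqrt a * (B r' w - B r w) $ i"
    unfolding path_increment_path[OF w r01(1)] path_increment_path[OF w r01(2)]
    by (simp add: lift_def algebra_simps)
  then show ?thesis
    using drift unfolding st.drift_increment_def martingale_part_def vector_minus_component by linarith
qed

lemma stopped_martingale_increment:
  assumes s: "s \<in> {e<..<e'}" and t: "t \<in> {e<..<e'}" and st: "s \<le> t" and A: "A \<in> sets (path_filtration s)"
  shows "(\<integral>w. indicator A (path 0 y w) *
    (stopped_martingale k t (path 0 y w) $ i - stopped_martingale k s (path 0 y w) $ i) * F x 0 (path 0 y w) \<partial>M) = 0"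
proof -
  have s01: "s \<in> {0..1}" and t01: "t \<in> {0..1}" using s t segment_bounds[OF seg] by auto
  have q01: "q \<in> {0..1}" if "q \<in> {s..t}" for q using that s01 t01 by auto
  define A' where "A' = path 0 y -` A \<inter> space M"
  have A': "A' \<in> sets (past_algebra s)"
    using measurable_sets[OF measurable_path_adapted[OF s01] A] by (simp add: A'_def)
  have "(\<integral>w. indicator A' w * (martingale_part (min t (localizer k (path 0 y w))) (path 0 y w) $ i -
      martingale_part (min s (localizer k (path 0 y w))) (path 0 y w) $ i) * F x 0 (path 0 y w) \<partial>M) = 0"
  proof (rule st.strip_martingale[OF s t st A', where R = "real k + 1"])
    fix q assume q: "q \<in> {s..t}"
    have "{\<xi>\<in>space (path_filtration q). q < localizer k \<xi>} \<in> sets (path_filtration q)"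
      using stopping_timeD2[OF stopping_time_localizer, of q k] by (simp add: pred_def)
    from measurable_sets[OF measurable_path_adapted[OF q01[OF q]] this, of y]
    show "{w \<in> space M. q < localizer k (path 0 y w)} \<in> sets (past_algebra q)"
      using path_in_path_space by (simp add: vimage_def Int_def conj_commute cong: conj_cong)
    show "(\<lambda>w. martingale_part q (path 0 y w) $ i) \<in> borel_measurable (past_algebra q)"
      by (rule measurable_compose[OF measurable_compose[OF measurable_path_adapted measurable_martingale_part] borel_measurable_nth])
        (fact q01[OF q])+
  next
    fix w q assume w: "w \<in> space M" and q: "q \<in> {s..t}" and le: "q < localizer k (path 0 y w)"
    have "size_process q (path 0 y w) \<le> real k + 1"
      by (rule le_localizer[OF path_in_path_space[OF w] q01[OF q] less_imp_le[OF le]])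
    then have "norm (lift 0 y w q - y) + norm (martingale_part q (path 0 y w)) \<le> real k + 1"
      unfolding size_process_def path_increment_path[OF w q01[OF q]] .
    then show "norm (lift 0 y w q - y) \<le> real k + 1 \<and> \<bar>martingale_part q (path 0 y w) $ i\<bar> \<le> real k + 1"
      using component_le_norm_cart[of "martingale_part q (path 0 y w)" i]
        norm_ge_zero[of "lift 0 y w q - y"] norm_ge_zero[of "martingale_part q (path 0 y w)"] by linarith
  next
    fix w r r' assume "w \<in> space M" "r \<in> {s..t}" "r' \<in> {s..t}" "r \<le> r'"
    moreover from this have "r \<in> {e<..<e'}" "r' \<in> {e<..<e'}" using s t by auto
    ultimately show "martingale_part r' (path 0 y w) $ i - martingale_part r (path 0 y w) $ i =
        st.drift_increment i r r' (lift 0 y w r) w"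
      by (intro martingale_part_increment)
  next
    fix w assume "w \<in> space M"
    from continuous_martingale_part[OF path_in_path_space[OF this]]
    have "continuous_on {s..t} (\<lambda>q. martingale_part q (path 0 y w))"
      by (rule continuous_on_subset) (use q01 in auto)
    then show "continuous_on {s..t} (\<lambda>q. martingale_part q (path 0 y w) $ i)" by (intro continuous_intros)
  qed
  also have "(\<integral>w. indicator A' w * (martingale_part (min t (localizer k (path 0 y w))) (path 0 y w) $ i -
      martingale_part (min s (localizer k (path 0 y w))) (path 0 y w) $ i) * F x 0 (path 0 y w) \<partial>M) =
    (\<integral>w. indicator A (path 0 y w) *
      (stopped_martingale k t (path 0 y w) $ i - stopped_martingale k s (path 0 y w) $ i) * F x 0 (path 0 y w) \<partial>M)"
    by (intro Bochner_Integration.integral_cong refl) (simp add: A'_def indicator_def stopped_martingale_def)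
  finally show ?thesis .
qed

end

section \<open>The laws conditioned on the initial point\<close>

text \<open>The law of \<open>P\<close> conditioned to start at \<open>x\<close>; by definition of
  \<psi> at time 0 the normalizing constant is \<open>exp (\<psi> x 0 x)\<close>.\<close>

definition conditional_law :: "'b \<Rightarrow> (real \<Rightarrow> 'b) measure" where
  "conditional_law x = density (law 0 x) (\<lambda>w. ennreal (F x 0 w / exp (\<psi> x 0 x)))"

lemma sets_conditional_law [measurable_cong]: "sets (conditional_law x) = sets path_space"
  by (simp add: conditional_law_def sets_law)

lemma space_conditional_law: "space (conditional_law x) = space path_space"
  by (rule sets_eq_imp_space_eq[OF sets_conditional_law])

lemma emeasure_conditional_law:
  assumes "A \<in> sets path_space"
  shows "ennreal (exp (\<psi> x 0 x)) * emeasure (conditional_law x) A = (\<integral>\<^sup>+w. ennreal (F x 0 w) * indicator A w \<partial>law 0 x)"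
proof -
  have F: "F x 0 \<in> borel_measurable (law 0 x)" using measurable_F_x[of 0 x] by (simp cong: measurable_cong_sets add: sets_law)
  have A: "A \<in> sets (law 0 x)" using assms by (simp add: sets_law)
  have "ennreal (exp (\<psi> x 0 x)) * emeasure (conditional_law x) A =
    (\<integral>\<^sup>+w. ennreal (exp (\<psi> x 0 x)) * (ennreal (F x 0 w / exp (\<psi> x 0 x)) * indicator A w) \<partial>law 0 x)"
    unfolding conditional_law_def using F A by (simp add: emeasure_density nn_integral_cmult)
  also have "\<dots> = (\<integral>\<^sup>+w. ennreal (F x 0 w) * indicator A w \<partial>law 0 x)"
    using F_pos[of x 0] by (intro nn_integral_cong)
      (simp add: mult.assoc[symmetric] ennreal_mult[symmetric] less_imp_le)
  finally show ?thesis .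
qed

lemma prob_space_conditional_law: "prob_space (conditional_law x)"
proof
  have "ennreal (exp (\<psi> x 0 x)) * emeasure (conditional_law x) (space path_space) = ennreal (exp (\<psi> x 0 x))"
    unfolding emeasure_conditional_law[OF sets.top]
    by (subst exp_\<psi>[of 0 x x, symmetric], simp, intro nn_integral_cong) (simp add: sets_eq_imp_space_eq[OF sets_law] indicator_def)
  also have "ennreal (exp (\<psi> x 0 x)) = ennreal (exp (\<psi> x 0 x)) * 1" by simp
  finally show "emeasure (conditional_law x) (space (conditional_law x)) = 1"
    unfolding space_conditional_law by (subst (asm) ennreal_mult_cancel_left) auto
qed

lemma integral_conditional_law:
  fixes f :: "(real \<Rightarrow> 'b) \<Rightarrow> real"
  assumes f: "f \<in> borel_measurable path_space"
  shows "(\<integral>w. f w \<partial>conditional_law x) =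
    (\<integral>w. f (path 0 (inv pr x) w) * F x 0 (path 0 (inv pr x) w) \<partial>M) / exp (\<psi> x 0 x)"
proof -
  have F: "F x 0 \<in> borel_measurable path_space" by (rule measurable_F_x) simp
  have "(\<integral>w. f w \<partial>conditional_law x) = (\<integral>w. (F x 0 w / exp (\<psi> x 0 x)) *\<^sub>R f w \<partial>law 0 x)"
    unfolding conditional_law_def
  proof (rule integral_density)
    show "f \<in> borel_measurable (law 0 x)" using f by (simp cong: measurable_cong_sets add: sets_law)
    have "(\<lambda>w. F x 0 w / exp (\<psi> x 0 x)) \<in> borel_measurable path_space" using F by measurable
    then show "(\<lambda>w. F x 0 w / exp (\<psi> x 0 x)) \<in> borel_measurable (law 0 x)" by (simp cong: measurable_cong_sets add: sets_law)
  qed (use F_pos[of x 0] in \<open>simp add: less_imp_le\<close>)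
  also have "\<dots> = (\<integral>w. (F x 0 w / exp (\<psi> x 0 x)) *\<^sub>R f w \<partial>distr M path_space (path 0 (inv pr x)))"
    using brownian_law_through_eq[of 0 "inv pr x"] by simp
  also have "\<dots> = (\<integral>w. (F x 0 (path 0 (inv pr x) w) / exp (\<psi> x 0 x)) *\<^sub>R f (path 0 (inv pr x) w) \<partial>M)"
    using F f by (intro integral_distr measurable_path) auto
  finally show ?thesis by (simp add: mult.commute)
qed

lemma integrable_stopped:
  assumes "finite_measure Q" "sets Q = sets path_space" "t \<in> {0..1}" "A \<in> sets path_space"
  shows "integrable Q (\<lambda>w. indicator A w *\<^sub>R stopped_martingale k t w)"
proof -
  interpret finite_measure Q by (fact assms(1))
  have sp: "space Q = space path_space" by (rule sets_eq_imp_space_eq[OF assms(2)])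
  have "stopped_martingale k t \<in> borel_measurable path_space"
    by (rule measurable_from_path_filtration[OF measurable_stopped_martingale[OF assms(3)]])
  then have "stopped_martingale k t \<in> borel_measurable Q" by (simp cong: measurable_cong_sets add: assms(2))
  moreover have "A \<in> sets Q" using assms by simp
  ultimately have "(\<lambda>w. indicator A w *\<^sub>R stopped_martingale k t w) \<in> borel_measurable Q" by measurable
  then show ?thesis
    by (rule integrable_const_bound[rotated, where B = "real k + 1"])
      (use stopped_martingale_bounded[OF _ assms(3)] in \<open>auto simp: indicator_def sp intro!: AE_I2\<close>)
qed

text \<open>Continuity in time and the uniform bound of the stopped process carry the martingale
  identity from open segments to their ends.\<close>

lemma tendsto_integral_stopped:
  assumes Q: "finite_measure Q" "sets Q = sets path_space" and r: "\<And>n. r n \<in> {0..1}" "r \<longlonglongrightarrow> t" "t \<in> {0..1}"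
    and A: "A \<in> sets path_space"
  shows "(\<lambda>n. set_lebesgue_integral Q A (stopped_martingale k (r n))) \<longlonglongrightarrow> set_lebesgue_integral Q A (stopped_martingale k t)"
  unfolding set_lebesgue_integral_def
proof (rule integral_dominated_convergence[where w = "\<lambda>_. real k + 1"])
  interpret finite_measure Q by (fact Q(1))
  have sp: "space Q = space path_space" by (rule sets_eq_imp_space_eq[OF Q(2)])
  show "(\<lambda>v. indicator A v *\<^sub>R stopped_martingale k t v) \<in> borel_measurable Q"
    "(\<lambda>v. indicator A v *\<^sub>R stopped_martingale k (r n) v) \<in> borel_measurable Q" for n
    using integrable_stopped[OF Q r(3) A] integrable_stopped[OF Q r(1) A] by (auto dest: borel_measurable_integrable)
  show "integrable Q (\<lambda>_. real k + 1)" by simp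
  show "AE v in Q. (\<lambda>n. indicator A v *\<^sub>R stopped_martingale k (r n) v) \<longlonglongrightarrow> indicator A v *\<^sub>R stopped_martingale k t v"
  proof (rule AE_I2)
    fix v assume "v \<in> space Q"
    then have v: "v \<in> space path_space" by (simp add: sp)
    have "(\<lambda>n. stopped_martingale k (r n) v) \<longlonglongrightarrow> stopped_martingale k t v"
      by (rule continuous_on_tendsto_compose[OF continuous_stopped_martingale[OF v] r(2,3) always_eventually[OF allI[OF r(1)]]])
    then show "(\<lambda>n. indicator A v *\<^sub>R stopped_martingale k (r n) v) \<longlonglongrightarrow> indicator A v *\<^sub>R stopped_martingale k t v"
      by (intro tendsto_intros)
  qed
  show "AE v in Q. norm (indicator A v *\<^sub>R stopped_martingale k (r n) v) \<le> real k + 1" for n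
    using stopped_martingale_bounded[OF _ r(1)] by (intro AE_I2) (auto simp: indicator_def sp)
qed

lemma stopped_martingale_open_segment:
  assumes seg: "segment e e'" and s: "s \<in> {e<..<e'}" and t: "t \<in> {e<..<e'}" and st: "s \<le> t" and A: "A \<in> sets (path_filtration s)"
  shows "set_lebesgue_integral (conditional_law x) A (stopped_martingale k t) =
    set_lebesgue_integral (conditional_law x) A (stopped_martingale k s)"
proof -
  interpret K: prob_space "conditional_law x" by (rule prob_space_conditional_law)
  obtain Tm G H where strip: "smooth_strip x e e' Tm G H" by (rule segment_strip[OF seg])
  have s01: "s \<in> {0..1}" and t01: "t \<in> {0..1}" using s t segment_bounds[OF seg] by auto
  have A': "A \<in> sets path_space" using A path_filtration_subset by blast
  let ?Y = "stopped_martingale k"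
  note int = integrable_stopped[OF K.finite_measure_axioms sets_conditional_law _ A', of _ k]
  have comp: "set_lebesgue_integral (conditional_law x) A (?Y q) $ i = (\<integral>w. indicator A w * ?Y q w $ i \<partial>conditional_law x)"
    and int_comp: "integrable (conditional_law x) (\<lambda>w. indicator A w * ?Y q w $ i)" if "q \<in> {0..1}" for q i
    using integral_bounded_linear[OF bounded_linear_vec_nth int[OF that], of i]
      integrable_bounded_linear[OF bounded_linear_vec_nth int[OF that], of i]
    unfolding set_lebesgue_integral_def by simp_all
  show ?thesis
  proof (rule vec_eq_iff[THEN iffD2], rule allI)
    fix i
    have meas: "(\<lambda>w. indicator A w * (?Y t w $ i - ?Y s w $ i)) \<in> borel_measurable path_space"
    proof -
      have "?Y q \<in> borel_measurable path_space" if "q \<in> {0..1}" for q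
        by (rule measurable_from_path_filtration[OF measurable_stopped_martingale[OF that]])
      from measurable_compose[OF this[OF t01] borel_measurable_nth[of i]] measurable_compose[OF this[OF s01] borel_measurable_nth[of i]]
      show ?thesis using A' by measurable
    qed
    have "(\<integral>w. indicator A w * ?Y t w $ i \<partial>conditional_law x) - (\<integral>w. indicator A w * ?Y s w $ i \<partial>conditional_law x) =
      (\<integral>w. indicator A w * (?Y t w $ i - ?Y s w $ i) \<partial>conditional_law x)"
      by (subst Bochner_Integration.integral_diff[symmetric]) (simp_all only: int_comp[OF s01] int_comp[OF t01] right_diff_distrib)
    also have "\<dots> = 0"
      unfolding integral_conditional_law[OF meas]
      using stopped_martingale_increment[OF strip seg pr_inv s t st A, of k i] by simp
    finally show "set_lebesgue_integral (conditional_law x) A (?Y t) $ i = set_lebesgue_integral (conditional_law x) A (?Y s) $ i"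
      by (simp only: comp[OF s01] comp[OF t01] right_minus_eq)
  qed
qed

lemma stopped_martingale_segment:
  assumes seg: "segment e e'" and s: "e \<le> s" and t: "t \<le> e'" and st: "s \<le> t" and A: "A \<in> sets (path_filtration s)"
  shows "set_lebesgue_integral (conditional_law x) A (stopped_martingale k t) =
    set_lebesgue_integral (conditional_law x) A (stopped_martingale k s)"
proof (cases "s = t")
  case False
  then have lt: "s < t" using st by simp
  interpret K: prob_space "conditional_law x" by (rule prob_space_conditional_law)
  note b = segment_bounds[OF seg]
  \<comment> \<open>The initial time is approached from the right, so events known at
    \<open>s\<close> are known at \<open>s' n\<close>; the summand 3 keeps
    \<open>s' n \<le> t' n\<close> from the start.\<close>
  define s' where "s' n = s + (t - s) / (real n + 3)" for n
  define t' where "t' n = t - (t - s) / (real n + 3)" for n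
  have st': "s < s' n" "s' n \<le> t' n" "t' n < t" for n
  proof -
    have "(t - s) / (real n + 3) \<le> (t - s) / 3" using lt by (intro divide_left_mono) auto
    moreover have "s + d \<le> t - d" if "d \<le> (t - s) / 3" for d using that lt by simp
    ultimately show "s' n \<le> t' n" unfolding s'_def t'_def by blast
  qed (use lt in \<open>simp_all add: s'_def t'_def\<close>)
  have "(\<lambda>n. (t - s) / (real n + 3)) \<longlonglongrightarrow> 0" by real_asymp
  then have "(\<lambda>n. s + (t - s) / (real n + 3)) \<longlonglongrightarrow> s + 0" "(\<lambda>n. t - (t - s) / (real n + 3)) \<longlonglongrightarrow> t - 0"
    by (intro tendsto_intros; assumption)+
  then have lim: "s' \<longlonglongrightarrow> s" "t' \<longlonglongrightarrow> t" by (simp_all add: s'_def[abs_def] t'_def[abs_def])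
  have in01: "s' n \<in> {0..1}" "t' n \<in> {0..1}" "s \<in> {0..1}" "t \<in> {0..1}" for n
    using st'[of n] b s t lt by auto
  have A': "A \<in> sets path_space" using A path_filtration_subset by blast
  have eq: "set_lebesgue_integral (conditional_law x) A (stopped_martingale k (t' n)) =
    set_lebesgue_integral (conditional_law x) A (stopped_martingale k (s' n))" for n
  proof (rule stopped_martingale_open_segment[OF seg _ _ st'(2)])
    show "s' n \<in> {e<..<e'}" "t' n \<in> {e<..<e'}" using st'[of n] s t by auto
    show "A \<in> sets (path_filtration (s' n))" using path_filtration_mono[OF less_imp_le[OF st'(1)]] A by blast
  qed
  note lims = tendsto_integral_stopped[where k = k, OF K.finite_measure_axioms sets_conditional_law _ _ _ A']
  show ?thesis
    using LIMSEQ_unique[OF lims[OF in01(2) lim(2) in01(4)] lims[OF in01(1) lim(1) in01(3), folded eq]] .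
qed simp

text \<open>Induction on the number of partition points strictly between the two times. The process
  is continuous in time even where \<psi> jumps, so the identities of adjacent segments
  chain.\<close>

lemma stopped_martingale_conditional_law:
  assumes "0 \<le> s" "s \<le> t" "t \<le> 1" "A \<in> sets (path_filtration s)"
  shows "set_lebesgue_integral (conditional_law x) A (stopped_martingale k t) =
    set_lebesgue_integral (conditional_law x) A (stopped_martingale k s)"
  using assms
proof (induction "card ((D \<union> {0, 1}) \<inter> {s<..<t})" arbitrary: s t A rule: less_induct)
  case less
  let ?E = "D \<union> {0, 1}"
  have fin: "finite (?E \<inter> {u<..<v})" for u v using finite_D by auto
  show ?case
  proof (cases "s = t")
    case False
    then have lt: "s < t" using less.prems by simp
    show ?thesis
    proof (cases "?E \<inter> {s<..<t} = {}")
      case True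
      obtain e e' where seg: "segment e e'" "e \<le> s" "s < e'" by (rule segment_right[of s]) (use less.prems lt in auto)
      have "e' \<notin> {s<..<t}" using True seg(1) unfolding segment_def by blast
      then have "t \<le> e'" using seg(3) by auto
      from stopped_martingale_segment[OF seg(1,2) this less.prems(2,4)] show ?thesis .
    next
      case False
      then obtain c where "c \<in> ?E \<inter> {s<..<t}" by blast
      then have c: "c \<in> ?E" "s < c" "c < t" by simp_all
      have 1: "card (?E \<inter> {s<..<c}) < card (?E \<inter> {s<..<t})"
        using c by (intro psubset_card_mono[OF fin]) auto
      have 2: "card (?E \<inter> {c<..<t}) < card (?E \<inter> {s<..<t})"
        using c by (intro psubset_card_mono[OF fin]) auto
      have "set_lebesgue_integral (conditional_law x) A (stopped_martingale k c) = set_lebesgue_integral (conditional_law x) A (stopped_martingale k s)"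
        using c less.prems by (intro less.hyps[OF 1]) auto
      moreover have "set_lebesgue_integral (conditional_law x) A (stopped_martingale k t) = set_lebesgue_integral (conditional_law x) A (stopped_martingale k c)"
        using c less.prems path_filtration_mono[of s c] by (intro less.hyps[OF 2]) auto
      ultimately show ?thesis by simp
    qed
  qed simp
qed

text \<open>The localizing sequence is a functional of the path and does not depend on the law, so
  the same one serves for \<open>P\<close> and for all its conditional laws.\<close>

lemma has_driftI:
  assumes Q: "finite_measure Q" "sets Q = sets path_space"
    and mart: "\<And>k s t A. 0 \<le> s \<Longrightarrow> s \<le> t \<Longrightarrow> t \<le> 1 \<Longrightarrow> A \<in> sets (path_filtration s) \<Longrightarrow>
      set_lebesgue_integral Q A (stopped_martingale k t) = set_lebesgue_integral Q A (stopped_martingale k s)"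
  shows "has_drift pr Q (\<lambda>t w. velocity t (w 0) (w t))"
proof -
  have sp: "space Q = space path_space" by (rule sets_eq_imp_space_eq[OF Q(2)])
  have "path_martingale Q (\<lambda>t w. martingale_part (min t (localizer k w)) w)" for k
    unfolding stopped_martingale_def[symmetric] path_martingale_def
  proof (intro conjI ballI allI impI)
    fix t :: real assume t: "t \<in> {0..1}"
    show "(\<lambda>w. stopped_martingale k t w) \<in> borel_measurable (path_filtration t)"
      by (rule measurable_stopped_martingale[OF t])
    have "integrable Q (\<lambda>w. indicator (space path_space) w *\<^sub>R stopped_martingale k t w)"
      by (rule integrable_stopped[OF Q t sets.top])
    then show "integrable Q (\<lambda>w. stopped_martingale k t w)"
      by (rule Bochner_Integration.integrable_cong[THEN iffD1, rotated 2]) (auto simp: sp)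
  qed (use mart in auto)
  then have "path_local_martingale Q martingale_part"
    unfolding path_local_martingale_def
    using measurable_martingale_part stopping_time_localizer localizer_nonneg
      hitting_time_mono[of size_process, OF continuous_size_process] hitting_time_eventually[of size_process, OF continuous_size_process]
    by (intro conjI exI[of _ localizer] ballI allI AE_I2) (auto simp: sp localizer_def incseq_def)
  moreover have "AE w in Q. set_integrable lborel {0..1} (\<lambda>r. velocity r (w 0) (w r))"
    by (intro AE_I2 set_integrable_velocity) (auto simp: sp)
  moreover have "AE w in Q. \<forall>t\<in>{0..1}. path_increment pr t w =
      (LBINT r:{0..t}. velocity r (w 0) (w r)) + martingale_part t w"
    by (simp add: martingale_part_def drift_part_def)
  ultimately show ?thesis
    unfolding has_drift_def using predictable_velocity by blast
qed

lemma has_drift_conditional_law: "has_drift pr (conditional_law x) (\<lambda>t w. velocity t (w 0) (w t))"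
proof (rule has_driftI[OF _ sets_conditional_law stopped_martingale_conditional_law])
  interpret K: prob_space "conditional_law x" by (rule prob_space_conditional_law)
  show "finite_measure (conditional_law x)" by (rule K.finite_measure_axioms)
qed

section \<open>Disintegration of the path measure\<close>

lemma brownian_law_eq: "brownian_law pr a M B = law 0"
proof
  fix x show "brownian_law pr a M B x = law 0 x"
    unfolding brownian_law_def brownian_law_through_def by (rule distr_cong) (simp_all add: B_0)
qed

lemma sets_vol: "sets vol = sets borel" and space_vol: "space vol = UNIV"
proof -
  obtain \<Lambda>' C where "vol = distr (restrict_space lborel C) borel pr" by (rule flat_space_lattice[OF flat]) blast
  then show "sets vol = sets borel" "space vol = UNIV" by simp_all
qed

lemma measurable_\<psi>_initial: "(\<lambda>x. \<psi> x 0 x) \<in> borel_measurable borel"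
proof -
  have "(\<lambda>x. (x, x)) \<in> (borel :: 'b measure) \<rightarrow>\<^sub>M borel \<Otimes>\<^sub>M borel" by simp
  from measurable_compose[OF this measurable_\<psi>[of 0]] show ?thesis by simp
qed

lemma measurable_conditional_law: "conditional_law \<in> borel \<rightarrow>\<^sub>M prob_algebra path_space"
proof (rule measurable_prob_algebraI[OF prob_space_conditional_law], rule measurable_subprob_algebra)
  show "subprob_space (conditional_law x)" for x
    by (rule prob_space_imp_subprob_space[OF prob_space_conditional_law])
  show "sets (conditional_law x) = sets path_space" for x by (rule sets_conditional_law)
  fix A :: "(real \<Rightarrow> 'b) set" assume A: "A \<in> sets path_space"
  have "(\<lambda>x. \<integral>\<^sup>+v. ennreal (F x 0 v / exp (\<psi> x 0 x)) * indicator A v \<partial>law 0 x) \<in> borel_measurable borel"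
  proof (rule nn_integral_measurable_subprob_algebra2)
    have "(\<lambda>w. F (fst w) 0 (snd w)) \<in> borel_measurable ((borel :: 'b measure) \<Otimes>\<^sub>M path_space)"
      using measurable_F[of 0] by (simp add: case_prod_beta)
    moreover have "(\<lambda>w. \<psi> (fst w) 0 (fst w)) \<in> borel_measurable ((borel :: 'b measure) \<Otimes>\<^sub>M (path_space :: (real \<Rightarrow> 'b) measure))"
      by (rule measurable_compose[OF measurable_fst measurable_\<psi>_initial])
    ultimately have "(\<lambda>w. ennreal (F (fst w) 0 (snd w) / exp (\<psi> (fst w) 0 (fst w))) * indicator A (snd w))
        \<in> borel_measurable ((borel :: 'b measure) \<Otimes>\<^sub>M path_space)"
      using A by measurable
    then show "(\<lambda>(x, v). ennreal (F x 0 v / exp (\<psi> x 0 x)) * indicator A v) \<in> borel_measurable ((borel :: 'b measure) \<Otimes>\<^sub>M path_space)"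
      by (simp add: case_prod_beta)
    show "law 0 \<in> borel \<rightarrow>\<^sub>M subprob_algebra path_space"
      by (rule measurable_prob_algebraD[OF measurable_law]) simp
  qed
  moreover have "emeasure (conditional_law x) A = (\<integral>\<^sup>+v. ennreal (F x 0 v / exp (\<psi> x 0 x)) * indicator A v \<partial>law 0 x)" for x
    unfolding conditional_law_def using measurable_F_x[of 0 x] A
    by (intro emeasure_density) (auto simp: sets_law cong: measurable_cong_sets)
  ultimately show "(\<lambda>x. emeasure (conditional_law x) A) \<in> borel_measurable borel" by simp
qed

lemma AE_law_start: "AE w in law 0 x. w 0 = x"
proof -
  have m: "{w \<in> space path_space. w 0 = x} \<in> sets (path_space :: (real \<Rightarrow> 'b) measure)"
    using measurable_sets[OF measurable_path_eval[of 0], of "{x}"] by (simp add: vimage_def Int_def conj_commute)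
  have eq: "law 0 x = distr M path_space (path 0 (inv pr x))" using brownian_law_through_eq[of 0 "inv pr x"] by simp
  have "path 0 (inv pr x) \<in> M \<rightarrow>\<^sub>M path_space" by (rule measurable_path) simp
  then show ?thesis unfolding eq using m by (simp add: AE_distr_iff path_eq)
qed

lemma AE_conditional_law_start: "AE w in conditional_law x. w 0 = x"
proof -
  have "(\<lambda>w. ennreal (F x 0 w / exp (\<psi> x 0 x))) \<in> borel_measurable (law 0 x)"
    using measurable_F_x[of 0 x] by (simp cong: measurable_cong_sets add: sets_law)
  then show ?thesis
    unfolding conditional_law_def using AE_law_start[of x] by (subst AE_density) (auto elim: eventually_mono)
qed

text \<open>The density of \<open>P\<close> integrates over all of \<open>T\<close> and
  \<open>F x 0\<close> only over positive times; the difference is at most the null set {0}.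
  Clamping makes the integrand a Borel function on the line.\<close>

lemma weight_initial:
  assumes w: "w \<in> space path_space"
  shows "exp (\<eta> (w 0) (w 1) + (\<Sum>s\<in>S. \<theta> s (w s)) + (LBINT t:T. p t (w t))) = F (w 0) 0 w"
proof -
  have S: "{s\<in>S. s > 0} = S" using S_subset by auto
  define f where "f q = indicator T q * p q (w (max 0 (min 1 q)))" for q
  have "continuous_on UNIV (\<lambda>q. w (max 0 (min 1 q)))"
  proof (rule continuous_on_compose2[of "{0..1}" w])
    show "continuous_on {0..1} w" using w unfolding space_path_space by blast
  qed (auto intro!: continuous_intros)
  then have "(\<lambda>q. w (max 0 (min 1 q))) \<in> borel \<rightarrow>\<^sub>M borel" by (rule borel_measurable_continuous_onI)
  then have "(\<lambda>q. (q, w (max 0 (min 1 q)))) \<in> borel \<rightarrow>\<^sub>M borel \<Otimes>\<^sub>M borel" by simp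
  from measurable_compose[OF this measurable_p] have f: "f \<in> borel_measurable borel" by (simp add: f_def[abs_def])
  have clamp: "max 0 (min 1 q) = q" if "q \<in> T" for q using that T_subset by auto
  have 1: "(\<lambda>q. indicator T q *\<^sub>R p q (w q)) = f"
    by (rule ext) (simp add: f_def clamp indicator_def)
  have 2: "(\<lambda>q. indicator (T \<inter> {0<..1}) q *\<^sub>R p q (w q)) = (\<lambda>q. indicator {0<..1} q * f q)"
    by (rule ext) (simp add: f_def clamp indicator_def)
  have "(LBINT t:T. p t (w t)) = (LBINT t:T \<inter> {0<..1}. p t (w t))"
    unfolding set_lebesgue_integral_def 1 2
  proof (rule integral_cong_AE)
    show "AE q in lborel. f q = indicator {0<..1} q * f q"
      using AE_lborel_singleton[of "0::real"]
    proof eventually_elim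
      fix q :: real assume "q \<noteq> 0"
      then show "f q = indicator {0<..1} q * f q"
        using T_subset by (cases "q \<in> T") (auto simp: f_def indicator_def)
    qed
  qed (use f in auto)
  then show ?thesis unfolding F_eq S by simp
qed

context
  fixes P :: "(real \<Rightarrow> 'b) measure"
  assumes P: "P = density (reversible_brownian pr vol a M B) (\<lambda>\<omega>. ennreal (
           exp (\<eta> (\<omega> 0) (\<omega> 1) + (\<Sum>s\<in>S. \<theta> s (\<omega> s))
                + (LBINT t:T. p t (\<omega> t)))))"
begin

lemma sets_P: "sets P = sets path_space"
  by (simp add: P sets_reversible)

text \<open>The reversible measure is a mixture of the laws started at \<open>x\<close>, under which
  the density has first argument \<open>x\<close> almost surely; normalizing each component splits
  off its total mass.\<close>

lemma emeasure_P:
  assumes A: "A \<in> sets path_space"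
  shows "emeasure P A = (\<integral>\<^sup>+x. ennreal (exp (\<psi> x 0 x)) * emeasure (conditional_law x) A \<partial>vol)"
proof -
  let ?R = "reversible_brownian pr vol a M B"
  have sR: "space ?R = space path_space" by (rule sets_eq_imp_space_eq[OF sets_reversible])
  define g where "g w = ennreal (F (w 0) 0 w)" for w
  have "(\<lambda>w. (w 0, w)) \<in> path_space \<rightarrow>\<^sub>M (borel :: 'b measure) \<Otimes>\<^sub>M path_space"
    by (intro measurable_Pair measurable_path_eval) auto
  from measurable_compose[OF this measurable_F[of 0]] have g: "g \<in> borel_measurable path_space" by (simp add: g_def[abs_def])
  have law_vol: "law 0 \<in> vol \<rightarrow>\<^sub>M subprob_algebra path_space"
    using measurable_prob_algebraD[OF measurable_law[of 0]] by (simp add: measurable_cong_sets[OF sets_vol refl])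
  have gR: "g \<in> borel_measurable ?R" using g by (simp cong: measurable_cong_sets add: sets_reversible)
  have "P = density ?R g"
    unfolding P
  proof (rule density_cong[OF _ gR AE_I2])
    show "(\<lambda>w. ennreal (exp (\<eta> (w 0) (w 1) + (\<Sum>s\<in>S. \<theta> s (w s)) +
        (LBINT t:T. p t (w t))))) \<in> borel_measurable ?R"
      by (rule measurable_cong[THEN iffD2, OF _ gR]) (simp add: sR weight_initial g_def)
  qed (simp add: sR weight_initial g_def)
  then have "emeasure P A = (\<integral>\<^sup>+w. g w * indicator A w \<partial>?R)"
    using g A by (simp add: emeasure_density sets_reversible cong: measurable_cong_sets)
  also have "\<dots> = (\<integral>\<^sup>+x. \<integral>\<^sup>+w. g w * indicator A w \<partial>law 0 x \<partial>vol)"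
    unfolding reversible_brownian_def brownian_law_eq
    using g A law_vol by (intro nn_integral_bind[where B = path_space]) auto
  also have "\<dots> = (\<integral>\<^sup>+x. ennreal (exp (\<psi> x 0 x)) * emeasure (conditional_law x) A \<partial>vol)"
  proof (intro nn_integral_cong)
    fix x
    have "(\<integral>\<^sup>+w. g w * indicator A w \<partial>law 0 x) = (\<integral>\<^sup>+w. ennreal (F x 0 w) * indicator A w \<partial>law 0 x)"
      by (rule nn_integral_cong_AE) (use AE_law_start[of x] in \<open>auto simp: g_def elim!: eventually_mono\<close>)
    then show "(\<integral>\<^sup>+w. g w * indicator A w \<partial>law 0 x) = ennreal (exp (\<psi> x 0 x)) * emeasure (conditional_law x) A"
      by (simp add: emeasure_conditional_law[OF A])
  qed
  finally show ?thesis .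
qed

lemma distr_P: "distr P borel (\<lambda>w. w 0) = density vol (\<lambda>x. ennreal (exp (\<psi> x 0 x)))"
proof (rule measure_eqI)
  show "sets (distr P borel (\<lambda>w. w 0)) = sets (density vol (\<lambda>x. ennreal (exp (\<psi> x 0 x))))" by (simp add: sets_vol)
  fix C assume "C \<in> sets (distr P borel (\<lambda>w. w 0))"
  then have C: "C \<in> sets borel" by simp
  have ev: "(\<lambda>w. w 0) \<in> P \<rightarrow>\<^sub>M borel"
    using measurable_path_eval[of 0] by (simp cong: measurable_cong_sets add: sets_P)
  have sP: "space P = space path_space" by (rule sets_eq_imp_space_eq[OF sets_P])
  define A where "A = (\<lambda>w. w 0) -` C \<inter> space (path_space :: (real \<Rightarrow> 'b) measure)"
  have A: "A \<in> sets path_space" unfolding A_def by (rule measurable_sets[OF measurable_path_eval C]) simp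
  have one: "emeasure (conditional_law x) A = indicator C x" for x
  proof -
    interpret K: prob_space "conditional_law x" by (rule prob_space_conditional_law)
    have "AE w in conditional_law x. w \<in> A \<longleftrightarrow> x \<in> C"
      using AE_conditional_law_start[of x] AE_space by eventually_elim (auto simp: A_def space_conditional_law)
    moreover have "A \<in> sets (conditional_law x)" using A by (simp add: sets_conditional_law)
    ultimately show ?thesis
      by (cases "x \<in> C") (auto simp: K.emeasure_eq_1_AE AE_iff_null_sets[symmetric])
  qed
  have "emeasure (distr P borel (\<lambda>w. w 0)) C = emeasure P A"
    by (simp add: emeasure_distr[OF ev C] A_def sP)
  also have "\<dots> = (\<integral>\<^sup>+x. ennreal (exp (\<psi> x 0 x)) * indicator C x \<partial>vol)" unfolding emeasure_P[OF A] one ..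
  also have "\<dots> = emeasure (density vol (\<lambda>x. ennreal (exp (\<psi> x 0 x)))) C"
    using C measurable_\<psi>_initial by (subst emeasure_density) (auto simp: sets_vol cong: measurable_cong_sets)
  finally show "emeasure (distr P borel (\<lambda>w. w 0)) C = emeasure (density vol (\<lambda>x. ennreal (exp (\<psi> x 0 x)))) C" .
qed

lemma bind_conditional_law: "P = Giry_Monad.bind (distr P borel (\<lambda>w. w 0)) conditional_law"
proof (rule measure_eqI)
  let ?\<nu> = "density vol (\<lambda>x. ennreal (exp (\<psi> x 0 x)))"
  have K: "conditional_law \<in> ?\<nu> \<rightarrow>\<^sub>M subprob_algebra path_space"
    using measurable_prob_algebraD[OF measurable_conditional_law]
    by (simp add: sets_vol cong: measurable_cong_sets)
  show "sets P = sets (Giry_Monad.bind (distr P borel (\<lambda>w. w 0)) conditional_law)"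
    unfolding sets_P by (rule sets_bind[symmetric]) (simp_all add: sets_conditional_law)
  fix A assume "A \<in> sets P"
  then have A: "A \<in> sets path_space" by (simp add: sets_P)
  have "emeasure (Giry_Monad.bind (distr P borel (\<lambda>w. w 0)) conditional_law) A = (\<integral>\<^sup>+x. emeasure (conditional_law x) A \<partial>?\<nu>)"
    unfolding distr_P by (rule emeasure_bind[OF _ K A]) (simp add: space_vol)
  also have "\<dots> = (\<integral>\<^sup>+x. ennreal (exp (\<psi> x 0 x)) * emeasure (conditional_law x) A \<partial>vol)"
    using measurable_\<psi>_initial measurable_compose[OF measurable_prob_algebraD[OF measurable_conditional_law] measurable_emeasure_subprob_algebra[OF A]]
    by (subst nn_integral_density) (auto simp: sets_vol cong: measurable_cong_sets)
  finally show "emeasure P A = emeasure (Giry_Monad.bind (distr P borel (\<lambda>w. w 0)) conditional_law) A"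
    by (simp add: emeasure_P[OF A])
qed

lemma regular_conditional_law_P: "regular_conditional_law borel P (\<lambda>w. w 0) conditional_law"
  unfolding regular_conditional_law_def
proof (intro conjI bind_conditional_law)
  have "prob_algebra P = prob_algebra path_space"
    unfolding prob_algebra_def by (simp add: sets_P cong: subprob_algebra_cong)
  then show "conditional_law \<in> borel \<rightarrow>\<^sub>M prob_algebra P" using measurable_conditional_law by simp
qed (use AE_conditional_law_start in simp)

text \<open>The stopped martingale is bounded, so its set integrals under \<open>P\<close> are
  averages over the initial law of those under the conditional laws, which agree at the two
  times.\<close>

lemma has_drift_P:
  assumes fin: "finite_measure P" shows "has_drift pr P (\<lambda>t w. velocity t (w 0) (w t))"
proof (rule has_driftI[OF fin sets_P])
  fix k :: nat and s t :: real and A :: "(real \<Rightarrow> 'b) set"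
  assume st: "0 \<le> s" "s \<le> t" "t \<le> 1" and A: "A \<in> sets (path_filtration s)"
  have A': "A \<in> sets path_space" using A path_filtration_subset by blast
  let ?\<nu> = "distr P borel (\<lambda>w. w 0)" and ?Y = "stopped_martingale k"
  interpret P: finite_measure P by (fact fin)
  have K: "conditional_law \<in> ?\<nu> \<rightarrow>\<^sub>M subprob_algebra path_space"
    using measurable_prob_algebraD[OF measurable_conditional_law] by simp
  have \<nu>: "finite_measure ?\<nu>"
    by (rule P.finite_measure_distr) (use measurable_path_eval[of 0] in \<open>simp cong: measurable_cong_sets add: sets_P\<close>)
  have comp: "set_lebesgue_integral Q A (?Y q) $ i = (\<integral>w. indicator A w * ?Y q w $ i \<partial>Q)"
    if "finite_measure Q" "sets Q = sets path_space" "q \<in> {0..1}" for q i Q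
    using integral_bounded_linear[OF bounded_linear_vec_nth[of i] integrable_stopped[where k = k, OF that A']]
    unfolding set_lebesgue_integral_def by simp
  have split: "set_lebesgue_integral P A (?Y q) $ i = (\<integral>x. set_lebesgue_integral (conditional_law x) A (?Y q) $ i \<partial>?\<nu>)"
    if q: "q \<in> {0..1}" for q i
  proof -
    define f where "f w = indicator A w * ?Y q w $ i" for w
    have f: "f \<in> borel_measurable path_space"
      unfolding f_def using A' measurable_compose[OF measurable_from_path_filtration[OF measurable_stopped_martingale[OF q]] borel_measurable_nth]
      by measurable
    have "set_lebesgue_integral P A (?Y q) $ i = integral\<^sup>L P f" unfolding comp[OF fin sets_P q] f_def ..
    also have "\<dots> = integral\<^sup>L (Giry_Monad.bind ?\<nu> conditional_law) f" using bind_conditional_law by simp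
    also have "\<dots> = (\<integral>x. integral\<^sup>L (conditional_law x) f \<partial>?\<nu>)"
    proof (rule integral_bind[OF f _ K \<nu>, where B = "real k + 1" and B' = 1])
      show "\<bar>f w\<bar> \<le> real k + 1" if "w \<in> space path_space" for w
        using component_le_norm_cart[of "?Y q w" i] stopped_martingale_bounded[OF that q, of k]
        by (auto simp: f_def indicator_def)
      show "AE x in ?\<nu>. emeasure (conditional_law x) (space (conditional_law x)) \<le> ennreal 1"
        using prob_space.emeasure_space_1[OF prob_space_conditional_law] by simp
    qed
    also have "\<dots> = (\<integral>x. set_lebesgue_integral (conditional_law x) A (?Y q) $ i \<partial>?\<nu>)"
      unfolding f_def
      by (simp only: comp[OF prob_space.finite_measure[OF prob_space_conditional_law] sets_conditional_law q])
    finally show ?thesis .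
  qed
  have 01: "s \<in> {0..1}" "t \<in> {0..1}" using st by auto
  show "set_lebesgue_integral P A (?Y t) = set_lebesgue_integral P A (?Y s)"
    unfolding vec_eq_iff split[OF 01(1)] split[OF 01(2)] stopped_martingale_conditional_law[OF st A] by simp
qed

theorem forward_velocity_P: "forward_velocity pr P (\<lambda>t w. velocity t (w 0) (w t))"
  unfolding forward_velocity_def
  using has_drift_P has_drift_conditional_law regular_conditional_law_P by auto

end

end

text \<open>Gives the finiteness of \<open>D\<close> for intervals of any kind, including single
  points.\<close>

lemma frontier_interval_subset:
  assumes "is_interval (J :: real set)" "bounded J"
  shows "frontier J \<subseteq> {Inf J, Sup J}"
proof (cases "J = {}")
  case False
  have bdd: "bdd_below J" "bdd_above J" using assms(2) by (auto intro: bounded_imp_bdd_below bounded_imp_bdd_above)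
  have "J \<subseteq> {Inf J..Sup J}" using cInf_lower[OF _ bdd(1)] cSup_upper[OF _ bdd(2)] by auto
  then have 1: "closure J \<subseteq> {Inf J..Sup J}" by (rule closure_minimal) simp
  have "{Inf J<..<Sup J} \<subseteq> J"
  proof
    fix q assume "q \<in> {Inf J<..<Sup J}"
    then have "Inf J < q" "q < Sup J" by auto
    then obtain l u where "l \<in> J" "l < q" "u \<in> J" "q < u"
      using cInf_less_iff[OF False bdd(1)] less_cSup_iff[OF False bdd(2)] by blast
    then show "q \<in> J" using assms(1) unfolding is_interval_1 by (meson less_imp_le)
  qed
  then have "{Inf J<..<Sup J} \<subseteq> interior J" by (rule interior_maximal) simp
  then have "frontier J \<subseteq> {Inf J..Sup J} - {Inf J<..<Sup J}" using 1 unfolding frontier_def by blast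
  also have "\<dots> \<subseteq> {Inf J, Sup J}" by auto
  finally show ?thesis .
qed simp

theorem theorem4p4:
  fixes pr :: "real^'n \<Rightarrow> 'x::{second_countable_topology, t2_space}"
    and vol :: "'x measure"
    and M :: "'w measure"
    and B :: "real \<Rightarrow> 'w \<Rightarrow> real^'n"
    and a :: real
    and R P :: "(real \<Rightarrow> 'x) measure"
    and \<I> :: "real set set"
    and T S D :: "real set"
    and \<eta> :: "'x \<Rightarrow> 'x \<Rightarrow> real"
    and p \<theta> :: "real \<Rightarrow> 'x \<Rightarrow> real"
    and F :: "'x \<Rightarrow> real \<Rightarrow> (real \<Rightarrow> 'x) \<Rightarrow> real"
    and \<psi> :: "'x \<Rightarrow> real \<Rightarrow> 'x \<Rightarrow> real"
  assumes "flat_space pr vol"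
    and "0 < a"
    and "standard_brownian_motion M B"
    and R: "R = reversible_brownian pr vol a M B"
    and "finite \<I>" and "\<forall>J\<in>\<I>. is_interval J \<and> J \<subseteq> {0..1}" and T: "T = \<Union>\<I>"
    and "finite S" and "S \<subseteq> {0<..<1}"
    and D: "D = S \<union> (\<Union>J\<in>\<I>. frontier J)"
    and "continuous_on UNIV (\<lambda>(x, y). \<eta> x y)"
    and "\<forall>s\<in>S. continuous_on UNIV (\<theta> s)"
    and "continuous_on (T \<times> UNIV) (\<lambda>(t, z). p t z)"
    and F: "\<forall>x t \<omega>. F x t \<omega> =
           exp (\<eta> x (\<omega> 1) + (\<Sum>s\<in>{s\<in>S. s > t}. \<theta> s (\<omega> s))
                + set_lebesgue_integral lborel (T \<inter> {t<..1}) (\<lambda>r. p r (\<omega> r)))"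
    and \<psi>: "\<forall>x t z. \<psi> x t z = ln (\<integral>\<omega>. F x t \<omega> \<partial>brownian_law_through pr a M B t z)"
    and well_defined: "\<forall>x z. \<forall>t\<in>{0..1}.
           (AE \<omega> in brownian_law_through pr a M B t z.
              set_integrable lborel (T \<inter> {t<..1}) (\<lambda>r. p r (\<omega> r))) \<and>
           integrable (brownian_law_through pr a M B t z) (F x t)"
    and regular: "\<forall>x. piecewise_smooth pr (D \<union> {0, 1}) (\<psi> x) \<and>
           right_continuous_with_jumps_in S (\<psi> x)"
    and P: "P = density R (\<lambda>\<omega>. ennreal (
           exp (\<eta> (\<omega> 0) (\<omega> 1) + (\<Sum>s\<in>S. \<theta> s (\<omega> s))
                + set_lebesgue_integral lborel T (\<lambda>t. p t (\<omega> t)))))"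
    and "relative_entropy P R < \<infinity>"
    and "bredinger_solution R (S \<union> T) P"
  shows "forward_velocity pr P (\<lambda>t \<omega>. a *\<^sub>R gradient pr (\<psi> (\<omega> 0) t) (\<omega> t)) \<and>
    (\<forall>x. hj_classical_solution pr a T S D p \<theta> (\<eta> x) (\<psi> x))"
proof -
  obtain \<Lambda> where \<Lambda>: "lattice_quotient \<Lambda> pr" "\<And>l. l \<in> \<Lambda> \<Longrightarrow> l \<noteq> 0 \<Longrightarrow> 1 \<le> norm l"
    "\<And>x y w. pr x = pr y \<Longrightarrow> pr (x + w) = pr (y + w)"
    by (rule flat_space_lattice[OF assms(1)]) blast
  have J: "is_interval J" "J \<subseteq> {0..1}" "bounded J" "frontier J \<subseteq> {0..1}" if "J \<in> \<I>" for J
  proof -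
    show "is_interval J" "J \<subseteq> {0..1}" using assms(6) that by auto
    then show "bounded J" using bounded_subset[OF bounded_closed_interval] by blast
    have "closure J \<subseteq> {0..1}" using \<open>J \<subseteq> {0..1}\<close> by (rule closure_minimal) simp
    then show "frontier J \<subseteq> {0..1}" by (auto simp: frontier_def)
  qed
  have "bredinger pr \<Lambda> M B a T S \<eta> p \<theta> F"
  proof unfold_locales
    show "lattice_quotient \<Lambda> pr" by (fact \<Lambda>(1))
    show "1 \<le> norm l" if "l \<in> \<Lambda>" "l \<noteq> 0" for l using \<Lambda>(2)[OF that] .
    show "pr (x + w) = pr (y + w)" if "pr x = pr y" for x y w using \<Lambda>(3)[OF that] .
    show "standard_brownian_motion M B" by (fact assms(3))
    show "0 < a" "finite S" "S \<subseteq> {0<..<1}" by (fact assms)+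
    show "T \<in> sets borel" unfolding T
      by (intro sets.finite_Union assms(5) subsetI real_interval_borel_measurable J(1))
    show "T \<subseteq> {0..1}" using J(2) by (auto simp: T)
    show "continuous_on UNIV (\<lambda>(x, y). \<eta> x y)" "continuous_on (T \<times> UNIV) (\<lambda>(t, z). p t z)" by (fact assms)+
    show "continuous_on UNIV (\<theta> s)" if "s \<in> S" for s using assms(12) that by blast
    show "F x t \<omega> = exp (\<eta> x (\<omega> 1) + (\<Sum>s\<in>{s\<in>S. s > t}. \<theta> s (\<omega> s))
                + set_lebesgue_integral lborel (T \<inter> {t<..1}) (\<lambda>r. p r (\<omega> r)))" for x t \<omega>
      using F by blast
    show "(AE \<omega> in brownian_law_through pr a M B t z. set_integrable lborel (T \<inter> {t<..1}) (\<lambda>r. p r (\<omega> r))) \<and>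
        integrable (brownian_law_through pr a M B t z) (F x t)" if "t \<in> {0..1}" for x z t
      using well_defined that by blast
  qed
  then interpret bredinger pr \<Lambda> M B a T S \<eta> p \<theta> F .
  have "regular_bredinger pr \<Lambda> M B a T S \<eta> p \<theta> F D \<psi> vol"
  proof unfold_locales
    have "finite (frontier J)" if "J \<in> \<I>" for J
      by (rule finite_subset[OF frontier_interval_subset[OF J(1,3)[OF that]]]) simp
    then show "finite D" unfolding D using assms(5,8) by simp
    show "D \<subseteq> {0..1}" unfolding D using J(4) assms(9) by fastforce
    show "S \<subseteq> D" by (simp add: D)
    show "frontier T \<subseteq> D" unfolding T D using frontier_Union_subset[OF assms(5)] by blast
    show "piecewise_smooth pr (D \<union> {0, 1}) (\<psi> x)" "right_continuous_with_jumps_in S (\<psi> x)" for x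
      using regular by blast+
    show "flat_space pr vol" by (fact assms(1))
    fix x and t :: real and y assume t: "t \<in> {0..1}"
    show "\<psi> x t (pr y) = ln (value_fun x t y)"
      unfolding \<psi>[rule_format] brownian_law_through_eq value_fun_def
      using t by (simp add: integral_distr measurable_path measurable_F_x)
  qed
  then interpret regular_bredinger pr \<Lambda> M B a T S \<eta> p \<theta> F D \<psi> vol .
  show ?thesis
    using forward_velocity_P[OF P[unfolded R]] hj_classical_solution_\<psi> by (simp add: velocity_def)
qed

end
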